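(* Let $\Omega$ be a bounded open subset of $\mathbb{R}^2$ such that $|\partial\Omega|=0$. Let $p_n,q_n,r_n$, $n\in\mathbb{N}$, be sequences of real numbers converging respectively to $p>0$, $q\in\mathbb{R}$ and $0$. Let $\alpha>0$, let $\beta_n$, $n\in\mathbb{N}$, be a sequence of real numbers such that $\beta_n\ge\alpha$, and let $A_n$ be a sequence of (not necessarily symmetric) matrix-valued functions in $\mathcal{M}(\alpha,\beta_n;\Omega)$ such that $$r_nA_n\ \text{ is bounded in }L^\infty(\Omega)^{2\times2}\qquad\text{and}\qquad\frac{\det A_n}{\det A_n^s}\,|A_n^s|\rightharpoonup\bar a\in L^\infty(\Omega)\ \text{ weakly-}*\text{ in }\mathcal{M}(\Omega),$$ and such that $$B_n=\big((p_nA_n+q_nJ)^{-1}+r_nJ\big)^{-1}\ \text{ is a sequence of symmetric matrices.}$$ Then there exist a subsequence of $n$, still denoted by $n$, and a matrix-valued function $A_*\in\mathcal{M}(\alpha,\beta;\Omega)$, with $\beta=2\|\bar a\|_{L^\infty(\Omega)}$, such that $$A_n\ \text{ $H(\mathcal{M}(\Omega)^2)$-converges to }A_*\qquad\text{and}\qquad\big((p_nA_n+q_nJ)^{-1}+r_nJ\big)^{-1}\ \text{ $H(\mathcal{M}(\Omega)^2)$-converges to }\ pA_*+qJ .$$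
   Context: $J=\begin{pmatrix}0&-1\\1&0\end{pmatrix}$; $A^s$ is the symmetric part of a matrix $A$; $|\cdot|$ denotes the Euclidean norm on $\mathbb{R}^2$, the subordinate norm on $\mathbb{R}^{2\times2}$, and Lebesgue measure for sets. $\mathcal{M}(\Omega)$ is the space of (bounded) Radon measures on $\Omega$; weak-$*$ convergence in $\mathcal{M}(\Omega)$ is in duality with $C_0(\Omega)$, and $L^1$ functions are identified with measures. For $\alpha,\beta>0$, $\mathcal{M}(\alpha,\beta;\Omega)$ is the set of invertible matrix-valued functions $A:\Omega\to\mathbb{R}^{2\times2}$ with $A(x)\xi\cdot\xi\ge\alpha|\xi|^2$ and $A^{-1}(x)\xi\cdot\xi\ge\beta^{-1}|\xi|^2$ for all $\xi\in\mathbb{R}^2$, a.e. in $\Omega$. $H(\mathcal{M}(\Omega)^2)$-convergence: let $0<\alpha_n\le\beta_n$ be sequences and $A_n\in\mathcal{M}(\alpha_n,\beta_n;\Omega)$. $A_n$ is said to $H(\mathcal{M}(\Omega)^2)$-converge to the matrix-valued function $A_*$ if for every $f\in H^{-1}(\Omega)$ the solution $u_n\in H^1_0(\Omega)$ of $\operatorname{div}(A_n\nabla u_n)=f$ in $\Omega$ satisfies $u_n\rightharpoonup u$ weakly in $H^1_0(\Omega)$ and $A_n\nabla u_n\rightharpoonup A_*\nabla u$ weakly-$*$ in $\mathcal{M}(\Omega)^2$, where $u\in H^1_0(\Omega)$ is the solution of $\operatorname{div}(A_*\nabla u)=f$ in $\Omega$. *)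

theory Defs
  imports "HOL-Analysis.Analysis" "HOL-Probability.Essential_Supremum"
begin

section \<open>Matrices\<close>

definition J :: "real^2^2" where
  "J = vector [vector [0, -1], vector [1, 0]]"

definition sym_part :: "real^2^2 \<Rightarrow> real^2^2" where
  "sym_part M = (1/2) *\<^sub>R (M + transpose M)"

text \<open>The norm \<open>norm M\<close> of the type \<^typ>\<open>real^2^2\<close> is the Frobenius norm; the norm
  subordinate to the Euclidean norm is the following one.\<close>

definition matrix_norm :: "real^2^2 \<Rightarrow> real" where
  "matrix_norm M = onorm (\<lambda>\<xi>. M *v \<xi>)"


section \<open>Function spaces on an open set\<close>

text \<open>Elements of a function space on \<open>\<Omega>\<close> are represented by total functions.
  Their values outside \<open>\<Omega>\<close> are irrelevant, and functions that agree almost everywhere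
  on \<open>\<Omega>\<close> represent the same element.\<close>

definition L2 :: "(real^2) set \<Rightarrow> (real^2 \<Rightarrow> 'b::euclidean_space) set" where
  "L2 \<Omega> = {f \<in> borel_measurable (lebesgue_on \<Omega>). integrable (lebesgue_on \<Omega>) (\<lambda>x. (norm (f x))\<^sup>2)}"

definition Linf :: "(real^2) set \<Rightarrow> (real^2 \<Rightarrow> real) set" where
  "Linf \<Omega> = {f \<in> borel_measurable (lebesgue_on \<Omega>). esssup (lebesgue_on \<Omega>) (\<lambda>x. ereal \<bar>f x\<bar>) < \<infinity>}"

definition Linf_norm :: "(real^2) set \<Rightarrow> (real^2 \<Rightarrow> real) \<Rightarrow> real" where
  "Linf_norm \<Omega> f = real_of_ereal (esssup (lebesgue_on \<Omega>) (\<lambda>x. ereal \<bar>f x\<bar>))"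

definition bounded_in_Linf_matrix :: "(real^2) set \<Rightarrow> (nat \<Rightarrow> real^2 \<Rightarrow> real^2^2) \<Rightarrow> bool" where
  "bounded_in_Linf_matrix \<Omega> M \<longleftrightarrow>
     (\<forall>n. M n \<in> borel_measurable (lebesgue_on \<Omega>)) \<and>
     (\<exists>C::real. \<forall>n. AE x in lebesgue_on \<Omega>. matrix_norm (M n x) \<le> C)"

fun k_times_continuously_differentiable :: "nat \<Rightarrow> (real^2 \<Rightarrow> real) \<Rightarrow> bool" where
  "k_times_continuously_differentiable 0 f \<longleftrightarrow> continuous_on UNIV f"
| "k_times_continuously_differentiable (Suc k) f \<longleftrightarrow>
     f differentiable_on UNIV \<and>
     (\<forall>b\<in>Basis. k_times_continuously_differentiable k (\<lambda>x. frechet_derivative f (at x) b))"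

definition test_functions :: "(real^2) set \<Rightarrow> (real^2 \<Rightarrow> real) set" where
  "test_functions \<Omega> = {\<phi>. (\<forall>k. k_times_continuously_differentiable k \<phi>) \<and>
     compact (closure {x. \<phi> x \<noteq> 0}) \<and> closure {x. \<phi> x \<noteq> 0} \<subseteq> \<Omega>}"

definition grad :: "(real^2 \<Rightarrow> real) \<Rightarrow> real^2 \<Rightarrow> real^2" where
  "grad \<phi> x = (\<chi> i. frechet_derivative \<phi> (at x) (axis i 1))"

definition has_weak_grad :: "(real^2) set \<Rightarrow> (real^2 \<Rightarrow> real) \<Rightarrow> (real^2 \<Rightarrow> real^2) \<Rightarrow> bool" where
  "has_weak_grad \<Omega> u g \<longleftrightarrow>
     (\<forall>\<phi>\<in>test_functions \<Omega>.
        (LINT x|lebesgue_on \<Omega>. u x *\<^sub>R grad \<phi> x) = - (LINT x|lebesgue_on \<Omega>. \<phi> x *\<^sub>R g x))"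

definition H1 :: "(real^2) set \<Rightarrow> (real^2 \<Rightarrow> real) set" where
  "H1 \<Omega> = {u \<in> L2 \<Omega>. \<exists>g\<in>L2 \<Omega>. has_weak_grad \<Omega> u g}"

text \<open>A representative of the weak gradient of \<open>u \<in> H1 \<Omega>\<close>, unique up to null sets.\<close>

definition weak_grad :: "(real^2) set \<Rightarrow> (real^2 \<Rightarrow> real) \<Rightarrow> real^2 \<Rightarrow> real^2" where
  "weak_grad \<Omega> u = (SOME g. g \<in> L2 \<Omega> \<and> has_weak_grad \<Omega> u g)"

definition H1_norm :: "(real^2) set \<Rightarrow> (real^2 \<Rightarrow> real) \<Rightarrow> real" where
  "H1_norm \<Omega> u = sqrt ((LINT x|lebesgue_on \<Omega>. (u x)\<^sup>2) + (LINT x|lebesgue_on \<Omega>. (norm (weak_grad \<Omega> u x))\<^sup>2))"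

definition H10 :: "(real^2) set \<Rightarrow> (real^2 \<Rightarrow> real) set" where
  "H10 \<Omega> = {u \<in> H1 \<Omega>. \<exists>\<phi>. (\<forall>k::nat. \<phi> k \<in> test_functions \<Omega>) \<and>
     (\<lambda>k. H1_norm \<Omega> (\<lambda>x. \<phi> k x - u x)) \<longlonglongrightarrow> 0}"

text \<open>The topological dual of \<open>H10 \<Omega>\<close>. Boundedness forces the functionals to respect
  equality almost everywhere on \<open>\<Omega>\<close>.\<close>

definition H_minus1 :: "(real^2) set \<Rightarrow> ((real^2 \<Rightarrow> real) \<Rightarrow> real) set" where
  "H_minus1 \<Omega> = {F.
     (\<forall>u\<in>H10 \<Omega>. \<forall>v\<in>H10 \<Omega>. F (\<lambda>x. u x + v x) = F u + F v) \<and>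
     (\<forall>c. \<forall>u\<in>H10 \<Omega>. F (\<lambda>x. c * u x) = c * F u) \<and>
     (\<exists>C. \<forall>u\<in>H10 \<Omega>. \<bar>F u\<bar> \<le> C * H1_norm \<Omega> u)}"

definition weakly_converges_H10 ::
    "(real^2) set \<Rightarrow> (nat \<Rightarrow> real^2 \<Rightarrow> real) \<Rightarrow> (real^2 \<Rightarrow> real) \<Rightarrow> bool" where
  "weakly_converges_H10 \<Omega> u v \<longleftrightarrow> (\<forall>n. u n \<in> H10 \<Omega>) \<and> v \<in> H10 \<Omega> \<and>
     (\<forall>F\<in>H_minus1 \<Omega>. (\<lambda>n. F (u n)) \<longlonglongrightarrow> F v)"

definition C0 :: "(real^2) set \<Rightarrow> (real^2 \<Rightarrow> real) set" where
  "C0 \<Omega> = {\<phi>. continuous_on \<Omega> \<phi> \<and> (\<forall>\<epsilon>>0. compact {x \<in> \<Omega>. \<bar>\<phi> x\<bar> \<ge> \<epsilon>})}"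

text \<open>Weak-* convergence of bounded Radon measures on \<open>\<Omega>\<close>, for measures given by (scalar or
  vector valued) integrable densities; for vector values this is componentwise convergence.\<close>

definition weak_star_converges ::
    "(real^2) set \<Rightarrow> (nat \<Rightarrow> real^2 \<Rightarrow> 'b::euclidean_space) \<Rightarrow> (real^2 \<Rightarrow> 'b) \<Rightarrow> bool" where
  "weak_star_converges \<Omega> g h \<longleftrightarrow>
     (\<forall>n. integrable (lebesgue_on \<Omega>) (g n)) \<and> integrable (lebesgue_on \<Omega>) h \<and>
     (\<forall>\<phi>\<in>C0 \<Omega>. (\<lambda>n. LINT x|lebesgue_on \<Omega>. \<phi> x *\<^sub>R g n x) \<longlonglongrightarrow> (LINT x|lebesgue_on \<Omega>. \<phi> x *\<^sub>R h x))"


section \<open>Conductivities and H-convergence\<close>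

definition conductivities :: "real \<Rightarrow> real \<Rightarrow> (real^2) set \<Rightarrow> (real^2 \<Rightarrow> real^2^2) set" where
  "conductivities \<alpha> \<beta> \<Omega> = {A \<in> borel_measurable (lebesgue_on \<Omega>).
     AE x in lebesgue_on \<Omega>. invertible (A x) \<and>
       (\<forall>\<xi>. (A x *v \<xi>) \<bullet> \<xi> \<ge> \<alpha> * (norm \<xi>)\<^sup>2) \<and>
       (\<forall>\<xi>. (matrix_inv (A x) *v \<xi>) \<bullet> \<xi> \<ge> inverse \<beta> * (norm \<xi>)\<^sup>2)}"

text \<open>\<open>u\<close> is an \<open>H10\<close> solution of \<open>div (A \<nabla>u) = f\<close> in the sense of distributions
  on \<open>\<Omega>\<close> (with \<open>+ div\<close>, whence the minus sign).\<close>

definition is_solution ::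
    "(real^2) set \<Rightarrow> (real^2 \<Rightarrow> real^2^2) \<Rightarrow> ((real^2 \<Rightarrow> real) \<Rightarrow> real) \<Rightarrow> (real^2 \<Rightarrow> real) \<Rightarrow> bool" where
  "is_solution \<Omega> A f u \<longleftrightarrow> u \<in> H10 \<Omega> \<and>
     integrable (lebesgue_on \<Omega>) (\<lambda>x. A x *v weak_grad \<Omega> u x) \<and>
     (\<forall>\<phi>\<in>test_functions \<Omega>.
        - (LINT x|lebesgue_on \<Omega>. (A x *v weak_grad \<Omega> u x) \<bullet> grad \<phi> x) = f \<phi>)"

definition is_unique_solution ::
    "(real^2) set \<Rightarrow> (real^2 \<Rightarrow> real^2^2) \<Rightarrow> ((real^2 \<Rightarrow> real) \<Rightarrow> real) \<Rightarrow> (real^2 \<Rightarrow> real) \<Rightarrow> bool" where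
  "is_unique_solution \<Omega> A f u \<longleftrightarrow> is_solution \<Omega> A f u \<and>
     (\<forall>v. is_solution \<Omega> A f v \<longrightarrow> (AE x in lebesgue_on \<Omega>. v x = u x))"

definition H_converges ::
    "(real^2) set \<Rightarrow> (nat \<Rightarrow> real^2 \<Rightarrow> real^2^2) \<Rightarrow> (real^2 \<Rightarrow> real^2^2) \<Rightarrow> bool" where
  "H_converges \<Omega> A A' \<longleftrightarrow>
     (\<exists>\<alpha> \<beta>. \<forall>n. 0 < \<alpha> n \<and> \<alpha> n \<le> \<beta> n \<and> A n \<in> conductivities (\<alpha> n) (\<beta> n) \<Omega>) \<and>
     (\<forall>f\<in>H_minus1 \<Omega>. \<exists>u v.
        (\<forall>n. is_unique_solution \<Omega> (A n) f (u n)) \<and> is_unique_solution \<Omega> A' f v \<and>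
        weakly_converges_H10 \<Omega> u v \<and>
        weak_star_converges \<Omega> (\<lambda>n x. A n x *v weak_grad \<Omega> (u n) x) (\<lambda>x. A' x *v weak_grad \<Omega> v x))"

end

theory Submission
  imports Defs "HOL-Real_Asymp.Real_Asymp" "HOL-Library.Diagonal_Subsequence"
begin

text \<open>
  Since \<open>|A \<xi>|\<^sup>2 \<le> (det A / det A\<^sup>s) |A\<^sup>s| (A \<xi> \<bullet> \<xi>)\<close>, the energy bounds the fluxes \<open>A\<^sub>n \<nabla> u\<^sub>n\<close> in \<open>L\<^sup>1\<close>, so along one
  subsequence potentials and fluxes converge for all right-hand sides \<open>h\<close> at once, to \<open>T h\<close> and \<open>S h\<close>.
  Everything rests on a div-curl lemma in dimension two: if \<open>\<sigma>\<^sub>n\<close> has fixed divergence, \<open>|\<sigma>\<^sub>n|\<^sup>2 \<le> b\<^sub>n e\<^sub>n\<close> with \<open>e\<^sub>n\<close> bounded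
  in \<open>L\<^sup>1\<close> and \<open>b\<^sub>n\<close> converging weakly-star to a bounded density, and \<open>G\<^sub>n\<close> is curl free and weakly convergent in \<open>L\<^sup>2\<close>,
  then \<open>\<sigma>\<^sub>n \<bullet> G\<^sub>n\<close> converges to the product of the limits. Indeed \<open>\<sigma>\<^sub>n - \<sigma>\<close> is a rotated gradient; by Sobolev's inequality
  its stream function oscillates on a square \<open>Q\<close> of side \<open>h\<close> by at most \<open>C (\<integral>\<^sub>Q b\<^sub>n)\<^sup>1\<^sup>/\<^sup>2 (\<integral>\<^sub>Q e\<^sub>n)\<^sup>1\<^sup>/\<^sup>2 \<le> C' h (\<integral>\<^sub>Q e\<^sub>n)\<^sup>1\<^sup>/\<^sup>2\<close> in \<open>L\<^sup>2\<close>,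
  and summing the squares over a grid shows that mollification at scale \<open>h\<close> costs \<open>O(h)\<close> uniformly in \<open>n\<close>.

  Passing to the limit in local energies gives \<open>|S h|\<^sup>2 \<le> \<beta> (S h \<bullet> T h)\<close> almost everywhere. As \<open>T\<close> is onto the gradients, this
  makes \<open>S h\<close> a pointwise linear function \<open>A\<^sub>* T h\<close>. For the perturbed matrices \<open>B\<^sub>n\<close>, the field \<open>(p\<^sub>n A\<^sub>n + q\<^sub>n J)\<^sup>-\<^sup>1 B\<^sub>n \<nabla> v\<^sub>n\<close> is a
  gradient up to a vanishing curl; the monotonicity of \<open>p\<^sub>n A\<^sub>n + q\<^sub>n J\<close> against local gradients of the first problem
  then passes to the limit, and Minty's argument identifies the homogenized matrix \<open>p A\<^sub>* + q J\<close>.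
\<close>

text \<open>The matrices have no uniform upper bound, so the fluxes are bounded only in L^1 and the
  usual L^2 div-curl lemma does not apply. Dimension two helps twice: divergence-free fields are
  rotated gradients, and W^{1,1} embeds into L^2 with a scale-invariant constant, so that
  Cauchy-Schwarz splits the L^1 norm of a flux into the mass of \<open>b n\<close> and an energy.
  Since the weak limit of \<open>b n\<close> has a bounded density, that mass stays below a multiple
  of h^2 on squares of side h, but only for n large depending on h; hence n tends to infinity before
  h tends to zero. Everything is localised to squares, because the domain need not be simply
  connected. Products of divergence-free and curl-free fields are the only nonlinear quantities that
  pass to the limit, so quadratic bounds are first linearised with a constant vector, which is
  afterwards set to the value of a field. The bound on \<open>r\<^sub>n A\<^sub>n\<close> acts
  twice: it keeps the perturbed matrices uniformly coercive, and it bounds \<open>r\<^sub>n\<close>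
  times a flux in L^2, so that this product vanishes weakly there.\<close>

abbreviation (input) lims (infix "---->" 60) where "X ----> L \<equiv> X \<longlonglongrightarrow> L"
abbreviation (input) Lint (binder "LI " 60) where "Lint f \<equiv> integral\<^sup>L lborel f"
abbreviation (input) "L1 \<equiv> integrable lborel"
abbreviation (input) "borel_fun \<equiv> borel_measurable borel"
abbreviation (input) "ind \<equiv> indicator"
abbreviation (input) nnint (binder "NN " 60) where "nnint f \<equiv> nn_integral lborel f"
abbreviation (input) ael (binder "AEl " 10) where "ael P \<equiv> almost_everywhere lborel P"
abbreviation (input) "TF \<equiv> test_functions"
notation (input) scaleR (infixr "*R" 75) and inner (infix "*." 70)

lemmas L1_bound = Bochner_Integration.integrable_bound
  and Lint_nonneg = Bochner_Integration.integral_nonneg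
  and Lint_norm_bound = Bochner_Integration.integral_norm_bound_integral
  and Lint_cong = Bochner_Integration.integral_cong
  and Lint_cong_AE = Bochner_Integration.integral_cong_AE

section \<open>The Hilbert space of square integrable vector fields\<close>

text \<open>Fields are Borel and live on the whole plane; the domain enters only through
  \<open>supported\<close>, \<open>fields\<close> and \<open>gradients\<close>. Translations, Fubini
  and convolution are thus available in \<open>lborel\<close>, and the passage from
  \<open>lebesgue_on\<close> is made separately near the end.\<close>

definition sqint :: "(real^2 => real^2) => bool" where
 "sqint f \<longleftrightarrow> f : borel_fun & L1 (%x. (norm (f x))^2)"

lemma sqint_measurable[measurable_dest]: "sqint f ==> f : borel_fun"
 by(simp add: sqint_def)

lemma sqint_integrable: "sqint f ==> L1 (%x. (norm (f x))^2)"
 by(simp add: sqint_def)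

lemma sqint_bound:
 assumes "f : borel_fun" "L1 g" "!!x. (norm (f x))^2 <= g x"
 shows "sqint f"
 unfolding sqint_def
proof
 show "L1 (%x. (norm (f x))^2)"
  by(rule L1_bound[OF assms(2)])
   (use assms in "auto intro: order_trans[OF _ abs_ge_self]")
qed (use assms in auto)

lemma norm_add_sq_le: "(norm (a + b))^2 <= 2 * (norm a)^2 + 2 * (norm (b::'a::real_inner))^2"
proof -
 have "0 <= (norm (a - b))^2" by simp
 thus ?thesis
  by(simp add: power2_norm_eq_inner inner_simps inner_commute)
qed

lemma two_inner_le: "2 * abs (a *. b) <= (norm a)^2 + (norm (b::'a::real_inner))^2"
proof -
 have "0 <= (norm (a - b))^2" "0 <= (norm (a + b))^2" by simp_all
 thus ?thesis
  by(simp add: power2_norm_eq_inner inner_simps inner_commute)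
qed

lemma sqint_add: assumes "sqint f" "sqint g" shows "sqint (%x. f x + g x)"
 by(rule sqint_bound[of _ "%x. 2 * (norm (f x))^2 + 2 * (norm (g x))^2"])
  (use assms norm_add_sq_le in "auto simp: sqint_def")

lemma sqint_scaleR: assumes "sqint f" shows "sqint (%x. c *R f x)"
 by(rule sqint_bound[of _ "%x. c^2 * (norm (f x))^2"])
  (use assms in "auto simp: sqint_def power_mult_distrib")

lemma sqint_minus: assumes "sqint f" "sqint g" shows "sqint (%x. f x - g x)"
 using sqint_add[OF assms(1) sqint_scaleR[OF assms(2), of "-1"]] by simp

lemma sqint_zero: "sqint (%x. 0)"
 by(simp add: sqint_def)

lemma integrable_inner:
 assumes "sqint f" "sqint g" shows "L1 (%x. f x *. g x)"
proof (rule L1_bound)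
 show "L1 (%x. (norm (f x))^2 + (norm (g x))^2)"
  using assms by(simp add: sqint_def)
 have "abs (f x *. g x) <= (norm (f x))^2 + (norm (g x))^2" for x
  using two_inner_le[of "f x" "g x"] by linarith
 thus "AEl x. norm (f x *. g x) <= norm ((norm (f x))^2 + (norm (g x))^2)"
  by(auto intro: order_trans[OF _ abs_ge_self])
qed (use assms in "auto simp: sqint_def")

definition l2_eq :: "(real^2 => real^2) => (real^2 => real^2) => bool" where
 "l2_eq f g \<longleftrightarrow> sqint f & sqint g & (AEl x. f x = g x)"

lemma part_equivp_l2: "part_equivp l2_eq"
proof (rule part_equivpI)
 show "EX f. l2_eq f f" using sqint_zero by(auto simp: l2_eq_def)
 show "symp l2_eq" by(rule sympI) (auto simp: l2_eq_def elim: AE_mp)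
 show "transp l2_eq"
 proof (rule transpI)
  fix f g h assume "l2_eq f g" "l2_eq g h"
  thus "l2_eq f h" unfolding l2_eq_def by(auto elim: AE_mp)
 qed
qed

\<comment> \<open>A partial quotient: only square integrable functions have classes, so the norm is
  definite. Having a type rather than a set allows the instances \<open>real_inner\<close> and
  \<open>complete_space\<close>, hence closures and Cauchy sequences in the library sense.\<close>
quotient_type l2 = "real^2 => real^2" / partial: l2_eq
 morphisms rep cls
 by(rule part_equivp_l2)

lemma rep_self: "l2_eq (rep u) (rep u)"
 by(rule Quotient3_rep_reflp[OF Quotient3_l2])

lemma sqint_rep[simp]: "sqint (rep u)"
 using rep_self[of u] by(simp add: l2_eq_def)

lemma rep_measurable[measurable]: "rep u : borel_fun"
 using sqint_rep[of u] by(simp add: sqint_def)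

lemma rep_cls: "sqint f ==> AEl x. rep (cls f) x = f x"
 using Quotient3_rep_abs[OF Quotient3_l2, of f] by(simp add: l2_eq_def)

lemma cls_rep[simp]: "cls (rep u) = u"
 by(rule Quotient3_abs_rep[OF Quotient3_l2])

lemma l2_eqI: assumes "AEl x. rep u x = rep v x" shows "u = v"
proof -
 have "l2_eq (rep u) (rep v)" using assms by(simp add: l2_eq_def)
 hence "cls (rep u) = cls (rep v)" by(rule Quotient3_rel_abs[OF Quotient3_l2])
 thus ?thesis by simp
qed

lemma cls_cong: assumes "sqint f" "sqint g" "AEl x. f x = g x" shows "cls f = cls g"
 by(rule Quotient3_rel_abs[OF Quotient3_l2]) (use assms in "simp add: l2_eq_def")

instantiation l2 :: real_inner
begin

lift_definition zero_l2 :: l2 is "%x. 0" by(simp add: l2_eq_def sqint_zero)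

lift_definition plus_l2 :: "l2 => l2 => l2" is "%f g x. f x + g x"
 by(auto simp: l2_eq_def sqint_add elim: AE_mp)

lift_definition minus_l2 :: "l2 => l2 => l2" is "%f g x. f x - g x"
 by(auto simp: l2_eq_def sqint_minus elim: AE_mp)

lift_definition scaleR_l2 :: "real => l2 => l2" is "%c f x. c *R f x"
 by(auto simp: l2_eq_def sqint_scaleR elim: AE_mp)

definition uminus_l2 :: "l2 => l2" where "uminus_l2 u = (-1) *R u"

definition inner_l2 :: "l2 => l2 => real" where
 "inner_l2 u v = (LI x. rep u x *. rep v x)"

definition norm_l2 :: "l2 => real" where "norm_l2 u = sqrt (inner u u)"

definition sgn_l2 :: "l2 => l2" where "sgn_l2 u = inverse (norm u) *R u"

definition dist_l2 :: "l2 => l2 => real" where "dist_l2 u v = norm (u - v)"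

definition uniformity_l2 :: "(l2 \<times> l2) filter" where
 "uniformity_l2 = (INF e\<in>{0 <..}. principal {(x, y). dist x y < e})"

definition open_l2 :: "l2 set => bool" where
 "open_l2 U \<longleftrightarrow> (ALL x:U. eventually (%(x', y). x' = x --> y : U) uniformity)"

lemma rep_add: "AEl x. rep (u + v) x = rep u x + rep v x"
 using rep_cls[OF sqint_add[OF sqint_rep sqint_rep], of u v]
 by(simp add: plus_l2_def)

lemma rep_scaleR: "AEl x. rep (c *R u) x = c *R rep u x"
 using rep_cls[OF sqint_scaleR[OF sqint_rep], of c u]
 by(simp add: scaleR_l2_def)

lemma rep_minus: "AEl x. rep (u - v) x = rep u x - rep v x"
 using rep_cls[OF sqint_minus[OF sqint_rep sqint_rep], of u v]
 by(simp add: minus_l2_def)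

lemma rep_zero: "AEl x. rep 0 x = 0"
 using rep_cls[OF sqint_zero] by(simp add: zero_l2_def)

instance
proof
 fix a b c :: l2 and r s :: real
 show "a + b + c = a + (b + c)"
  by(rule l2_eqI) (use rep_add[of "a+b" c] rep_add[of a b] rep_add[of a "b+c"] rep_add[of b c] in
    \<open>eventually_elim, auto\<close>)
 show "a + b = b + a"
  by(rule l2_eqI) (use rep_add[of a b] rep_add[of b a] in "eventually_elim, auto")
 show "0 + a = a"
  by(rule l2_eqI) (use rep_add[of 0 a] rep_zero in "eventually_elim, auto")
 show "- a + a = 0"
  unfolding uminus_l2_def
  by(rule l2_eqI) (use rep_add[of "(-1) *R a" a] rep_scaleR[of "-1" a] rep_zero in "eventually_elim, auto")
 show "a - b = a + - b"
  unfolding uminus_l2_def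
  by(rule l2_eqI) (use rep_minus[of a b] rep_add[of a "(-1) *R b"] rep_scaleR[of "-1" b] in "eventually_elim, auto")
 show "r *R (a + b) = r *R a + r *R b"
  by(rule l2_eqI) (use rep_scaleR[of r "a+b"] rep_add[of a b] rep_add[of "r *R a" "r *R b"]
    rep_scaleR[of r a] rep_scaleR[of r b] in "eventually_elim, auto simp: scaleR_add_right")
 show "(r + s) *R a = r *R a + s *R a"
  by(rule l2_eqI) (use rep_scaleR[of "r+s" a] rep_add[of "r *R a" "s *R a"]
    rep_scaleR[of r a] rep_scaleR[of s a] in "eventually_elim, auto simp: scaleR_add_left")
 show "r *R (s *R a) = (r * s) *R a"
  by(rule l2_eqI) (use rep_scaleR[of r "s *R a"] rep_scaleR[of "r * s" a]
    rep_scaleR[of s a] in "eventually_elim, auto")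
 show "1 *R a = a"
  by(rule l2_eqI) (use rep_scaleR[of 1 a] in "eventually_elim, auto")
 show "sgn a = inverse (norm a) *R a" by(rule sgn_l2_def)
 show "dist a b = norm (a - b)" by(rule dist_l2_def)
 show "uniformity = (INF e\<in>{0 <..}. principal {(x :: l2, y). dist x y < e})" by(rule uniformity_l2_def)
 show "open U \<longleftrightarrow> (ALL x:U. \<forall>\<^sub>F (x', y) in uniformity. x' = x --> y : U)" for U :: "l2 set"
  by(rule open_l2_def)
 show "norm a = sqrt (inner a a)" by(rule norm_l2_def)
 show "inner a b = inner b a"
  by(simp add: inner_l2_def inner_commute)
 show "inner (a + b) c = inner a c + inner b c"
 proof -
  have "inner (a + b) c = (LI x. (rep a x + rep b x) *. rep c x)"
   unfolding inner_l2_def by(rule integral_cong_AE) (use rep_add[of a b] in auto)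
  also have "... = inner a c + inner b c"
   unfolding inner_l2_def inner_add_left
   by(rule Bochner_Integration.integral_add) (auto intro: integrable_inner)
  finally show ?thesis .
 qed
 show "inner (r *R a) b = r * inner a b"
 proof -
  have "inner (r *R a) b = (LI x. (r *R rep a x) *. rep b x)"
   unfolding inner_l2_def by(rule integral_cong_AE) (use rep_scaleR[of r a] in auto)
  also have "... = r * inner a b"
   unfolding inner_l2_def by simp
  finally show ?thesis .
 qed
 show "0 <= inner a a" unfolding inner_l2_def by(rule Lint_nonneg) simp
 show "(inner a a = 0) = (a = 0)"
 proof
  assume "inner a a = 0"
  hence "AEl x. rep a x *. rep a x = 0"
   unfolding inner_l2_def
   by(subst (asm) integral_nonneg_eq_0_iff_AE) (auto intro: integrable_inner)
  with rep_zero have "AEl x. rep a x = rep 0 x"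
   by eventually_elim simp
  thus "a = 0" by(rule l2_eqI)
 next
  assume "a = 0"
  have "inner (0::l2) 0 = (LI x. (0::real^2) *. rep 0 x)"
   unfolding inner_l2_def by(rule integral_cong_AE) (use rep_zero in auto)
  thus "inner a a = 0" using \<open>a = 0\<close> by simp
 qed
qed

end

lemma rep_uminus: "AEl x. rep (- u) x = - rep u x"
 using rep_scaleR[of "-1" u] by simp

lemma inner_cls:
 assumes "sqint f" "sqint g" shows "inner (cls f) (cls g) = (LI x. f x *. g x)"
 unfolding inner_l2_def
 by(rule integral_cong_AE) (use assms rep_cls[OF assms(1)] rep_cls[OF assms(2)] in "auto simp: sqint_def")

lemma inner_rep_cls:
 assumes "sqint g" shows "inner u (cls g) = (LI x. rep u x *. g x)"
 using inner_cls[OF sqint_rep assms, of u] by simp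

lemma norm_cls: "sqint f ==> (norm (cls f))^2 = (LI x. (norm (f x))^2)"
 by(simp add: power2_norm_eq_inner inner_cls)

lemma norm_l2_sq: "(norm u)^2 = (LI x. (norm (rep u x))^2)"
 using norm_cls[OF sqint_rep, of u] by simp

lemma cls_add: assumes "sqint f" "sqint g" shows "cls f + cls g = cls (%x. f x + g x)"
 by(rule l2_eqI) (use rep_add[of "cls f" "cls g"] rep_cls[OF assms(1)] rep_cls[OF assms(2)]
    rep_cls[OF sqint_add[OF assms]] in "eventually_elim, auto")

lemma cls_minus: assumes "sqint f" "sqint g" shows "cls f - cls g = cls (%x. f x - g x)"
 by(rule l2_eqI) (use rep_minus[of "cls f" "cls g"] rep_cls[OF assms(1)] rep_cls[OF assms(2)]
    rep_cls[OF sqint_minus[OF assms]] in "eventually_elim, auto")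

lemma cls_scaleR: assumes "sqint f" shows "c *R cls f = cls (%x. c *R f x)"
 by(rule l2_eqI) (use rep_scaleR[of c "cls f"] rep_cls[OF assms]
    rep_cls[OF sqint_scaleR[OF assms], of c] in "eventually_elim, auto")

section \<open>Completeness of the space of square integrable fields\<close>

lemma Cauchy_rapid_subseq:
 fixes X :: "nat => 'a::metric_space"
 assumes "Cauchy X" shows "EX r. strict_mono r & (ALL k. dist (X (r (Suc k))) (X (r k)) <= (1/2)^k)"
proof -
 have ex: "EX M. ALL m>=M. ALL n>=M. dist (X m) (X n) < (1/2)^k" for k
  using assms unfolding Cauchy_def by simp
 then obtain M where M: "!!k m n. m >= M k ==> n >= M k ==> dist (X m) (X n) < (1/2)^k" by metis
 define r where "r = rec_nat (M 0) (%k r. Suc (max r (M (Suc k))))"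
 have r: "r 0 = M 0" "r (Suc k) = Suc (max (r k) (M (Suc k)))" for k by(simp_all add: r_def)
 have ge: "r k >= M k" for k by(cases k) (auto simp: r)
 have sm: "strict_mono r" by(rule strict_monoI_Suc) (simp add: r)
 have "dist (X (r (Suc k))) (X (r k)) <= (1/2)^k" for k
  using M[OF _ ge[of k], of "r (Suc k)"] ge[of k] r(2)[of k] by fastforce
 with sm show ?thesis by blast
qed

text \<open>The norm written as a nonnegative integral, the form in which Fatou's lemma applies in
  the proof of completeness.\<close>

lemma nn_integral_diff_sq:
 assumes f: "sqint f"
 shows "(NN x. ennreal ((norm (rep u x - f x))^2)) = ennreal ((norm (u - cls f))^2)"
proof -
 have s: "sqint (%x. rep u x - f x)" by(rule sqint_minus[OF sqint_rep f])
 have "u - cls f = cls (%x. rep u x - f x)" using cls_minus[OF sqint_rep f, of u] by simp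
 thus ?thesis
  unfolding norm_cls[OF s, symmetric] using norm_cls[OF s] by(simp add: nn_integral_eq_integral[OF sqint_integrable[OF s]])
qed

text \<open>The weights \<open>2 ^ k\<close> turn the summable squared norms into a pointwise summable series, by AM-GM.\<close>

lemma rapidly_Cauchy_AE_convergent:
 assumes s: "!!k. norm (X (Suc k) - X k) <= (1/2)^k"
 shows "AEl x. convergent (%k. rep (X k) x)"
proof -
 define D where "D k x = 2^k * (norm (rep (X (Suc k)) x - rep (X k) x))^2" for k x
 have [measurable]: "D k : borel_fun" for k unfolding D_def by measurable
 have "(NN x. (\<Sum>k. ennreal (D k x))) = (\<Sum>k. \<integral>\<^sup>+x. ennreal (D k x) \<partial>lborel)"
  by(rule nn_integral_suminf) measurable
 also have "... <= (\<Sum>k. ennreal ((1/2)^k))"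
 proof (rule suminf_le[OF _ summableI summableI])
  fix k
  have "(NN x. ennreal (D k x)) = ennreal (2^k) * ennreal ((norm (X (Suc k) - X k))^2)"
   using nn_integral_diff_sq[OF sqint_rep, of "X (Suc k)" "X k"] by(simp add: D_def ennreal_mult nn_integral_cmult)
  also have "... <= ennreal (2^k * ((1/2)^k)^2)"
   using power_mono[OF s norm_ge_zero, of k 2] by(simp add: ennreal_mult[symmetric] ennreal_leI)
  also have "2^k * ((1/2)^k)^2 = ((1/2)^k :: real)" by(simp add: power2_eq_square power_mult_distrib[symmetric] flip: mult.assoc)
  finally show "(NN x. ennreal (D k x)) <= ennreal ((1/2)^k)" .
 qed
 also have "... = ennreal 2" by(rule suminf_ennreal_eq) (use geometric_sums[of "1/2::real"] in auto)
 finally have "AEl x. (\<Sum>k. ennreal (D k x)) ~= \<infinity>"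
  by(intro nn_integral_noteq_infinite) (auto simp: top_unique)
 thus ?thesis
 proof eventually_elim
  case (elim x)
  define d where "d k = rep (X (Suc k)) x - rep (X k) x" for k
  have "summable (%k. D k x + (1/2)^k)"
   by(intro summable_add summable_suminf_not_top summable_geometric) (use elim in "auto simp: D_def")
  moreover have "norm (d k) <= D k x + (1/2)^k" for k
  proof -
   have "2 * norm (d k) * 1 <= 2^k * (norm (d k))^2 + (1/2)^k"
    using sum_squares_bound[of "sqrt (2^k) * norm (d k)" "1 / sqrt (2^k)"]
    by(simp add: power_mult_distrib power_divide)
   thus ?thesis using norm_ge_zero[of "d k"] unfolding D_def d_def by linarith
  qed
  ultimately have "summable d" by(intro summable_comparison_test[of d]) auto
  hence "convergent (%n. rep (X n) x - rep (X 0) x)"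
   using sum_lessThan_telescope[of "%k. rep (X k) x"] by(simp add: summable_iff_convergent d_def)
  from convergent_add[OF this convergent_const[of "rep (X 0) x"]] show ?case by simp
 qed
qed

instance l2 :: complete_space
proof
 fix X :: "nat => l2" assume C: "Cauchy X"
 obtain r where r: "strict_mono r" "!!k. dist (X (r (Suc k))) (X (r k)) <= (1/2)^k"
  using Cauchy_rapid_subseq[OF C] by blast
 define Y where "Y k = X (r k)" for k
 have CY: "Cauchy Y" unfolding Y_def using Cauchy_subseq_Cauchy[OF C r(1)] by(simp add: o_def)
 define F where "F x = lim (%k. rep (Y k) x)" for x
 have [measurable]: "F : borel_fun" unfolding F_def by measurable
 have "AEl x. convergent (%k. rep (Y k) x)"
  by(rule rapidly_Cauchy_AE_convergent) (use r(2) in "simp add: Y_def dist_norm")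
 hence Fl: "AEl x. (%k. rep (Y k) x) ----> F x" by eventually_elim (simp add: F_def convergent_LIMSEQ_iff)
 \<comment> \<open>Fatou's lemma in \<open>j\<close> turns the Cauchy estimate for
   \<open>Y k - Y j\<close> into one for \<open>Y k - F\<close>, before \<open>F\<close> is known to
   be square integrable.\<close>
 have key: "EX K. ALL k>=K. (NN x. ennreal ((norm (rep (Y k) x - F x))^2)) <= ennreal (e^2)" if e: "e > 0" for e
 proof -
  from CY e obtain K where K: "!!m n. m >= K ==> n >= K ==> norm (Y m - Y n) < e"
   unfolding Cauchy_def dist_norm by meson
  have "(NN x. ennreal ((norm (rep (Y k) x - F x))^2)) <= ennreal (e^2)" if k: "k >= K" for k
  proof -
   have "AEl x. ennreal ((norm (rep (Y k) x - F x))^2) = liminf (%j. ennreal ((norm (rep (Y k) x - rep (Y j) x))^2))"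
    using Fl by eventually_elim (intro lim_imp_Liminf[symmetric] tendsto_ennrealI tendsto_intros, simp_all)
   hence "(NN x. ennreal ((norm (rep (Y k) x - F x))^2))
     = (NN x. liminf (%j. ennreal ((norm (rep (Y k) x - rep (Y j) x))^2)))" by(rule nn_integral_cong_AE)
   also have "... <= liminf (%j. \<integral>\<^sup>+x. ennreal ((norm (rep (Y k) x - rep (Y j) x))^2) \<partial>lborel)"
    by(rule nn_integral_liminf) measurable
   also have "... = liminf (%j. ennreal ((norm (Y k - Y j))^2))" by(simp add: nn_integral_diff_sq)
   also have "... <= liminf (%j. ennreal (e^2))"
    by(intro Liminf_mono eventually_sequentiallyI[of K] ennreal_leI power_mono less_imp_le[OF K[OF k]]) auto
   finally show ?thesis by(simp add: Liminf_const)
  qed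
  thus ?thesis by blast
 qed
 obtain K where "(NN x. ennreal ((norm (rep (Y K) x - F x))^2)) <= ennreal (1^2)" using key[of 1] by auto
 hence "L1 (%x. (norm (rep (Y K) x - F x))^2)"
  by(intro integrableI_bounded) (auto simp: le_less_trans)
 hence "sqint (%x. rep (Y K) x - F x)" by(simp add: sqint_def)
 from sqint_minus[OF sqint_rep[of "Y K"] this] have sF: "sqint F" by simp
 have "Y ----> cls F"
 proof (rule metric_LIMSEQ_I)
  fix e :: real assume e: "e > 0"
  then obtain K where K: "!!k. k >= K ==> ennreal ((norm (Y k - cls F))^2) <= ennreal ((e/2)^2)"
   using key[of "e/2"] by(auto simp: nn_integral_diff_sq[OF sF])
  have "dist (Y k) (cls F) < e" if k: "k >= K" for k
  proof -
   have "norm (Y k - cls F) <= e/2" using K[OF k] e by(simp add: ennreal_le_iff power2_le_iff_abs_le)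
   thus ?thesis using e by(simp add: dist_norm)
  qed
  thus "EX K. ALL k>=K. dist (Y k) (cls F) < e" by blast
 qed
 hence "X ----> cls F" using Cauchy_converges_subseq[OF C r(1)] by(simp add: Y_def[abs_def] o_def)
 thus "convergent X" by(rule convergentI)
qed

section \<open>Hilbert spaces\<close>

lemma parallelogram:
 fixes a b :: "'a::real_inner"
 shows "(norm (a - b))^2 = 2 * (norm a)^2 + 2 * (norm b)^2 - 4 * (norm ((1/2) *R (a + b)))^2"
 unfolding power2_norm_eq_inner by(simp add: inner_simps inner_commute field_simps)

text \<open>The representing element minimises \<open>\<parallel>v\<parallel>\<^sup>2 - 2 L v\<close>.\<close>

theorem Riesz_subspace:
 fixes V :: "'a::{real_inner, complete_space} set"
 assumes V: "subspace V"
  and add: "!!u v. u : V ==> v : V ==> L (u + v) = L u + (L v :: real)"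
  and scale: "!!c u. u : V ==> L (c *R u) = c * L u"
  and bound: "!!u. u : V ==> abs (L u) <= C * norm u"
 obtains g where "g : closure V" "!!v. v : V ==> inner g v = L v"
proof -
 define j where "j v = (norm v)^2 - 2 * L v" for v
 have V0: "0 : V" using V by(rule subspace_0)
 have jb: "- C\<^sup>2 <= j v" if "v : V" for v
 proof -
  have "2 * L v <= 2 * (C * norm v)" using bound[OF that] by simp
  also have "... <= C^2 + (norm v)^2" using sum_squares_bound[of C "norm v"] by(simp add: mult.assoc)
  finally show ?thesis by(simp add: j_def)
 qed
 define m where "m = Inf (j ` V)"
 have bdd: "bdd_below (j ` V)" using jb by(auto intro!: bdd_belowI)
 have mle: "m <= j v" if "v : V" for v unfolding m_def using that bdd by(simp add: cInf_lower)
 have "EX v:V. j v < m + 1 / real (Suc n)" for n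
 proof -
  have "m < m + 1 / real (Suc n)" by simp
  thus ?thesis unfolding m_def using cInf_lessD[of "j ` V"] V0 by(metis (no_types, lifting) empty_iff imageE image_eqI)
 qed
 then obtain x where x: "!!n. x n : V" "!!n. j (x n) < m + 1 / real (Suc n)" by metis
 \<comment> \<open>The midpoint lies in \<open>V\<close>, so \<open>j\<close> is at least
   \<open>m\<close> there; by the parallelogram law two near-minimisers are then close to each
   other.\<close>
 have xd: "(norm (x i - x k))^2 <= 2 / real (Suc i) + 2 / real (Suc k)" for i k
 proof -
  have mid: "(1/2) *R (x i + x k) : V" using x V by(simp add: subspace_add subspace_scale)
  have L: "L ((1/2) *R (x i + x k)) = (L (x i) + L (x k)) / 2"
   using scale[of "x i + x k" "1/2"] add[of "x i" "x k"] x V by(simp add: subspace_add)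
  have "(norm (x i - x k))^2 = 2 * j (x i) + 2 * j (x k) - 4 * j ((1/2) *R (x i + x k))"
   unfolding parallelogram j_def L by(simp add: field_simps)
  also have "... <= 2 * (m + 1 / real (Suc i)) + 2 * (m + 1 / real (Suc k)) - 4 * m"
  proof -
   have "2 * p + 2 * q - 4 * w <= 2 * (m + s) + 2 * (m + s') - 4 * m"
    if "p < m + s" "q < m + s'" "m <= w" for p q w s s' :: real using that by(simp add: algebra_simps)
   from this[OF x(2) x(2) mle[OF mid]] show ?thesis .
  qed
  finally show ?thesis by(simp add: algebra_simps)
 qed
 have "Cauchy x"
 proof (rule metric_CauchyI)
  fix e :: real assume e: "e > 0"
  obtain N where N: "4 / e^2 < real (Suc N)" using reals_Archimedean2 by(metis less_trans lessI of_nat_less_iff)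
  have "dist (x i) (x k) < e" if "i >= N" "k >= N" for i k
  proof -
   have "2 / real (Suc i) <= 2 / real (Suc N)" "2 / real (Suc k) <= 2 / real (Suc N)"
    using that by(auto intro!: divide_left_mono)
   hence "(norm (x i - x k))^2 <= 4 / real (Suc N)" using xd[of i k] by simp
   also have "... < e^2" using N e by(simp add: field_simps)
   finally show ?thesis using e by(simp add: dist_norm power_less_imp_less_base)
  qed
  thus "EX M. ALL m>=M. ALL n>=M. dist (x m) (x n) < e" by blast
 qed
 then obtain g where g: "x ----> g" using Cauchy_convergent convergentD by blast
 have gV: "g : closure V" using g x(1) closure_sequential by blast
 have "inner g v = L v" if v: "v : V" for v
 proof -
  have nn: "0 <= 2 * t * (inner g v - L v) + t^2 * (norm v)^2" for t :: real
  proof -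
   have ineq: "- 1 / real (Suc n) <= 2 * t * (inner (x n) v - L v) + t^2 * (norm v)^2" for n
   proof -
    have tv: "t *R v : V" using v V by(simp add: subspace_scale)
    have "m <= j (x n + t *R v)" using x(1) tv V by(intro mle subspace_add)
    also have "... = j (x n) + 2 * t * (inner (x n) v - L v) + t^2 * (norm v)^2"
     unfolding j_def power2_norm_eq_inner using add[OF x(1) tv, of n] scale[OF v, of t]
     by(simp add: inner_simps inner_commute algebra_simps power2_eq_square)
    finally show ?thesis using x(2)[of n] by simp
   qed
   have "(%n. - 1 / real (Suc n)) ----> 0"
    using tendsto_minus[OF LIMSEQ_inverse_real_of_nat] by(simp add: inverse_eq_divide)
   moreover have "(%n. 2 * t * (inner (x n) v - L v) + t^2 * (norm v)^2) ----> 2 * t * (inner g v - L v) + t^2 * (norm v)^2"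
    by(intro tendsto_intros g)
   ultimately show ?thesis using ineq by(auto intro: LIMSEQ_le)
  qed
  define d where "d = inner g v - L v"
  have "d = 0"
  proof (rule ccontr)
   assume "d ~= 0"
   \<comment> \<open>This minimises the quadratic in \<open>t\<close> after
     \<open>(norm v)^2\<close> has been enlarged by 1, which avoids a division by zero when
     \<open>v = 0\<close>.\<close>
   define t where "t = - d / ((norm v)^2 + 1)"
   have p: "(norm v)^2 + 1 > 0" by(simp add: add_nonneg_pos)
   have "0 <= 2 * t * d + t^2 * (norm v)^2" using nn[of t] by(simp add: d_def)
   also have "... <= 2 * t * d + t^2 * ((norm v)^2 + 1)" by(simp add: algebra_simps)
   also have "... = - d\<^sup>2 / ((norm v)^2 + 1)"
   proof -
    have "2 * (- d / q) * d + (- d / q)^2 * q = - d\<^sup>2 / q" if "q > 0" for q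
     using that by(simp add: field_simps power2_eq_square)
    from this[OF p] show ?thesis unfolding t_def .
   qed
   also have "... < 0" using p \<open>d ~= 0\<close> by simp
   finally show False by simp
  qed
  thus ?thesis by(simp add: d_def)
 qed
 with gV show thesis by(rule that)
qed

lemma subspace_closure_inner:
 fixes V :: "'a::real_inner set"
 assumes "!!v. v : V ==> inner x v = inner y v" "z : closure V"
 shows "inner x z = inner y z"
proof -
 obtain f where f: "!!n. f n : V" "f ----> z" using assms(2) closure_sequential by blast
 have "(%n. inner x (f n)) ----> inner x z" "(%n. inner y (f n)) ----> inner y z"
  by(intro tendsto_intros f)+
 thus ?thesis using assms(1)[OF f(1)] LIMSEQ_unique by force
qed

lemma subspace_closure:
 fixes V :: "'a::real_normed_vector set"
 assumes "subspace V" shows "subspace (closure V)"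
 unfolding subspace_def
proof (intro conjI ballI allI)
 show "0 : closure V" using assms closure_subset subspace_0 by blast
next
 fix x y assume "x : closure V" "y : closure V"
 then obtain f g where "!!n. f n : V" "f ----> x" "!!n. g n : V" "g ----> y"
  unfolding closure_sequential by blast
 thus "x + y : closure V" unfolding closure_sequential
  by(intro exI[of _ "%n. f n + g n"]) (auto intro: tendsto_add subspace_add[OF assms])
next
 fix c x assume "x : closure V"
 then obtain f where "!!n. f n : V" "f ----> x" unfolding closure_sequential by blast
 thus "c *R x : closure V" unfolding closure_sequential
  by(intro exI[of _ "%n. c *R f n"]) (auto intro: tendsto_intros subspace_scale[OF assms])
qed

lemma closed_subspace_projection:
 fixes V :: "'a::{real_inner, complete_space} set"
 assumes "subspace V"
 obtains y where "y : closure V" "!!v. v : closure V ==> inner (x - y) v = 0"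
proof -
 have "EX y. y : closure V & (ALL v:V. inner y v = inner x v)"
  by(rule Riesz_subspace[OF assms, of "inner x" "norm x"])
   (auto simp: inner_simps Cauchy_Schwarz_ineq2)
 then obtain y where y: "y : closure V" "!!v. v : V ==> inner y v = inner x v" by blast
 have "inner (x - y) v = 0" if "v : closure V" for v
  using subspace_closure_inner[of V x y v] y(2) that by(simp add: inner_simps)
 with y(1) show thesis by(rule that)
qed

text \<open>Subtracting from a vector of \<open>W\<close> its projection onto
  \<open>closure V\<close> leaves a vector of \<open>W\<close> orthogonal to \<open>V\<close>. All
  density statements about fields below are proved in this way.\<close>

lemma dense_by_orthogonality:
 fixes V W :: "'a::{real_inner, complete_space} set"
 assumes V: "subspace V" and W: "subspace W" "closed W" "V \<subseteq> W"
  and orth: "!!x. x : W ==> (!!v. v : V ==> inner x v = 0) ==> x = 0"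
 shows "closure V = W"
proof
 show "closure V \<subseteq> W" using W by(simp add: closure_minimal)
 show "W \<subseteq> closure V"
 proof
  fix x assume x: "x : W"
  obtain y where y: "y : closure V" "!!v. v : closure V ==> inner (x - y) v = 0"
   using closed_subspace_projection[OF V] by blast
  have "y : W" using y(1) \<open>closure V \<subseteq> W\<close> by blast
  hence "x - y = 0"
   using x W(1) y(2) closure_subset by(intro orth subspace_diff) blast+
  thus "x : closure V" using y(1) by simp
 qed
qed

text \<open>Solved by a contraction: for small \<open>t\<close> the map \<open>u \<mapsto> u - t P (A u - f)\<close>,
 with \<open>P\<close> the orthogonal projection onto \<open>W\<close>, is contracting.\<close>

theorem Lax_Milgram:
 fixes W :: "'a::{real_inner, complete_space} set"
 assumes W: "subspace W" "closed W"
  and A: "bounded_linear A" and \<alpha>: "\<alpha> > 0" "!!u. u : W ==> \<alpha> * (norm u)^2 <= inner (A u) u"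
 shows "\<exists>!u. u : W & (ALL v:W. inner (A u) v = inner f v)"
proof -
 interpret A: bounded_linear A by(rule A)
 obtain K where K: "K > 0" "!!x. norm (A x) <= norm x * K" using A.pos_bounded by blast
 have cW: "closure W = W" using W by simp
 have "ALL x. EX y. y : W & (ALL v:W. inner (x - y) v = 0)"
  using closed_subspace_projection[OF W(1)] unfolding cW by metis
 then obtain P where P: "!!x. P x : W" "!!x v. v : W ==> inner (x - P x) v = 0" by metis
 have Pi: "inner (P x) v = inner x v" if "v : W" for x v
  using P(2)[OF that, of x] by(simp add: inner_simps)
 have Pn: "norm (P x - P y) <= norm (x - y)" for x y
 proof -
  have "P x - P y : W" using P W by(simp add: subspace_diff)
  hence "(norm (P x - P y))^2 = inner (x - y) (P x - P y)"
   by(simp add: power2_norm_eq_inner inner_simps Pi P)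
  also have "... <= norm (x - y) * norm (P x - P y)" by(rule norm_cauchy_schwarz)
  finally show ?thesis by(metis linorder_not_le mult_right_less_imp_less norm_ge_zero order_le_less power2_eq_square mult_strict_right_mono)
 qed
 \<comment> \<open>This \<open>t\<close> minimises \<open>1 - 2 * t * \<alpha> + t^2 * K^2\<close>,
   with value \<open>1 - \<alpha>^2 / K^2\<close>. The maximum with 0 in \<open>c\<close> covers the
   trivial subspace, where \<alpha> may exceed \<open>K\<close>.\<close>
 define t where "t = \<alpha> / K^2"
 define c where "c = sqrt (max 0 (1 - \<alpha>\<^sup>2 / K^2))"
 define F where "F u = u - t *R P (A u - f)" for u
 have c: "0 <= c" "c < 1" using \<alpha> K by(auto simp: c_def)
 have t: "t > 0" using \<alpha> K by(simp add: t_def)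
 have contr: "dist (F u) (F v) <= c * dist u v" if "u : W" "v : W" for u v
 proof -
  define d where "d = u - v"
  have d: "d : W" using that W by(simp add: d_def subspace_diff)
  define e where "e = P (A u - f) - P (A v - f)"
  have en: "norm e <= K * norm d"
   unfolding e_def d_def using Pn[of "A u - f" "A v - f"] K(2)[of "u - v"] by(simp add: A.diff mult.commute)
  have ed: "inner e d = inner (A d) d"
   unfolding e_def using d by(simp add: inner_diff_left Pi A.diff[symmetric] d_def[symmetric]) (simp add: inner_diff_left d_def A.diff)
  have "(norm (F u - F v))^2 = (norm (d - t *R e))^2"
   by(simp add: F_def d_def e_def algebra_simps)
  also have "... = (norm d)^2 - 2 * t * inner e d + t^2 * (norm e)^2"
   unfolding power2_norm_eq_inner by(simp add: inner_simps inner_commute power2_eq_square)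
  also have "... <= (norm d)^2 - 2 * t * (\<alpha> * (norm d)^2) + t^2 * (K * norm d)^2"
  proof -
   have "t * (\<alpha> * (norm d)^2) <= t * inner e d" using \<alpha>(2)[OF d] t ed by simp
   moreover have "t^2 * (norm e)^2 <= t^2 * (K * norm d)^2" using en by(intro mult_left_mono power_mono) auto
   ultimately show ?thesis by linarith
  qed
  also have "... = (1 - \<alpha>\<^sup>2 / K^2) * (norm d)^2"
   unfolding t_def using K by(simp add: field_simps power2_eq_square)
  also have "... <= c^2 * (norm d)^2" unfolding c_def by(intro mult_right_mono) auto
  finally have "(norm (F u - F v))^2 <= (c * norm d)^2" by(simp add: power_mult_distrib)
  thus ?thesis using c by(simp add: dist_norm d_def power2_le_iff_abs_le)
 qed
 have FW: "F ` W \<subseteq> W" using P W by(auto simp: F_def intro!: subspace_diff subspace_scale)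
 have "\<exists>!u\<in>W. F u = u"
  using Banach_fix[of W c F] c FW contr W subspace_0[OF W(1)] by(auto simp: complete_eq_closed)
 moreover have "F u = u \<longleftrightarrow> (ALL v:W. inner (A u) v = inner f v)" if "u : W" for u
 proof
  assume "F u = u"
  hence "P (A u - f) = 0" using t by(simp add: F_def)
  thus "ALL v:W. inner (A u) v = inner f v"
   using Pi[of _ "A u - f"] by(auto simp: inner_simps)
 next
  assume "ALL v:W. inner (A u) v = inner f v"
  hence "inner (P (A u - f)) (P (A u - f)) = 0" using P by(simp add: Pi inner_simps)
  thus "F u = u" by(simp add: F_def)
 qed
 ultimately show ?thesis by blast
qed

lemma subspace_closure_tendsto_inner:
 fixes V :: "'a::real_inner set"
 assumes conv: "!!v. v : V ==> (%n. inner (x n) v) ----> inner y v"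
  and bd: "!!n. norm (x n) <= C" and z: "z : closure V"
 shows "(%n. inner (x n) z) ----> inner y z"
proof (rule LIMSEQ_I)
 fix e :: real assume e: "e > 0"
 define B where "B = C + norm y + 1"
 have B: "B > 0" using bd[of 0] norm_ge_zero[of "x 0"] norm_ge_zero[of y] unfolding B_def by linarith
 obtain v where v: "v : V" "dist v z < e / (2 * B)"
  using z e B unfolding closure_approachable by(metis divide_pos_pos mult_pos_pos zero_less_numeral)
 obtain N where N: "!!n. n >= N ==> norm (inner (x n) v - inner y v) < e / 2"
  using LIMSEQ_D[OF conv[OF v(1)], of "e/2"] e by auto
 have "norm (inner (x n) z - inner y z) < e" if "n >= N" for n
 proof -
  have "inner (x n) z - inner y z = (inner (x n) v - inner y v) + inner (x n - y) (z - v)"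
   by(simp add: inner_simps)
  also have "abs ... <= abs (inner (x n) v - inner y v) + norm (x n - y) * norm (z - v)"
   using Cauchy_Schwarz_ineq2[of "x n - y" "z - v"] by linarith
  also have "norm (x n - y) * norm (z - v) <= B * (e / (2 * B))"
   using norm_triangle_ineq4[of "x n" y] bd[of n] v(2) B
   by(intro mult_mono) (auto simp: B_def dist_norm norm_minus_commute)
  also have "B * (e / (2 * B)) = e / 2" using B by simp
  finally show ?thesis using N[OF that] by simp
 qed
 thus "EX N. ALL n>=N. norm (inner (x n) z - inner y z) < e" by blast
qed

section \<open>Test functions\<close>

abbreviation Ck :: "nat => (real^2 => real) => bool" where
 "Ck \<equiv> k_times_continuously_differentiable"

lemma Ck_SucI:
 assumes "!!x. (f has_derivative D x) (at x)" "!!b. b : Basis ==> Ck k (%x. D x b)"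
 shows "Ck (Suc k) f"
proof -
 have "frechet_derivative f (at x) = D x" for x
  using frechet_derivative_at[OF assms(1)] by simp
 moreover have "f differentiable_on UNIV"
  using assms(1) by(auto simp: differentiable_on_def differentiable_def)
 ultimately show ?thesis using assms(2) by simp
qed

lemma Ck_SucD:
 assumes "Ck (Suc k) f"
 shows "(f has_derivative frechet_derivative f (at x)) (at x)"
  and "b : Basis ==> Ck k (%x. frechet_derivative f (at x) b)"
 using assms by(auto simp: differentiable_on_def frechet_derivative_works)

lemma Ck_continuous: "Ck k f ==> continuous_on UNIV f"
 by(cases k) (auto intro: differentiable_imp_continuous_on)

lemma Ck_Suc_imp: "Ck (Suc k) f ==> Ck k f"
proof (induction k arbitrary: f)
 case 0 thus ?case by(auto intro: differentiable_imp_continuous_on)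
next
 case (Suc k)
 thus ?case
  using k_times_continuously_differentiable.simps(2) by blast
qed

lemma Ck_const: "Ck k (%x. c)"
proof (induction k arbitrary: c)
 case (Suc k)
 show ?case by(rule Ck_SucI[of _ "%x v. 0"]) (auto intro: Suc has_derivative_const)
qed simp

lemma Ck_inner: "Ck k (%x. x *. a)"
proof (cases k)
 case (Suc m)
 show ?thesis unfolding Suc
  by(rule Ck_SucI[of _ "%x v. v *. a"])
   (auto intro: Ck_const bounded_linear_imp_has_derivative bounded_linear_inner_left)
qed (auto intro!: continuous_intros)

lemma Ck_add: "Ck k f ==> Ck k g ==> Ck k (%x. f x + g x)"
proof (induction k arbitrary: f g)
 case 0 thus ?case by(auto intro!: continuous_intros)
next
 case (Suc k)
 show ?case
  by(rule Ck_SucI[OF has_derivative_add[OF Ck_SucD(1)[OF Suc.prems(1)] Ck_SucD(1)[OF Suc.prems(2)]]])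
   (auto intro: Suc.IH Ck_SucD(2)[OF Suc.prems(1)] Ck_SucD(2)[OF Suc.prems(2)])
qed

lemma Ck_mult: "Ck k f ==> Ck k g ==> Ck k (%x. f x * g x)"
proof (induction k arbitrary: f g)
 case 0 thus ?case by(auto intro!: continuous_intros)
next
 case (Suc k)
 show ?case
  by(rule Ck_SucI[OF has_derivative_mult[OF Ck_SucD(1)[OF Suc.prems(1)] Ck_SucD(1)[OF Suc.prems(2)]]])
   (auto intro!: Ck_add Suc.IH Ck_SucD(2)[OF Suc.prems(1)] Ck_SucD(2)[OF Suc.prems(2)]
     Ck_Suc_imp[OF Suc.prems(1)] Ck_Suc_imp[OF Suc.prems(2)])
qed

text \<open>The functions \<open>t\<^sup>-\<^sup>k exp (-1/t)\<close> for \<open>t > 0\<close>, extended by zero: their derivatives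
 are linear combinations of functions of the same kind.\<close>

definition exp_cutoff :: "nat => real => real" where
 "exp_cutoff k t = (if t > 0 then exp (- (1/t)) / t^k else 0)"

lemma exp_cutoff_tendsto_0: "(exp_cutoff k \<longlongrightarrow> 0) (at 0)"
proof -
 have "((%x::real. x^k / exp x) \<longlongrightarrow> 0) at_top" by(rule tendsto_power_div_exp_0)
 hence "((%t::real. (inverse t)^k / exp (inverse t)) \<longlongrightarrow> 0) (at_right 0)"
  by(rule filterlim_compose[OF _ filterlim_inverse_at_top_right])
 hence "(exp_cutoff k \<longlongrightarrow> 0) (at_right 0)"
  by(rule Lim_transform_eventually)
   (auto simp: exp_cutoff_def eventually_at_right_less exp_minus field_simps power_divide
     intro!: eventually_mono[OF eventually_at_right_less[of 0]])
 moreover have "(exp_cutoff k \<longlongrightarrow> 0) (at_left 0)"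
  by(rule Lim_transform_eventually[OF tendsto_const])
   (auto simp: exp_cutoff_def eventually_at_filter)
 ultimately show ?thesis by(rule filterlim_split_at_real[rotated])
qed

lemma exp_cutoff_deriv:
 "(exp_cutoff k has_real_derivative exp_cutoff (k + 2) t - real k * exp_cutoff (k + 1) t) (at t)"
proof -
 consider "t > 0" | "t < 0" | "t = 0" by linarith
 thus ?thesis
 proof cases
  case 1
  have "((%t. exp (- (1/t)) / t^k) has_real_derivative exp_cutoff (k + 2) t - real k * exp_cutoff (k + 1) t) (at t)"
   using 1 by(auto intro!: derivative_eq_intros simp: exp_cutoff_def field_simps power_add power2_eq_square)
    (cases k; simp add: field_simps)
  thus ?thesis
   by(rule DERIV_cong_ev[THEN iffD1, rotated 3, OF _ refl _ refl])
    (use 1 in \<open>auto simp: exp_cutoff_def intro!: eventually_mono[OF eventually_nhds_in_open[of "{0<..}"]]\<close>)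
 next
  case 2
  have "((%t. 0) has_real_derivative exp_cutoff (k + 2) t - real k * exp_cutoff (k + 1) t) (at t)"
   using 2 by(auto simp: exp_cutoff_def)
  thus ?thesis
   by(rule DERIV_cong_ev[THEN iffD1, rotated 3, OF _ refl _ refl])
    (use 2 in \<open>auto simp: exp_cutoff_def intro!: eventually_mono[OF eventually_nhds_in_open[of "{..<0}"]]\<close>)
 next
  case 3
  \<comment> \<open>At zero the difference quotient of \<open>exp_cutoff k\<close> is
    \<open>exp_cutoff (Suc k)\<close>, a member of the same family.\<close>
  have "((%h. (exp_cutoff k (0 + h) - exp_cutoff k 0) / h) \<longlongrightarrow> 0) (at 0)"
   by(rule Lim_transform_eventually[OF exp_cutoff_tendsto_0[of "Suc k"]])
    (auto simp: exp_cutoff_def eventually_at_filter)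
  thus ?thesis using 3 by(simp add: DERIV_def exp_cutoff_def)
 qed
qed

lemma Ck_exp_cutoff: "Ck m (%x::real^2. exp_cutoff k (1 - c * (x *. x)))"
proof (induction m arbitrary: k)
 case 0
 have "continuous_on UNIV (exp_cutoff k)"
  using exp_cutoff_deriv by(auto intro!: DERIV_continuous_on)
 thus ?case
  by(auto intro!: continuous_on_compose2[of UNIV "exp_cutoff k"] continuous_intros)
next
 case (Suc m)
 define e where "e x = exp_cutoff (k + 2) (1 - c * (x *. x)) + (- real k) * exp_cutoff (k + 1) (1 - c * (x *. x))"
  for x :: "real^2"
 have e: "Ck m e" unfolding e_def by(intro Ck_add Ck_mult Ck_const Suc)
 show ?case
 proof (rule Ck_SucI)
  fix x :: "real^2"
  have "((%x. 1 - c * (x *. x)) has_derivative (%v. (x *. v) * (- 2 * c))) (at x)"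
   by(auto intro!: derivative_eq_intros simp: inner_commute)
  moreover have "(exp_cutoff k has_derivative (%h. e x * h)) (at (1 - c * (x *. x)))"
   using exp_cutoff_deriv[of k "1 - c * (x *. x)"] by(simp add: has_field_derivative_def e_def)
  ultimately show "((%x. exp_cutoff k (1 - c * (x *. x))) has_derivative (%v. e x * ((x *. v) * (- 2 * c)))) (at x)"
   by(rule has_derivative_compose)
 next
  fix b :: "real^2"
  show "Ck m (%x. e x * ((x *. b) * (- 2 * c)))"
   by(intro Ck_mult e Ck_inner Ck_const)
 qed
qed

subsection \<open>Continuous functions with compact support\<close>

text \<open>Continuity is required on the whole plane, so extension by zero is built in. Any compact
  set containing the support may serve as witness, which makes sums and products immediate.\<close>

definition cc :: "(real^2) set => (real^2 => 'b::euclidean_space) => bool" where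
 "cc U f \<longleftrightarrow> continuous_on UNIV f & (EX K. compact K & K \<subseteq> U & (ALL x. x ~: K --> f x = 0))"

lemma ccI: "continuous_on UNIV f ==> compact K ==> K \<subseteq> U ==> (!!x. x ~: K ==> f x = 0) ==> cc U f"
 unfolding cc_def by blast

lemma ccE:
 assumes "cc U f" obtains K where "compact K" "K \<subseteq> U" "!!x. x ~: K ==> f x = 0"
 using assms unfolding cc_def by blast

lemma cc_mono: "cc U f ==> U \<subseteq> U' ==> cc U' f"
 unfolding cc_def by blast

lemma cc_continuous: "cc U f ==> continuous_on UNIV f"
 by(simp add: cc_def)

lemma cc_measurable[measurable_dest]: "cc U f ==> f : borel_fun"
 by(intro borel_measurable_continuous_onI cc_continuous)

lemma cc_zero: "cc U (%x. 0)"
 by(rule ccI[of _ "{}"]) auto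

lemma cc_eq_0: "cc U f ==> x ~: U ==> f x = 0"
 unfolding cc_def by blast

lemma cc_bounded:
 assumes "cc U f" obtains B where "B > 0" "!!x. norm (f x) <= B"
proof -
 obtain K where K: "compact K" "!!x. x ~: K ==> f x = 0" using ccE[OF assms] by metis
 have "compact (f ` K)"
  using K(1) assms by(intro compact_continuous_image) (auto simp: cc_def intro: continuous_on_subset)
 then obtain B where B: "B > 0" "!!x. x : K ==> norm (f x) <= B"
  using compact_imp_bounded bounded_pos by(metis imageI)
 have "norm (f x) <= B" for x using B K(2) by(cases "x : K") auto
 with B(1) show thesis by(rule that)
qed

lemma cc_integrable:
 assumes "cc U (f :: real^2 => 'b::euclidean_space)" shows "L1 f"
proof -
 obtain K where K: "compact K" "!!x. x ~: K ==> f x = 0" using ccE[OF assms] by metis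
 have "L1 (%x. ind K x *R f x)"
  by(rule borel_integrable_compact[OF K(1)]) (use assms in "auto simp: cc_def intro: continuous_on_subset")
 moreover have "(%x. ind K x *R f x) = f" using K(2) by(auto simp: indicator_def)
 ultimately show ?thesis by simp
qed

lemma cc_uniformly_continuous:
 assumes "cc U f" "e > 0"
 obtains d where "d > 0" "!!x y. dist x y < d ==> dist (f x) (f y) < e"
proof -
 obtain K where K: "compact K" "!!x. x ~: K ==> f x = 0" using ccE[OF assms(1)] by metis
 obtain R where R: "!!x. x : K ==> norm x <= R" using compact_imp_bounded[OF K(1)] unfolding bounded_iff by blast
 define K' where "K' = cball (0::real^2) (R + 1)"
 have "compact K'" by(simp add: K'_def)
 hence "uniformly_continuous_on K' f"
  using assms by(intro compact_uniformly_continuous) (auto simp: cc_def intro: continuous_on_subset)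
 then obtain d where d: "d > 0" "!!x y. x : K' ==> y : K' ==> dist y x < d ==> dist (f y) (f x) < e"
  using assms(2) unfolding uniformly_continuous_on_def by metis
 have "dist (f x) (f y) < e" if "dist x y < min d 1" for x y
 proof (cases "x : K \<or> y : K")
  case True
  hence "x : K' & y : K'" using that R[of x] R[of y] norm_triangle_sub[of x y] norm_triangle_sub[of y x]
   unfolding K'_def by(auto simp: dist_norm norm_minus_commute)
  thus ?thesis using d(2) that by simp
 next
  case False thus ?thesis using K(2) assms(2) by simp
 qed
 thus thesis using d(1) by(intro that[of "min d 1"]) auto
qed

lemma cc_sq:
 assumes "cc U (f :: real^2 => 'b::euclidean_space)" shows "cc U (%x. (norm (f x))^2)"
 using assms unfolding cc_def by(auto intro!: continuous_intros)

lemma cc_sqint: "cc U f ==> sqint f"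
 unfolding sqint_def by(auto intro: cc_integrable cc_sq cc_measurable)

lemma cc_add: assumes "cc U f" "cc U g" shows "cc U (%x. f x + g x)"
proof -
 obtain K L where "compact K" "K \<subseteq> U" "!!x. x ~: K ==> f x = 0" "compact L" "L \<subseteq> U" "!!x. x ~: L ==> g x = 0"
  using ccE[OF assms(1)] ccE[OF assms(2)] by metis
 thus ?thesis
  using assms by(intro ccI[of _ "K \<union> L"]) (auto simp: cc_def intro!: continuous_intros)
qed

lemma cc_scale_left:
 fixes f :: "real^2 => real" and g :: "real^2 => 'b::euclidean_space"
 assumes "cc U f" "continuous_on UNIV g" shows "cc U (%x. f x *R g x)"
 using assms unfolding cc_def by(auto intro!: continuous_intros)

lemma cc_scale_right:
 fixes f :: "real^2 => real" and g :: "real^2 => 'b::euclidean_space"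
 assumes "cc U g" "continuous_on UNIV f" shows "cc U (%x. f x *R g x)"
 using assms unfolding cc_def by(auto intro!: continuous_intros)

lemma cc_inner_right:
 fixes f g :: "real^2 => real^2"
 assumes "cc U g" "continuous_on UNIV f" shows "cc U (%x. f x *. g x)"
 using assms unfolding cc_def by(auto intro!: continuous_intros)

lemma cc_matrix: "cc U g ==> cc U (%x. M *v (g x::real^2))"
 unfolding cc_def by(auto intro: bounded_linear.continuous_on[OF matrix_vector_mul_bounded_linear])

subsection \<open>Continuously differentiable functions with compact support\<close>

text \<open>The gradient is an explicit second argument, so the gradients of products and
  convolutions are written down instead of being computed from \<open>frechet_derivative\<close>.
  One derivative suffices for all integrations by parts below.\<close>

definition c1c :: "(real^2) set => (real^2 => real) => (real^2 => real^2) => bool" where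
 "c1c U f g \<longleftrightarrow> cc U f & cc U g & (ALL x. (f has_derivative (%v. g x *. v)) (at x))"

lemma c1cI:
 assumes der: "!!x. (f has_derivative (%v. g x *. v)) (at x)" and g: "continuous_on UNIV g"
  and K: "compact K" "K \<subseteq> U" "!!x. x ~: K ==> f x = 0"
 shows "c1c U f g"
proof -
 have f: "continuous_on UNIV f"
  using der by(meson continuous_at_imp_continuous_on has_derivative_continuous)
 have "g x = 0" if "x ~: K" for x
 proof -
  have "open (- K)" using K(1) by(simp add: compact_imp_closed open_Compl)
  hence "((%x. 0) has_derivative (%v. g x *. v)) (at x)"
   using K(3) that by(intro has_derivative_transform_within_open[OF der[of x], of "- K"]) auto
  hence "(%v. g x *. v) = (%v. 0)"
   using has_derivative_unique[OF _ has_derivative_const] by blast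
  hence "g x *. g x = 0" by meson
  thus ?thesis by simp
 qed
 hence "cc U g" using g K by(intro ccI[of g K]) auto
 with f K der show ?thesis unfolding c1c_def by(auto intro: ccI[of f K])
qed

lemma c1c_D:
 assumes "c1c U f g"
 shows "cc U f" "cc U g" "(f has_derivative (%v. g x *. v)) (at x)"
 using assms by(auto simp: c1c_def)

lemma c1c_mono: "c1c U f g ==> U \<subseteq> U' ==> c1c U' f g"
 unfolding c1c_def by(auto intro: cc_mono)

lemma c1c_mult:
 assumes "c1c U f g" and h: "!!x. (h has_derivative (%v. k x *. v)) (at x)" "continuous_on UNIV k"
 shows "c1c U (%x. f x * h x) (%x. h x *R g x + f x *R k x)"
proof -
 obtain K where K: "compact K" "K \<subseteq> U" "!!x. x ~: K ==> f x = 0"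
  using assms(1) ccE unfolding c1c_def by metis
 have ch: "continuous_on UNIV h"
  using h(1) by(meson continuous_at_imp_continuous_on has_derivative_continuous)
 show ?thesis
 proof (rule c1cI[OF _ _ K(1,2)])
  fix x show "((%x. f x * h x) has_derivative (%v. (h x *R g x + f x *R k x) *. v)) (at x)"
   by(rule derivative_eq_intros c1c_D(3)[OF assms(1)] h(1))+ (auto simp: inner_simps)
 qed (use assms ch K in "auto simp: c1c_def cc_def intro!: continuous_intros")
qed

lemma grad_inner:
 assumes "(f has_derivative D) (at x)" shows "grad f x *. v = D v"
proof -
 have D: "D = frechet_derivative f (at x)" using frechet_derivative_at[OF assms] .
 interpret bounded_linear D using assms by(rule has_derivative_bounded_linear)
 have v: "v = v $ 1 *R axis 1 1 + v $ 2 *R axis 2 1" by(simp add: vec_eq_iff axis_def forall_2)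
 have "D v = v $ 1 * D (axis 1 1) + v $ 2 * D (axis 2 1)"
  by(subst v) (simp only: add scaleR real_scaleR_def)
 thus ?thesis by(simp add: grad_def inner_vec_def D sum_2 mult.commute)
qed

lemma c1c_grad: assumes "c1c U f g" shows "grad f = g"
proof
 fix x
 have "(grad f x - g x) *. (grad f x - g x) = 0"
  using grad_inner[OF c1c_D(3)[OF assms]] by(simp add: inner_diff_left)
 thus "grad f x = g x" by simp
qed

lemma Basis_real2: "(b::real^2) : Basis \<longleftrightarrow> b = axis 1 1 \<or> b = axis 2 1"
proof -
 have "UNIV = {1, 2::2}" using exhaust_2 by auto
 have "(Basis :: (real^2) set) = (\<Union>i\<in>UNIV. {axis i 1})" by(simp add: Basis_vec_def)
 also have "... = {axis 1 1, axis 2 1}" unfolding \<open>UNIV = {1, 2}\<close> by auto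
 finally show ?thesis by blast
qed

lemma test_function_c1c:
 assumes "\<phi> : TF U" shows "c1c U \<phi> (grad \<phi>)"
proof (rule c1cI)
 have C: "Ck (Suc 0) \<phi>" using assms by(simp add: test_functions_def)
 show "(\<phi> has_derivative (%v. grad \<phi> x *. v)) (at x)" for x
  using Ck_SucD(1)[OF C, of x] grad_inner[OF Ck_SucD(1)[OF C, of x]] by simp
 have "continuous_on UNIV (%x. frechet_derivative \<phi> (at x) (axis i 1))" for i
  using Ck_SucD(2)[OF C, of "axis i 1"] by(simp add: Basis_real2) (metis exhaust_2)
 thus "continuous_on UNIV (grad \<phi>)" unfolding grad_def by(intro continuous_on_vec_lambda)
 show "compact (closure {x. \<phi> x ~= 0})" "closure {x. \<phi> x ~= 0} \<subseteq> U"
  using assms by(auto simp: test_functions_def)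
 show "\<phi> x = 0" if "x ~: closure {x. \<phi> x ~= 0}" for x
  using that closure_subset[of "{x. \<phi> x ~= 0}"] by auto
qed

lemma test_functionI:
 assumes "!!k. Ck k f" "compact K" "K \<subseteq> U" "!!x. x ~: K ==> f x = 0"
 shows "f : TF U"
proof -
 have "closure {x. f x ~= 0} \<subseteq> K"
  using assms by(intro closure_minimal) (auto intro: compact_imp_closed)
 moreover have "bounded {x. f x ~= 0}"
  using assms by(intro bounded_subset[OF compact_imp_bounded, of K]) auto
 ultimately show ?thesis using assms unfolding test_functions_def by auto
qed

lemma test_functions_add: assumes "f : TF U" "g : TF U"
 shows "(%x. f x + g x) : TF U"
proof -
 obtain K L where "compact K" "K \<subseteq> U" "!!x. x ~: K ==> f x = 0" "compact L" "L \<subseteq> U" "!!x. x ~: L ==> g x = 0"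
  using ccE[OF c1c_D(1)[OF test_function_c1c[OF assms(1)]]] ccE[OF c1c_D(1)[OF test_function_c1c[OF assms(2)]]] by metis
 thus ?thesis
  using assms by(intro test_functionI[of _ "K \<union> L"]) (auto simp: test_functions_def intro: Ck_add)
qed

lemma test_functions_scale: assumes "f : TF U" shows "(%x. c * f x) : TF U"
proof -
 obtain K where "compact K" "K \<subseteq> U" "!!x. x ~: K ==> f x = 0"
  using ccE[OF c1c_D(1)[OF test_function_c1c[OF assms(1)]]] by metis
 thus ?thesis
  using assms by(intro test_functionI[of _ K]) (auto simp: test_functions_def intro: Ck_mult Ck_const)
qed

lemma test_functions_zero: "(%x. 0) : TF U"
 by(rule test_functionI[of _ "{}"]) (auto intro: Ck_const)

lemma c1c_add: assumes "c1c U f g" "c1c U h k" shows "c1c U (%x. f x + h x) (%x. g x + k x)"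
proof -
 have "((%x. f x + h x) has_derivative (%v. (g x + k x) *. v)) (at x)" for x
  using has_derivative_add[OF c1c_D(3)[OF assms(1)] c1c_D(3)[OF assms(2)]] by(simp add: inner_add_left)
 thus ?thesis using assms unfolding c1c_def by(simp add: cc_add)
qed

lemma c1c_scale: assumes "c1c U f g" shows "c1c U (%x. c * f x) (%x. c *R g x)"
proof -
 have "((%x. c * f x) has_derivative (%v. (c *R g x) *. v)) (at x)" for x
  using has_derivative_mult_right[OF c1c_D(3)[OF assms], of c] by simp
 moreover have "cc U (%x. c *R g x)" "cc U (%x. c *R f x)"
  using assms cc_scale_right[of U _ "%x. c"] unfolding c1c_def by(auto simp del: real_scaleR_def)
 ultimately show ?thesis unfolding c1c_def real_scaleR_def by blast
qed

subsection \<open>Integration by parts\<close>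

lemma lborel_integral_shift:
 fixes f :: "'a::euclidean_space => 'b::{banach, second_countable_topology}"
 assumes [measurable]: "f : borel_fun"
 shows "(LI x. f (x + a)) = (LI x. f x)"
proof -
 have "(LI x. f x) = (LINT x|distr lborel borel ((+) a). f x)"
  by(simp add: lborel_distr_plus)
 also have "... = (LI x. f (a + x))" by(subst integral_distr) auto
 finally show ?thesis by(simp add: add.commute)
qed

lemma lborel_integrable_shift:
 fixes f :: "'a::euclidean_space => 'b::{banach, second_countable_topology}"
 assumes "L1 f" shows "L1 (%x. f (x + a))"
proof -
 have [measurable]: "f : borel_fun" using assms by auto
 have "integrable (distr lborel borel ((+) a)) f" using assms by(simp add: lborel_distr_plus)
 thus ?thesis by(subst (asm) integrable_distr_eq) (auto simp: add.commute)
qed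

lemma c1c_difference_bound:
 assumes "c1c U f g" "!!x. norm (g x) <= B" shows "abs (f (x + v) - f x) <= B * norm v"
proof -
 have "norm (f (x + v) - f x) <= B * norm ((x + v) - x)"
 proof (rule differentiable_bound[OF convex_UNIV])
  show "(f has_derivative (%v. g x *. v)) (at x within UNIV)" for x using c1c_D(3)[OF assms(1)] by simp
  show "onorm (%v. g x *. v) <= B" for x
  proof (rule onorm_le)
   fix v
   have "norm (g x *. v) <= norm (g x) * norm v" by(simp add: Cauchy_Schwarz_ineq2)
   also have "... <= B * norm v" by(rule mult_right_mono) (use assms(2) in auto)
   finally show "norm (g x *. v) <= B * norm v" .
  qed
 qed auto
 thus ?thesis by simp
qed

lemma c1c_difference_quotient:
 assumes "c1c U f g" "t ----> 0" "!!n. t n ~= 0"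
 shows "(%n. (f (x + t n *R v) - f x) / t n) ----> g x *. v"
proof -
 have "((%s. f (x + s *R v)) has_derivative (%s. g x *. (s *R v))) (at 0)"
  by(rule has_derivative_compose[where f="%s. x + s *R v" and g=f])
   (auto intro!: derivative_eq_intros c1c_D(3)[OF assms(1)])
 moreover have "(%s. g x *. (s *R v)) = (*) (g x *. v)" by(auto simp: mult.commute)
 ultimately
 have "((%s. f (x + s *R v)) has_real_derivative (g x *. v)) (at 0)"
  by(simp add: has_field_derivative_def)
 hence "((%h. (f (x + h *R v) - f x) / h) \<longlongrightarrow> g x *. v) (at 0)"
  by(simp add: DERIV_def)
 thus ?thesis
  by(rule filterlim_compose) (use assms in "simp add: filterlim_at")
qed

text \<open>Integration by parts reduces to translation invariance of the integral.\<close>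

lemma c1c_quotient_bound:
 assumes f: "c1c UNIV f g"
 obtains B R where "B >= 0" "!!t x. 0 < abs t ==> abs t <= 1 ==>
   \<bar>(f (x + t *R v) - f x) / t\<bar> <= B * ind (cball 0 R) x"
proof -
 obtain B where B: "B > 0" "!!x. norm (g x) <= B" using cc_bounded[OF c1c_D(2)[OF f]] by blast
 obtain K where K: "compact K" "!!x. x ~: K ==> f x = 0" using ccE[OF c1c_D(1)[OF f]] by metis
 obtain R where R: "!!x. x : K ==> norm x <= R" using compact_imp_bounded[OF K(1)] unfolding bounded_iff by blast
 have w: "abs ((f (x + t *R v) - f x) / t) <= B * norm v * ind (cball 0 (R + norm v)) x"
  if t: "0 < abs t" "abs t <= 1" for t x
 proof (cases "x : cball 0 (R + norm v)")
  case True
  have "abs (f (x + t *R v) - f x) <= B * norm (t *R v)" by(rule c1c_difference_bound[OF f B(2)])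
  thus ?thesis using t True by(simp add: field_simps)
 next
  case False
  have "norm (t *R v) <= norm v" using t by(simp add: mult_left_le_one_le)
  moreover have "norm x > R + norm v" using False by simp
  moreover have "norm x <= norm (x + t *R v) + norm (t *R v)"
   using norm_triangle_ineq4[of "x + t *R v" "t *R v"] by simp
  ultimately have "norm x > R" "norm (x + t *R v) > R" using norm_ge_zero[of v] by linarith+
  hence "f x = 0" "f (x + t *R v) = 0" using K(2) R by force+
  thus ?thesis by(simp add: B(1) less_imp_le)
 qed
 show thesis by(rule that[OF _ w]) (use B in auto)
qed

lemma integrable_indicator_cball: "L1 (%x::real^2. B * ind (cball 0 R) x :: real)"
 by(intro integrable_mult_right integrable_real_indicator) (auto simp: emeasure_lborel_cball_finite[unfolded infinity_ennreal_def])

lemma integral_grad_zero: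
 assumes f: "c1c U f g" shows "(LI x. g x *. v) = 0"
proof -
 note f = c1c_mono[OF f subset_UNIV]
 have [measurable]: "f : borel_fun" "g : borel_fun"
  using c1c_D[OF f] by(auto intro: cc_measurable)
 obtain B R where BR: "B >= 0" "!!t x. 0 < abs t ==> abs t <= 1 ==>
   \<bar>(f (x + t *R v) - f x) / t\<bar> <= B * ind (cball 0 R) x"
  using c1c_quotient_bound[OF f] by blast
 define t where "t n = 1 / real (Suc n)" for n
 have t: "t ----> 0" "t n ~= 0" "0 < abs (t n)" "abs (t n) <= 1" for n
  unfolding t_def using LIMSEQ_inverse_real_of_nat by(auto simp: inverse_eq_divide)
 have "(%n. LI x. (f (x + t n *R v) - f x) / t n) ----> (LI x. g x *. v)"
 proof (rule integral_dominated_convergence)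
  show "L1 (%x::real^2. B * ind (cball 0 R) x :: real)" by(rule integrable_indicator_cball)
  show "AEl x. (%n. (f (x + t n *R v) - f x) / t n) ----> g x *. v"
   using c1c_difference_quotient[OF f t(1) t(2)] by simp
  show "AEl x. norm ((f (x + t n *R v) - f x) / t n) <= B * ind (cball 0 R) x" for n
   using BR(2)[OF t(3)[of n] t(4)[of n]] by simp
 qed measurable
 moreover have "(LI x. (f (x + t n *R v) - f x) / t n) = 0" for n
 proof -
  have i: "L1 f" using c1c_D(1)[OF f] by(rule cc_integrable)
  have "(LI x. f (x + t n *R v) - f x) = 0"
   using i lborel_integrable_shift[OF i] by(simp add: lborel_integral_shift)
  thus ?thesis by simp
 qed
 ultimately show ?thesis by(simp only: LIMSEQ_const_iff)
qed

text \<open>Central differences are antisymmetric and commute with each other.\<close>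

lemma integral_central_difference_swap:
 fixes f h :: "real^2 => real"
 assumes f: "cc U f" and h: "cc U h"
 shows "(LI x. (f (x + a) - f (x - a)) * (h (x + b) - h (x - b)))
   = (LI x. (f (x + b) - f (x - b)) * (h (x + a) - h (x - a)))"
proof -
 define \<phi> where "\<phi> c = (LI x. f x * h (x + c))" for c
 have [measurable]: "f : borel_fun" "h : borel_fun"
  using f h by(auto intro: cc_measurable)
 obtain B where B: "!!x. norm (h x) <= B" using cc_bounded[OF h] by blast
 have i: "L1 (%x. f x * h (x + c))" for c
 proof (rule L1_bound[of _ "%x. f x * B"])
  have "abs (f x) * abs (h (x + c)) <= abs (f x) * abs B" for x
   using B[of "x + c"] by(intro mult_left_mono) auto
  thus "AEl x. norm (f x * h (x + c)) <= norm (f x * B)" by(simp add: abs_mult)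
 qed (use cc_integrable[OF f] in auto)
 have I: "L1 (%x. f (x + a) * h (x + b)) & (LI x. f (x + a) * h (x + b)) = \<phi> (b - a)" for a b
  using lborel_integrable_shift[OF i[of "b - a"], of a]
   lborel_integral_shift[of "%x. f x * h (x + (b - a))" a] by(simp add: \<phi>_def add.commute add.left_commute)
 have E: "(LI x. (f (x + a) - f (x - a)) * (h (x + b) - h (x - b)))
   = \<phi> (b - a) - \<phi> (- b - a) - \<phi> (b + a) + \<phi> (a - b)" for a b
 proof -
  have "(%x. (f (x + a) - f (x - a)) * (h (x + b) - h (x - b))) = (%x. f (x + a) * h (x + b)
    - f (x + a) * h (x + - b) - f (x + - a) * h (x + b) + f (x + - a) * h (x + - b))"
   by(simp add: algebra_simps)
  thus ?thesis
   using I[of a b] I[of a "- b"] I[of "- a" b] I[of "- a" "- b"] by(simp add: add.commute)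
 qed
 have "\<phi> (- b - a) = \<phi> (- a - b)" "\<phi> (b + a) = \<phi> (a + b)"
  by(rule arg_cong[where f=\<phi>], simp)+
 thus ?thesis unfolding E by simp
qed

text \<open>This is the symmetry of mixed second derivatives after two integrations by parts. It
  holds for functions of class C^1 because only central differences in two directions have to
  commute; dominated convergence then replaces them by derivatives.\<close>

lemma integral_grad_swap:
 assumes f: "c1c U f g" and h: "c1c U h k"
 shows "(LI x. (g x *. a) * (k x *. b)) = (LI x. (g x *. b) * (k x *. a))"
proof -
 define t where "t n = 1 / real (Suc n)" for n
 have t: "t ----> 0" "t n ~= 0" "0 < abs (t n)" "abs (t n) <= 1" for n
  unfolding t_def using LIMSEQ_inverse_real_of_nat by(auto simp: inverse_eq_divide)
 define C where "C f v n x = (f (x + t n *R v) - f (x - t n *R v)) / t n"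
  for f :: "real^2 => real" and v x n
 have C: "EX B R. B >= 0 & (ALL n x. abs (C f v n x) <= B * ind (cball 0 R) x) &
   (ALL x. (%n. C f v n x) ----> 2 * (g x *. v))" if c: "c1c U f g" for f g v
 proof -
  note c = c1c_mono[OF c subset_UNIV]
  have Ceq: "C f v n x = (f (x + t n *R v) - f x) / t n + (f (x + (- t n) *R v) - f x) / (- t n)" for n x
   using t(2)[of n] by(simp add: C_def field_simps)
  obtain B R where BR: "B >= 0" "!!t x. 0 < abs t ==> abs t <= 1 ==>
   \<bar>(f (x + t *R v) - f x) / t\<bar> <= B * ind (cball 0 R) x"
   using c1c_quotient_bound[OF c] by blast
  have "abs (C f v n x) <= 2 * B * ind (cball 0 R) x" for n x
   using BR(2)[of "t n" x] BR(2)[of "- t n" x] t(3,4)[of n] unfolding Ceq by linarith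
  moreover
  have "(%n. C f v n x) ----> g x *. v + g x *. v" for x
   unfolding Ceq
   by(intro tendsto_add c1c_difference_quotient[OF c]) (use t tendsto_minus[OF t(1)] in auto)
  hence "(%n. C f v n x) ----> 2 * (g x *. v)" for x by simp
  moreover have "0 <= 2 * B" using BR(1) by simp
  ultimately show ?thesis by blast
 qed
 have lim: "(%n. LI x. C f a n x * C h b n x) ----> (LI x. 2 * (g x *. a) * (2 * (k x *. b)))" for a b
 proof -
  obtain B R where 1: "B >= 0" "!!n x. abs (C f a n x) <= B * ind (cball 0 R) x"
   "!!x. (%n. C f a n x) ----> 2 * (g x *. a)" using C[OF f, of a] by blast
  obtain B' R' where 2: "B' >= 0" "!!n x. abs (C h b n x) <= B' * ind (cball 0 R') x"
   "!!x. (%n. C h b n x) ----> 2 * (k x *. b)" using C[OF h, of b] by blast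
  have [measurable]: "f : borel_fun" "g : borel_fun"
    "h : borel_fun" "k : borel_fun"
   using c1c_D[OF f] c1c_D[OF h] by(auto intro: cc_measurable)
  show ?thesis
  proof (rule integral_dominated_convergence)
   show "L1 (%x::real^2. (B * B') * ind (cball 0 R) x :: real)" by(rule integrable_indicator_cball)
   show "AEl x. (%n. C f a n x * C h b n x) ----> 2 * (g x *. a) * (2 * (k x *. b))"
    by(intro AE_I2 tendsto_mult 1 2)
   show "AEl x. norm (C f a n x * C h b n x) <= B * B' * ind (cball 0 R) x" for n
   proof (intro AE_I2)
    fix x
    have "abs (C f a n x) * abs (C h b n x) <= (B * ind (cball 0 R) x) * (B' * 1)"
    proof (rule mult_mono[OF 1(2)])
     show "abs (C h b n x) <= B' * 1"
     using 2(2)[of n x] 2(1) by(cases "x : cball 0 R'") auto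
    qed (use 1 in auto)
    thus "norm (C f a n x * C h b n x) <= B * B' * ind (cball 0 R) x" by(simp add: abs_mult mult.commute mult.left_commute)
   qed
  qed (unfold C_def, measurable)
 qed
 have "(LI x. C f a n x * C h b n x) = (LI x. C f b n x * C h a n x)" for n
  using integral_central_difference_swap[OF c1c_D(1)[OF f] c1c_D(1)[OF h], of "t n *R a" "t n *R b"]
  by(simp add: C_def)
 hence "(LI x. 2 * (g x *. a) * (2 * (k x *. b))) = (LI x. 2 * (g x *. b) * (2 * (k x *. a)))"
  using LIMSEQ_unique[OF lim[of a b]] lim[of b a] by simp
 thus ?thesis by simp
qed

lemma J_mult: "(J *v x) $ 1 = - x $ 2" "(J *v x) $ 2 = x $ 1"
 by(simp_all add: J_def matrix_vector_mult_def sum_2)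

lemma inner_real2: "(x::real^2) *. y = x $ 1 * y $ 1 + x $ 2 * y $ 2"
 by(simp add: inner_vec_def sum_2)

lemma inner_J: "(x::real^2) *. (J *v y) = - ((J *v x) *. y)" "(J *v x) *. (J *v y) = x *. y"
  "J *v (J *v x) = - x" "x *. (J *v x) = 0"
 by(simp_all add: inner_real2 J_mult vec_eq_iff forall_2)

lemma norm_J[simp]: "norm (J *v x) = norm x"
 by(simp add: norm_eq_sqrt_inner inner_J(2))

lemma integral_grad_J_grad:
 assumes "c1c U f g" "c1c U h k" shows "(LI x. g x *. (J *v k x)) = 0"
proof -
 have i: "L1 (%x. (g x *. a) * (k x *. b))" for a b
 proof -
  have "cc U (%x. (g x *. a) *R (k x *. b))"
   using cc_inner_right[OF c1c_D(2)[OF assms(1)], of "%x. a"] c1c_D(2)[OF assms(2)]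
   by(intro cc_scale_left) (auto simp: inner_commute cc_def intro!: continuous_intros)
  thus ?thesis using cc_integrable by fastforce
 qed
 have "g x *. (J *v k x) = (g x *. axis 2 1) * (k x *. axis 1 1) - (g x *. axis 1 1) * (k x *. axis 2 1)" for x
  by(simp add: inner_real2 J_mult axis_def)
 thus ?thesis
  using integral_grad_swap[OF assms, of "axis 2 1" "axis 1 1"] i by simp
qed

text \<open>The divergence of the field \<open>f^2 x_1 e_1\<close> integrates to zero, so the
  integral of f^2 equals minus that of \<open>2 x_1 f g_1\<close>. On the support \<open>x_1\<close>
  is at most \<open>R\<close>, and Young's inequality absorbs half of the f^2 term.\<close>

lemma Poincare:
 assumes f: "c1c U f g" and U: "!!x. x : U ==> norm x <= R" and R: "R >= 0"
 shows "(LI x. (f x)^2) <= 4 * R^2 * (LI x. (norm (g x))^2)"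
proof -
 let ?D = "%x. ((x *. axis 1 1) *R (f x *R g x + f x *R g x) + (f x * f x) *R axis 1 1) *. axis 1 (1::real)" and ?E = "%x. (f x)^2 / 2 - 2 * R^2 * (norm (g x))^2"
 have 1: "c1c U (%x. f x * f x) (%x. f x *R g x + f x *R g x)"
  using c1c_mult[OF f c1c_D(3)[OF f]] c1c_D(2)[OF f] by(simp add: cc_def)
 have 2: "((%x::real^2. x *. axis 1 1) has_derivative (%v. axis 1 1 *. v)) (at x)" for x
  by(auto intro!: derivative_eq_intros simp: inner_commute)
 note m = c1c_mult[OF 1 2]
 have sq: "L1 (%x. (f x)^2)" "L1 (%x. (norm (g x))^2)"
  using cc_integrable[OF cc_sq[OF c1c_D(1)[OF f]]] cc_integrable[OF cc_sq[OF c1c_D(2)[OF f]]] by auto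
 have 0: "0 = (LI x. ?D x)"
  using integral_grad_zero[OF m, of "axis 1 1"] by simp
 have "(LI x. ?E x) <= 0"
  unfolding 0
 proof (rule integral_mono)
  show "L1 (%x. ?E x)" using sq by simp
  show "L1 (%x. ?D x)"
   by(rule integrable_inner_left) (use cc_integrable[OF c1c_D(2)[OF m]] in auto)
  fix x
  have "abs ((x *. axis 1 1) * (f x * (g x *. axis 1 1))) <= R * (abs (f x) * norm (g x))"
  proof (cases "x : U")
   case True
   have "abs (x *. axis 1 1) <= R" using U[OF True] Cauchy_Schwarz_ineq2[of x "axis 1 1"] by simp
   moreover have "abs (g x *. axis 1 1) <= norm (g x)" using Cauchy_Schwarz_ineq2[of "g x" "axis 1 1"] by simp
   ultimately show ?thesis unfolding abs_mult using R by(intro mult_mono) auto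
  next
   case False thus ?thesis using cc_eq_0[OF c1c_D(1)[OF f]] by simp
  qed
  moreover have "2 * (R * (abs (f x) * norm (g x))) <= (f x)^2 / 2 + 2 * R^2 * (norm (g x))^2"
   using sum_squares_bound[of "abs (f x) / 2" "R * norm (g x)"]
   by(simp add: power_mult_distrib power_divide mult.left_commute)
  moreover have "?D x
    = 2 * ((x *. axis 1 1) * (f x * (g x *. axis 1 1))) + (f x)^2"
   by(simp only: inner_add_left inner_scaleR_left) (simp add: inner_axis_axis power2_eq_square)
  ultimately show "?E x
    <= ?D x"
   unfolding abs_le_iff by linarith
 qed
 thus ?thesis using sq by simp
qed

subsection \<open>Convolution and mollification\<close>

lemma lborel_integral_reflect:
 fixes f :: "'a::euclidean_space => 'b::{banach, second_countable_topology}"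
 assumes [measurable]: "f : borel_fun"
 shows "(LI x. f (a - x)) = (LI x. f x)"
proof -
 have "(LI x. f x) = (LINT x|density (distr lborel borel (%x. a + (-1) *R x)) (%_. abs (-1::real)^DIM('a)). f x)"
  by(subst lborel_affine[of "-1" a]) simp_all
 also have "... = (LINT x|distr lborel borel (%x. a + (-1) *R x). f x)"
  by(simp add: density_1)
 also have "... = (LI x. f (a - x))" by(subst integral_distr) auto
 finally show ?thesis by simp
qed

lemma lborel_integrable_reflect:
 fixes f :: "'a::euclidean_space => 'b::{banach, second_countable_topology}"
 assumes f: "L1 f"
 shows "L1 (%x. f (a - x))"
proof -
 have [measurable]: "f : borel_fun" using f by auto
 have "lborel = density (distr lborel borel (%x::'a. a + (-1) *R x)) (%_. abs (-1::real)^DIM('a))"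
  by(rule lborel_affine) simp
 hence "lborel = distr lborel borel (%x::'a. a - x)" by(simp add: density_1)
 hence "integrable (distr lborel borel (%x::'a. a - x)) f" using f by simp
 thus ?thesis by(subst (asm) integrable_distr_eq) auto
qed

definition conv :: "(real^2 => real) => (real^2 => 'b::euclidean_space) => real^2 => 'b" where
 "conv \<rho> f x = (LI y. \<rho> (x - y) *R f y)"

lemma conv_integrable:
 fixes f :: "real^2 => 'b::euclidean_space"
 assumes \<rho>: "cc UNIV \<rho>" and f: "L1 f"
 shows "L1 (%y. \<rho> (x - y) *R f y)"
proof -
 have [measurable]: "\<rho> : borel_fun" "f : borel_fun"
  using \<rho> f by(auto intro: cc_measurable)
 obtain B where B: "B > 0" "!!x. norm (\<rho> x) <= B" using cc_bounded[OF \<rho>] by blast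
 show ?thesis
  by(rule L1_bound[of _ "%y. B *R f y"])
   (use f B in "auto intro!: mult_right_mono")
qed

lemma conv_swap:
 fixes f \<rho> :: "real^2 => real"
 assumes [measurable]: "\<rho> : borel_fun" "f : borel_fun"
 shows "conv \<rho> f = conv f \<rho>"
proof
 fix x
 have "(LI y. \<rho> (x - (x - y)) *R f (x - y)) = (LI y. \<rho> (x - y) *R f y)"
  by(rule lborel_integral_reflect) measurable
 thus "conv \<rho> f x = conv f \<rho> x" by(simp add: conv_def mult.commute[of "f (x - _)"])
qed

lemma conv_difference:
 fixes f :: "real^2 => 'b::euclidean_space"
 assumes \<rho>: "cc UNIV \<rho>" and f: "L1 f" and e: "!!z. abs (\<rho> (z + h) - \<rho> z) <= e"
 shows "norm (conv \<rho> f (x + h) - conv \<rho> f x) <= e * (LI y. norm (f y))"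
proof -
 have "conv \<rho> f (x + h) - conv \<rho> f x = (LI y. (\<rho> (x + h - y) - \<rho> (x - y)) *R f y)"
  unfolding conv_def using conv_integrable[OF \<rho> f] by(simp add: scaleR_diff_left)
 also have "norm ... <= (LI y. e * norm (f y))"
 proof (rule Lint_norm_bound)
  show "L1 (%y. (\<rho> (x + h - y) - \<rho> (x - y)) *R f y)"
   using conv_integrable[OF \<rho> f] by(simp add: scaleR_diff_left)
  show "L1 (%y. e * norm (f y))" using f by auto
  show "norm ((\<rho> (x + h - y) - \<rho> (x - y)) *R f y) <= e * norm (f y)" for y
  proof -
   have "x + h - y = (x - y) + h" by simp
   thus ?thesis using e[of "x - y"] unfolding norm_scaleR real_norm_def by(metis mult_right_mono norm_ge_zero)
  qed
 qed
 finally show ?thesis by simp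
qed

lemma conv_continuous:
 fixes f :: "real^2 => 'b::euclidean_space"
 assumes \<rho>: "cc UNIV \<rho>" and f: "L1 f"
 shows "continuous_on UNIV (conv \<rho> f)"
 unfolding continuous_on_iff
proof (intro ballI allI impI)
 fix x :: "real^2" and e :: real assume e: "e > 0"
 define I where "I = (LI y. norm (f y)) + 1"
 have I: "I > 0" unfolding I_def by(simp add: add_nonneg_pos)
 obtain d where d: "d > 0" "!!x y. dist x y < d ==> dist (\<rho> x) (\<rho> y) < e / I"
  using cc_uniformly_continuous[OF \<rho>, of "e / I"] e I by auto
 have "dist (conv \<rho> f y) (conv \<rho> f x) < e" if "dist y x < d" for y
 proof -
  have "abs (\<rho> (z + (y - x)) - \<rho> z) <= e / I" for z
   using d(2)[of "z + (y - x)" z] that by(auto simp: dist_norm intro: less_imp_le)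
  from conv_difference[OF \<rho> f this, of x]
  have "dist (conv \<rho> f y) (conv \<rho> f x) <= e / I * (I - 1)" by(simp add: dist_norm I_def)
  also have "... < e" using e I by(simp add: field_simps)
  finally show ?thesis .
 qed
 thus "EX d>0. ALL y:UNIV. dist y x < d --> dist (conv \<rho> f y) (conv \<rho> f x) < e" using d(1) by blast
qed

lemma c1c_uniform_derivative:
 assumes f: "c1c UNIV f g" and e: "e > 0"
 obtains d where "d > 0" "!!z h. norm h < d ==> abs (f (z + h) - f z - g z *. h) <= e * norm h"
proof -
 obtain d where d: "d > 0" "!!x y. dist x y < d ==> dist (g x) (g y) < e"
  using cc_uniformly_continuous[OF c1c_D(2)[OF f] e] by blast
 have "abs (f (z + h) - f z - g z *. h) <= e * norm h" if h: "norm h < d" for z h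
 proof -
  have "norm ((f (z + h) - g z *. (z + h)) - (f z - g z *. z)) <= e * norm ((z + h) - z)"
  proof (rule differentiable_bound[of "ball z d"])
   show "((%w. f w - g z *. w) has_derivative (%v. (g w - g z) *. v)) (at w within ball z d)" if "w : ball z d" for w
   proof -
    have "((%w. g z *. w) has_derivative (%v. g z *. v)) (at w)"
     by(rule bounded_linear_imp_has_derivative[OF bounded_linear_inner_right])
    hence "((%w. f w - g z *. w) has_derivative (%v. g w *. v - g z *. v)) (at w)"
     by(rule has_derivative_diff[OF c1c_D(3)[OF f]])
    thus ?thesis unfolding inner_diff_left by(rule has_derivative_at_withinI)
   qed
   show "onorm (%v. (g w - g z) *. v) <= e" if "w : ball z d" for w
   proof (rule onorm_le)
    fix v
    have "norm ((g w - g z) *. v) <= norm (g w - g z) * norm v" by(simp add: Cauchy_Schwarz_ineq2)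
    also have "... <= e * norm v"
     using d(2)[of w z] that by(intro mult_right_mono) (auto simp: dist_norm norm_minus_commute[of z])
    finally show "norm ((g w - g z) *. v) <= e * norm v" .
   qed
  qed (use h d(1) in "auto simp: dist_norm")
  thus ?thesis by(simp add: inner_add_right)
 qed
 with d(1) show thesis by(rule that)
qed

text \<open>The derivative falls on the kernel: its first order Taylor remainder is uniformly small
  relative to the increment, and \<open>f\<close> contributes only its L^1 norm.\<close>

lemma conv_has_derivative:
 fixes f :: "real^2 => 'b::euclidean_space"
 assumes \<rho>: "c1c UNIV \<rho> g" and f: "L1 f"
 shows "(conv \<rho> f has_derivative (%v. conv (%x. g x *. v) f x)) (at x)"
proof -
 have gv: "cc UNIV (%x. g x *. v)" for v
  using cc_inner_right[OF c1c_D(2)[OF \<rho>], of "%x. v"] by(simp add: inner_commute)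
 note i0 = conv_integrable[OF c1c_D(1)[OF \<rho>] f] and i1 = conv_integrable[OF gv f]
 show ?thesis
  unfolding has_derivative_at_alt
 proof (intro conjI allI impI)
  have "linear (%v. conv (%x. g x *. v) f x)"
   using i1 by(intro linearI) (auto simp: conv_def inner_add_right scaleR_add_left simp flip: scaleR_scaleR)
  thus "bounded_linear (%v. conv (%x. g x *. v) f x)"
   by(simp add: linear_conv_bounded_linear)
  fix e :: real assume e: "e > 0"
  define I where "I = (LI y. norm (f y)) + 1"
  have I: "I > 0" unfolding I_def by(simp add: add_nonneg_pos)
  obtain d where d: "d > 0" "!!z h. norm h < d ==> abs (\<rho> (z + h) - \<rho> z - g z *. h) <= e / I * norm h"
   using c1c_uniform_derivative[OF \<rho>, of "e / I"] e I by auto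
  have "norm (conv \<rho> f y - conv \<rho> f x - conv (%w. g w *. (y - x)) f x) <= e * norm (y - x)"
   if "norm (y - x) < d" for y
  proof -
   have "conv \<rho> f y - conv \<rho> f x - conv (%w. g w *. (y - x)) f x
     = (LI z. (\<rho> (y - z) - \<rho> (x - z) - g (x - z) *. (y - x)) *R f z)"
    unfolding conv_def using i0 i1 by(simp add: scaleR_diff_left)
   also have "norm ... <= (LI z. (e / I * norm (y - x)) * norm (f z))"
   proof (rule Lint_norm_bound)
    show "L1 (%z. (\<rho> (y - z) - \<rho> (x - z) - g (x - z) *. (y - x)) *R f z)"
     using i0 i1 by(simp add: scaleR_diff_left)
    show "L1 (%z. (e / I * norm (y - x)) * norm (f z))" using f by auto
    fix z
    have "abs (\<rho> ((x - z) + (y - x)) - \<rho> (x - z) - g (x - z) *. (y - x)) <= e / I * norm (y - x)"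
     by(rule d(2)[OF that])
    moreover have "(x - z) + (y - x) = y - z" by simp
    ultimately have "abs (\<rho> (y - z) - \<rho> (x - z) - g (x - z) *. (y - x)) <= e / I * norm (y - x)" by(simp only:)
    thus "norm ((\<rho> (y - z) - \<rho> (x - z) - g (x - z) *. (y - x)) *R f z) <= (e / I * norm (y - x)) * norm (f z)"
     unfolding norm_scaleR by(rule mult_right_mono) simp
   qed
   also have "... = e * norm (y - x) * ((I - 1) / I)" by(simp add: I_def)
   also have "... <= e * norm (y - x) * 1" using e I by(intro mult_left_mono) auto
   finally show ?thesis by simp
  qed
  thus "EX d>0. ALL y. norm (y - x) < d -->
    norm (conv \<rho> f y - conv \<rho> f x - conv (%w. g w *. (y - x)) f x) <= e * norm (y - x)"
   using d(1) by blast
 qed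
qed

lemma Ck_conv:
 assumes "Ck k \<rho>" "compact K" "!!x. x ~: K ==> \<rho> x = 0" and f: "L1 f"
 shows "Ck k (conv \<rho> f)"
 using assms(1,3)
proof (induction k arbitrary: \<rho>)
 case 0
 hence "cc UNIV \<rho>" using assms(2) by(intro ccI[of \<rho> K]) auto
 thus ?case using conv_continuous[OF _ f] by simp
next
 case (Suc k)
 have C1: "Ck (Suc 0) \<rho>" using Suc.prems(1) by(auto dest: Ck_continuous)
 have g: "grad \<rho> x *. v = frechet_derivative \<rho> (at x) v" for x v
  by(rule grad_inner[OF Ck_SucD(1)[OF Suc.prems(1)]])
 have c: "c1c UNIV \<rho> (grad \<rho>)"
 proof (rule c1cI[of \<rho> _ K])
  show "(\<rho> has_derivative (%v. grad \<rho> x *. v)) (at x)" for x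
   unfolding g using Ck_SucD(1)[OF Suc.prems(1)] by(simp add: eta_contract_eq)
  have "continuous_on UNIV (%x. frechet_derivative \<rho> (at x) (axis i 1))" for i
   using Ck_SucD(2)[OF C1, of "axis i 1"] Basis_real2 by(auto simp: Basis_vec_def)
  thus "continuous_on UNIV (grad \<rho>)" unfolding grad_def by(intro continuous_on_vec_lambda)
 qed (use assms(2) Suc.prems in auto)
 have g0: "grad \<rho> x = 0" if "x ~: K" for x
 proof -
  have "((%x. 0) has_derivative frechet_derivative \<rho> (at x)) (at x)"
   using assms(2) Suc.prems(2) that
   by(intro has_derivative_transform_within_open[OF Ck_SucD(1)[OF Suc.prems(1)], of "- K"])
    (auto simp: compact_imp_closed open_Compl)
  hence "frechet_derivative \<rho> (at x) = (%v. 0)"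
   using has_derivative_unique[OF _ has_derivative_const] by blast
  hence "grad \<rho> x *. grad \<rho> x = 0" unfolding g by simp
  thus ?thesis by simp
 qed
 show ?case
 proof (rule Ck_SucI[OF conv_has_derivative[OF c f]])
  fix b :: "real^2" assume "b : Basis"
  hence "Ck k (%x. grad \<rho> x *. b)" unfolding g using Ck_SucD(2)[OF Suc.prems(1)] by blast
  thus "Ck k (%x. conv (%x. grad \<rho> x *. b) f x)"
   using Suc.IH[of "%x. grad \<rho> x *. b"] g0 by(simp add: eta_contract_eq)
 qed
qed

definition bump :: "real => real^2 => real" where
 "bump d x = exp_cutoff 0 (1 - (1 / d^2) * (x *. x))"

definition moll :: "real => real^2 => real" where
 "moll d x = bump d x / (LI y. bump d y)"

abbreviation "mconv d \<equiv> conv (moll d)"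

lemma bump_eq_0: "d > 0 ==> x ~: cball 0 d ==> bump d x = 0"
proof -
 assume d: "d > 0" "x ~: cball 0 d"
 hence "d^2 <= (norm x)^2" by(intro power_mono) auto
 thus ?thesis using d by(simp add: bump_def exp_cutoff_def power2_norm_eq_inner field_simps)
qed

lemma bump_bounds: "0 <= bump d x" "bump d x <= 1"
 by(auto simp: bump_def exp_cutoff_def)

lemma Ck_bump: "Ck k (bump d)"
 unfolding bump_def by(rule Ck_exp_cutoff)

lemma cc_bump: "d > 0 ==> cc UNIV (bump d)"
 by(rule ccI[of _ "cball 0 d"]) (auto intro: Ck_continuous[OF Ck_bump] bump_eq_0)

text \<open>On the square of half-side d/4 one has |y|^2 / d^2 <= 1/8, so the bump is at least
  exp(-8/7) there, and this square has area d^2/4. The explicit bound yields \<open>moll_le\<close>,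
  whose constant reappears in \<open>sq_const\<close>.\<close>

lemma bump_integral_ge:
 assumes d: "d > 0" shows "exp (- (8/7)) * d^2 / 4 <= (LI y. bump d y)"
proof -
 define Q where "Q = (cbox (vec (- (d/4))) (vec (d/4)) :: (real^2) set)"
 have "exp (- (8/7)) * ind Q y <= bump d y" for y
 proof (cases "y : Q")
  case True
  hence *: "- (d/4) <= y $ i & y $ i <= d/4" for i by(simp add: Q_def mem_box_cart)
  have "abs (y $ i) <= d/4" for i using *[of i] by linarith
  hence "(y $ i)^2 <= (d/4)^2" for i using d by(simp add: abs_le_square_iff[symmetric])
  from this[of 1] this[of 2] have le: "(1 / d^2) * (y *. y) <= 1/8"
   using d by(simp add: inner_real2 power2_eq_square field_simps)
  define s where "s = (1 / d^2) * (y *. y)"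
  have s: "s <= 1/8" using le by(simp only: s_def)
  hence "1 / (1 - s) <= 8/7" by(simp add: field_simps)
  moreover have "bump d y = exp (- (1 / (1 - s)))"
   using s unfolding bump_def exp_cutoff_def s_def[symmetric] by simp
  ultimately show ?thesis using True by simp
 qed (simp add: bump_bounds)
 hence "(LI y. exp (- (8/7)) * ind Q y) <= (LI y. bump d y)"
  by(intro integral_mono integrable_mult_right integrable_real_indicator cc_integrable[OF cc_bump[OF d]])
   (auto simp: Q_def emeasure_lborel_cbox_finite[unfolded infinity_ennreal_def])
 moreover have "measure lborel Q = d^2 / 4"
 proof -
  have "measure lborel Q = (\<Prod>i\<in>UNIV. vec (d/4) $ i - vec (- (d/4)) $ (i::2))"
   unfolding Q_def
  proof (rule content_cbox_cart)
   have "(0::real^2) : cbox (vec (- (d/4))) (vec (d/4))" using d by(simp add: mem_box_cart)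
   thus "cbox (vec (- (d/4))) (vec (d/4)) ~= ({} :: (real^2) set)" by blast
  qed
  thus ?thesis by(simp add: power2_eq_square)
 qed
 moreover have "Q : sets lborel" by(simp add: Q_def)
 ultimately show ?thesis by simp
qed

lemma bump_integral_pos: "d > 0 ==> 0 < (LI y. bump d y)"
 by(rule less_le_trans[OF _ bump_integral_ge]) auto

lemma moll_nonneg: "d > 0 ==> 0 <= moll d x"
 using bump_integral_pos[of d] bump_bounds[of d x] by(simp add: moll_def)

lemma moll_le: "d > 0 ==> moll d x <= 4 * exp (8/7) / d^2"
proof -
 assume d: "d > 0"
 have "moll d x <= 1 / (exp (- (8/7)) * d^2 / 4)"
  unfolding moll_def using d bump_integral_ge[OF d] bump_bounds bump_integral_pos[OF d]
  by(intro frac_le) auto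
 thus ?thesis by(simp add: exp_minus field_simps)
qed

lemma moll_eq_0: "d > 0 ==> x ~: cball 0 d ==> moll d x = 0"
 by(simp add: moll_def bump_eq_0)

lemma Ck_moll: "Ck k (moll d)"
 unfolding moll_def divide_inverse by(intro Ck_mult Ck_bump Ck_const)

lemma cc_moll: "d > 0 ==> cc UNIV (moll d)"
 by(rule ccI[of _ "cball 0 d"]) (auto intro: Ck_continuous[OF Ck_moll] moll_eq_0)

lemma moll_measurable[measurable]: "moll d : borel_fun"
 by(intro borel_measurable_continuous_onI Ck_continuous[OF Ck_moll])

lemma integrable_moll: "d > 0 ==> L1 (moll d)"
 by(rule cc_integrable[OF cc_moll])

lemma integral_moll: "d > 0 ==> (LI y. moll d y) = 1"
 using bump_integral_pos[of d] by(simp add: moll_def)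

lemma test_function_moll: "d > 0 ==> moll d : TF UNIV"
 by(rule test_functionI[of _ "cball 0 d"]) (auto intro: Ck_moll moll_eq_0)

lemma c1c_moll: "d > 0 ==> c1c UNIV (moll d) (grad (moll d))"
 by(rule test_function_c1c[OF test_function_moll])

lemma conv_moll_eq_0:
 assumes "d > 0" "!!y. y : cball x d ==> f y = 0" shows "mconv d f x = 0"
proof -
 have "moll d (x - y) *R f y = 0" for y
  using assms(2)[of y] moll_eq_0[OF assms(1), of "x - y"] by(cases "y : cball x d") (auto simp: dist_norm norm_minus_commute)
 thus ?thesis unfolding conv_def by(simp only: Bochner_Integration.integral_zero)
qed

lemma compact_thickening:
 fixes K :: "(real^2) set"
 assumes "compact K" "open U" "K \<subseteq> U"
 obtains e K' where "e > 0" "compact K'" "K' \<subseteq> U" "!!x y. x : K ==> dist x y <= e ==> y : K'"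
proof -
 obtain e where e: "e > 0" "(\<Union>x\<in>K. cball x e) \<subseteq> U"
  using compact_subset_open_imp_cball_epsilon_subset[OF assms] by metis
 have eq: "(\<Union>x\<in>K. cball x e) = {x + y |x y. x : K & y : cball 0 e}"
 proof safe
  fix x y assume "x : K" "y : cball x e"
  thus "EX x' y'. y = x' + y' & x' : K & y' : cball 0 e"
   by(intro exI[of _ x] exI[of _ "y - x"]) (auto simp: dist_norm norm_minus_commute)
 next
  fix x y :: "real^2" assume "x : K" "y : cball 0 e"
  thus "x + y : (\<Union>x\<in>K. cball x e)" by(intro UN_I[of x]) (auto simp: dist_norm)
 qed
 have "compact (\<Union>x\<in>K. cball x e)"
  unfolding eq by(intro compact_sums assms(1)) simp
 with e show thesis by(intro that[of e "\<Union>x\<in>K. cball x e"]) auto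
qed

lemma test_function_conv:
 fixes f :: "real^2 => real"
 assumes f: "L1 f" and d: "d > 0"
  and K: "compact K" "K \<subseteq> U" "!!x y. f y ~= 0 ==> dist x y <= d ==> x : K"
 shows "mconv d f : TF U"
proof (rule test_functionI[OF _ K(1,2)])
 show "Ck k (mconv d f)" for k
  by(rule Ck_conv[OF Ck_moll _ _ f, of "cball 0 d"]) (use d in "auto intro: moll_eq_0")
 show "mconv d f x = 0" if "x ~: K" for x
  by(rule conv_moll_eq_0[OF d]) (use K(3) that in "auto simp: dist_commute")
qed

lemma conv_moll_close:
 fixes f :: "real^2 => 'b::euclidean_space"
 assumes d: "d > 0" and f: "L1 f" and e: "!!y. y : cball x d ==> norm (f y - f x) <= e"
 shows "norm (mconv d f x - f x) <= e"
proof -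
 have e0: "e >= 0" using e[of x] d by(auto intro: order_trans[OF norm_ge_zero])
 have i: "L1 (%y. moll d (x - y) *R f y)" by(rule conv_integrable[OF cc_moll[OF d] f])
 have i1: "L1 (%y. moll d (x - y))"
  by(rule lborel_integrable_reflect[OF integrable_moll[OF d]])
 have one: "(LI y. moll d (x - y)) = 1"
  using lborel_integral_reflect[of "moll d" x] integral_moll[OF d] by simp
 have "mconv d f x - f x = (LI y. moll d (x - y) *R (f y - f x))"
  unfolding conv_def using i i1 one by(simp add: scaleR_diff_right)
 also have "norm ... <= (LI y. e * moll d (x - y))"
 proof (rule Lint_norm_bound)
  show "L1 (%y. moll d (x - y) *R (f y - f x))"
   using i i1 by(simp add: scaleR_diff_right)
  show "norm (moll d (x - y) *R (f y - f x)) <= e * moll d (x - y)" for y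
  proof (cases "y : cball x d")
   case True
   thus ?thesis using e[OF True] moll_nonneg[OF d, of "x - y"] by(simp add: mult.commute[of e] mult_left_mono)
  next
   case False
   hence "moll d (x - y) = 0" by(intro moll_eq_0[OF d]) (simp add: dist_norm norm_minus_commute)
   thus ?thesis by simp
  qed
 qed (use i1 in auto)
 also have "... = e" using one by simp
 finally show ?thesis .
qed

lemma tendsto_l2I:
 fixes h :: "nat => real^2 => real^2"
 assumes "!!n. sqint (h n)" "sqint g" "compact K"
  and K: "!!n x. x ~: K ==> h n x = g x"
  and u: "!!e. e > 0 ==> \<forall>\<^sub>F n in sequentially. ALL x. norm (h n x - g x) <= e"
 shows "(%n. cls (h n)) ----> cls g"
proof -
 have mK: "emeasure lborel K < \<infinity>" using \<open>compact K\<close> by(rule emeasure_compact_finite)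
 have [measurable]: "K : sets borel" using \<open>compact K\<close> by(simp add: borel_compact)
 have le: "norm (cls (h n) - cls g) <= e * sqrt (measure lborel K)"
  if e: "e >= 0" "ALL x. norm (h n x - g x) <= e" for n e
 proof -
  have "(norm (cls (h n) - cls g))^2 = (LI x. (norm (h n x - g x))^2)"
   using assms by(simp add: cls_minus norm_cls sqint_minus)
  also have "... <= (LI x. e^2 * ind K x)"
  proof (rule integral_mono)
   show "L1 (%x. (norm (h n x - g x))^2)" using assms by(intro sqint_integrable sqint_minus) auto
   show "L1 (%x. e^2 * ind K x)" using mK by simp
   show "(norm (h n x - g x))^2 <= e^2 * ind K x" for x
    using e K[of x n] by(cases "x : K") (auto intro: power_mono)
  qed
  also have "... = (e * sqrt (measure lborel K))^2" by(simp add: power_mult_distrib)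
  finally show ?thesis using e by(simp add: power2_le_iff_abs_le)
 qed
 show ?thesis
 proof (rule LIMSEQ_I)
  fix r :: real assume r: "r > 0"
  define e where "e = r / (sqrt (measure lborel K) + 1)"
  have p: "sqrt (measure lborel K) + 1 > 0" by(simp add: add_nonneg_pos)
  have e: "e > 0" unfolding e_def using r p by simp
  have er: "e * sqrt (measure lborel K) < r"
  proof -
   have "e * sqrt (measure lborel K) < e * (sqrt (measure lborel K) + 1)" using e by simp
   also have "... = r" using p by(simp add: e_def)
   finally show ?thesis .
  qed
  obtain N where "!!n. n >= N ==> ALL x. norm (h n x - g x) <= e"
   using u[OF e] unfolding eventually_sequentially by blast
  hence "norm (cls (h n) - cls g) < r" if "n >= N" for n
   using le[of e n] er e that by(meson le_less_trans less_imp_le)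
  thus "EX no. ALL n>=no. norm (cls (h n) - cls g) < r" by blast
 qed
qed

lemma conv_moll_uniform:
 fixes f :: "real^2 => 'b::euclidean_space"
 assumes f: "cc U f" and d: "d ----> 0" "!!n. d n > 0" and e: "e > 0"
 shows "\<forall>\<^sub>F n in sequentially. ALL x. norm (mconv (d n) f x - f x) <= e"
proof -
 obtain r where r: "r > 0" "!!x y. dist x y < r ==> dist (f x) (f y) < e"
  using cc_uniformly_continuous[OF f e] by blast
 have "\<forall>\<^sub>F n in sequentially. d n < r" using d(1) r(1) by(rule order_tendstoD)
 thus ?thesis
 proof (rule eventually_mono, intro allI)
  fix n x assume n: "d n < r"
  show "norm (mconv (d n) f x - f x) <= e"
  proof (rule conv_moll_close[OF d(2) cc_integrable[OF f]])
   fix y assume "y : cball x (d n)"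
   thus "norm (f y - f x) <= e" using r(2)[of y x] n by(auto simp: dist_norm norm_minus_commute)
  qed
 qed
qed

lemma conv_cc_support:
 fixes f :: "real^2 => 'b::euclidean_space"
 assumes f: "cc U f" and "open U"
 obtains e K where "e > 0" "compact K" "K \<subseteq> U" "!!x. x ~: K ==> f x = 0"
  "!!d x. 0 < d ==> d <= e ==> x ~: K ==> mconv d f x = 0"
  "!!d x y. d <= e ==> f y ~= 0 ==> dist x y <= d ==> x : K"
proof -
 obtain L where L: "compact L" "L \<subseteq> U" "!!x. x ~: L ==> f x = 0" using ccE[OF f] by metis
 obtain e K where eK: "e > 0" "compact K" "K \<subseteq> U" "!!x y. x : L ==> dist x y <= e ==> y : K"
  using compact_thickening[OF L(1) assms(2) L(2)] by blast
 show thesis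
 proof (rule that[OF eK(1-3)])
  show "f x = 0" if "x ~: K" for x using eK(1) eK(4)[of x x] that L(3) by force
  show 1: "x : K" if "d <= e" "f y ~= 0" "dist x y <= d" for d x y
   using eK(4)[of y x] L(3)[of y] that by(auto simp: dist_commute)
  show "mconv d f x = 0" if "0 < d" "d <= e" "x ~: K" for d x
   by(rule conv_moll_eq_0[OF that(1)]) (use 1[of d _ x] that in auto)
 qed
qed

text \<open>By commutativity of the convolution the roles are exchanged: \<open>f\<close> acts as
  the differentiable kernel and \<open>moll d\<close> as the integrable function, so the derivative
  falls on \<open>f\<close>.\<close>

lemma conv_has_gradient:
 assumes d: "d > 0" and f: "c1c U f g"
 shows "(mconv d f has_derivative (%v. mconv d g x *. v)) (at x)"
proof -
 have [measurable]: "f : borel_fun" "g : borel_fun"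
  using c1c_D[OF f] by(auto intro: cc_measurable)
 have "conv (%x. g x *. v) (moll d) x = mconv d g x *. v" for v
 proof -
  have "conv (%x. g x *. v) (moll d) x = mconv d (%x. g x *. v) x"
   by(subst conv_swap) auto
  also have "... = (LI y. (moll d (x - y) *R g y) *. v)" by(simp add: conv_def)
  also have "... = mconv d g x *. v"
   unfolding conv_def
   by(rule integral_inner_left) (rule conv_integrable[OF cc_moll[OF d] cc_integrable[OF c1c_D(2)[OF f]]])
  finally show ?thesis .
 qed
 moreover have "conv f (moll d) = mconv d f" by(rule conv_swap) auto
 ultimately show ?thesis
  using conv_has_derivative[OF c1c_mono[OF f subset_UNIV] integrable_moll[OF d], of x]
  by simp
qed

lemma cc_conv:
 fixes f :: "real^2 => 'b::euclidean_space"
 assumes d: "d > 0" and f: "L1 f" and R: "!!x. norm x > R ==> f x = 0"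
 shows "cc UNIV (mconv d f)"
proof (rule ccI[of _ "cball 0 (R + d)"])
 show "continuous_on UNIV (mconv d f)" by(rule conv_continuous[OF cc_moll[OF d] f])
 fix x :: "real^2" assume x: "x ~: cball 0 (R + d)"
 show "mconv d f x = 0"
 proof (rule conv_moll_eq_0[OF d])
  fix y assume "y : cball x d"
  thus "f y = 0" using x norm_triangle_sub[of x y] by(intro R) (auto simp: dist_norm)
 qed
qed auto

lemma cc_conv_cc:
 fixes h :: "real^2 => 'b::euclidean_space"
 assumes d: "d > 0" and h: "cc UNIV h" shows "cc UNIV (mconv d h)"
proof -
 obtain K where K: "compact K" "!!x. x ~: K ==> h x = 0" using ccE[OF h] by metis
 obtain R where R: "!!x. x : K ==> norm x <= R" using compact_imp_bounded[OF K(1)] unfolding bounded_iff by blast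
 show ?thesis by(rule cc_conv[OF d cc_integrable[OF h], of R]) (use K(2) R in force)
qed

lemma c1c_conv:
 assumes d: "d > 0" and f: "c1c UNIV f g"
 shows "c1c UNIV (mconv d f) (mconv d g)"
 using conv_has_gradient[OF d f] cc_conv_cc[OF d c1c_D(1)[OF f]] cc_conv_cc[OF d c1c_D(2)[OF f]]
 by(simp add: c1c_def)

text \<open>The closed space of gradients of \<open>H\<^sup>1\<^sub>0\<close> functions.\<close>

definition gradients :: "(real^2) set => l2 set" where
 "gradients U = closure {cls (grad \<phi>) |\<phi>. \<phi> : TF U}"

lemma test_sqint: "\<phi> : TF U ==> sqint (grad \<phi>)"
 using test_function_c1c c1c_D(2) cc_sqint by blast

lemma subspace_test_gradients: "subspace {cls (grad \<phi>) |\<phi>. \<phi> : TF U}"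
proof -
 have add: "grad (%x. f x + h x) = (%x. grad f x + grad h x)"
  if "f : TF U" "h : TF U" for f h
  by(rule c1c_grad[OF c1c_add[OF test_function_c1c[OF that(1)] test_function_c1c[OF that(2)]]])
 have sc: "grad (%x. c * f x) = (%x. c *R grad f x)" if "f : TF U" for c f
  by(rule c1c_grad[OF c1c_scale[OF test_function_c1c[OF that]]])
 show ?thesis
  unfolding subspace_def
 proof (intro conjI ballI allI)
  have "c1c U (%x. 0) (%x. 0)" by(rule c1cI[of _ _ "{}"]) auto
  hence "grad (%x::real^2. 0) = (%x. 0)" by(rule c1c_grad)
  hence "0 = cls (grad (%x::real^2. 0))" by(simp add: zero_l2_def)
  thus "0 : {cls (grad \<phi>) |\<phi>. \<phi> : TF U}" using test_functions_zero by blast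
 next
  fix x y assume "x : {cls (grad \<phi>) |\<phi>. \<phi> : TF U}" "y : {cls (grad \<phi>) |\<phi>. \<phi> : TF U}"
  then obtain f h where fh: "f : TF U" "h : TF U" "x = cls (grad f)" "y = cls (grad h)" by blast
  have "x + y = cls (grad (%x. f x + h x))" using fh by(simp add: add cls_add test_sqint)
  thus "x + y : {cls (grad \<phi>) |\<phi>. \<phi> : TF U}" using fh test_functions_add by blast
 next
  fix c x assume "x : {cls (grad \<phi>) |\<phi>. \<phi> : TF U}"
  then obtain f where f: "f : TF U" "x = cls (grad f)" by blast
  have "c *R x = cls (grad (%x. c * f x))" using f by(simp add: sc cls_scaleR test_sqint)
  thus "c *R x : {cls (grad \<phi>) |\<phi>. \<phi> : TF U}" using f test_functions_scale by blast
 qed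
qed

lemma subspace_gradients: "subspace (gradients U)"
 unfolding gradients_def by(rule subspace_closure[OF subspace_test_gradients])

lemma closed_gradients: "closed (gradients U)"
 by(simp add: gradients_def)

lemma test_gradient_in: "\<phi> : TF U ==> cls (grad \<phi>) : gradients U"
 unfolding gradients_def by(rule subsetD[OF closure_subset]) blast

text \<open>Mollification at small scales stays in a fixed compact subset of \<open>U\<close> and
  converges uniformly together with the gradient. Hence cutoffs times C^1 functions may serve
  wherever gradients of test functions are allowed.\<close>

lemma c1c_gradient_in:
 assumes f: "c1c U f g" and U: "open U" shows "cls g : gradients U"
proof -
 obtain e K where K: "e > 0" "compact K" "K \<subseteq> U" "!!x. x ~: K ==> f x = 0"
  "!!d x. 0 < d ==> d <= e ==> x ~: K ==> mconv d f x = 0"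
  "!!d x y. d <= e ==> f y ~= 0 ==> dist x y <= d ==> x : K"
  using conv_cc_support[OF c1c_D(1)[OF f] U] by metis
 obtain e' K' where K': "e' > 0" "compact K'" "!!x. x ~: K' ==> g x = 0"
  "!!d x. 0 < d ==> d <= e' ==> x ~: K' ==> mconv d g x = 0"
  using conv_cc_support[OF c1c_D(2)[OF f] U] by metis
 define d where "d n = min e e' / real (Suc n)" for n
 have d: "d n > 0" "d n <= e" "d n <= e'" for n
 proof -
  have m: "min e e' > 0" using K(1) K'(1) by simp
  thus "d n > 0" by(simp add: d_def)
  have "d n <= min e e' / 1" unfolding d_def using m by(intro divide_left_mono) auto
  thus "d n <= e" "d n <= e'" by auto
 qed
 have d0: "d ----> 0" unfolding d_def by real_asymp
 note if' = cc_integrable[OF c1c_D(1)[OF f]]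
 have t: "mconv (d n) f : TF U" for n
  by(rule test_function_conv[OF if' d(1) K(2,3)]) (use K(6)[OF d(2)] in blast)
 have gr: "grad (mconv (d n) f) = mconv (d n) g" for n
  by(rule c1c_grad[OF c1c_conv[OF d(1) c1c_mono[OF f subset_UNIV]]])
 have "(%n. cls (grad (mconv (d n) f))) ----> cls g"
 proof (rule tendsto_l2I[OF test_sqint[OF t] cc_sqint[OF c1c_D(2)[OF f]] K'(2)])
  show "grad (mconv (d n) f) x = g x" if "x ~: K'" for n x
   using K'(3,4) that d(1)[of n] d(3)[of n] by(simp add: gr)
  show "\<forall>\<^sub>F n in sequentially. ALL x. norm (grad (mconv (d n) f) x - g x) <= r" if "r > 0" for r
   unfolding gr by(rule conv_moll_uniform[OF c1c_D(2)[OF f] d0 d(1) that])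
 qed
 thus ?thesis
  unfolding gradients_def closure_sequential using t
  by(intro exI[of _ "%n. cls (grad (mconv (d n) f))"]) auto
qed

subsection \<open>The fundamental lemma of the calculus of variations\<close>

text \<open>The indicator of the closed \<open>d n\<close>-neighbourhood of \<open>K\<close> is
  mollified at the same scale \<open>d n\<close>: balls of that radius around points of
  \<open>K\<close> stay inside the neighbourhood, and everything remains within
  \<open>2 * d n\<close> of \<open>K\<close>. A sequence is provided because dominated convergence
  needs the indicator of \<open>K\<close> as a pointwise limit.\<close>

lemma cutoff_exists:
 assumes K: "compact K" "K \<subseteq> U" "open U"
 obtains \<phi> where "!!n. \<phi> n : TF U" "!!n x. 0 <= \<phi> n x & \<phi> n x <= (1::real)"
  "!!n x. x : K ==> \<phi> n x = 1" "!!x. x ~: K ==> \<forall>\<^sub>F n in sequentially. \<phi> n x = 0"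
proof (cases "K = {}")
 case True
 show thesis
  by(rule that[of "%n x. 0"]) (use True test_functions_zero in auto)
next
 case False
 obtain e L where L: "e > 0" "compact L" "L \<subseteq> U" "!!x y. x : K ==> dist x y <= e ==> y : L"
  using compact_thickening[OF K(1,3,2)] by blast
 define d where "d n = e / (2 * real (Suc n))" for n
 have d: "d n > 0" "2 * d n <= e" for n using L(1) by(auto simp: d_def field_simps)
 have d0: "d ----> 0" unfolding d_def by real_asymp
 define N where "N n = {y. infdist y K <= d n}" for n
 define f where "f n = (ind (N n) :: real^2 => real)" for n
 have cN: "closed (N n)" for n unfolding N_def by(intro closed_Collect_le continuous_intros)
 have att: "EX z:K. dist y z = infdist y K" for y
  using infdist_attains_inf[OF compact_imp_closed[OF K(1)] False, of y] by(metis)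
 have NL: "x : L" if y: "y : N n" "dist x y <= d n" for x y n
 proof -
  obtain z where z: "z : K" "dist y z <= d n" using att[of y] y(1) by(auto simp: N_def)
  have "dist z x <= e" using dist_triangle[of z x y] z(2) y(2) d(2)[of n] by(simp add: dist_commute)
  thus ?thesis using L(4) z(1) by blast
 qed
 have NsubL: "N n \<subseteq> L" for n using NL[of _ n] d(1)[of n] by(force simp: less_imp_le)
 have mN: "emeasure lborel (N n) < \<infinity>" for n
  using emeasure_bounded_finite bounded_subset[OF compact_imp_bounded[OF L(2)] NsubL] by blast
 have fi: "L1 (f n)" for n
  unfolding f_def using cN mN by(intro integrable_real_indicator) auto
 have i: "L1 (%y. moll (d n) (x - y) *R f n y)" for n x
  by(rule conv_integrable[OF cc_moll[OF d(1)] fi])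
 have i1: "L1 (%y. moll (d n) (x - y))" for n x
  by(rule lborel_integrable_reflect[OF integrable_moll[OF d(1)]])
 have one: "(LI y. moll (d n) (x - y)) = 1" for n x
  using lborel_integral_reflect[of "moll (d n)" x] integral_moll[OF d(1)] by simp
 show thesis
 proof (rule that[of "%n. mconv (d n) (f n)"])
  show "mconv (d n) (f n) : TF U" for n
  proof (rule test_function_conv[OF fi d(1) L(2,3)])
   fix x y assume "f n y ~= 0" "dist x y <= d n"
   thus "x : L" using NL[of y n x] by(auto simp: f_def indicator_def split: if_splits)
  qed
  show "0 <= mconv (d n) (f n) x & mconv (d n) (f n) x <= 1" for n x
  proof
   show "0 <= mconv (d n) (f n) x"
    unfolding conv_def by(rule Lint_nonneg) (simp add: f_def moll_nonneg[OF d(1)])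
   have "mconv (d n) (f n) x <= (LI y. moll (d n) (x - y))"
    unfolding conv_def by(rule integral_mono[OF i i1]) (simp add: f_def indicator_def moll_nonneg[OF d(1)])
   thus "mconv (d n) (f n) x <= 1" using one by simp
  qed
  show "mconv (d n) (f n) x = 1" if "x : K" for n x
  proof -
   have "norm (mconv (d n) (f n) x - f n x) <= 0"
   proof (rule conv_moll_close[OF d(1) fi])
    fix y assume "y : cball x (d n)"
    hence "infdist y K <= d n" using infdist_le2[OF that, of y "d n"] by(simp add: dist_commute)
    moreover have "infdist x K <= d n" using that d(1)[of n] by simp
    ultimately show "norm (f n y - f n x) <= 0" by(simp add: f_def N_def)
   qed
   thus ?thesis using that d(1)[of n] by(simp add: f_def N_def less_imp_le)
  qed
  show "\<forall>\<^sub>F n in sequentially. mconv (d n) (f n) x = 0" if "x ~: K" for x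
  proof -
   have "infdist x K > 0"
    using that compact_imp_closed[OF K(1)] False in_closed_iff_infdist_zero[of K x] infdist_nonneg[of x K] by force
   hence "\<forall>\<^sub>F n in sequentially. d n < infdist x K / 2"
    by(intro order_tendstoD(2)[OF d0]) simp
   thus ?thesis
   proof (rule eventually_mono)
    fix n assume n: "d n < infdist x K / 2"
    show "mconv (d n) (f n) x = 0"
    proof (rule conv_moll_eq_0[OF d(1)])
     fix y assume "y : cball x (d n)"
     hence "infdist y K > d n" using infdist_triangle[of x K y] n by simp
     thus "f n y = 0" by(simp add: f_def N_def)
    qed
   qed
  qed
 qed
qed

text \<open>Inner regularity, applied to the bounded pieces of \<open>S\<close>: a piece of positive
  measure would contain a compact set of positive measure.\<close>

lemma AE_lborel_pos_measure_compact:
 assumes "S : sets borel" "!!K. compact K ==> K \<subseteq> S ==> emeasure lborel K = 0"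
 shows "emeasure lborel (S::'a::euclidean_space set) = 0"
proof -
 have b: "emeasure lborel (S \<inter> cball 0 (real k)) = 0" for k
 proof (rule ccontr)
  assume "emeasure lborel (S \<inter> cball 0 (real k)) ~= 0"
  hence p: "0 < emeasure lborel (S \<inter> cball 0 (real k))" by(simp add: zero_less_iff_neq_zero)
  then obtain e where e: "0 < e" "e < emeasure lborel (S \<inter> cball 0 (real k))" using dense by blast
  have fin: "emeasure lborel (S \<inter> cball 0 (real k)) < \<infinity>"
   by(rule emeasure_bounded_finite) (auto intro: bounded_subset[OF bounded_cball])
  hence "e < \<infinity>" using e(2) by(metis order_less_trans)
  then obtain r where r: "e = ennreal r" "r >= 0" by(metis ennreal_cases infinity_ennreal_def less_irrefl)
  have "r > 0" using e(1) r by(simp add: ennreal_less_zero_iff)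
  moreover have "S \<inter> cball 0 (real k) : sets lebesgue" using assms(1) by auto
  ultimately obtain T where T: "closed T" "T \<subseteq> S \<inter> cball 0 (real k)" "S \<inter> cball 0 (real k) - T : lmeasurable"
   "emeasure lebesgue (S \<inter> cball 0 (real k) - T) < ennreal r"
   using sets_lebesgue_inner_closed by metis
  have "compact T" using T(1,2) by(meson bounded_cball bounded_subset compact_eq_bounded_closed le_inf_iff)
  hence T0: "emeasure lborel T = 0" using assms(2) T(2) by blast
  have [measurable]: "T : sets borel" "S : sets borel" using T(1) assms(1) by auto
  have "emeasure lborel (S \<inter> cball 0 (real k)) = emeasure lborel T + emeasure lborel (S \<inter> cball 0 (real k) - T)"
   using T(2) by(subst plus_emeasure) (auto intro!: arg_cong[where f="emeasure lborel"])
  also have "... < e" using T(4) T0 r by simp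
  finally show False using e(2) by simp
 qed
 have "S = (\<Union>k. S \<inter> cball 0 (real k))"
  by(auto simp: real_arch_simple)
 moreover have "emeasure lborel (\<Union>k. S \<inter> cball 0 (real k)) = 0"
  by(rule emeasure_UN_eq_0) (use b assms(1) in auto)
 ultimately show ?thesis by simp
qed

text \<open>Let \<open>K\<close> be a compact set of points where \<open>f\<close> is negative.
  Cutoffs converging to its indicator show that the integral of \<open>f\<close> over
  \<open>K\<close> is nonnegative, which forces \<open>K\<close> to be null.\<close>

theorem AE_nonneg_of_test:
 fixes f :: "real^2 => real"
 assumes U: "open U" and [measurable]: "f : borel_fun" and i: "L1 (%x. ind U x * f x)"
  and t: "!!\<phi>. \<phi> : TF U ==> (!!x. 0 <= \<phi> x) ==> 0 <= (LI x. \<phi> x * f x)"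
 shows "AE x\<in>U in lborel. 0 <= f x"
proof -
 define S where "S = {x : U. f x < 0}"
 have [measurable]: "U : sets borel" using U by simp
 have S: "S : sets borel" unfolding S_def by measurable
 have "emeasure lborel S = 0"
 proof (rule AE_lborel_pos_measure_compact[OF S])
  fix K assume K: "compact K" "K \<subseteq> S"
  hence KU: "K \<subseteq> U" by(auto simp: S_def)
  have [measurable]: "K : sets borel" using K(1) by(simp add: borel_compact)
  obtain \<phi> where \<phi>: "!!n. \<phi> n : TF U" "!!n x. 0 <= \<phi> n x & \<phi> n x <= (1::real)"
   "!!n x. x : K ==> \<phi> n x = 1" "!!x. x ~: K ==> \<forall>\<^sub>F n in sequentially. \<phi> n x = 0"
   using cutoff_exists[OF K(1) KU U] by blast
  have \<phi>0: "\<phi> n x = 0" if "x ~: U" for n x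
   using cc_eq_0[OF c1c_D(1)[OF test_function_c1c[OF \<phi>(1)]] that] .
  have [measurable]: "\<phi> n : borel_fun" for n
   using c1c_D(1)[OF test_function_c1c[OF \<phi>(1)]] by(auto intro: cc_measurable)
  have "(%n. LI x. \<phi> n x * f x) ----> (LI x. ind K x * f x)"
  proof (rule integral_dominated_convergence)
   show "L1 (%x. abs (ind U x * f x))" using i by(rule integrable_abs)
   show "AEl x. (%n. \<phi> n x * f x) ----> ind K x * f x"
   proof (intro AE_I2 tendsto_mult tendsto_const)
    fix x show "(%n. \<phi> n x) ----> ind K x"
     using \<phi>(3,4)[of x] by(cases "x : K") (auto intro: tendsto_eventually)
   qed
   show "AEl x. norm (\<phi> n x * f x) <= abs (ind U x * f x)" for n
    using \<phi>(2)[of n] \<phi>0[of _ n] by(intro AE_I2) (auto simp: abs_mult indicator_def intro: mult_left_le_one_le)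
  qed measurable
  hence nn: "0 <= (LI x. ind K x * f x)"
   using t[OF \<phi>(1)] \<phi>(2) by(intro LIMSEQ_le_const) auto
  have iK: "L1 (%x. ind K x * f x)"
   by(rule L1_bound[OF i]) (use KU in "auto simp: indicator_def")
  have neg: "ind K x * f x <= 0" for x using K(2) by(auto simp: indicator_def S_def)
  have "(LI x. ind K x * f x) <= 0"
   using Lint_nonneg[of lborel "%x. - (ind K x * f x)"] neg iK by simp
  hence "(LI x. - (ind K x * f x)) = 0" using nn by simp
  hence "AEl x. - (ind K x * f x) = 0"
   using iK neg by(subst (asm) integral_nonneg_eq_0_iff_AE) auto
  hence "AEl x. x ~: K"
   by eventually_elim (use K(2) in "auto simp: S_def")
  thus "emeasure lborel K = 0"
   by(subst (asm) AE_iff_measurable[of K]) auto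
 qed
 thus ?thesis using S by(intro AE_I[of _ _ S]) (auto simp: S_def)
qed

lemma AE_eq_0_of_test:
 fixes f :: "real^2 => real"
 assumes U: "open U" and f: "f : borel_fun" and i: "L1 (%x. ind U x * f x)"
  and t: "!!\<phi>. \<phi> : TF U ==> (LI x. \<phi> x * f x) = 0"
 shows "AE x\<in>U in lborel. f x = 0"
proof -
 have "AE x\<in>U in lborel. 0 <= f x" by(rule AE_nonneg_of_test[OF U f i]) (use t in auto)
 moreover have "AE x\<in>U in lborel. 0 <= - f x"
  by(rule AE_nonneg_of_test[OF U]) (use f i t in auto)
 ultimately show ?thesis by eventually_elim force
qed

subsection \<open>Density of continuous fields\<close>

text \<open>Fluxes are bounded only in L^1, so their convergence can be tested against continuous
  fields of compact support but not against arbitrary elements of \<open>l2\<close>.\<close>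

definition fields :: "(real^2) set => l2 set" where
 "fields U = {cls h |h. cc U h}"

lemma subspace_fields: "subspace (fields U)"
 unfolding subspace_def
proof (intro conjI ballI allI)
 show "0 : fields U" using cc_zero[of U] by(auto simp: fields_def zero_l2_def)
next
 fix x y assume "x : fields U" "y : fields U"
 then obtain f h where fh: "cc U f" "cc U h" "x = cls f" "y = cls h" by(auto simp: fields_def)
 hence "x + y = cls (%x. f x + h x)" by(simp add: cls_add cc_sqint)
 thus "x + y : fields U" using fh cc_add by(auto simp: fields_def)
next
 fix c x assume "x : fields U"
 then obtain f where f: "cc U f" "x = cls f" by(auto simp: fields_def)
 hence "c *R x = cls (%x. c *R f x)" by(simp add: cls_scaleR cc_sqint)
 thus "c *R x : fields U" using f cc_scale_right[of U f "%x. c"] by(auto simp: fields_def)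
qed

lemma measurable_vec_nth[measurable]:
 "f : borel_measurable M ==> (%x. (f x :: real^'n) $ i) : borel_measurable M"
 by(rule measurable_compose[OF _ borel_measurable_continuous_onI]) (auto intro: continuous_intros)

lemma orthogonal_fields:
 assumes U: "open U" and o: "!!h. cc U h ==> inner u (cls h) = 0"
 shows "AE x\<in>U in lborel. rep u x = 0"
proof -
 \<comment> \<open>The balls make the components integrable on the set considered: \<open>U\<close>
   may be unbounded here, and the lemma is applied to the whole plane.\<close>
 have "AEl x. x : U \<inter> ball 0 (real k) --> rep u x $ i = 0" for k i
 proof (rule AE_eq_0_of_test)
  show "open (U \<inter> ball 0 (real k))" using U by auto
  show "L1 (%x. ind (U \<inter> ball 0 (real k)) x * rep u x $ i)"
  proof (rule L1_bound)
   show "L1 (%x::real^2. 1 * ind (cball 0 (real k)) x + (norm (rep u x))^2)"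
    by(intro Bochner_Integration.integrable_add integrable_indicator_cball sqint_integrable) simp
   show "AEl x. norm (ind (U \<inter> ball 0 (real k)) x * rep u x $ i)
     <= norm (1 * ind (cball 0 (real k)) x + (norm (rep u x))^2)"
   proof (rule AE_I2)
    fix x
    have a: "abs (rep u x $ i) <= norm (rep u x)" by(rule component_le_norm_cart)
    have "norm (rep u x) <= 1 + (norm (rep u x))^2"
     using sum_squares_bound[of "norm (rep u x)" 1] by(simp add: add_nonneg_nonneg) (smt (verit) zero_le_power2 norm_ge_zero)
    thus "norm (ind (U \<inter> ball 0 (real k)) x * rep u x $ i)
     <= norm (1 * ind (cball 0 (real k)) x + (norm (rep u x))^2)"
     using a by(auto simp: indicator_def abs_mult)
   qed
   show "(%x. ind (U \<inter> ball 0 (real k)) x * rep u x $ i) : borel_measurable lborel"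
    using U by(intro borel_measurable_times borel_measurable_indicator) auto
  qed
  show "(LI x. \<phi> x * rep u x $ i) = 0" if "\<phi> : TF (U \<inter> ball 0 (real k))" for \<phi>
  proof -
   have c: "cc U (%x. \<phi> x *R axis i 1 :: real^2)"
    by(intro cc_scale_left cc_mono[OF c1c_D(1)[OF test_function_c1c[OF that]]]) auto
   have "0 = (LI x. rep u x *. (\<phi> x *R axis i 1))"
    using o[OF c] by(simp add: inner_rep_cls cc_sqint[OF c])
   thus ?thesis by(simp add: inner_axis)
  qed
 qed auto
 hence "AEl x. ALL k i. x : U \<inter> ball 0 (real k) --> rep u x $ i = 0"
  unfolding AE_all_countable by blast
 thus ?thesis
 proof (rule AE_mp, intro AE_I2 impI)
  fix x assume a: "ALL k i. x : U \<inter> ball 0 (real k) --> rep u x $ i = 0" "x : U"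
  obtain k where "norm x < real k" using reals_Archimedean2 by blast
  thus "rep u x = 0" using a by(auto simp: vec_eq_iff)
 qed
qed

lemma fields_UNIV_dense: "closure (fields UNIV) = UNIV"
proof (rule dense_by_orthogonality[OF subspace_fields])
 fix u :: l2 assume "!!v. v : fields UNIV ==> inner u v = 0"
 hence "AE x\<in>UNIV in lborel. rep u x = 0"
  by(intro orthogonal_fields) (auto simp: fields_def)
 with rep_zero have "AEl x. rep u x = rep 0 x" by eventually_elim simp
 thus "u = 0" by(rule l2_eqI)
qed auto

subsection \<open>Multiplication by bounded matrix fields\<close>

text \<open>The bound is required at every point, not only almost everywhere; the representatives of
  the data are chosen accordingly.\<close>

definition bounded_field :: "real => (real^2 => real^2^2) => bool" where
 "bounded_field B M \<longleftrightarrow> M : borel_fun & (ALL x v. norm (M x *v v) <= B * norm v)"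

definition mul :: "(real^2 => real^2^2) => l2 => l2" where
 "mul M u = cls (%x. M x *v rep u x)"

lemma measurable_matrix_vector[measurable (raw)]:
 fixes M :: "'a => real^2^2"
 assumes [measurable]: "M : borel_measurable N" "f : borel_measurable N"
 shows "(%x. M x *v f x) : borel_measurable N"
proof -
 have "continuous_on UNIV (%p::(real^2^2) \<times> (real^2). fst p *v snd p)"
  unfolding matrix_vector_mult_def
  by(intro continuous_on_vec_lambda continuous_intros)
 hence "(%p::(real^2^2) \<times> (real^2). fst p *v snd p) : borel_fun"
  by(rule borel_measurable_continuous_onI)
 hence "(%p::(real^2^2) \<times> (real^2). fst p *v snd p) : borel_measurable (borel \<Otimes>\<^sub>M borel)"
  by(simp add: borel_prod)
 from measurable_compose[OF measurable_Pair[OF assms] this] show ?thesis by simp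
qed

lemma bounded_field_measurable[measurable_dest]: "bounded_field B M ==> M : borel_fun"
 by(simp add: bounded_field_def)

lemma bounded_field_le: "bounded_field B M ==> norm (M x *v v) <= B * norm v"
 by(simp add: bounded_field_def)

lemma bounded_field_nonneg: "bounded_field B M ==> 0 <= B"
proof -
 assume "bounded_field B M"
 from bounded_field_le[OF this, of 0 "axis 1 1"] have "norm (M 0 *v axis 1 1) <= B" by simp
 thus ?thesis using norm_ge_zero order_trans by blast
qed

lemma sqint_mul:
 assumes "bounded_field B M" "sqint f" shows "sqint (%x. M x *v f x)"
proof (rule sqint_bound)
 have [measurable]: "M : borel_fun" "f : borel_fun"
  using assms by(auto simp: bounded_field_def sqint_def)
 show "(%x. M x *v f x) : borel_fun" by measurable
 show "L1 (%x. B^2 * (norm (f x))^2)" using sqint_integrable[OF assms(2)] by simp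
 show "(norm (M x *v f x))^2 <= B^2 * (norm (f x))^2" for x
  using power_mono[OF bounded_field_le[OF assms(1)] norm_ge_zero, of x "f x" 2] by(simp add: power_mult_distrib)
qed

lemma rep_mul: "bounded_field B M ==> AEl x. rep (mul M u) x = M x *v rep u x"
 unfolding mul_def by(rule rep_cls) (rule sqint_mul[OF _ sqint_rep])

lemma mul_cls: assumes "bounded_field B M" "sqint f" shows "mul M (cls f) = cls (%x. M x *v f x)"
 unfolding mul_def
 by(rule cls_cong[OF sqint_mul[OF assms(1) sqint_rep] sqint_mul[OF assms]])
  (use rep_cls[OF assms(2)] in "eventually_elim, simp")

lemma norm_mul_le: assumes "bounded_field B M" shows "norm (mul M u) <= B * norm u"
proof -
 have "(norm (mul M u))^2 = (LI x. (norm (M x *v rep u x))^2)"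
  unfolding mul_def by(rule norm_cls) (rule sqint_mul[OF assms sqint_rep])
 also have "... <= (LI x. B^2 * (norm (rep u x))^2)"
 proof (rule integral_mono)
  show "(norm (M x *v rep u x))^2 <= B^2 * (norm (rep u x))^2" for x
   using power_mono[OF bounded_field_le[OF assms] norm_ge_zero, of x "rep u x" 2] by(simp add: power_mult_distrib)
 qed (use sqint_integrable[OF sqint_mul[OF assms sqint_rep]] sqint_integrable[OF sqint_rep] in auto)
 also have "... = (B * norm u)^2" by(simp add: norm_l2_sq power_mult_distrib)
 finally show ?thesis using bounded_field_nonneg[OF assms] by(simp add: power2_le_iff_abs_le)
qed

lemma bounded_linear_mul: assumes M: "bounded_field B M" shows "bounded_linear (mul M)"
proof (rule bounded_linear_intro[of _ B])
 show "mul M (u + v) = mul M u + mul M v" for u v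
  by(rule l2_eqI) (use rep_add[of u v] rep_add[of "mul M u" "mul M v"] rep_mul[OF M, of u] rep_mul[OF M, of v]
    rep_mul[OF M, of "u + v"] in "eventually_elim, simp add: matrix_vector_right_distrib")
 show "mul M (c *R u) = c *R mul M u" for c u
  by(rule l2_eqI) (use rep_scaleR[of c u] rep_scaleR[of c "mul M u"] rep_mul[OF M, of u]
    rep_mul[OF M, of "c *R u"] in "eventually_elim, simp add: matrix_vector_mult_scaleR")
 show "norm (mul M u) <= norm u * B" for u using norm_mul_le[OF M] by(simp add: mult.commute)
qed

lemma inner_mul:
 assumes "bounded_field B M" shows "inner (mul M u) v = (LI x. (M x *v rep u x) *. rep v x)"
 using inner_cls[OF sqint_mul[OF assms sqint_rep] sqint_rep, of u v] by(simp add: mul_def)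

lemma bounded_field_const: "bounded_field (onorm ((*v) M)) (%x. M)"
 by(auto simp: bounded_field_def onorm)

lemma bounded_field_J: "bounded_field 1 (%x. J)"
 by(simp add: bounded_field_def)

abbreviation rot :: "l2 => l2" where "rot \<equiv> mul (%x. J)"

lemma rep_rot: "AEl x. rep (rot u) x = J *v rep u x"
 by(rule rep_mul[OF bounded_field_J])

lemma rot_cls: "sqint f ==> rot (cls f) = cls (%x. J *v f x)"
 by(rule mul_cls[OF bounded_field_J])

lemma inner_rot: "inner (rot u) v = - inner u (rot v)"
proof -
 have "(J *v rep u x) *. rep v x = - ((J *v rep v x) *. rep u x)" for x
  using inner_J(1)[of "rep u x" "rep v x"] inner_commute[of "rep u x" "J *v rep v x"] by linarith
 hence "inner (rot u) v = - inner (rot v) u"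
  unfolding inner_mul[OF bounded_field_J] by simp
 thus ?thesis by(simp only: inner_commute[of u])
qed

lemma rot_rot: "rot (rot u) = - u"
 by(rule l2_eqI) (use rep_rot[of u] rep_rot[of "rot u"] rep_uminus[of u] in "eventually_elim, simp add: inner_J")

lemma inner_rot_rot: "inner (rot u) (rot v) = inner u v"
 by(simp add: inner_rot rot_rot)

abbreviation smul :: "(real^2 => real) => l2 => l2" where
 "smul \<phi> \<equiv> mul (%x. \<phi> x *R mat 1)"

lemma bounded_field_scalar:
 assumes [measurable]: "\<phi> : borel_fun" and "!!x. abs (\<phi> x) <= B"
 shows "bounded_field B (%x. \<phi> x *R mat 1)"
 unfolding bounded_field_def
proof (intro conjI allI)
 show "(%x. \<phi> x *R (mat 1 :: real^2^2)) : borel_fun" by measurable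
 show "norm ((\<phi> x *R mat 1) *v v) <= B * norm v" for x and v :: "real^2"
  using assms(2)[of x] by(simp add: scaleR_matrix_vector_assoc[symmetric] mult_right_mono)
qed

lemma rep_smul:
 assumes "\<phi> : borel_fun" and "!!x. abs (\<phi> x) <= B"
 shows "AEl x. rep (smul \<phi> u) x = \<phi> x *R rep u x"
 using rep_mul[OF bounded_field_scalar[OF assms], of u] by(simp add: scaleR_matrix_vector_assoc[symmetric])

lemma inner_smul:
 assumes "\<phi> : borel_fun" and "!!x. abs (\<phi> x) <= B"
 shows "inner (smul \<phi> u) v = (LI x. \<phi> x * (rep u x *. rep v x))"
 using inner_mul[OF bounded_field_scalar[OF assms], of u v] by(simp add: scaleR_matrix_vector_assoc[symmetric])

lemma inner_smul_commute:
 assumes "\<phi> : borel_fun" and "!!x. abs (\<phi> x) <= B"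
 shows "inner (smul \<phi> u) v = inner u (smul \<phi> v)"
 using inner_smul[OF assms, of u v] inner_smul[OF assms, of v u] by(simp add: inner_commute)

section \<open>Fields supported in a set, and the orthogonality of gradients and rotated
  gradients\<close>

definition supported :: "(real^2) set => l2 set" where
 "supported U = {u. AEl x. x ~: U --> rep u x = 0}"

abbreviation restr :: "(real^2) set => l2 => l2" where "restr U \<equiv> smul (ind U)"

lemma rep_restr: "U : sets borel ==> AEl x. rep (restr U u) x = ind U x *R rep u x"
 by(rule rep_smul[of _ 1]) (auto simp: indicator_def)

lemma bounded_linear_restr: "U : sets borel ==> bounded_linear (restr U)"
 by(rule bounded_linear_mul[OF bounded_field_scalar[of _ 1]]) (auto simp: indicator_def)

lemma supported_iff: "U : sets borel ==> u : supported U \<longleftrightarrow> restr U u = u"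
proof
 assume U: "U : sets borel" and "u : supported U"
 hence "AEl x. x ~: U --> rep u x = 0" by(simp add: supported_def)
 with rep_restr[OF U, of u] have "AEl x. rep (restr U u) x = rep u x"
  by eventually_elim (auto simp: indicator_def)
 thus "restr U u = u" by(rule l2_eqI)
next
 assume U: "U : sets borel" and e: "restr U u = u"
 show "u : supported U" unfolding supported_def mem_Collect_eq
  using rep_restr[OF U, of u] unfolding e by eventually_elim (auto simp: indicator_def)
qed

lemma restr_supported: assumes U: "U : sets borel" shows "restr U u : supported U"
 unfolding supported_def mem_Collect_eq using rep_restr[OF U, of u] by eventually_elim simp

lemma subspace_supported: assumes "U : sets borel" shows "subspace (supported U)"
proof -
 interpret bounded_linear "restr U" by(rule bounded_linear_restr[OF assms])
 show ?thesis by(auto simp: subspace_def supported_iff[OF assms] zero add scaleR)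
qed

lemma closed_supported: assumes "U : sets borel" shows "closed (supported U)"
proof -
 have "supported U = {u. restr U u = u}" using supported_iff[OF assms] by blast
 thus ?thesis
  by(simp, intro closed_Collect_eq continuous_intros linear_continuous_on bounded_linear_restr[OF assms])
qed

lemma supported_cls: "sqint f ==> (!!x. x ~: U ==> f x = 0) ==> cls f : supported U"
 unfolding supported_def mem_Collect_eq by(rule AE_mp[OF rep_cls]) auto

lemma fields_supported: "fields U \<subseteq> supported U"
proof
 fix u assume "u : fields U"
 then obtain h where h: "cc U h" "u = cls h" by(auto simp: fields_def)
 thus "u : supported U" using supported_cls[OF cc_sqint[OF h(1)], of U] cc_eq_0[OF h(1)] by blast
qed

lemma closure_fields: assumes U: "open U" shows "closure (fields U) = supported U"
proof (rule dense_by_orthogonality[OF subspace_fields])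
 have bU: "U : sets borel" using U by simp
 show "subspace (supported U)" "closed (supported U)" using bU subspace_supported closed_supported by blast+
 show "fields U \<subseteq> supported U" by(rule fields_supported)
 fix u assume u: "u : supported U" "!!v. v : fields U ==> inner u v = 0"
 have "AE x\<in>U in lborel. rep u x = 0"
  using u(2) by(intro orthogonal_fields[OF U]) (auto simp: fields_def)
 moreover have "AEl x. x ~: U --> rep u x = 0" using u(1) by(simp add: supported_def)
 ultimately have "AEl x. rep u x = rep 0 x" using rep_zero by eventually_elim auto
 thus "u = 0" by(rule l2_eqI)
qed

lemma c1c_gradient_field: "c1c U f g ==> cls g : fields U"
 using c1c_D(2) by(auto simp: fields_def)

lemma test_gradient_field: "\<phi> : TF U ==> cls (grad \<phi>) : fields U"
 using test_function_c1c c1c_gradient_field by blast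

lemma gradients_supported: "open U ==> gradients U \<subseteq> supported U"
 unfolding closure_fields[symmetric] gradients_def
 by(rule closure_mono) (use test_gradient_field in auto)

text \<open>The closure is taken in one argument at a time, starting from
  \<open>integral_grad_J_grad\<close> for two test functions.\<close>

lemma gradient_orthogonal_rot:
 assumes "u : gradients U" "v : gradients U" shows "inner u (rot v) = 0"
proof -
 have 1: "inner (cls (grad \<phi>)) (rot (cls (grad \<psi>))) = 0"
  if "\<phi> : TF U" "\<psi> : TF U" for \<phi> \<psi>
  using integral_grad_J_grad[OF test_function_c1c[OF that(1)] test_function_c1c[OF that(2)]] that
   inner_cls[OF test_sqint cc_sqint[OF cc_matrix[OF c1c_D(2)[OF test_function_c1c]]], of \<phi> U \<psi> U J]
  by(simp add: rot_cls test_sqint)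
 have 2: "inner (rot (cls (grad \<psi>))) u = inner 0 u" if "\<psi> : TF U" for \<psi>
  by(rule subspace_closure_inner[OF _ assms(1)[unfolded gradients_def]])
   (use 1 that in "auto simp: inner_commute")
 have "inner (rot u) v = inner 0 v"
  by(rule subspace_closure_inner[OF _ assms(2)[unfolded gradients_def]])
   (use 2 in "auto simp: inner_rot inner_commute[of u]")
 thus ?thesis by(simp add: inner_rot)
qed

subsection \<open>Mollification in the mean\<close>

text \<open>Jensen's inequality for the probability density \<open>moll d\<close>, obtained by
  integrating \<open>2 c . v - |c|^2 <= |v|^2\<close> with \<open>c\<close> the mean.\<close>

lemma conv_norm_sq_le:
 fixes f :: "real^2 => real^2"
 assumes d: "d > 0" and f: "sqint f" "L1 f"
 shows "(norm (mconv d f x))^2 <= mconv d (%y. (norm (f y))^2) x"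
proof -
 define c where "c = mconv d f x"
 have i: "L1 (%y. moll d (x - y) *R f y)"
  by(rule conv_integrable[OF cc_moll[OF d] f(2)])
 have i2: "L1 (%y. moll d (x - y) *R (norm (f y))\<^sup>2)"
  by(rule conv_integrable[OF cc_moll[OF d] sqint_integrable[OF f(1)]])
 have i1: "L1 (%y. moll d (x - y))"
  by(rule lborel_integrable_reflect[OF integrable_moll[OF d]])
 have one: "(LI y. moll d (x - y)) = 1"
  using lborel_integral_reflect[of "moll d" x] integral_moll[OF d] by simp
 have "2 * (norm c)^2 - (norm c)\<^sup>2 = 2 * (c *. c) - (norm c)\<^sup>2 * (LI y. moll d (x - y))"
  using one by(simp add: power2_norm_eq_inner)
 also have "... = (LI y. 2 * (c *. (moll d (x - y) *R f y)) - (norm c)\<^sup>2 * moll d (x - y))"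
  using i i1 by(simp add: integral_inner_right[OF i] c_def[symmetric] conv_def[symmetric] del: inner_scaleR_right)
 also have "... <= (LI y. moll d (x - y) *R (norm (f y))\<^sup>2)"
 proof (rule integral_mono)
  show "L1 (%y. 2 * (c *. (moll d (x - y) *R f y)) - (norm c)\<^sup>2 * moll d (x - y))"
   using i i1 by(auto simp del: inner_scaleR_right)
  fix y
  have "2 * (c *. f y) - (norm c)\<^sup>2 <= (norm (f y))^2"
   using two_inner_le[of c "f y"] by linarith
  hence "moll d (x - y) * (2 * (c *. f y) - (norm c)\<^sup>2) <= moll d (x - y) * (norm (f y))^2"
   by(rule mult_left_mono) (rule moll_nonneg[OF d])
  thus "2 * (c *. (moll d (x - y) *R f y)) - (norm c)\<^sup>2 * moll d (x - y)
    <= moll d (x - y) *R (norm (f y))\<^sup>2" by(simp add: algebra_simps)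
 qed (rule i2)
 finally show ?thesis by(simp add: c_def conv_def)
qed

lemma nn_integral_conv:
 fixes h :: "real^2 => real"
 assumes d: "d > 0" and h: "L1 h" "!!x. h x >= 0"
 shows "(NN x. ennreal (mconv d h x)) = (NN x. ennreal (h x))"
proof -
 have [measurable]: "h : borel_fun" using h by auto
 have "(NN x. ennreal (mconv d h x))
   = (NN x. (NN y. ennreal (moll d (x - y) * h y)))"
 proof (rule nn_integral_cong)
  fix x
  show "ennreal (mconv d h x) = (NN y. ennreal (moll d (x - y) * h y))"
   unfolding conv_def real_scaleR_def
   using conv_integrable[OF cc_moll[OF d] h(1), of x] moll_nonneg[OF d] h(2)
   by(intro nn_integral_eq_integral[symmetric]) auto
 qed
 also have "... = (NN y. (NN x. ennreal (moll d (x - y) * h y)))"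
  by(rule lborel_pair.Fubini') measurable
 also have "... = (NN y. ennreal (h y))"
 proof (rule nn_integral_cong)
  fix y
  have i: "L1 (%x. moll d (x - y) * h y)"
   using lborel_integrable_shift[OF integrable_moll[OF d], of "- y"] by simp
  have "(NN x. ennreal (moll d (x - y) * h y)) = ennreal (LI x. moll d (x - y) * h y)"
   by(rule nn_integral_eq_integral[OF i]) (use moll_nonneg[OF d] h(2) in auto)
  also have "(LI x. moll d (x - y) * h y) = h y"
   using lborel_integral_shift[OF moll_measurable, of d "- y"] integral_moll[OF d] by simp
  finally show "(NN x. ennreal (moll d (x - y) * h y)) = ennreal (h y)" .
 qed
 finally show ?thesis .
qed

lemma conv_measurable: "d > 0 ==> L1 f ==> mconv d f : borel_fun"
 by(intro borel_measurable_continuous_onI conv_continuous cc_moll)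

lemma sqint_conv:
 fixes f :: "real^2 => real^2"
 assumes d: "d > 0" and f: "sqint f" "L1 f"
 shows "sqint (mconv d f)" "norm (cls (mconv d f)) <= norm (cls f)"
proof -
 have [measurable]: "mconv d f : borel_fun" by(rule conv_measurable[OF d f(2)])
 have "(NN x. ennreal ((norm (mconv d f x))^2))
   <= (NN x. ennreal (mconv d (%y. (norm (f y))^2) x))"
  by(rule nn_integral_mono) (rule ennreal_leI[OF conv_norm_sq_le[OF d f]])
 also have "... = (NN x. ennreal ((norm (f x))^2))"
  by(rule nn_integral_conv[OF d sqint_integrable[OF f(1)]]) simp
 also have "... = ennreal ((norm (cls f))^2)"
  unfolding norm_cls[OF f(1)] by(rule nn_integral_eq_integral[OF sqint_integrable[OF f(1)]]) simp
 finally have le: "(NN x. ennreal ((norm (mconv d f x))^2)) <= ennreal ((norm (cls f))^2)" .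
 hence i: "L1 (%x. (norm (mconv d f x))^2)"
  by(intro integrableI_bounded) (auto simp: le_less_trans)
 thus s: "sqint (mconv d f)" by(simp add: sqint_def)
 have "ennreal ((norm (cls (mconv d f)))^2) <= ennreal ((norm (cls f))^2)"
  using le unfolding norm_cls[OF s] by(subst (asm) nn_integral_eq_integral[OF i]) auto
 thus "norm (cls (mconv d f)) <= norm (cls f)"
  by(simp add: ennreal_le_iff power2_le_iff_abs_le)
qed

lemma conv_diff:
 fixes f g :: "real^2 => 'b::euclidean_space"
 assumes "d > 0" "L1 f" "L1 g"
 shows "mconv d (%x. f x - g x) = (%x. mconv d f x - mconv d g x)"
 unfolding conv_def scaleR_diff_right
 by(intro ext Bochner_Integration.integral_diff conv_integrable[OF cc_moll[OF assms(1)]] assms)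

text \<open>Mollification does not increase the L^2 norm, and it converges uniformly on the dense
  set of continuous fields with compact support.\<close>

theorem conv_tendsto:
 fixes f :: "real^2 => real^2"
 assumes d: "d ----> 0" "!!n. d n > 0" and f: "sqint f" "L1 f"
 shows "(%n. cls (mconv (d n) f)) ----> cls f"
proof (rule metric_LIMSEQ_I)
 fix e :: real assume e: "e > 0"
 have "cls f : closure (fields UNIV)" by(simp add: fields_UNIV_dense)
 then obtain h where h: "cc UNIV h" "dist (cls h) (cls f) < e / 3"
  unfolding closure_approachable fields_def using e by(auto dest: spec[of _ "e/3"])
 note hs = cc_sqint[OF h(1)] and hi = cc_integrable[OF h(1)]
 obtain r K where K: "r > 0" "compact K" "!!x. x ~: K ==> h x = 0"
  "!!d x. 0 < d ==> d <= r ==> x ~: K ==> mconv d h x = 0"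
  using conv_cc_support[OF h(1) open_UNIV] by metis
 \<comment> \<open>Capping the scale at \<open>r\<close> confines all mollifications of
   \<open>h\<close> to \<open>K\<close>; the capped scales eventually agree with
   \<open>d\<close>.\<close>
 define d' where "d' n = min (d n) r" for n
 have d': "d' ----> 0" "d' n > 0" for n
  using tendsto_min[OF d(1) tendsto_const[of r]] K(1) d(2)[of n] by(auto simp: d'_def[abs_def])
 have "(%n. cls (mconv (d' n) h)) ----> cls h"
 proof (rule tendsto_l2I[OF sqint_conv(1)[OF d'(2) hs hi] hs K(2)])
  show "mconv (d' n) h x = h x" if "x ~: K" for n x
   using K(3,4) d'(2)[of n] that by(simp add: d'_def)
 qed (rule conv_moll_uniform[OF h(1) d'])
 then obtain N1 where N1: "!!n. n >= N1 ==> dist (cls (mconv (d' n) h)) (cls h) < e / 3"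
  using e unfolding lim_sequentially by(meson divide_pos_pos zero_less_numeral)
 have "\<forall>\<^sub>F n in sequentially. d n < r" using d(1) K(1) by(rule order_tendstoD)
 then obtain N2 where N2: "!!n. n >= N2 ==> d n < r" unfolding eventually_sequentially by blast
 have "dist (cls (mconv (d n) f)) (cls f) < e" if n: "n >= max N1 N2" for n
 proof -
  have dd: "d' n = d n" using N2[of n] n by(simp add: d'_def)
  have fhi: "L1 (%x. f x - h x)" and fhs: "sqint (%x. f x - h x)"
   using f hi hs by(auto intro: sqint_minus)
  have "dist (cls (mconv (d n) f)) (cls (mconv (d n) h))
    = norm (cls (mconv (d n) (%x. f x - h x)))"
   unfolding conv_diff[OF d(2) f(2) hi] dist_norm
   by(subst cls_minus[OF sqint_conv(1)[OF d(2) f] sqint_conv(1)[OF d(2) hs hi]]) simp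
  also have "... <= norm (cls (%x. f x - h x))" by(rule sqint_conv(2)[OF d(2) fhs fhi])
  also have "... = dist (cls h) (cls f)"
   using f hs by(simp add: cls_minus[symmetric] dist_norm norm_minus_commute)
  finally have "dist (cls (mconv (d n) f)) (cls (mconv (d n) h)) < e / 3" using h(2) by simp
  moreover have "dist (cls (mconv (d n) h)) (cls h) < e / 3" using N1[of n] n dd by simp
  ultimately show ?thesis
   using h(2) dist_triangle[of "cls (mconv (d n) f)" "cls f" "cls (mconv (d n) h)"]
    dist_triangle[of "cls (mconv (d n) h)" "cls f" "cls h"] by simp
 qed
 thus "EX N. ALL n>=N. dist (cls (mconv (d n) f)) (cls f) < e" by blast
qed

section \<open>The div-curl lemma in dimension two\<close>

subsection \<open>Sobolev's inequality on squares\<close>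

definition pt :: "real => real => real^2" where
 "pt a b = a *R axis 1 1 + b *R axis 2 1"

lemma pt_nth[simp]: "pt a b $ 1 = a" "pt a b $ 2 = b"
 by(simp_all add: pt_def axis_def)

lemma continuous_on_pt[continuous_intros]:
 "continuous_on S f ==> continuous_on S g ==> continuous_on S (%x. pt (f x) (g x))"
 unfolding pt_def by(intro continuous_intros)

lemma measurable_pt[measurable (raw)]:
 assumes [measurable]: "f : borel_measurable M" "g : borel_measurable M"
 shows "(%x. pt (f x) (g x)) : borel_measurable M"
 unfolding pt_def by measurable

lemma lborel_pt: "lborel = distr (lborel \<Otimes>\<^sub>M lborel) borel (%(a, b). pt a b)"
proof (rule lborel_eqI)
 fix l u :: "real^2" assume "!!b. b : Basis ==> l *. b <= u *. b"
 hence le: "l $ 1 <= u $ 1" "l $ 2 <= u $ 2"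
  by(auto simp: Basis_real2 inner_axis dest: spec[of _ "axis 1 1"] spec[of _ "axis 2 1"]) (metis Basis_real2 inner_axis inner_real_def mult.right_neutral)+
 have "emeasure (distr (lborel \<Otimes>\<^sub>M lborel) borel (%(a, b). pt a b)) (box l u)
   = emeasure (lborel \<Otimes>\<^sub>M lborel) ((%(a, b). pt a b) -` box l u \<inter> space (lborel \<Otimes>\<^sub>M lborel))"
  by(rule emeasure_distr) auto
 also have "(%(a, b). pt a b) -` box l u \<inter> space (lborel \<Otimes>\<^sub>M lborel) = {l $ 1<..<u $ 1} \<times> {l $ 2<..<u $ 2}"
  by(auto simp: mem_box_cart forall_2 space_pair_measure)
 also have "emeasure (lborel \<Otimes>\<^sub>M lborel) ... = ennreal (u $ 1 - l $ 1) * ennreal (u $ 2 - l $ 2)"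
  using le by(subst lborel.emeasure_pair_measure_Times) auto
 also have "... = ennreal (\<Prod>b\<in>Basis. (u - l) *. b)"
 proof -
  have B: "(Basis :: (real^2) set) = {axis 1 1, axis 2 1}" using Basis_real2 by auto
  have "axis 1 (1::real) ~= (axis 2 1 :: real^2)" by(simp add: axis_eq_axis)
  thus ?thesis using le unfolding B by(simp add: inner_axis ennreal_mult)
 qed
 finally show "emeasure (distr (lborel \<Otimes>\<^sub>M lborel) borel (%(a, b). pt a b)) (box l u) = (\<Prod>b\<in>Basis. (u - l) *. b)" .
qed simp

lemma nn_integral_pt:
 assumes [measurable]: "f : borel_fun"
 shows "(NN x. f x) = (NN a. \<integral>\<^sup>+b. f (pt a b) \<partial>lborel)"
proof -
 have "(NN x. f x) = (\<integral>\<^sup>+p. f (case p of (a, b) => pt a b) \<partial>(lborel \<Otimes>\<^sub>M lborel))"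
  by(subst lborel_pt, subst nn_integral_distr) auto
 also have "... = (NN a. \<integral>\<^sup>+b. f (pt a b) \<partial>lborel)"
  by(subst lborel.nn_integral_fst[symmetric]) auto
 finally show ?thesis .
qed

definition sq :: "real^2 => real => (real^2) set" where
 "sq c l = {x. abs (x $ 1 - c $ 1) <= l & abs (x $ 2 - c $ 2) <= l}"

lemma sq_cbox: "sq c l = cbox (c - vec l) (c + vec l)"
 by(auto simp: sq_def mem_box_cart forall_2 abs_le_iff)

lemma compact_sq: "compact (sq c l)" unfolding sq_cbox by simp

lemma sq_borel[measurable]: "sq c l : sets borel" unfolding sq_cbox by simp

lemma sq_mono: "l <= l' ==> sq c l \<subseteq> sq c l'" by(auto simp: sq_def)

lemma sq_trans: "x : sq c l ==> y : sq x l' ==> y : sq c (l + l')"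
 unfolding sq_def by(auto simp: abs_le_iff)

lemma cball_sq: "cball x d \<subseteq> sq x d"
proof
 fix y assume "y : cball x d"
 hence "norm (y - x) <= d" by(simp add: dist_norm norm_minus_commute)
 thus "y : sq x d"
  using component_le_norm_cart[of "y - x" 1] component_le_norm_cart[of "y - x" 2] by(simp add: sq_def)
qed

lemma emeasure_sq: "l >= 0 ==> emeasure lborel (sq c l) = ennreal (4 * l^2)"
proof -
 assume l: "l >= 0"
 have "c : sq c l" using l by(simp add: sq_def)
 hence "measure lborel (sq c l) = (\<Prod>i\<in>UNIV. (c + vec l) $ i - (c - vec l) $ i)"
  unfolding sq_cbox by(intro content_cbox_cart) blast
 hence "measure lborel (sq c l) = 4 * l^2" by(simp add: power2_eq_square)
 moreover have "emeasure lborel (sq c l) < \<infinity>" unfolding sq_cbox by(rule emeasure_lborel_cbox_finite)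
 ultimately show ?thesis by(metis emeasure_eq_ennreal_measure infinity_ennreal_def less_irrefl)
qed

lemma FTC_line_bound:
 fixes f F :: "real => real"
 assumes "!!t. (f has_real_derivative F t) (at t)" "continuous_on UNIV F" "continuous_on UNIV n"
  and n: "!!t. abs (F t) <= n t"
  and st: "s : {c - l..c + l}" "t : {c - l..c + l}"
 shows "ennreal \<bar>f s - f t\<bar> <= (\<integral>\<^sup>+\<tau>. ind {c - l..c + l} \<tau> * ennreal (n \<tau>) \<partial>lborel)"
 using st
proof (induction s t rule: linorder_wlog)
 case (sym s t) thus ?case by(simp add: abs_minus_commute)
next
 case (le s t)
 have [measurable]: "n : borel_fun" "F : borel_fun"
  using assms(2,3) by(auto intro: borel_measurable_continuous_onI)
 have b: "has_bochner_integral lborel (%x. F x * ind {s .. t} x) (f t - f s)"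
  using assms(1,2) le by(intro has_bochner_integral_FTC_Icc_real) (auto simp: continuous_on_eq_continuous_at)
 have "ennreal \<bar>f t - f s\<bar> = ennreal (norm (LI x. F x * ind {s .. t} x))"
  using has_bochner_integral_integral_eq[OF b] by simp
 also have "... <= (NN x. ennreal (norm (F x * ind {s .. t} x)))"
  by(rule integral_norm_bound_ennreal) (use b in "simp add: has_bochner_integral_iff")
 also have "... <= (\<integral>\<^sup>+\<tau>. ind {c - l..c + l} \<tau> * ennreal (n \<tau>) \<partial>lborel)"
  using le n by(intro nn_integral_mono) (auto simp: indicator_def intro: ennreal_leI)
 finally show ?case by(simp add: abs_minus_commute)
qed

text \<open>Joining two points of the square by its two rectilinear paths bounds the square of the
 difference by a product in which the variables separate.\<close>

theorem square_inequality:
 assumes w: "c1c UNIV w g" and l: "l > 0"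
 shows "(NN x. \<integral>\<^sup>+y. ind (sq c l) x * ind (sq c l) y * ennreal ((w x - w y)^2) \<partial>lborel)
   <= ennreal (16 * l^2) * (NN x. ind (sq c l) x * ennreal (norm (g x)))^2"
proof -
 have cw: "continuous_on UNIV w" and cg: "continuous_on UNIV g"
  using c1c_D(1,2)[OF w] by(auto intro: cc_continuous)
 have [measurable]: "w : borel_fun" "g : borel_fun"
  using cw cg by(auto intro: borel_measurable_continuous_onI)
 define I1 where "I1 = {c $ 1 - l..c $ 1 + l}"
 define I2 where "I2 = {c $ 2 - l..c $ 2 + l}"
 have [measurable]: "I1 : sets borel" "I2 : sets borel" by(auto simp: I1_def I2_def)
 have sq: "(ind (sq c l) (pt a b) :: ennreal) = ind I1 a * ind I2 b" for a b
  by(auto simp: sq_def I1_def I2_def indicator_def)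
 define A where "A b = (NN a. ind I1 a * ennreal (norm (g (pt a b))))" for b
 define B where "B a = (NN b. ind I2 b * ennreal (norm (g (pt a b))))" for a
 define M where "M = (NN x. ind (sq c l) x * ennreal (norm (g x)))"
 have [measurable]: "A : borel_fun" "B : borel_fun"
  unfolding A_def B_def by measurable
 have MB: "M = (NN a. ind I1 a * B a)"
  unfolding M_def B_def by(subst nn_integral_pt) (auto simp: sq nn_integral_cmult[symmetric] mult.assoc)
 have MA: "M = (NN b. ind I2 b * A b)"
  unfolding M_def
  by(subst nn_integral_pt, measurable, subst lborel_pair.Fubini')
   (auto simp: A_def sq nn_integral_cmult[symmetric] mult.assoc mult.left_commute)
 have h: "ennreal \<bar>w (pt a b) - w (pt a' b)\<bar> <= A b" if "a : I1" "a' : I1" for a a' b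
  unfolding A_def I1_def
 proof (rule FTC_line_bound[where f="%a. w (pt a b)" and F="%a. g (pt a b) $ 1"])
  show "((%a. w (pt a b)) has_real_derivative g (pt t b) $ 1) (at t)" for t
  proof -
   have "((%a. pt a b) has_derivative (%v. v *R axis 1 1)) (at t)"
    unfolding pt_def by(auto intro!: derivative_eq_intros)
   from has_derivative_compose[OF this c1c_D(3)[OF w]] show ?thesis
    by(simp add: has_field_derivative_def inner_axis mult.commute[of _ "_ $ _"])
  qed
 qed (use that component_le_norm_cart cg in "auto simp: I1_def intro!: continuous_intros continuous_on_compose2[OF cg]")
 have v: "ennreal \<bar>w (pt a b) - w (pt a b')\<bar> <= B a" if "b : I2" "b' : I2" for a b b'
  unfolding B_def I2_def
 proof (rule FTC_line_bound[where f="%b. w (pt a b)" and F="%b. g (pt a b) $ 2"])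
  show "((%b. w (pt a b)) has_real_derivative g (pt a t) $ 2) (at t)" for t
  proof -
   have "((%b. pt a b) has_derivative (%v. v *R axis 2 1)) (at t)"
    unfolding pt_def by(auto intro!: derivative_eq_intros)
   from has_derivative_compose[OF this c1c_D(3)[OF w]] show ?thesis
    by(simp add: has_field_derivative_def inner_axis mult.commute[of _ "_ $ _"])
  qed
 qed (use that component_le_norm_cart cg in "auto simp: I2_def intro!: continuous_intros continuous_on_compose2[OF cg]")
 \<comment> \<open>The path through \<open>pt a' b\<close> gives a bound involving only
   \<open>b\<close> and \<open>a'\<close>, the path through \<open>pt a b'\<close> one involving
   only \<open>a\<close> and \<open>b'\<close>. In their product the integrals over
   \<open>a'\<close> and \<open>b'\<close> factorise.\<close>
 have two: "ennreal ((w (pt a b) - w (pt a' b'))^2) <= (A b + B a') * (B a + A b')"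
  if "a : I1" "a' : I1" "b : I2" "b' : I2" for a a' b b'
 proof -
  have "ennreal \<bar>w (pt a b) - w (pt a' b')\<bar> <= ennreal (abs (w (pt a b) - w (pt a' b)) + abs (w (pt a' b) - w (pt a' b')))"
   by(rule ennreal_leI) simp
  also have "... <= A b + B a'" using h[of a a' b] v[of b b' a'] that by(simp add: add_mono)
  finally have 1: "ennreal \<bar>w (pt a b) - w (pt a' b')\<bar> <= A b + B a'" .
  have "ennreal \<bar>w (pt a b) - w (pt a' b')\<bar> <= ennreal (abs (w (pt a b) - w (pt a b')) + abs (w (pt a b') - w (pt a' b')))"
   by(rule ennreal_leI) simp
  also have "... <= B a + A b'" using h[of a a' b'] v[of b b' a] that by(simp add: add_mono)
  finally have 2: "ennreal \<bar>w (pt a b) - w (pt a' b')\<bar> <= B a + A b'" .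
  have "ennreal ((w (pt a b) - w (pt a' b'))^2) = ennreal \<bar>w (pt a b) - w (pt a' b')\<bar> * ennreal \<bar>w (pt a b) - w (pt a' b')\<bar>"
   by(simp add: ennreal_mult[symmetric] power2_eq_square flip: abs_mult)
  also have "... <= (A b + B a') * (B a + A b')" by(rule mult_mono[OF 1 2]) auto
  finally show ?thesis .
 qed
 \<comment> \<open>\<open>L\<close> is the side length. Each of the two final factors is
   \<open>2 * L * M = 4 * l * M\<close>, whence the constant \<open>16 * l^2\<close>.\<close>
 define L where "L = ennreal (2 * l)"
 have L1: "(NN a. ind I1 a) = L" "(NN a. ind I2 a) = L"
  using l by(auto simp: I1_def I2_def L_def)
 have "(NN x. \<integral>\<^sup>+y. ind (sq c l) x * ind (sq c l) y * ennreal ((w x - w y)^2) \<partial>lborel)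
   = (\<integral>\<^sup>+a. \<integral>\<^sup>+b. \<integral>\<^sup>+a'. \<integral>\<^sup>+b'. (ind I1 a * ind I2 b) * (ind I1 a' * ind I2 b')
     * ennreal ((w (pt a b) - w (pt a' b'))^2) \<partial>lborel \<partial>lborel \<partial>lborel \<partial>lborel)"
  by(subst nn_integral_pt, measurable) (intro nn_integral_cong, subst nn_integral_pt, auto simp: sq)
 also have "... <= (\<integral>\<^sup>+a. \<integral>\<^sup>+b. \<integral>\<^sup>+a'. \<integral>\<^sup>+b'. (ind I1 a * ind I2 b) * (ind I1 a' * (A b + B a'))
     * (ind I2 b' * (B a + A b')) \<partial>lborel \<partial>lborel \<partial>lborel \<partial>lborel)"
  using two by(intro nn_integral_mono) (auto simp: indicator_def)
 also have "... = (NN a. \<integral>\<^sup>+b. (ind I1 a * ind I2 b) * ((L * A b + M) * (L * B a + M)) \<partial>lborel)"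
 proof (intro nn_integral_cong)
  fix a b
  have e1: "(\<integral>\<^sup>+b'. ind I2 b' * (B a + A b') \<partial>lborel) = L * B a + M"
   unfolding MA by(simp add: distrib_left nn_integral_add nn_integral_multc L1)
  have e2: "(\<integral>\<^sup>+a'. ind I1 a' * (A b + B a') \<partial>lborel) = L * A b + M"
   unfolding MB by(simp add: distrib_left nn_integral_add nn_integral_multc L1)
  show "(\<integral>\<^sup>+a'. \<integral>\<^sup>+b'. (ind I1 a * ind I2 b) * (ind I1 a' * (A b + B a'))
     * (ind I2 b' * (B a + A b')) \<partial>lborel \<partial>lborel)
    = (ind I1 a * ind I2 b) * ((L * A b + M) * (L * B a + M))"
   using nn_integral_multc[of "%a'. ind I1 a' * (A b + B a')" lborel "L * B a + M"] e2
   by(simp add: nn_integral_cmult e1 mult.assoc)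
 qed
 also have "... = (NN a. \<integral>\<^sup>+b. (ind I1 a * (L * B a + M)) * (ind I2 b * (L * A b + M)) \<partial>lborel)"
  by(intro nn_integral_cong) (simp add: mult_ac)
 also have "... = (L * M + L * M) * (L * M + L * M)"
 proof -
  have e1: "(NN b. ind I2 b * (L * A b + M)) = L * M + L * M"
   using MA by(simp add: distrib_left nn_integral_add nn_integral_multc nn_integral_cmult L1 mult.left_commute[of _ L])
  have e2: "(NN a. ind I1 a * (L * B a + M)) = L * M + L * M"
   using MB by(simp add: distrib_left nn_integral_add nn_integral_multc nn_integral_cmult L1 mult.left_commute[of _ L])
  show ?thesis by(simp add: nn_integral_cmult nn_integral_multc e1 e2)
 qed
 also have "... = ennreal (16 * l^2) * M^2"
 proof -
  have "L * M + L * M = ennreal (4 * l) * M"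
   using l by(simp add: L_def distrib_right[symmetric] ennreal_plus[symmetric] del: ennreal_plus)
  moreover have "ennreal (4 * l) * ennreal (4 * l) = ennreal (16 * l^2)"
   using l by(simp add: ennreal_mult[symmetric] power2_eq_square)
  ultimately show ?thesis by(simp add: power2_eq_square mult_ac)
 qed
 finally show ?thesis unfolding M_def .
qed

subsection \<open>Stream functions\<close>

lemma c1c_zero_gradient:
 assumes f: "c1c U f g" and S: "open S" "x : S" "!!y. y : S ==> f y = c"
 shows "g x = 0"
proof -
 have "((%x. c) has_derivative (%v. g x *. v)) (at x)"
  using S by(intro has_derivative_transform_within_open[OF c1c_D(3)[OF f]]) auto
 hence "(%v. g x *. v) = (%v. 0)"
  using has_derivative_unique[OF _ has_derivative_const] by blast
 hence "g x *. g x = 0" by meson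
 thus ?thesis by simp
qed

text \<open>The potential \<open>\<integral>\<^sub>0\<^sup>1 F (z + t (x - z)) *. (x - z) dt\<close>.\<close>

lemma closed_field_potential:
 fixes F :: "real^2 => real^2"
 assumes F: "!!x. (F has_derivative D x) (at x)" and cD: "!!v. continuous_on UNIV (%x. D x v)"
  and S: "convex S" "z : S" and sym: "!!x v w. x : S ==> D x v *. w = D x w *. v"
 obtains w where "continuous_on UNIV w" "!!x. x : S ==> (w has_derivative (%v. F x *. v)) (at x)"
proof -
 define y where "y x t = z + t *R (x - z)" for x and t :: real
 define w where "w x = integral (cbox 0 1) (%t::real. F (y x t) *. (x - z))" for x
 define B where "B x t = Blinfun (%v. D (y x t) (t *R v) *. (x - z) + F (y x t) *. v)" for x t
 have cF: "continuous_on UNIV F"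
  using F by(meson continuous_at_imp_continuous_on has_derivative_continuous)
 have lD: "bounded_linear (D x)" for x using F by(rule has_derivative_bounded_linear)
 have Bl: "bounded_linear (%v. D (y x t) (t *R v) *. (x - z) + F (y x t) *. v)" for x t
  by(intro bounded_linear_intros bounded_linear_inner_left_comp bounded_linear_compose[OF lD]) 
 have Bapp: "blinfun_apply (B x t) v = D (y x t) (t *R v) *. (x - z) + F (y x t) *. v" for x t v
  unfolding B_def by(simp add: bounded_linear_Blinfun_apply[OF Bl])
 have Dt: "D x (t *R v) = t *R D x v" for x t v
  using lD by(simp add: linear_simps)
 have cy: "continuous_on A (%p. y (fst p) (snd p))" for A
  unfolding y_def by(intro continuous_intros)
 have cB: "continuous_on (UNIV \<times> cbox 0 1) (%(x, t). B x t)"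
 proof (rule continuous_on_blinfun_componentwise)
  fix i :: "real^2" assume "i : Basis"
  have "continuous_on (UNIV \<times> cbox 0 1) (%p. snd p *R D (y (fst p) (snd p)) i *. (fst p - z) + F (y (fst p) (snd p)) *. i)"
   by(intro continuous_intros continuous_on_compose2[OF cD] continuous_on_compose2[OF cF] cy) auto
  thus "continuous_on (UNIV \<times> cbox 0 1) (%p. blinfun_apply (case p of (x, t) => B x t) i)"
   by(simp add: case_prod_beta Bapp Dt)
 qed
 have int: "(%t. F (y x t) *. (x - z)) integrable_on cbox 0 1" for x
  unfolding y_def by(intro integrable_continuous continuous_intros continuous_on_compose2[OF cF]) auto
 have dw: "(w has_derivative blinfun_apply (integral (cbox 0 1) (B x))) (at x)" for x
 proof -
  have "((%x. integral (cbox 0 1) (%t::real. F (y x t) *. (x - z))) has_derivative blinfun_apply (integral (cbox 0 1) (B x))) (at x within UNIV)"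
  proof (rule leibniz_rule[OF _ int cB])
   fix x :: "real^2" and t :: real
   have "((%x. y x t) has_derivative (%v. t *R v)) (at x)"
    unfolding y_def by(auto intro!: derivative_eq_intros)
   from has_derivative_compose[OF this F]
   have "((%x. F (y x t)) has_derivative (%v. D (y x t) (t *R v))) (at x)" .
   moreover have "((%x. x - z) has_derivative (%v. v)) (at x)" by(auto intro!: derivative_eq_intros)
   ultimately have "((%x. F (y x t) *. (x - z)) has_derivative
     (%v. F (y x t) *. v + D (y x t) (t *R v) *. (x - z))) (at x)"
    by(rule has_derivative_inner)
   thus "((%x. F (y x t) *. (x - z)) has_derivative blinfun_apply (B x t)) (at x within UNIV)"
    unfolding Bapp[abs_def] by(simp add: add.commute)
  qed auto
  thus ?thesis by(simp add: w_def[abs_def])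
 qed
 have "blinfun_apply (integral (cbox 0 1) (B x)) v = F x *. v" if x: "x : S" for x v
 proof -
  have "continuous_on (cbox 0 1) (%t. case (x, t) of (x, t) => B x t)"
   by(rule continuous_on_compose2[OF cB, of "cbox 0 1" "%t. (x, t)"]) (auto intro!: continuous_intros)
  hence Bi: "B x integrable_on cbox 0 1" by(intro integrable_continuous) simp
  have "((%t. blinfun_apply (B x t) v) has_integral (1 *R F (y x 1) *. v - 0 *R F (y x 0) *. v)) {0..1}"
  proof (rule fundamental_theorem_of_calculus)
   fix t :: real assume t: "t : {0..1}"
   have yS: "y x t : S"
    using convexD[OF S(1) S(2) x, of "1 - t" t] t by(simp add: y_def algebra_simps)
   have "(y x has_vector_derivative (x - z)) (at t)"
    unfolding y_def[abs_def] by(auto intro!: derivative_eq_intros)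
   hence "((%s. F (y x s)) has_derivative (%h. D (y x t) (h *R (x - z)))) (at t)"
    unfolding has_vector_derivative_def using has_derivative_compose[OF _ F] by blast
   hence "((%s. F (y x s)) has_vector_derivative D (y x t) (x - z)) (at t)"
    unfolding has_vector_derivative_def by(simp add: Dt)
   hence "((%s. s *R F (y x s) *. v) has_vector_derivative (t *R D (y x t) (x - z) *. v + F (y x t) *. v)) (at t)"
    by(auto intro!: derivative_eq_intros simp: has_vector_derivative_def inner_simps algebra_simps)
   thus "((%s. s *R F (y x s) *. v) has_vector_derivative blinfun_apply (B x t) v) (at t within {0..1})"
    using sym[OF yS, of "x - z" v] by(simp add: Bapp Dt has_vector_derivative_at_within)
  qed simp
  hence "integral (cbox 0 1) (%t. blinfun_apply (B x t) v) = F x *. v"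
   by(simp add: integral_unique y_def)
  thus ?thesis using blinfun_apply_integral[OF Bi] by simp
 qed
 hence "(w has_derivative (%v. F x *. v)) (at x)" if "x : S" for x
  using dw[of x] that by(metis (no_types, lifting) ext)
 moreover have "continuous_on UNIV w"
  using dw by(meson continuous_at_imp_continuous_on has_derivative_continuous)
 ultimately show thesis using that by blast
qed

text \<open>Here \<open>L\<close> stands for the derivative of a divergence-free field: rotating the
  field makes its derivative symmetric, so that it has a potential on a convex set.\<close>

lemma trace_free_J_symmetric:
 fixes L :: "real^2 => real^2"
 assumes "linear L" "L (axis 1 1) $ 1 + L (axis 2 1) $ 2 = 0"
 shows "(J *v L v) *. w = (J *v L w) *. v"
proof -
 have e: "L v = v $ 1 *R L (axis 1 1) + v $ 2 *R L (axis 2 1)" for v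
 proof -
  have v: "v = v $ 1 *R axis 1 1 + v $ 2 *R axis 2 1" by(simp add: vec_eq_iff axis_def forall_2)
  show ?thesis by(subst v) (simp only: linear_add[OF assms(1)] linear_cmul[OF assms(1)])
 qed
 have t: "L (axis 2 1) $ 2 = - L (axis 1 1) $ 1" using assms(2) by simp
 show ?thesis
  unfolding e[of v] e[of w] by(simp add: inner_real2 J_mult t algebra_simps)
qed

lemma conv_matrix:
 assumes "cc UNIV \<rho>" "L1 f" shows "conv \<rho> (%y. M *v f y) x = M *v (conv \<rho> f x :: real^2)"
 using integral_bounded_linear[OF matrix_vector_mul_bounded_linear conv_integrable[OF assms], of M x]
 by(simp add: conv_def matrix_vector_mult_scaleR)

lemma convex_open_square:
 fixes z :: "real^2"
 shows "convex {x::real^2. abs (x $ 1 - z $ 1) < l & abs (x $ 2 - z $ 2) < (l::real)}"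
  "open {x::real^2. abs (x $ 1 - z $ 1) < l & abs (x $ 2 - z $ 2) < l}"
proof -
 have "{x::real^2. abs (x $ 1 - z $ 1) < l & abs (x $ 2 - z $ 2) < l} = box (z - vec l) (z + vec l)"
  by(auto simp: mem_box_cart forall_2 abs_less_iff)
 thus "convex {x::real^2. abs (x $ 1 - z $ 1) < l & abs (x $ 2 - z $ 2) < l}"
  "open {x::real^2. abs (x $ 1 - z $ 1) < l & abs (x $ 2 - z $ 2) < l}" by(simp_all add: convex_box open_box)
qed

text \<open>At points within \<open>s\<close> of the centre the mollifying kernel is supported in
  \<open>U\<close>, so orthogonality to gradients makes the mollified field divergence free there.
  Minus its rotation is then curl free and has a potential on the open square; a cutoff gives it
  compact support, and J^2 = -1 recovers the field.\<close>

lemma mollified_stream_function: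
 assumes U: "open U" and f: "sqint f" "L1 f" and o: "!!g. g : gradients U ==> inner (cls f) g = 0"
  and d: "d > 0" and r: "r < s" "0 <= r" and sU: "sq z (s + d) \<subseteq> U"
 obtains w g where "c1c UNIV w g" "!!x. x : sq z r ==> J *v g x = mconv d f x"
proof -
 define E where "E = mconv d f"
 define m where "m = grad (moll d)"
 have c1: "c1c UNIV (moll d) m" unfolding m_def by(rule c1c_moll[OF d])
 have mv: "cc UNIV (%w. m w *. v)" for v
  using cc_inner_right[OF c1c_D(2)[OF c1], of "%x. v"] by(simp add: inner_commute)
 define D where "D x v = conv (%w. m w *. v) f x" for x v
 have DE: "(E has_derivative D x) (at x)" for x
  unfolding E_def D_def using conv_has_derivative[OF c1 f(2), of x] by(simp add: eta_contract_eq)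
 have cD: "continuous_on UNIV (%x. D x v)" for v
  unfolding D_def using conv_continuous[OF mv f(2), of v] by(simp add: eta_contract_eq)
 define S where "S l = {x::real^2. abs (x $ 1 - z $ 1) < l & abs (x $ 2 - z $ 2) < l}" for l
 have tr: "D x (axis 1 1) $ 1 + D x (axis 2 1) $ 2 = 0" if x: "x : S s" for x
 proof -
  have i: "L1 (%y. (m (x - y) *. v) *R f y)" for v by(rule conv_integrable[OF mv f(2)])
  have "D x (axis 1 1) $ 1 + D x (axis 2 1) $ 2 = D x (axis 1 1) *. axis 1 1 + D x (axis 2 1) *. axis 2 1"
   by(simp add: inner_axis)
  also have "... = (LI y. ((m (x - y) *. axis 1 1) *R f y) *. axis 1 1) + (LI y. ((m (x - y) *. axis 2 1) *R f y) *. axis 2 1)"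
   unfolding D_def conv_def by(simp only: integral_inner_left[OF i])
  also have "... = (LI y. ((m (x - y) *. axis 1 1) *R f y) *. axis 1 1 + ((m (x - y) *. axis 2 1) *R f y) *. axis 2 1)"
   by(intro Bochner_Integration.integral_add[symmetric] integrable_inner_left i)
  also have "... = (LI y. f y *. m (x - y))"
   by(intro Lint_cong refl) (simp add: inner_axis inner_real2 axis_def mult.commute)
  also have "... = 0"
  proof -
   have "c1c U (%y. moll d (x - y)) (%y. - m (x - y))"
   proof (rule c1cI[of _ _ "cball x d"])
    show "((%y. moll d (x - y)) has_derivative (%v. - m (x - y) *. v)) (at y)" for y
    proof -
     have "((%y. x - y) has_derivative (%v. - v)) (at y)" by(auto intro!: derivative_eq_intros)
     from has_derivative_compose[OF this c1c_D(3)[OF c1]] show ?thesis by simp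
    qed
    show "continuous_on UNIV (%y. - m (x - y))"
     by(intro continuous_intros continuous_on_compose2[OF cc_continuous[OF c1c_D(2)[OF c1]]]) auto
    show "moll d (x - y) = 0" if "y ~: cball x d" for y
     by(rule moll_eq_0[OF d]) (use that in "simp add: dist_norm norm_minus_commute")
    have "x : sq z s" using x by(auto simp: S_def sq_def)
    thus "cball x d \<subseteq> U" using cball_sq[of x d] sq_trans[of x z s _ d] sU by blast
   qed simp
   hence "inner (cls f) (cls (%y. - m (x - y))) = 0" and "sqint (%y. - m (x - y))"
    using o c1c_gradient_in[OF _ U] cc_sqint c1c_D(2) by blast+
   thus ?thesis using f(1) by(simp add: inner_cls)
  qed
  finally show ?thesis .
 qed
 have lD: "linear (D x)" for x using has_derivative_bounded_linear[OF DE] by(rule bounded_linear.linear)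
 define F where "F x = - (J *v E x)" for x
 have dF: "(F has_derivative (%v. - (J *v D x v))) (at x)" for x
  unfolding F_def
  by(intro has_derivative_minus bounded_linear.has_derivative[OF matrix_vector_mul_bounded_linear] DE)
 have cF: "continuous_on UNIV F"
  using dF by(meson continuous_at_imp_continuous_on has_derivative_continuous)
 have zS: "z : S s" using r by(simp add: S_def)
 obtain w where w: "continuous_on UNIV w" "!!x. x : S s ==> (w has_derivative (%v. F x *. v)) (at x)"
 proof (rule closed_field_potential[OF dF _ _ zS])
  show "continuous_on UNIV (%x. - (J *v D x v))" for v
   by(intro continuous_intros bounded_linear.continuous_on[OF matrix_vector_mul_bounded_linear] cD)
  show "convex (S s)" unfolding S_def by(rule convex_open_square)
  show "- (J *v D x v) *. u = - (J *v D x u) *. v" if "x : S s" for x v u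
   using trace_free_J_symmetric[OF lD tr[OF that], of v u] by simp
 qed blast
 \<comment> \<open>The intermediate radius makes the cutoff equal to 1 on an open neighbourhood of
   \<open>sq z r\<close>, so that its gradient vanishes there.\<close>
 define t where "t = (r + s) / 2"
 have t: "r < t" "t < s" using r by(auto simp: t_def)
 have tS: "sq z t \<subseteq> S s" using t by(auto simp: sq_def S_def)
 have oS: "open (S l)" for l unfolding S_def by(rule convex_open_square)
 obtain \<eta> where \<eta>: "\<eta> : TF (S s)" "!!x. x : sq z t ==> \<eta> x = 1"
  using cutoff_exists[OF compact_sq tS oS] by metis
 define \<eta>' where "\<eta>' = grad \<eta>"
 have c\<eta>: "c1c (S s) \<eta> \<eta>'" unfolding \<eta>'_def by(rule test_function_c1c[OF \<eta>(1)])
 obtain K where K: "compact K" "K \<subseteq> S s" "!!x. x ~: K ==> \<eta> x = 0" using ccE[OF c1c_D(1)[OF c\<eta>]] by metis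
 have oK: "open (- K)" using K(1) by(simp add: compact_imp_closed open_Compl)
 define g where "g x = w x *R \<eta>' x + \<eta> x *R F x" for x
 show thesis
 proof (rule that)
  show "c1c UNIV (%x. \<eta> x * w x) g"
  proof (rule c1cI[OF _ _ K(1)])
   show "((%x. \<eta> x * w x) has_derivative (%v. g x *. v)) (at x)" for x
   proof (cases "x : S s")
    case True
    have "((%x. \<eta> x * w x) has_derivative (%v. \<eta> x * (F x *. v) + (\<eta>' x *. v) * w x)) (at x)"
     by(rule has_derivative_mult[OF c1c_D(3)[OF c\<eta>] w(2)[OF True]])
    thus ?thesis by(simp add: g_def inner_simps algebra_simps)
   next
    case False
    hence x: "x : - K" using K(2) by blast
    have "\<eta>' x = 0" by(rule c1c_zero_gradient[OF c\<eta> oK x]) (use K(3) in auto)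
    hence "g x = 0" using K(3) x by(simp add: g_def)
    moreover have "((%x. \<eta> x * w x) has_derivative (%v. 0)) (at x)"
     by(rule has_derivative_transform_within_open[OF has_derivative_const[of 0] oK x]) (use K(3) in auto)
    ultimately show ?thesis by simp
   qed
   show "continuous_on UNIV g" unfolding g_def
    using c1c_D(1,2)[OF c\<eta>] by(intro continuous_intros w(1) cF cc_continuous)
   show "\<eta> x * w x = 0" if "x ~: K" for x using K(3) that by simp
  qed simp
  show "J *v g x = mconv d f x" if x: "x : sq z r" for x
  proof -
   have "x : S t" using x t by(auto simp: sq_def S_def)
   hence "\<eta>' x = 0" by(rule c1c_zero_gradient[OF c\<eta> oS]) (auto simp: S_def sq_def intro: \<eta>(2))
   moreover have "\<eta> x = 1" using x t sq_mono[of r t z] by(intro \<eta>(2)) auto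
   ultimately have "g x = F x" by(simp add: g_def)
   thus ?thesis using inner_J(3)[of "E x"] by(simp add: F_def E_def linear_neg[OF matrix_vector_mul_linear])
  qed
 qed
qed

subsection \<open>The div-curl estimate\<close>

text \<open>The product of the bound \<open>4 * exp (8/7) / h^2\<close> on the mollifier with the
  Sobolev constant \<open>16 * l^2\<close> at \<open>l = 2 * h\<close>; the powers of
  \<open>h\<close> cancel.\<close>

abbreviation sq_const :: real where "sq_const \<equiv> 256 * exp (8/7)"

text \<open>By Jensen's inequality \<open>(w x - mconv h w x)^2\<close> is at most the mean of
  \<open>(w x - w y)^2\<close> over the ball of radius \<open>h\<close>, which lies in the doubled
  square. The square inequality then applies, with a constant independent of the scale.\<close>

lemma mollification_oscillation:
 assumes w: "c1c UNIV w g" and h: "h > 0"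
 shows "(NN x. ind (sq c h) x * ennreal ((w x - mconv h w x)^2))
   <= ennreal sq_const * (NN x. ind (sq c (2*h)) x * ennreal (norm (g x)))^2"
proof -
 have [measurable]: "w : borel_fun" using c1c_D(1)[OF w] by(auto intro: cc_measurable)
 have wi: "L1 w" by(rule cc_integrable[OF c1c_D(1)[OF w]])
 obtain B where B: "!!x. norm (w x) <= B" using cc_bounded[OF c1c_D(1)[OF w]] by blast
 define Cm where "Cm = 4 * exp (8/7) / h^2"
 have Cm: "Cm >= 0" by(simp add: Cm_def)
 let ?S = "sq c (2 * h)"
 have pw: "ind (sq c h) x * ennreal ((w x - mconv h w x)^2)
   <= ennreal Cm * (NN y. ind ?S x * ind ?S y * ennreal ((w x - w y)^2))" for x
 proof (cases "x : sq c h")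
  case True
  have i1: "L1 (%y. moll h (x - y))"
   by(rule lborel_integrable_reflect[OF integrable_moll[OF h]])
  have one: "(LI y. moll h (x - y)) = 1"
   using lborel_integral_reflect[of "moll h" x] integral_moll[OF h] by simp
  have i: "L1 (%y. moll h (x - y) * w y)"
   using conv_integrable[OF cc_moll[OF h] wi, of x] by simp
  have i2: "L1 (%y. moll h (x - y) * (w x - w y)^2)"
  proof (rule L1_bound)
   show "L1 (%y. (2 * B)^2 * moll h (x - y))" using i1 by simp
   show "AEl y. norm (moll h (x - y) * (w x - w y)^2) <= norm ((2 * B)^2 * moll h (x - y))"
   proof (rule AE_I2)
    fix y
    have "abs (w x - w y) <= abs (2 * B)" using B[of x] B[of y] by auto
    hence "(w x - w y)^2 <= (2 * B)^2" by(simp only: abs_le_square_iff)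
    thus "norm (moll h (x - y) * (w x - w y)^2) <= norm ((2 * B)^2 * moll h (x - y))"
     using moll_nonneg[OF h, of "x - y"] by(simp add: mult.commute mult_left_mono)
   qed
  qed measurable
  define a where "a = w x - mconv h w x"
  have "a^2 = 2 * a * (w x - mconv h w x) - a\<^sup>2" by(simp add: a_def power2_eq_square)
  also have "... = (LI y. 2 * a * (w x * moll h (x - y) - moll h (x - y) * w y) - a\<^sup>2 * moll h (x - y))"
   using i i1 one by(simp add: conv_def)
  also have "... <= (LI y. moll h (x - y) * (w x - w y)^2)"
  proof (rule integral_mono[OF _ i2])
   show "L1 (%y. 2 * a * (w x * moll h (x - y) - moll h (x - y) * w y) - a\<^sup>2 * moll h (x - y))"
    using i i1 by simp
   fix y
   have "2 * a * (w x - w y) - a\<^sup>2 <= (w x - w y)^2"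
    using sum_squares_bound[of a "w x - w y"] by simp
   hence "moll h (x - y) * (2 * a * (w x - w y) - a\<^sup>2) <= moll h (x - y) * (w x - w y)^2"
    by(rule mult_left_mono) (rule moll_nonneg[OF h])
   thus "2 * a * (w x * moll h (x - y) - moll h (x - y) * w y) - a\<^sup>2 * moll h (x - y)
     <= moll h (x - y) * (w x - w y)^2" by(simp add: algebra_simps)
  qed
  finally have "ennreal (a^2) <= ennreal (LI y. moll h (x - y) * (w x - w y)^2)" by(rule ennreal_leI)
  also have "... = (NN y. ennreal (moll h (x - y) * (w x - w y)^2))"
   by(rule nn_integral_eq_integral[symmetric, OF i2]) (simp add: moll_nonneg[OF h])
  also have "... <= (NN y. ennreal Cm * (ind ?S x * ind ?S y * ennreal ((w x - w y)^2)))"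
  proof (rule nn_integral_mono)
   fix y
   show "ennreal (moll h (x - y) * (w x - w y)^2) <= ennreal Cm * (ind ?S x * ind ?S y * ennreal ((w x - w y)^2))"
   proof (cases "y : cball x h")
    case yx: True
    hence "y : sq x h" using cball_sq[of x h] by blast
    hence "y : sq c (h + h)" by(rule sq_trans[OF True])
    hence "y : ?S" by simp
    moreover have "x : ?S" using True by(rule subsetD[OF sq_mono, rotated]) (use h in simp)
    moreover have "moll h (x - y) <= Cm" unfolding Cm_def by(rule moll_le[OF h])
    ultimately show ?thesis
     using Cm by(simp add: ennreal_mult[symmetric] ennreal_leI mult_right_mono)
   next
    case False
    hence "moll h (x - y) = 0"
     by(intro moll_eq_0[OF h]) (simp add: dist_norm norm_minus_commute)
    thus ?thesis by simp
   qed
  qed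
  also have "... = ennreal Cm * (NN y. ind ?S x * ind ?S y * ennreal ((w x - w y)^2))"
   by(rule nn_integral_cmult) measurable
  finally show ?thesis using True by(simp add: a_def)
 qed simp
 have "(NN x. ind (sq c h) x * ennreal ((w x - mconv h w x)^2))
   <= (NN x. ennreal Cm * (NN y. ind ?S x * ind ?S y * ennreal ((w x - w y)^2)))"
  by(rule nn_integral_mono) (rule pw)
 also have "... = ennreal Cm * (NN x. \<integral>\<^sup>+y. ind ?S x * ind ?S y * ennreal ((w x - w y)^2) \<partial>lborel)"
  by(rule nn_integral_cmult) measurable
 also have "... <= ennreal Cm * (ennreal (16 * (2 * h)^2) * (NN x. ind ?S x * ennreal (norm (g x)))^2)"
  by(rule mult_left_mono[OF square_inequality[OF w]]) (use h in auto)
 also have "... = ennreal sq_const * (NN x. ind ?S x * ennreal (norm (g x)))^2"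
 proof -
  have "ennreal Cm * ennreal (16 * (2 * h)^2) = ennreal sq_const"
   using h Cm by(simp add: ennreal_mult[symmetric] Cm_def power_mult_distrib)
  thus ?thesis by(simp only: mult.assoc[symmetric])
 qed
 finally show ?thesis .
qed

definition l1 :: "(real^2) set => (real^2 => real^2) => real" where
 "l1 S f = (LI x. ind S x * norm (f x))"

lemma l1_nn_integral:
 assumes "sqint f" "compact S"
 shows "L1 (%x. ind S x * norm (f x))"
  "(NN x. ind S x * ennreal (norm (f x))) = ennreal (l1 S f)"
proof -
 have [measurable]: "f : borel_fun" "S : sets borel" using assms by(auto simp: sqint_def borel_compact)
 have iS: "L1 (%x. ind S x :: real)"
  using emeasure_compact_finite[OF assms(2)] by(intro integrable_real_indicator) auto
 show i: "L1 (%x. ind S x * norm (f x))"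
 proof (rule L1_bound)
  show "L1 (%x. ind S x + (norm (f x))^2)"
   using iS sqint_integrable[OF assms(1)] by simp
  show "AEl x. norm (ind S x * norm (f x)) <= norm (ind S x + (norm (f x))^2)"
  proof (rule AE_I2)
   fix x
   have "2 * norm (f x) <= 1 + (norm (f x))^2" using sum_squares_bound[of 1 "norm (f x)"] by simp
   hence "norm (f x) <= 1 + (norm (f x))^2" using norm_ge_zero[of "f x"] by linarith
   thus "norm (ind S x * norm (f x)) <= norm (ind S x + (norm (f x))^2)"
    by(auto simp: indicator_def)
  qed
 qed measurable
 have "(NN x. ind S x * ennreal (norm (f x))) = (NN x. ennreal (ind S x * norm (f x)))"
  by(intro nn_integral_cong) (simp add: indicator_def)
 also have "... = ennreal (l1 S f)" unfolding l1_def by(rule nn_integral_eq_integral[OF i]) auto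
 finally show "(NN x. ind S x * ennreal (norm (f x))) = ennreal (l1 S f)" .
qed

lemma l1_nonneg: "0 <= l1 S f"
 unfolding l1_def by(rule Lint_nonneg) simp

text \<open>Stated for \<open>f^2 <= a * b\<close> to avoid square roots of \<open>a\<close> and
  \<open>b\<close>. Pointwise AM-GM gives \<open>2 * s * t * f <= s^2 * a + t^2 * b\<close>, and
  \<open>s\<close>, \<open>t\<close> are chosen after integration.\<close>

lemma Cauchy_Schwarz_integral:
 fixes a b :: "'a => real"
 assumes a: "integrable M a" "!!x. a x >= 0" and b: "integrable M b" "!!x. b x >= 0" and f: "integrable M f"
  and le: "AE x in M. (f x)^2 <= a x * b x"
 shows "(LINT x|M. f x)^2 <= (LINT x|M. a x) * (LINT x|M. b x)"
proof -
 define \<alpha> \<beta> where "\<alpha> = (LINT x|M. a x)" and "\<beta> = (LINT x|M. b x)"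
 have p: "\<alpha> >= 0" "\<beta> >= 0" unfolding \<alpha>_def \<beta>_def using a b by(auto intro: Lint_nonneg)
 have q: "2 * s * t * (LINT x|M. f x) <= s^2 * \<alpha> + t^2 * \<beta>" for s t :: real
 proof -
  have "(LINT x|M. 2 * s * t * f x) <= (LINT x|M. s^2 * a x + t^2 * b x)"
  proof (rule integral_mono_AE)
   show "AE x in M. 2 * s * t * f x <= s^2 * a x + t^2 * b x"
    using le
   proof eventually_elim
    case (elim x)
    have "(s * t * f x)^2 <= (s^2 * a x) * (t^2 * b x)"
     using mult_left_mono[OF elim, of "(s * t)^2"] by(simp add: power_mult_distrib mult_ac)
    also have "... <= ((s^2 * a x + t^2 * b x) / 2)^2"
     using sum_squares_bound[of "s^2 * a x" "t^2 * b x"] by(simp add: power2_eq_square field_simps)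
    finally have "abs (s * t * f x) <= abs ((s^2 * a x + t^2 * b x) / 2)" by(simp only: abs_le_square_iff)
    thus ?case using a(2)[of x] b(2)[of x] by auto
   qed
  qed (use a b f in auto)
  thus ?thesis using a b f by(simp add: \<alpha>_def \<beta>_def)
 qed
 define I where "I = (LINT x|M. f x)"
 have "I^2 <= \<alpha> * \<beta>"
 proof (cases "\<alpha> = 0")
  case True
  have "I = 0"
  proof (rule ccontr)
   assume I: "I ~= 0"
   \<comment> \<open>When \<alpha> vanishes the bound is linear in \<open>s\<close>, and this
     \<open>s\<close> would yield \<open>\<beta> + 1 <= \<beta>\<close>.\<close>
   have "2 * ((\<beta> + 1) / (2 * I)) * 1 * I <= \<beta>" using q[of "(\<beta> + 1) / (2 * I)" 1] True by(simp add: I_def)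
   thus False using I by simp
  qed
  thus ?thesis using p by simp
 next
  case False
  hence "\<alpha> > 0" using p by simp
  have "2 * I * \<alpha> * I <= I^2 * \<alpha> + \<alpha>^2 * \<beta>" using q[of I \<alpha>] by(simp add: I_def)
  hence "\<alpha> * I^2 <= \<alpha> * (\<alpha> * \<beta>)" by(simp add: power2_eq_square algebra_simps)
  thus ?thesis using \<open>\<alpha> > 0\<close> by simp
 qed
 thus ?thesis by(simp add: I_def \<alpha>_def \<beta>_def)
qed

lemma l1_tendsto:
 assumes h: "!!n. sqint (h n)" "sqint f" and lim: "(%n. cls (h n)) ----> cls f" and S: "compact S"
 shows "(%n. l1 S (h n)) ----> l1 S f"
proof -
 have [measurable]: "S : sets borel" using S by(simp add: borel_compact)
 have iS: "L1 (%x. ind S x :: real)"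
  using emeasure_compact_finite[OF S] by(intro integrable_real_indicator) auto
 have "norm (l1 S (h n) - l1 S f) <= sqrt (measure lborel S) * norm (cls (h n) - cls f)" for n
 proof -
  have s: "sqint (%x. h n x - f x)" by(rule sqint_minus[OF h])
  have "abs (l1 S (h n) - l1 S f) = abs (LI x. ind S x * norm (h n x) - ind S x * norm (f x))"
   unfolding l1_def using l1_nn_integral(1)[OF h(1) S] l1_nn_integral(1)[OF h(2) S] by simp
  also have "... <= l1 S (%x. h n x - f x)"
   unfolding l1_def
  proof (rule Lint_norm_bound[where 'a="real^2" and 'b=real, simplified real_norm_def])
   show "abs (ind S x * norm (h n x) - ind S x * norm (f x)) <= ind S x * norm (h n x - f x)" for x
    using norm_triangle_ineq3[of "h n x" "f x"] by(simp add: indicator_def)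
  qed (use l1_nn_integral(1)[OF h(1) S] l1_nn_integral(1)[OF h(2) S] l1_nn_integral(1)[OF s S] in auto)
  also have "... <= sqrt (measure lborel S) * norm (cls (h n) - cls f)"
  proof -
   have "(l1 S (%x. h n x - f x))^2 <= (LI x. ind S x) * (LI x. (norm (h n x - f x))^2)"
    unfolding l1_def
    by(rule Cauchy_Schwarz_integral[OF iS _ sqint_integrable[OF s] _ l1_nn_integral(1)[OF s S]])
     (auto simp: indicator_def)
   also have "... = (sqrt (measure lborel S) * norm (cls (h n) - cls f))^2"
    by(simp add: power_mult_distrib cls_minus[OF h] norm_cls[OF s])
   finally show ?thesis using l1_nonneg[of S] by(simp add: power2_le_iff_abs_le)
  qed
  finally show ?thesis by simp
 qed
 hence "\<forall>\<^sub>F n in sequentially. norm (l1 S (h n) - l1 S f) <= sqrt (measure lborel S) * norm (cls (h n) - cls f)"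
  by(rule always_eventually[OF allI])
 moreover have "(%n. sqrt (measure lborel S) * norm (cls (h n) - cls f)) ----> 0"
  using tendsto_mult_left[OF tendsto_norm_zero[OF LIM_zero[OF lim]], of "sqrt (measure lborel S)"] by simp
 ultimately have "(%n. l1 S (h n) - l1 S f) ----> 0"
  by(rule Lim_null_comparison)
 thus ?thesis by(rule LIM_zero_cancel)
qed

text \<open>Testing the curl of \<open>G\<close> against \<open>\<phi> (w - w * \<rho>\<^sub>h)\<close>, with \<open>w\<close> a stream function of \<open>E\<close>,
 moves all derivatives off \<open>E - E * \<rho>\<^sub>h\<close>.\<close>

lemma div_curl_estimate_smooth:
 assumes U: "open U" and G: "!!g. g : gradients U ==> inner G (rot g) = 0"
  and \<phi>: "c1c U \<phi> \<phi>'" "!!x. x ~: sq z r ==> \<phi> x = 0" "!!x. norm (\<phi>' x) <= B" and h: "h > 0"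
  and I: "finite I" "sq z r \<subseteq> (\<Union>i\<in>I. sq (c i) h)" "!!i. i : I ==> sq (c i) (2*h) \<subseteq> sq z (r + 2*h)"
  and E: "cc UNIV E" and w: "c1c UNIV w g" "!!x. x : sq z (r + 2*h) ==> J *v g x = E x"
 shows "abs (inner (smul \<phi> (cls E - cls (mconv h E))) G)
   <= B * norm G * sqrt (sq_const * (\<Sum>i\<in>I. (l1 (sq (c i) (2*h)) E)^2))"
proof -
 let ?Q = "%i. sq (c i) (2*h)"
 let ?l = "%i. l1 (?Q i) E"
 let ?t = "%i. sq_const * (?l i)^2" and ?s = "sq_const * (\<Sum>i\<in>I. (?l i)^2)"
 define W where "W x = w x - mconv h w x" for x
 let ?w = "%i x. ind (sq (c i) h) x * ennreal ((W x)^2)"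
 let ?F = "%x. \<Sum>i\<in>I. ennreal (B^2) * ?w i x"
 define g' where "g' x = g x - mconv h g x" for x
 have cW: "c1c UNIV W g'"
  using c1c_add[OF w(1) c1c_scale[OF c1c_conv[OF h w(1)], of "-1"]] by(simp add: W_def[abs_def] g'_def[abs_def])
 have [measurable]: "W : borel_fun" using c1c_D(1)[OF cW] by(auto intro: cc_measurable)
 have \<phi>'0: "\<phi>' x = 0" if "x ~: sq z r" for x
  by(rule c1c_zero_gradient[OF \<phi>(1), of "- sq z r"])
   (use that \<phi>(2) compact_sq in "auto simp: compact_imp_closed open_Compl")
 have B0: "B >= 0" using \<phi>(3)[of 0] norm_ge_zero order_trans by blast
 obtain Bp where Bp: "!!x. norm (\<phi> x) <= Bp" using cc_bounded[OF c1c_D(1)[OF \<phi>(1)]] by blast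
 have [measurable]: "\<phi> : borel_fun" using c1c_D(1)[OF \<phi>(1)] by(auto intro: cc_measurable)
 have Ec: "cc UNIV (mconv h E)" by(rule cc_conv_cc[OF h E])
 have m: "c1c U (%x. \<phi> x * W x) (%x. W x *R \<phi>' x + \<phi> x *R g' x)"
  by(rule c1c_mult[OF \<phi>(1) c1c_D(3)[OF cW] cc_continuous[OF c1c_D(2)[OF cW]]])
 \<comment> \<open>For \<open>x\<close> in \<open>sq z r\<close> the convolution sees
   \<open>E\<close> only within distance \<open>h\<close>, where \<open>E\<close> is the rotated
   gradient of \<open>w\<close>, so that it commutes with the representation. Outside that square
   both sides vanish.\<close>
 have pt: "J *v (W x *R \<phi>' x + \<phi> x *R g' x) = W x *R (J *v \<phi>' x) + \<phi> x *R (E x - mconv h E x)" for x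
 proof (cases "x : sq z r")
  case True
  hence x2: "x : sq z (r + 2*h)" by(rule subsetD[OF sq_mono, rotated]) (use h in simp)
  have "mconv h E x = mconv h (%y. J *v g y) x"
   unfolding conv_def
  proof (intro Lint_cong refl)
   fix y
   show "moll h (x - y) *R E y = moll h (x - y) *R (J *v g y)"
   proof (cases "y : cball x h")
    case yx: True
    hence "y : sq x h" using cball_sq[of x h] by blast
    hence "y : sq z (r + h)" by(rule sq_trans[OF True])
    hence "y : sq z (r + 2*h)" by(rule subsetD[OF sq_mono, rotated]) (use h in simp)
    thus ?thesis using w(2)[of y] by simp
   next
    case False
    thus ?thesis using moll_eq_0[OF h, of "x - y"] by(simp add: dist_norm norm_minus_commute)
   qed
  qed
  also have "... = J *v mconv h g x"
   by(rule conv_matrix[OF cc_moll[OF h] cc_integrable[OF c1c_D(2)[OF w(1)]]])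
  finally show ?thesis
   using w(2)[OF x2] by(simp add: g'_def matrix_vector_right_distrib matrix_vector_mult_scaleR matrix_vector_mult_diff_distrib)
 qed (simp add: \<phi>(2) \<phi>'0)
 define f1 where "f1 x = W x *R (J *v \<phi>' x)" for x
 define f2 where "f2 x = \<phi> x *R (E x - mconv h E x)" for x
 have s1: "sqint f1" unfolding f1_def
  by(rule cc_sqint[OF cc_scale_right[OF cc_matrix[OF c1c_D(2)[OF \<phi>(1)]] cc_continuous[OF c1c_D(1)[OF cW]]]])
 have c2: "smul \<phi> (cls E - cls (mconv h E)) = cls f2" "sqint f2"
  using mul_cls[OF bounded_field_scalar[of \<phi> Bp], of "%x. E x - mconv h E x"]
   sqint_mul[OF bounded_field_scalar[of \<phi> Bp], of "%x. E x - mconv h E x"] Bp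
   cc_sqint[OF E] cc_sqint[OF Ec]
  by(auto simp: cls_minus sqint_minus f2_def[abs_def] scaleR_matrix_vector_assoc[symmetric])
 have "rot (cls (%x. W x *R \<phi>' x + \<phi> x *R g' x)) = cls f1 + cls f2"
  using s1 c2(2) cc_sqint[OF c1c_D(2)[OF m]] by(simp add: rot_cls pt cls_add f1_def f2_def)
 hence "inner G (cls f1) + inner G (cls f2) = 0"
  using G[OF c1c_gradient_in[OF m U]] by(simp add: inner_add_right)
 hence "abs (inner (cls f2) G) = abs (inner G (cls f1))" by(simp add: inner_commute[of "cls f2"] add_eq_0_iff)
 also have "... <= norm G * norm (cls f1)" by(rule Cauchy_Schwarz_ineq2)
 also have "norm G * norm (cls f1) <= norm G * (B * sqrt ?s)"
 proof (rule mult_left_mono[OF _ norm_ge_zero])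
 show "norm (cls f1) <= B * sqrt ?s"
 proof -
  have "ennreal ((norm (cls f1))^2) = (NN x. ennreal ((norm (f1 x))^2))"
   unfolding norm_cls[OF s1] by(rule nn_integral_eq_integral[symmetric, OF sqint_integrable[OF s1]]) simp
  also have "... <= (NN x. ?F x)"
  proof (rule nn_integral_mono)
   fix x
   show "ennreal ((norm (f1 x))^2) <= ?F x"
   proof (cases "x : sq z r")
    case True
    then obtain i where i: "i : I" "x : sq (c i) h" using I(2) by blast
    have "(norm (f1 x))^2 <= B^2 * (W x)^2"
     using power_mono[OF \<phi>(3)[of x] norm_ge_zero, of 2] by(simp add: f1_def power_mult_distrib mult.commute[of "(W x)^2"] mult_right_mono)
    hence "ennreal ((norm (f1 x))^2) <= ennreal (B^2 * (W x)^2)" by(rule ennreal_leI)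
    also have "... = ennreal (B^2) * ?w i x"
     using i by(simp add: ennreal_mult)
    also have "... <= ?F x"
     using i(1) I(1) by(intro member_le_sum) auto
    finally show ?thesis .
   qed (simp add: f1_def \<phi>'0)
  qed
  also have "... = (\<Sum>i\<in>I. ennreal (B^2) * (NN x. ?w i x))"
   by(subst nn_integral_sum) (auto simp: nn_integral_cmult)
  also have "... <= (\<Sum>i\<in>I. ennreal (B^2) * ennreal (?t i))"
  proof (intro sum_mono mult_left_mono)
   fix i assume i: "i : I"
   have "(NN x. ?w i x)
     <= ennreal sq_const * (NN x. ind (?Q i) x * ennreal (norm (g x)))^2"
    unfolding W_def by(rule mollification_oscillation[OF w(1) h])
   also have "(NN x. ind (?Q i) x * ennreal (norm (g x)))
     = (NN x. ind (?Q i) x * ennreal (norm (E x)))"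
   proof (rule nn_integral_cong)
    fix x
    show "ind (?Q i) x * ennreal (norm (g x)) = ind (?Q i) x * ennreal (norm (E x))"
    proof (cases "x : ?Q i")
     case True
     hence "J *v g x = E x" using w(2)[of x] I(3)[OF i] by blast
     hence "norm (g x) = norm (E x)" by(metis norm_J)
     thus ?thesis by simp
    qed simp
   qed
   also have "... = ennreal (?l i)" by(rule l1_nn_integral(2)[OF cc_sqint[OF E] compact_sq])
   finally show "(NN x. ?w i x) <= ennreal (?t i)"
    by(simp add: ennreal_mult ennreal_power l1_nonneg)
  qed simp
  also have "... = ennreal (B^2 * ?s)"
   by(simp add: ennreal_mult[symmetric] sum_ennreal sum_distrib_left)
  finally have "(norm (cls f1))^2 <= B^2 * ?s"
   by(subst (asm) ennreal_le_iff) (auto intro!: mult_nonneg_nonneg sum_nonneg)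
  hence "sqrt ((norm (cls f1))^2) <= sqrt (B^2 * ?s)"
   by(rule real_sqrt_le_mono)
  thus ?thesis using B0 by(simp add: real_sqrt_mult)
 qed
 qed
 finally show ?thesis unfolding c2 by(simp add: mult_ac)
qed

lemma sqint_bounded_support_integrable:
 assumes f: "sqint f" and U: "bounded U" "!!x. x ~: U ==> f x = 0"
 shows "L1 f"
proof -
 obtain R where R: "!!x. x : U ==> norm x <= R" using U(1) unfolding bounded_iff by blast
 have "L1 (%x. ind (cball 0 R) x * norm (f x))" by(rule l1_nn_integral(1)[OF f]) simp
 hence "L1 (%x. norm (f x))"
  by(rule Bochner_Integration.integrable_cong[THEN iffD1, rotated 2])
   (use U(2) R in "force simp: indicator_def")+
 thus ?thesis using f by(simp add: integrable_norm_iff sqint_def)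
qed

text \<open>The smooth estimate is applied to mollifications of \<open>T\<close>, and both sides
  pass to the limit. The margin \<open>4 * h\<close> consists of \<open>2 * h\<close> for the
  doubled squares, \<open>h\<close> for cutting off the stream function and \<open>h\<close> for the
  mollification radius.\<close>

theorem div_curl_estimate:
 assumes U: "open U" "bounded U" and T: "sqint T" "!!x. x ~: U ==> T x = 0"
  and o: "!!g. g : gradients U ==> inner (cls T) g = 0"
  and G: "!!g. g : gradients U ==> inner G (rot g) = 0"
  and \<phi>: "c1c U \<phi> \<phi>'" "!!x. x ~: sq z r ==> \<phi> x = 0" "!!x. norm (\<phi>' x) <= B"
  and h: "h > 0" "r >= 0" "sq z (r + 4*h) \<subseteq> U"
  and I: "finite I" "sq z r \<subseteq> (\<Union>i\<in>I. sq (c i) h)" "!!i. i : I ==> sq (c i) (2*h) \<subseteq> sq z (r + 2*h)"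
 shows "abs (inner (smul \<phi> (cls T - cls (mconv h T))) G)
   <= B * norm G * sqrt (sq_const * (\<Sum>i\<in>I. (l1 (sq (c i) (2*h)) T)^2))"
proof -
 have Ti: "L1 T" by(rule sqint_bounded_support_integrable[OF T(1) U(2) T(2)])
 obtain R where R: "!!x. x : U ==> norm x <= R" using U(2) unfolding bounded_iff by blast
 define d where "d n = h / real (n + 2)" for n
 have d: "d n > 0" "d n <= h" for n using h(1) by(auto simp: d_def field_simps)
 have d0: "d ----> 0" unfolding d_def by real_asymp
 define E where "E n = mconv (d n) T" for n
 have E: "cc UNIV (E n)" for n
  unfolding E_def by(rule cc_conv[OF d(1) Ti, of R]) (use T(2) R in force)
 have lim: "(%n. cls (E n)) ----> cls T" unfolding E_def by(rule conv_tendsto[OF d0 d(1) T(1) Ti])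
 obtain Bp where Bp: "!!x. norm (\<phi> x) <= Bp" using cc_bounded[OF c1c_D(1)[OF \<phi>(1)]] by blast
 have \<phi>m: "\<phi> : borel_fun" using c1c_D(1)[OF \<phi>(1)] by(rule cc_measurable)
 have bl: "bounded_linear (smul \<phi>)" by(rule bounded_linear_mul[OF bounded_field_scalar[OF \<phi>m, of Bp]]) (use Bp in auto)
 have ineq: "abs (inner (smul \<phi> (cls (E n) - cls (mconv h (E n)))) G)
   <= B * norm G * sqrt (sq_const * (\<Sum>i\<in>I. (l1 (sq (c i) (2*h)) (E n))^2))" for n
 proof -
  have "sq z (r + 3*h + d n) \<subseteq> U"
   using h(3) sq_mono[of "r + 3*h + d n" "r + 4*h" z] d(2)[of n] by auto
  then obtain w g where w: "c1c UNIV w g" "!!x. x : sq z (r + 2*h) ==> J *v g x = E n x"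
   unfolding E_def
   by(rule mollified_stream_function[OF U(1) T(1) Ti o d(1), of "r + 2*h" "r + 3*h", rotated 3])
    (use h in auto)
  show ?thesis by(rule div_curl_estimate_smooth[OF U(1) G \<phi> h(1) I E[of n] w])
 qed
 have limh: "(%n. cls (mconv h (E n))) ----> cls (mconv h T)"
 proof (rule LIM_zero_cancel, rule Lim_null_comparison[of _ "%n. norm (cls (E n) - cls T)"])
  show "(%n. norm (cls (E n) - cls T)) ----> 0" by(intro tendsto_norm_zero LIM_zero lim)
  have "norm (cls (mconv h (E n)) - cls (mconv h T)) <= norm (cls (E n) - cls T)" for n
  proof -
   note s = cc_sqint[OF E[of n]] and i = cc_integrable[OF E[of n]]
   have "norm (cls (mconv h (%x. E n x - T x))) <= norm (cls (%x. E n x - T x))"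
    by(rule sqint_conv(2)[OF h(1)]) (use s i T(1) Ti in "auto intro: sqint_minus")
   thus ?thesis
    unfolding conv_diff[OF h(1) i Ti]
    by(simp add: cls_minus s T(1) sqint_conv(1)[OF h(1) s i] sqint_conv(1)[OF h(1) T(1) Ti])
  qed
  thus "\<forall>\<^sub>F n in sequentially. norm (cls (mconv h (E n)) - cls (mconv h T)) <= norm (cls (E n) - cls T)"
   by simp
 qed
 show ?thesis
 proof (rule LIMSEQ_le)
  show "(%n. abs (inner (smul \<phi> (cls (E n) - cls (mconv h (E n)))) G))
    ----> abs (inner (smul \<phi> (cls T - cls (mconv h T))) G)"
   by(intro tendsto_rabs tendsto_inner bounded_linear.tendsto[OF bl] tendsto_diff lim limh tendsto_const)
  show "(%n. B * norm G * sqrt (sq_const * (\<Sum>i\<in>I. (l1 (sq (c i) (2*h)) (E n))^2)))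
    ----> B * norm G * sqrt (sq_const * (\<Sum>i\<in>I. (l1 (sq (c i) (2*h)) T)^2))"
   by(intro tendsto_mult tendsto_real_sqrt tendsto_sum tendsto_power tendsto_const
     l1_tendsto[OF cc_sqint[OF E] T(1) lim compact_sq])
 qed (use ineq in blast)
qed

subsection \<open>The div-curl lemma\<close>

text \<open>The overlap constant is 5 times 5: in each direction at most five multiples of
  \<open>h\<close> lie within \<open>2 * h\<close> of a given number. Covering uses the grid point
  obtained by rounding both coordinates down.\<close>

lemma grid_cover:
 fixes z :: "real^2"
 assumes h: "h > 0" and r: "r = real N * h"
 defines "I \<equiv> {- int N..int N} \<times> {- int N..int N}"
  and "c \<equiv> %(i, j). z + pt (real_of_int i * h) (real_of_int j * h)"
 shows "finite I" "sq z r \<subseteq> (\<Union>i\<in>I. sq (c i) h)" "!!i. i : I ==> sq (c i) l \<subseteq> sq z (r + l)"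
  and "(\<Sum>i\<in>I. ind (sq (c i) (2*h)) x) <= (25::real)"
proof -
 show "finite I" by(simp add: I_def)
 have fl: "abs (t - real_of_int \<lfloor>t / h\<rfloor> * h) <= h" "- int N <= \<lfloor>t / h\<rfloor>" "\<lfloor>t / h\<rfloor> <= int N" if t: "abs t <= r" for t
 proof -
  have "t / h <= real_of_int \<lfloor>t / h\<rfloor> + 1" by linarith
  hence "(t / h) * h <= (real_of_int \<lfloor>t / h\<rfloor> + 1) * h" by(rule mult_right_mono) (use h in auto)
  moreover have "real_of_int \<lfloor>t / h\<rfloor> * h <= (t / h) * h" by(rule mult_right_mono) (use h in auto)
  ultimately have "real_of_int \<lfloor>t / h\<rfloor> * h <= t" "t <= real_of_int \<lfloor>t / h\<rfloor> * h + h"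
   using h by(simp_all add: distrib_right)
  thus "abs (t - real_of_int \<lfloor>t / h\<rfloor> * h) <= h" using h by linarith
  have "- real N <= t / h" "t / h <= real N" using t h r by(auto simp: field_simps abs_le_iff)
  thus "- int N <= \<lfloor>t / h\<rfloor>" "\<lfloor>t / h\<rfloor> <= int N" by linarith+
 qed
 show "sq z r \<subseteq> (\<Union>i\<in>I. sq (c i) h)"
 proof
  fix x assume "x : sq z r"
  hence x: "abs (x $ 1 - z $ 1) <= r" "abs (x $ 2 - z $ 2) <= r" by(auto simp: sq_def)
  show "x : (\<Union>i\<in>I. sq (c i) h)"
   by(rule UN_I[of "(\<lfloor>(x $ 1 - z $ 1) / h\<rfloor>, \<lfloor>(x $ 2 - z $ 2) / h\<rfloor>)"])
    (use fl[OF x(1)] fl[OF x(2)] in "auto simp: I_def c_def sq_def algebra_simps")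
 qed
 show "sq (c i) l \<subseteq> sq z (r + l)" if iI: "i : I" for i
 proof
  fix x assume x: "x : sq (c i) l"
  obtain a b where ab: "i = (a, b)" "abs (real_of_int a) <= real N" "abs (real_of_int b) <= real N"
   using iI by(cases i) (auto simp: I_def abs_le_iff)
  hence "abs (real_of_int a * h) <= r" "abs (real_of_int b * h) <= r" using h r by(auto simp: abs_mult)
  thus "x : sq z (r + l)" using x ab(1) by(auto simp: sq_def c_def abs_le_iff)
 qed
 have card: "finite {i::int. abs (t - real_of_int i * h) <= 2*h}" "card {i::int. abs (t - real_of_int i * h) <= 2*h} <= 5" for t
 proof -
  have sub: "{i::int. abs (t - real_of_int i * h) <= 2*h} \<subseteq> {\<lceil>t / h\<rceil> - 2..\<lceil>t / h\<rceil> + 2}"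
  proof
   fix i :: int assume "i : {i::int. abs (t - real_of_int i * h) <= 2*h}"
   hence "t - 2*h <= real_of_int i * h" "real_of_int i * h <= t + 2*h" by(auto simp: abs_le_iff)
   hence "t / h - 2 <= real_of_int i" "real_of_int i <= t / h + 2" using h by(simp_all add: field_simps)
   thus "i : {\<lceil>t / h\<rceil> - 2..\<lceil>t / h\<rceil> + 2}" by(simp, linarith)
  qed
  thus "finite {i::int. abs (t - real_of_int i * h) <= 2*h}" by(rule finite_subset) simp
  show "card {i::int. abs (t - real_of_int i * h) <= 2*h} <= 5"
   using card_mono[OF _ sub] by simp
 qed
 define A where "A = {i::int. abs ((x $ 1 - z $ 1) - real_of_int i * h) <= 2*h}"
 define B where "B = {i::int. abs ((x $ 2 - z $ 2) - real_of_int i * h) <= 2*h}"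
 have "(\<Sum>i\<in>I. ind (sq (c i) (2*h)) x) = real (card {i : I. x : sq (c i) (2*h)})"
  using \<open>finite I\<close> by(simp add: indicator_def sum.If_cases Int_def)
 also have "... <= real (card (A \<times> B))"
 proof (intro of_nat_mono card_mono finite_cartesian_product)
  show "finite A" "finite B" unfolding A_def B_def by(rule card(1))+
 qed (auto simp: A_def B_def c_def sq_def algebra_simps)
 also have "... <= real (5 * 5)"
  unfolding card_cartesian_product A_def B_def by(intro of_nat_mono mult_mono card) auto
 finally show "(\<Sum>i\<in>I. ind (sq (c i) (2*h)) x) <= (25::real)" by simp
qed

text \<open>At a fixed point and scale, mollification is a pairing with a fixed continuous field.
  Convergence against \<open>fields U\<close> therefore gives pointwise convergence of the mollified
  fields.\<close>

lemma inner_moll_field: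
 assumes U: "open U" and d: "d > 0" "cball x d \<subseteq> U" and T: "sqint T" "L1 T"
 shows "cc U (%y. moll d (x - y) *R v)"
  "mconv d T x *. v = inner (cls T) (cls (%y. moll d (x - y) *R v))"
proof -
 let ?g = "%y. moll d (x - y) *R v"
 show c: "cc U ?g"
 proof (rule ccI[of _ "cball x d"])
  show "continuous_on UNIV ?g"
   by(intro continuous_intros continuous_on_compose2[OF Ck_continuous[OF Ck_moll]]) auto
  show "moll d (x - y) *R v = 0" if "y ~: cball x d" for y
   using moll_eq_0[OF d(1), of "x - y"] that by(simp add: dist_norm norm_minus_commute)
 qed (use d in auto)
 have "mconv d T x *. v = (LI y. (moll d (x - y) *R T y) *. v)"
  unfolding conv_def by(rule integral_inner_left[symmetric]) (rule conv_integrable[OF cc_moll[OF d(1)] T(2)])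
 also have "... = inner (cls T) (cls ?g)"
  by(simp add: inner_cls[OF T(1) cc_sqint[OF c]])
 finally show "mconv d T x *. v = inner (cls T) (cls ?g)" .
qed

text \<open>For fixed \<open>h\<close> the mollified fields tend to zero pointwise, as pairings with
  fixed fields, and are bounded on \<open>sq z r\<close> through their L^1 norms; after
  multiplication by \<phi> they tend to zero in L^2. What remains is the error of mollification,
  controlled by \<open>div_curl_estimate\<close>.\<close>

theorem div_curl_null:
 fixes \<theta> G :: "nat => l2" and b e :: "nat => real^2 => real"
 assumes U: "open U" "bounded U"
  and \<theta>: "!!n. \<theta> n : supported U" "!!n g. g : gradients U ==> inner (\<theta> n) g = 0"
  and G: "!!n g. g : gradients U ==> inner (G n) (rot g) = 0" "!!n. norm (G n) <= K"
  and be: "!!n x. 0 <= b n x" "!!n x. 0 <= e n x"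
   "!!n. L1 (%x. ind U x * b n x)" "!!n. L1 (%x. ind U x * e n x)"
   "!!n. (LI x. ind U x * b n x) <= K" "!!n. (LI x. ind U x * e n x) <= K"
   "!!n. AE x\<in>U in lborel. (norm (rep (\<theta> n) x))^2 <= b n x * e n x"
  and bw: "!!\<psi>. cc U \<psi> ==> (!!x. 0 <= \<psi> x) ==>
   EX L. (%n. LI x. \<psi> x * b n x) ----> L & L <= K * (LI x. \<psi> x)"
  and \<theta>w: "!!v. v : fields U ==> (%n. inner (\<theta> n) v) ----> 0"
  and \<phi>: "c1c U \<phi> \<phi>'" "!!x. x ~: sq z r ==> \<phi> x = 0" "0 < r" "r < s" "sq z s \<subseteq> U"
 shows "(%n. inner (smul \<phi> (\<theta> n)) (G n)) ----> 0"
proof -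
 have bU[measurable]: "U : sets borel" using U by simp
 have K0: "K >= 0" using G(2)[of 0] norm_ge_zero order_trans by blast
 obtain B where B: "B > 0" "!!x. norm (\<phi>' x) <= B" using cc_bounded[OF c1c_D(2)[OF \<phi>(1)]] by blast
 obtain Bp where Bp: "Bp > 0" "!!x. norm (\<phi> x) <= Bp" using cc_bounded[OF c1c_D(1)[OF \<phi>(1)]] by blast
 have \<phi>m[measurable]: "\<phi> : borel_fun" using c1c_D(1)[OF \<phi>(1)] by(rule cc_measurable)
 note bf = bounded_field_scalar[OF \<phi>m, of Bp, OF Bp(2)[unfolded real_norm_def]]
 interpret \<phi>: bounded_linear "smul \<phi>" by(rule bounded_linear_mul[OF bf])
 define T where "T n x = ind U x *R rep (\<theta> n) x" for n x
 have T0: "T n x = 0" if "x ~: U" for n x using that by(simp add: T_def)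
 have Tm: "T n : borel_fun" for n unfolding T_def by measurable
 have Ts: "sqint (T n)" for n
  by(rule sqint_bound[OF _ sqint_integrable[OF sqint_rep[of "\<theta> n"]]]) (use Tm in "auto simp: T_def indicator_def")
 have Ti: "L1 (T n)" for n by(rule sqint_bounded_support_integrable[OF Ts U(2) T0])
 have \<theta>T: "\<theta> n = cls (T n)" for n
 proof (rule l2_eqI)
  have "AEl x. x ~: U --> rep (\<theta> n) x = 0" using \<theta>(1) by(simp add: supported_def)
  thus "AEl x. rep (\<theta> n) x = rep (cls (T n)) x"
   using rep_cls[OF Ts[of n]] by eventually_elim (auto simp: T_def indicator_def)
 qed
 have l1sq: "(l1 S (T n))^2 <= (LI x. ind S x * b n x) * (LI x. ind S x * e n x)"
  and iSb: "L1 (%x. ind S x * b n x)" and iSe: "L1 (%x. ind S x * e n x)"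
  if S: "compact S" "S \<subseteq> U" for S n
 proof -
  have [measurable]: "S : sets borel" using S by(simp add: borel_compact)
  have R: "L1 (%x. ind S x * f x)" if "L1 (%x. ind U x * f x)" for f :: "real^2 => real"
  proof -
   have "(%x. ind S x * f x) = (%x. ind S x * (ind U x * f x))"
    using S(2) by(auto simp: indicator_def fun_eq_iff)
   moreover have "L1 (%x. ind S x * (ind U x * f x))"
    using integrable_mult_indicator[of S lborel "%x. ind U x * f x"] that by simp
   ultimately show ?thesis by simp
  qed
  show ib: "L1 (%x. ind S x * b n x)" and ie: "L1 (%x. ind S x * e n x)"
   by(intro R be)+
  show "(l1 S (T n))^2 <= (LI x. ind S x * b n x) * (LI x. ind S x * e n x)"
   unfolding l1_def
  proof (rule Cauchy_Schwarz_integral[OF ib _ ie _ l1_nn_integral(1)[OF Ts S(1)]])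
   show "AEl x. (ind S x * norm (T n x))^2 <= (ind S x * b n x) * (ind S x * e n x)"
    using be(7)[of n] by eventually_elim (use S(2) in "auto simp: indicator_def T_def")
  qed (use be in auto)
 qed
 have l1b: "l1 S (T n) <= K" if S: "compact S" "S \<subseteq> U" for S n
 proof -
  have "(LI x. ind S x * f x) <= (LI x. ind U x * f x)"
   if "L1 (%x. ind S x * f x)" "L1 (%x. ind U x * f x)" "!!x. 0 <= f x" for f :: "real^2 => real"
   by(rule integral_mono[OF that(1,2)]) (use that(3) S(2) in "auto simp: indicator_def")
  from this[OF iSb[OF S] be(3) be(1)] this[OF iSe[OF S] be(4) be(2)]
  have "(LI x. ind S x * b n x) <= K" "(LI x. ind S x * e n x) <= K"
   using be(5,6)[of n] by(auto intro: order_trans)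
  moreover have "0 <= (LI x. ind S x * e n x)"
   by(rule Lint_nonneg) (use be(2) in auto)
  ultimately have "(LI x. ind S x * b n x) * (LI x. ind S x * e n x) <= K * K"
   using K0 by(intro mult_mono) auto
  with l1sq[OF S] have "(l1 S (T n))^2 <= K * K" by(rule order_trans)
  thus ?thesis using K0 by(metis power2_eq_square power2_le_imp_le)
 qed
 have main: "\<forall>\<^sub>F n in sequentially. abs (inner (smul \<phi> (\<theta> n)) (G n)) < \<epsilon>" if eps: "\<epsilon> > 0" for \<epsilon>
 proof -
  \<comment> \<open>\<open>36 * h^2\<close> is the area of the square of half-side
    \<open>3 * h\<close>, which carries the cutoff below, and the \<open>+ 1\<close> leaves room for
    a strict inequality in the limit. \<open>25 * K\<close> bounds the sum of the energies by
    bounded overlap.\<close>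
  define C where "C = B * K * sqrt (sq_const * ((36 * K + 1) * (25 * K)))"
  \<comment> \<open>The three lower bounds ensure that \<open>N\<close> is positive, that the margin
    \<open>4 * h\<close> fits inside \<open>s\<close>, and that
    \<open>C * h < \<epsilon> / 2\<close>. Since \<open>h = r / N\<close>, the grid fits the square
    exactly.\<close>
  obtain N where N: "real N > max 1 (max (4 * r / (s - r)) (2 * r * C / \<epsilon>))" using reals_Archimedean2 by blast
  define h where "h = r / real N"
  have Np: "real N > 0" using N by linarith
  have h: "h > 0" "r = real N * h" using Np \<phi>(3) by(auto simp: h_def)
  have h4: "r + 4*h <= s"
  proof -
   have "4 * r / (s - r) < real N" using N by linarith
   hence "4 * r < real N * (s - r)" using \<phi>(4) by(simp add: pos_divide_less_eq)
   hence "4 * h < s - r" unfolding h_def using Np by(simp add: field_simps)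
   thus ?thesis by simp
  qed
  have hC: "C * h < \<epsilon> / 2"
  proof -
   have "2 * r * C / \<epsilon> < real N" using N by linarith
   thus ?thesis using eps Np by(simp add: h_def field_simps)
  qed
  define I where "I = {- int N..int N} \<times> {- int N..int N}"
  define c where "c = (%(i, j). z + pt (real_of_int i * h) (real_of_int j * h))"
  note gc = grid_cover(1)[OF h, folded I_def] grid_cover(2-4)[where z=z, OF h, folded I_def c_def]
  have sU: "sq z (r + l) \<subseteq> U" if "l <= 4*h" for l
   using \<phi>(5) sq_mono[of "r + l" s z] h4 that by auto
  have S3: "sq (c i) l \<subseteq> U" if "i : I" "l <= 4*h" for i l
   using gc(3)[OF that(1), of l] sU[OF that(2)] by blast
  let ?Q = "%i. sq (c i) (2*h)" and ?m = "%n. mconv h (T n)" and ?k = "(36 * K + 1) * h^2"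
  let ?b = "%i n. LI x. ind (?Q i) x * b n x" and ?e = "%i n. LI x. ind (?Q i) x * e n x"
  let ?Z = "%n. smul \<phi> (cls (?m n))" and ?f = "%n x. \<phi> x *R ?m n x"
  have small: "\<forall>\<^sub>F n in sequentially. ?b i n <= ?k" if i: "i : I" for i
  proof -
   \<comment> \<open>The mass of \<open>b n\<close> on the doubled square is dominated by a cutoff
     supported in a slightly larger one, because weak convergence controls only continuous test
     functions.\<close>
   define V where "V = {x::real^2. abs (x $ 1 - c i $ 1) < 3*h & abs (x $ 2 - c i $ 2) < 3*h}"
   have V: "open V" "?Q i \<subseteq> V" "V \<subseteq> sq (c i) (3*h)"
    using h(1) unfolding V_def by(auto simp: convex_open_square sq_def)
   obtain \<psi> where \<psi>: "\<psi> : TF V" "!!x. 0 <= \<psi> x & \<psi> x <= (1::real)" "!!x. x : ?Q i ==> \<psi> x = 1"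
    using cutoff_exists[OF compact_sq V(2,1)] by metis
   have cV: "cc V \<psi>" by(rule c1c_D(1)[OF test_function_c1c[OF \<psi>(1)]])
   have cU: "cc U \<psi>" using V(3) S3[OF i, of "3*h"] h(1) by(intro cc_mono[OF cV]) auto
   have [measurable]: "\<psi> : borel_fun" using cU by(rule cc_measurable)
   obtain L where L: "(%n. LI x. \<psi> x * b n x) ----> L" "L <= K * (LI x. \<psi> x)"
    using bw[OF cU] \<psi>(2) by blast
   have fin: "emeasure lborel (sq (c i) (3*h)) < \<infinity>" by(rule emeasure_compact_finite[OF compact_sq])
   have "(LI x. \<psi> x) <= (LI x. ind (sq (c i) (3*h)) x)"
   proof (rule integral_mono[OF cc_integrable[OF cU]])
    show "L1 (%x. ind (sq (c i) (3*h)) x :: real)" using fin by(intro integrable_real_indicator) auto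
    show "\<psi> x <= ind (sq (c i) (3*h)) x" for x
     using \<psi>(2)[of x] cc_eq_0[OF cV, of x] V(3) by(cases "x : V") (auto simp: indicator_def)
   qed
   also have "... = 36 * h^2"
    using emeasure_sq[of "3*h" "c i"] h(1) by(simp add: measure_def power_mult_distrib)
   finally have "K * (LI x. \<psi> x) <= K * (36 * h^2)" using K0 by(rule mult_left_mono)
   hence "L < ?k" using L(2) h(1) by(simp add: algebra_simps) (smt (verit) zero_less_power)
   hence "\<forall>\<^sub>F n in sequentially. (LI x. \<psi> x * b n x) < ?k"
    using L(1) by(intro order_tendstoD(2)) auto
   thus ?thesis
   proof (rule eventually_mono)
    fix n assume n: "(LI x. \<psi> x * b n x) < ?k"
    have "?b i n <= (LI x. \<psi> x * b n x)"
    proof (rule integral_mono)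
     show "L1 (%x. ind (?Q i) x * b n x)"
     by(rule iSb[OF compact_sq S3[OF i]]) (use h in auto)
     have "L1 (%x. \<psi> x * (ind U x * b n x))"
     by(rule L1_bound[OF be(3)[of n]])
     (use \<psi>(2) be(1) be(3)[of n] in "auto simp: abs_mult indicator_def mult_left_le_one_le")
     moreover have "(%x. \<psi> x * (ind U x * b n x)) = (%x. \<psi> x * b n x)"
     using cc_eq_0[OF cU] by(force simp: indicator_def)
     ultimately show "L1 (%x. \<psi> x * b n x)" by simp
     show "ind (?Q i) x * b n x <= \<psi> x * b n x" for x
     using \<psi>(2,3)[of x] be(1)[of n x] by(auto simp: indicator_def)
    qed
    thus "?b i n <= ?k" using n by simp
   qed
  qed
  \<comment> \<open>For fixed \<open>h\<close> there are finitely many squares, hence a common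
    threshold in \<open>n\<close>.\<close>
  have ev1: "\<forall>\<^sub>F n in sequentially. ALL i:I. ?b i n <= ?k"
   using small gc(1) by(simp add: eventually_ball_finite)
  have est: "abs (inner (smul \<phi> (cls (T n) - cls (?m n))) (G n)) <= C * h"
   if n: "ALL i:I. ?b i n <= ?k" for n
  proof -
   have ie: "L1 (%x. ind (?Q i) x * e n x)" if "i : I" for i
    by(rule iSe[OF compact_sq S3[OF that]]) (use h in auto)
   have "(\<Sum>i\<in>I. (l1 (?Q i) (T n))^2) <= (\<Sum>i\<in>I. ?k * ?e i n)"
   proof (rule sum_mono)
    fix i assume i: "i : I"
    have "(l1 (?Q i) (T n))^2 <= ?b i n * ?e i n"
     by(rule l1sq[OF compact_sq S3[OF i]]) (use h in auto)
    also have "... <= ?k * ?e i n"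
     using n i be(2) by(intro mult_right_mono Lint_nonneg) auto
    finally show "(l1 (?Q i) (T n))^2 <= ?k * ?e i n" .
   qed
   also have "... = ?k * (LI x. (\<Sum>i\<in>I. ind (?Q i) x * e n x))"
    using ie by(subst Bochner_Integration.integral_sum) (auto simp: sum_distrib_left)
   also have "... <= ?k * (LI x. 25 * (ind U x * e n x))"
   proof (intro mult_left_mono integral_mono)
    show "L1 (%x. \<Sum>i\<in>I. ind (?Q i) x * e n x)" using ie by(intro Bochner_Integration.integrable_sum) auto
    show "L1 (%x. 25 * (ind U x * e n x))" using be(4) by simp
    fix x
    show "(\<Sum>i\<in>I. ind (?Q i) x * e n x) <= 25 * (ind U x * e n x)"
    proof (cases "x : U")
     case True
     have "(\<Sum>i\<in>I. ind (?Q i) x) * e n x <= 25 * e n x"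
     by(rule mult_right_mono[OF gc(4) be(2)])
     thus ?thesis using True by(simp add: sum_distrib_right)
    next
     case False
     hence "ind (?Q i) x * e n x = 0" if "i : I" for i
     using S3[OF that, of "2*h"] h(1) by(auto simp: indicator_def)
     hence "(\<Sum>i\<in>I. ind (?Q i) x * e n x) = 0" by(intro sum.neutral) blast
     thus ?thesis using False by simp
    qed
   qed (use K0 in auto)
   also have "... <= ?k * (25 * K)"
    using be(6)[of n] K0 by(intro mult_left_mono) auto
   finally have sm: "(\<Sum>i\<in>I. (l1 (?Q i) (T n))^2) <= ?k * (25 * K)" .
   have "abs (inner (smul \<phi> (cls (T n) - cls (?m n))) (G n))
     <= B * norm (G n) * sqrt (sq_const * (\<Sum>i\<in>I. (l1 (?Q i) (T n))^2))"
    by(rule div_curl_estimate[OF U Ts T0 _ G(1) \<phi>(1,2) B(2) h(1) _ sU gc(1,2,3)])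
     (use \<theta>(2) \<theta>T \<phi>(3) in auto)
   also have "... <= B * K * sqrt (sq_const * (?k * (25 * K)))"
    using sm G(2)[of n] B(1) K0 by(intro mult_mono real_sqrt_le_mono mult_left_mono) (auto intro!: sum_nonneg mult_nonneg_nonneg)
   also have "... = C * sqrt (h^2)"
   proof -
    have "sq_const * (?k * (25 * K)) = (sq_const * ((36 * K + 1) * (25 * K))) * h^2"
     by(simp only: mult_ac)
    thus ?thesis unfolding C_def by(simp only: real_sqrt_mult mult.assoc)
   qed
   finally show ?thesis using h(1) by simp
  qed
  have conv0: "(%n. norm (?Z n)) ----> 0"
  proof -
   define Cm where "Cm = 4 * exp (8/7) / h^2"
   have cm: "?m n : borel_fun" for n by(rule conv_measurable[OF h(1) Ti])
   note [measurable] = cm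
   have cs: "sqint (?m n)" for n by(rule sqint_conv(1)[OF h(1) Ts Ti])
   have s1: "cball x h \<subseteq> sq z (r + h)" if "x : sq z r" for x
    using cball_sq[of x h] sq_trans[OF that, of _ h] by blast
   have ptw: "(%n. ?m n x) ----> 0" if x: "x : sq z r" for x
   proof (rule vec_tendstoI)
    fix i
    have xU: "cball x h \<subseteq> U" using s1[OF x] sU[of h] h(1) by auto
    have "(%n. inner (\<theta> n) (cls (%y. moll h (x - y) *R axis i 1))) ----> 0"
     using inner_moll_field(1)[OF U(1) h(1) xU Ts Ti] by(intro \<theta>w) (auto simp: fields_def)
    thus "(%n. ?m n x $ i) ----> 0 $ i"
     using inner_moll_field(2)[OF U(1) h(1) xU Ts Ti, of _ "axis i 1"] by(simp add: \<theta>T inner_axis)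
   qed
   have bd: "norm (?m n x) <= Cm * K" if x: "x : sq z r" for n x
   proof -
    have S: "sq z (r + h) \<subseteq> U" using sU[of h] h(1) by simp
    have "norm (?m n x) <= (LI y. Cm * (ind (sq z (r + h)) y * norm (T n y)))"
     unfolding conv_def
    proof (rule Lint_norm_bound)
     show "L1 (%y. Cm * (ind (sq z (r + h)) y * norm (T n y)))"
     using l1_nn_integral(1)[OF Ts compact_sq] by simp
     show "norm (moll h (x - y) *R T n y) <= Cm * (ind (sq z (r + h)) y * norm (T n y))" for y
     proof (cases "y : cball x h")
     case True
     hence "y : sq z (r + h)" using s1[OF x] by blast
     moreover have "moll h (x - y) <= Cm" unfolding Cm_def by(rule moll_le[OF h(1)])
     ultimately show ?thesis using moll_nonneg[OF h(1), of "x - y"] by(simp add: mult_right_mono)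
     next
     case False
     hence "moll h (x - y) = 0" by(intro moll_eq_0[OF h(1)]) (simp add: dist_norm norm_minus_commute)
     thus ?thesis by(simp add: Cm_def)
     qed
    qed (rule conv_integrable[OF cc_moll[OF h(1)] Ti])
    also have "... = Cm * l1 (sq z (r + h)) (T n)" by(simp add: l1_def)
    also have "... <= Cm * K" by(intro mult_left_mono l1b[OF compact_sq S]) (simp add: Cm_def)
    finally show ?thesis .
   qed
   have eq: "(norm (?Z n))^2 = (LI x. (norm (?f n x))^2)" for n
    using mul_cls[OF bf cs[of n]] norm_cls[OF sqint_mul[OF bf cs[of n]]] by(simp add: scaleR_matrix_vector_assoc[symmetric])
   have "(%n. LI x. (norm (?f n x))^2) ----> (LINT x::real^2|lborel. 0)"
   proof (rule integral_dominated_convergence)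
    show "L1 (%x. (Bp * (Cm * K))^2 * ind (sq z r) x)"
     using emeasure_compact_finite[OF compact_sq, of z r] by(intro integrable_mult_right integrable_real_indicator) auto
    show "AEl x. (%n. (norm (?f n x))^2) ----> 0"
    proof (rule AE_I2)
     fix x
     show "(%n. (norm (?f n x))^2) ----> 0"
     proof (cases "x : sq z r")
     case True
     have "(%n. (norm (?f n x))^2) ----> (norm (\<phi> x *R (0::real^2)))^2"
     by(intro tendsto_intros ptw[OF True])
     thus ?thesis by simp
     qed (simp add: \<phi>(2))
    qed
    show "AEl x. norm ((norm (?f n x))^2) <= (Bp * (Cm * K))^2 * ind (sq z r) x" for n
    proof (rule AE_I2)
     fix x
     show "norm ((norm (?f n x))^2) <= (Bp * (Cm * K))^2 * ind (sq z r) x"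
     proof (cases "x : sq z r")
     case True
     have "norm (?f n x) <= Bp * (Cm * K)"
     unfolding norm_scaleR using Bp bd[OF True, of n] by(intro mult_mono) auto
     thus ?thesis using True by(auto intro: power_mono)
     qed (simp add: \<phi>(2))
    qed
   qed (use cm in measurable)
   hence "(%n. (norm (?Z n))^2) ----> 0" by(simp add: eq)
   hence "(%n. sqrt ((norm (?Z n))^2)) ----> sqrt 0" by(rule tendsto_real_sqrt)
   thus ?thesis by simp
  qed
  have "(%n. norm (?Z n) * K) ----> 0"
   using tendsto_mult_right[OF conv0, of K] by simp
  hence ev2: "\<forall>\<^sub>F n in sequentially. norm (?Z n) * K < \<epsilon> / 2"
   using eps by(intro order_tendstoD(2)) auto
  show ?thesis
   using ev1 ev2
  proof eventually_elim
   case (elim n)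
   have "inner (smul \<phi> (\<theta> n)) (G n) = inner (smul \<phi> (cls (T n) - cls (?m n))) (G n)
     + inner (?Z n) (G n)"
    by(simp add: \<theta>T \<phi>.diff inner_diff_left)
   also have "abs ... <= C * h + norm (?Z n) * K"
    using est[OF elim(1)] Cauchy_Schwarz_ineq2[of "?Z n" "G n"]
     mult_left_mono[OF G(2)[of n] norm_ge_zero[of "?Z n"]] by linarith
   finally show ?case using hC elim(2) by linarith
  qed
 qed
 show ?thesis
  by(rule tendstoI) (use main in "simp add: dist_real_def")
qed

section \<open>Weak compactness of potentials and fluxes\<close>

lemma diagonal_convergent_subsequence:
 fixes s :: "'i => nat => real"
 assumes "countable I" "!!i. i : I ==> bounded (range (s i))"
 obtains r :: "nat => nat" where "strict_mono r" "!!i. i : I ==> convergent (%n. s i (r n))"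
proof (cases "I = {}")
 case True thus thesis by(intro that[of id]) (auto simp: strict_mono_def)
next
 case False
 define e where "e = from_nat_into I"
 have e: "range e = I" unfolding e_def using assms(1) False by(simp add: range_from_nat_into)
 define P where "P i r \<longleftrightarrow> convergent (%n. s (e i) (r n))" for i and r :: "nat => nat"
 have Pe: "P i r \<longleftrightarrow> convergent (%n. s (e i) (r n))" for i and r :: "nat => nat"
  by(simp add: P_def)
 interpret subseqs P
 proof
  fix i and r :: "nat => nat" assume "strict_mono r"
  have "bounded (range (s (e i)))" using assms(2) e by blast
  hence "bounded (range (%n. s (e i) (r n)))" by(rule bounded_subset) auto
  then obtain l r' where "strict_mono r'" "((%n. s (e i) (r n)) \<circ> r') ----> l"
   using bounded_imp_convergent_subsequence by blast
  thus "EX r'. strict_mono r' & P i (r \<circ> r')"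
   unfolding P_def by(auto simp: o_def convergent_def)
 qed
 have "P i diagseq" for i
 proof -
  have "P i (diagseq \<circ> (+) (Suc i))"
  proof (rule diagseq_holds)
   fix r r' :: "nat => nat" and n assume "strict_mono r'" "P n r"
   thus "P n (r \<circ> r')" unfolding Pe
    using convergent_subseq_convergent[of "%k. s (e n) (r k)" r'] by(simp add: o_def)
  qed
  hence "convergent (%n. s (e i) (diagseq (n + Suc i)))" unfolding Pe by(simp add: add.commute)
  thus ?thesis unfolding Pe by(rule convergent_ignore_initial_segment[THEN iffD1])
 qed
 hence "convergent (%n. s i (diagseq n))" if "i : I" for i
  using that e unfolding Pe by blast
 thus thesis by(rule that[OF subseq_diagseq])
qed

section \<open>A countable family of fields with dense span\<close>

definition trunc :: "(real^2) set => (real^2 => real^2) => l2" where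
 "trunc U f = cls (%x. ind U x *R f x)"

text \<open>An arbitrary countable dense subset of L^2 would not do, since the flux bounds are only
  in L^1. Restrictions of polynomials are bounded, and by Weierstrass they approximate continuous
  fields uniformly on \<open>U\<close>.\<close>

definition monomials :: "(real^2) set => l2 set" where
 "monomials U = (\<Union>m n i. {trunc U (%x. (x $ 1 ^ m * x $ 2 ^ n) *R axis i 1)})"

lemma countable_monomials: "countable (monomials U)"
 unfolding monomials_def by(intro countable_UN countable_insert) auto

lemma sqint_trunc:
 assumes U: "open U" "bounded U" and f: "continuous_on UNIV f"
 shows "sqint (%x. ind U x *R f x)"
proof -
 have [measurable]: "f : borel_fun" "U : sets borel"
  using f U(1) by(auto intro: borel_measurable_continuous_onI)
 obtain R where R: "!!x. x : U ==> norm x <= R" using U(2) unfolding bounded_iff by blast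
 have "compact (f ` cball 0 R)" using f by(intro compact_continuous_image) (auto intro: continuous_on_subset)
 then obtain B where B: "!!x. x : cball 0 R ==> norm (f x) <= B"
  using compact_imp_bounded[of "f ` cball 0 R"] unfolding bounded_iff by blast
 show ?thesis
  by(rule sqint_bound[OF _ integrable_indicator_cball[of "B^2" R]])
   (use R B in "auto simp: indicator_def intro: power_mono")
qed

lemma polynomial_in_span_monomials:
 assumes U: "open U" "bounded U" and q: "real_polynomial_function q"
 shows "trunc U (%x. q x *R axis i 1) : span (monomials U)"
proof -
 define P where "P w m n i x = (w x * (x $ 1 ^ m * x $ 2 ^ n)) *R (axis i 1 :: real^2)" for w :: "real^2 => real" and m n i x
 define good where "good w \<longleftrightarrow> continuous_on UNIV w & (ALL m n i. trunc U (P w m n i) : span (monomials U))" for w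
 have lin: "good (%x. a * v x + b * w x)" if g: "good v" "good w" for a b v w
  unfolding good_def
 proof (intro conjI allI)
  fix m n i
  have s: "sqint (%x. ind U x *R P u m n i x)" if "good u" for u
   by(rule sqint_trunc[OF U]) (use that in "auto simp: good_def P_def intro!: continuous_intros")
  have "trunc U (P (%x. a * v x + b * w x) m n i) = a *R trunc U (P v m n i) + b *R trunc U (P w m n i)"
   unfolding trunc_def cls_scaleR[OF s[OF g(1)]] cls_scaleR[OF s[OF g(2)]]
    cls_add[OF sqint_scaleR[OF s[OF g(1)]] sqint_scaleR[OF s[OF g(2)]]]
   by(rule arg_cong[of _ _ cls]) (simp add: P_def fun_eq_iff algebra_simps scaleR_add_left)
  thus "trunc U (P (%x. a * v x + b * w x) m n i) : span (monomials U)"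
   using g by(simp add: good_def span_add span_scale)
 qed (use g in "auto simp: good_def intro!: continuous_intros")
 have shift: "good (%x. x $ 1 * w x)" "good (%x. x $ 2 * w x)" if "good w" for w
 proof -
  have "P (%x. x $ 1 * w x) m n i = P w (Suc m) n i" "P (%x. x $ 2 * w x) m n i = P w m (Suc n) i" for m n i
   by(auto simp: P_def mult_ac)
  thus "good (%x. x $ 1 * w x)" "good (%x. x $ 2 * w x)"
   using that unfolding good_def by(auto intro!: continuous_intros)
 qed
 \<comment> \<open>The induction proves that multiplication by \<open>q\<close> preserves
   \<open>good\<close>; a product of polynomials is then the composition of two such
   multiplications.\<close>
 have "good w ==> good (%x. q x * w x)" for w
  using q
 proof (induction q arbitrary: w rule: real_polynomial_function.induct)
  case (linear f)
  have "f x * w x = f (axis 1 1) * (x $ 1 * w x) + f (axis 2 1) * (x $ 2 * w x)" for x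
  proof -
   have x: "x = x $ 1 *R axis 1 1 + x $ 2 *R axis 2 1" by(simp add: vec_eq_iff axis_def forall_2)
   have "f x = x $ 1 * f (axis 1 1) + x $ 2 * f (axis 2 1)"
    by(subst x) (simp add: linear_simps[OF linear(1)])
   thus ?thesis by(simp add: algebra_simps)
  qed
  thus ?case using lin[OF shift(1,2)[OF linear(2)]] by presburger
 next
  case (const c) thus ?case using lin[of w w c 0] by simp
 next
  case (add f g)
  thus ?case using lin[OF add.IH(1,2)[OF add.prems], of 1 1] by(simp add: algebra_simps)
 next
  case (mult f g)
  thus ?case using mult.IH(1)[OF mult.IH(2)[OF mult.prems]] by(simp add: mult.assoc)
 qed
 moreover have "P (%x. 1) m n i = (%x. (x $ 1 ^ m * x $ 2 ^ n) *R axis i 1)" for m n i by(simp add: P_def fun_eq_iff)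
 hence "good (%x. 1)" unfolding good_def by(auto intro!: span_base simp: monomials_def)
 ultimately have "good q" by fastforce
 moreover have "P q 0 0 i = (%x. q x *R axis i 1)" by(simp add: P_def fun_eq_iff)
 ultimately show ?thesis unfolding good_def by metis
qed

lemma uniform_approximation:
 fixes f :: "real^2 => real^2"
 assumes U: "open U" "bounded U" and f: "continuous_on UNIV f" and e: "e > 0"
 obtains q where "continuous_on UNIV q" "trunc U q : span (monomials U)" "!!x. x : U ==> norm (f x - q x) < e"
proof -
 have "compact (closure U)" using U(2) by(simp add: compact_closure)
 then obtain q where q: "polynomial_function q" "!!x. x : closure U ==> norm (f x - q x) < e"
  using Stone_Weierstrass_polynomial_function[of "closure U" f e] f e by(auto intro: continuous_on_subset)
 have p: "real_polynomial_function (%x. q x $ i)" for i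
 proof -
  have "bounded_linear (%v::real^2. v $ i)" by(rule bounded_linear_vec_nth)
  thus ?thesis using q(1) unfolding polynomial_function_def o_def by blast
 qed
 have cq: "continuous_on UNIV q" by(rule continuous_on_polymonial_function[OF q(1)])
 have qe: "q x = q x $ 1 *R axis 1 1 + q x $ 2 *R axis 2 1" for x
  by(simp add: vec_eq_iff axis_def forall_2)
 have c: "continuous_on UNIV (%x. q x $ i *R axis i 1 :: real^2)" for i
  using cq by(intro continuous_intros)
 have "(%x. ind U x *R q x) = (%x. ind U x *R (q x $ 1 *R axis 1 1) + ind U x *R (q x $ 2 *R axis 2 1))"
  unfolding scaleR_add_right[symmetric] using qe by simp
 hence "trunc U q = trunc U (%x. q x $ 1 *R axis 1 1) + trunc U (%x. q x $ 2 *R axis 2 1)"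
  unfolding trunc_def cls_add[OF sqint_trunc[OF U c] sqint_trunc[OF U c]] by simp
 hence "trunc U q : span (monomials U)"
  using polynomial_in_span_monomials[OF U p] by(simp add: span_add)
 with cq show thesis using q(2) closure_subset by(intro that) auto
qed

lemma trunc_supported: "open U ==> bounded U ==> continuous_on UNIV f ==> trunc U f : supported U"
 unfolding trunc_def by(rule supported_cls[OF sqint_trunc]) auto

lemma trunc_cc: assumes "cc U h" shows "trunc U h = cls h"
proof -
 have "(%x. ind U x *R h x) = h" using cc_eq_0[OF assms] by(auto simp: indicator_def fun_eq_iff)
 thus ?thesis by(simp add: trunc_def)
qed

lemma trunc_diff_bound:
 assumes U: "open U" "bounded U" and f: "continuous_on UNIV f" "continuous_on UNIV q"
  and e: "e >= 0" "!!x. x : U ==> norm (f x - q x) <= e" and s: "sqint g"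
 shows "abs (inner (cls g) (trunc U f) - inner (cls g) (trunc U q)) <= e * (LI x. ind U x * norm (g x))"
  "L1 (%x. ind U x * norm (g x))"
proof -
 have bU: "U : sets borel" using U(1) by simp
 note [measurable] = bU
 have gm[measurable]: "g : borel_fun" using s by(simp add: sqint_def)
 have "compact (closure U)" using U(2) by(simp add: compact_closure)
 from l1_nn_integral(1)[OF s this] have "L1 (%x. ind (closure U) x * norm (g x))" .
 thus i: "L1 (%x. ind U x * norm (g x))"
  by(rule L1_bound) (use closure_subset[of U] in "auto simp: indicator_def")
 note sf = sqint_trunc[OF U f(1)] and sq = sqint_trunc[OF U f(2)]
 have "inner (cls g) (trunc U f) - inner (cls g) (trunc U q) = (LI x. g x *. (ind U x *R f x) - g x *. (ind U x *R q x))"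
  unfolding trunc_def inner_cls[OF s sf] inner_cls[OF s sq]
  by(rule Bochner_Integration.integral_diff[symmetric]) (rule integrable_inner[OF s sf] integrable_inner[OF s sq])+
 also have "norm ... <= (LI x. e * (ind U x * norm (g x)))"
 proof (rule Lint_norm_bound)
  show "norm (g x *. (ind U x *R f x) - g x *. (ind U x *R q x)) <= e * (ind U x * norm (g x))" for x
  proof (cases "x : U")
   case True
   have "abs (g x *. (f x - q x)) <= norm (g x) * norm (f x - q x)" by(rule Cauchy_Schwarz_ineq2)
   also have "... <= norm (g x) * e" by(rule mult_left_mono[OF e(2)[OF True]]) simp
   finally show ?thesis using True by(simp add: inner_diff_right mult.commute)
  qed simp
 qed (use i integrable_inner[OF s sf] integrable_inner[OF s sq] in auto)
 finally show "abs (inner (cls g) (trunc U f) - inner (cls g) (trunc U q)) <= e * (LI x. ind U x * norm (g x))" by simp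
qed

lemma closure_span_monomials:
 assumes U: "open U" "bounded U" shows "closure (span (monomials U)) = supported U"
proof (rule dense_by_orthogonality[OF subspace_span])
 have bU: "U : sets borel" using U(1) by simp
 show "subspace (supported U)" "closed (supported U)" using bU subspace_supported closed_supported by blast+
 have "monomials U \<subseteq> supported U"
  unfolding monomials_def by(auto intro!: trunc_supported[OF U] continuous_intros)
 thus "span (monomials U) \<subseteq> supported U" by(rule span_minimal[OF _ subspace_supported[OF bU]])
 fix u assume u: "u : supported U" "!!v. v : span (monomials U) ==> inner u v = 0"
 have "inner u (cls h) = 0" if h: "cc U h" for h
 proof -
  define I where "I = (LI x. ind U x * norm (rep u x)) + 1"
  have "(LI x. ind U x * norm (rep u x)) >= 0" by(rule Lint_nonneg) simp
  hence I: "I > 0" unfolding I_def by linarith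
  have "abs (inner u (cls h)) <= e" if e: "e > 0" for e
  proof -
   obtain q where q: "continuous_on UNIV q" "trunc U q : span (monomials U)" "!!x. x : U ==> norm (h x - q x) < e / I"
    using uniform_approximation[OF U cc_continuous[OF h], of "e / I"] e I by auto
   have "abs (inner (cls (rep u)) (trunc U h) - inner (cls (rep u)) (trunc U q)) <= e / I * (LI x. ind U x * norm (rep u x))"
    by(rule trunc_diff_bound(1)[OF U cc_continuous[OF h] q(1)]) (use e I q(3) in "auto intro: less_imp_le")
   also have "... <= e / I * I" using e I by(intro mult_left_mono) (auto simp: I_def)
   finally show ?thesis using u(2)[OF q(2)] I by(simp add: trunc_cc[OF h])
  qed
  thus ?thesis by(meson abs_le_zero_iff dense_ge)
 qed
 hence "AE x\<in>U in lborel. rep u x = 0" by(intro orthogonal_fields[OF U(1)])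
 moreover have "AEl x. x ~: U --> rep u x = 0" using u(1) by(simp add: supported_def)
 ultimately have "AEl x. rep u x = rep 0 x" using rep_zero by eventually_elim auto
 thus "u = 0" by(rule l2_eqI)
qed

lemma convergent_uniform_approx:
 fixes x :: "nat => real"
 assumes "!!e. e > 0 ==> EX y. convergent y & (ALL n. abs (x n - y n) <= e)"
 shows "convergent x"
proof -
 have "Cauchy x"
 proof (rule metric_CauchyI)
  fix e :: real assume e: "e > 0"
  obtain y where y: "convergent y" "!!n. abs (x n - y n) <= e / 4" using assms[of "e/4"] e by auto
  obtain N where N: "!!m n. m >= N ==> n >= N ==> dist (y m) (y n) < e / 4"
   using metric_CauchyD[OF convergent_Cauchy[OF y(1)], of "e/4"] e by auto
  have "dist (x m) (x n) < e" if "m >= N" "n >= N" for m n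
   using N[OF that] y(2)[of m] y(2)[of n] e unfolding dist_real_def by linarith
  thus "EX N. ALL m>=N. ALL n>=N. dist (x m) (x n) < e" by blast
 qed
 thus ?thesis by(simp add: Cauchy_convergent_iff)
qed

lemma convergent_on_span:
 fixes L :: "nat => 'a::real_vector => real"
 assumes lin: "!!n. linear (L n)" and S: "!!u. u : S ==> convergent (%n. L n u)" and v: "v : span S"
 shows "convergent (%n. L n v)"
 using v
proof (induction rule: span_induct_alt)
 case base thus ?case using linear_0[OF lin] by(simp add: convergent_const)
next
 case (step c x y)
 have "convergent (%n. c * L n x + L n y)"
  using S[OF step(1)] step(2) by(intro convergent_add convergent_mult convergent_const)
 thus ?case by(simp add: linear_add[OF lin] linear_scale[OF lin])
qed

lemma convergent_on_closed_span:
 fixes L :: "nat => 'a::real_normed_vector => real"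
 assumes lin: "!!n. linear (L n)" and bd: "!!n u. abs (L n u) <= C * norm u"
  and S: "!!u. u : S ==> convergent (%n. L n u)" and u: "u : closure (span S)"
 shows "convergent (%n. L n u)"
proof -
 have span: "convergent (%n. L n v)" if "v : span S" for v
  by(rule convergent_on_span[OF lin _ that]) (rule S)
 show ?thesis
 proof (rule convergent_uniform_approx)
  fix e :: real assume e: "e > 0"
  obtain v where v: "v : span S" "dist v u < e / (abs C + 1)"
   using u e by(auto simp: closure_approachable dest!: spec[of _ "e / (abs C + 1)"])
  have "abs (L n u - L n v) <= e" for n
  proof -
   have "abs (L n u - L n v) = abs (L n (u - v))" by(simp add: linear_diff[OF lin])
   also have "... <= C * norm (u - v)" by(rule bd)
   also have "... <= (abs C + 1) * norm (u - v)" by(rule mult_right_mono) auto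
   also have "... <= e" using v(2) by(simp add: dist_norm norm_minus_commute field_simps)
   finally show ?thesis .
  qed
  thus "EX y. convergent y & (ALL n. abs (L n u - y n) <= e)" using span[OF v(1)] by blast
 qed
qed

text \<open>With \<open>z\<close> the projection of \<open>y\<close>, the difference
  \<open>y - z\<close> is orthogonal to every \<open>x n\<close>, hence by weak convergence to
  \<open>y\<close>, and it is orthogonal to \<open>z\<close> as well.\<close>

lemma weak_limit_in_closed_subspace:
 fixes x :: "nat => 'a::{real_inner, complete_space}"
 assumes W: "subspace W" "closed W" and x: "!!n. x n : W" "!!v. (%n. inner (x n) v) ----> inner y v"
 shows "y : W"
proof -
 obtain z where z: "z : W" "!!v. v : W ==> inner (y - z) v = 0"
  using closed_subspace_projection[OF W(1), of y] W(2) by auto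
 have "(%n. inner (x n) (y - z)) = (%n. 0)" using z(2)[OF x(1)] by(simp add: inner_commute)
 hence "inner y (y - z) = 0" using x(2)[of "y - z"] by(simp add: LIMSEQ_const_iff)
 moreover have "inner z (y - z) = 0" using z(2)[OF z(1)] by(simp add: inner_commute)
 ultimately have "inner (y - z) (y - z) = 0" by(simp add: inner_diff_left)
 thus ?thesis using z(1) by simp
qed

section \<open>The elliptic problem as an equation for gradients\<close>

definition coercive_field :: "real => (real^2 => real^2^2) => bool" where
 "coercive_field \<alpha> N \<longleftrightarrow> (EX B. bounded_field B N) & (ALL x \<xi>. \<alpha> * (norm \<xi>)^2 <= (N x *v \<xi>) *. \<xi>)"

text \<open>This is the gradient of the weak solution of \<open>div (N grad u) = div h\<close>, not
  \<open>u\<close> itself: a right-hand side is encoded by a vector field \<open>h\<close>, so that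
  data, gradients and fluxes all lie in \<open>l2\<close>.\<close>

definition potential :: "(real^2) set => (real^2 => real^2^2) => l2 => l2" where
 "potential U N h = (THE u. u : gradients U & (ALL v:gradients U. inner (mul N u) v = inner h v))"

definition flux :: "(real^2) set => (real^2 => real^2^2) => l2 => l2" where
 "flux U N h = mul N (potential U N h)"

lemma mul_coercive:
 assumes "coercive_field \<alpha> N" shows "\<alpha> * (norm u)^2 <= inner (mul N u) u"
proof -
 obtain B where B: "bounded_field B N" using assms by(auto simp: coercive_field_def)
 have "\<alpha> * (norm u)^2 = (LI x. \<alpha> * (norm (rep u x))^2)" by(simp add: norm_l2_sq)
 also have "... <= (LI x. (N x *v rep u x) *. rep u x)"
  by(rule integral_mono) (use assms sqint_integrable[OF sqint_rep] integrable_inner[OF sqint_mul[OF B sqint_rep] sqint_rep]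
   in "auto simp: coercive_field_def")
 finally show ?thesis by(simp add: inner_mul[OF B])
qed

lemma bounded_linear_coercive_mul: "coercive_field \<alpha> N ==> bounded_linear (mul N)"
 using bounded_linear_mul by(auto simp: coercive_field_def)

lemma potential_unique_exists:
 assumes "coercive_field \<alpha> N" "\<alpha> > 0"
 shows "\<exists>!u. u : gradients U & (ALL v:gradients U. inner (mul N u) v = inner h v)"
 by(rule Lax_Milgram[OF subspace_gradients closed_gradients bounded_linear_coercive_mul[OF assms(1)] assms(2) mul_coercive[OF assms(1)]])

lemma potential:
 assumes "coercive_field \<alpha> N" "\<alpha> > 0"
 shows "potential U N h : gradients U" "v : gradients U ==> inner (flux U N h) v = inner h v"
 using theI'[OF potential_unique_exists[OF assms, of U h]] unfolding potential_def flux_def by auto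

lemma potential_eqI:
 assumes "coercive_field \<alpha> N" "\<alpha> > 0" "u : gradients U" "!!v. v : gradients U ==> inner (mul N u) v = inner h v"
 shows "potential U N h = u"
 unfolding potential_def by(rule the1_equality[OF potential_unique_exists[OF assms(1,2)]]) (use assms in auto)

lemma linear_potential:
 assumes c: "coercive_field \<alpha> N" "\<alpha> > 0" shows "linear (potential U N)"
proof (rule linearI)
 interpret m: bounded_linear "mul N" by(rule bounded_linear_coercive_mul[OF c(1)])
 note f = potential(2)[OF c, unfolded flux_def]
 show "potential U N (h + k) = potential U N h + potential U N k" for h k
  by(rule potential_eqI[OF c subspace_add[OF subspace_gradients potential(1)[OF c] potential(1)[OF c]]])
   (simp add: m.add inner_add_left f)
 show "potential U N (r *R h) = r *R potential U N h" for r h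
  by(rule potential_eqI[OF c subspace_scale[OF subspace_gradients potential(1)[OF c]]]) (simp add: m.scaleR f)
qed

lemma linear_flux: assumes c: "coercive_field \<alpha> N" "\<alpha> > 0" shows "linear (flux U N)"
 using linear_compose[OF linear_potential[OF c] bounded_linear.linear[OF bounded_linear_coercive_mul[OF c(1)]]]
 by(simp add: flux_def[abs_def] o_def)

lemma potential_norm_le:
 assumes c: "coercive_field \<alpha> N" "\<alpha> > 0" shows "norm (potential U N h) <= norm h / \<alpha>"
proof -
 let ?u = "potential U N h"
 have "\<alpha> * (norm ?u)^2 <= inner (mul N ?u) ?u" by(rule mul_coercive[OF c(1)])
 also have "... = inner h ?u" using potential(2)[OF c potential(1)[OF c]] by(simp add: flux_def)
 also have "... <= norm h * norm ?u" by(rule norm_cauchy_schwarz)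
 finally have "norm ?u * (\<alpha> * norm ?u) <= norm ?u * norm h" by(simp add: power2_eq_square mult_ac)
 hence "\<alpha> * norm ?u <= norm h \<or> norm ?u = 0" by(auto simp: mult_le_cancel_left)
 thus ?thesis using c(2) by(auto simp: field_simps)
qed

lemma flux_energy:
 assumes c: "coercive_field \<alpha> N" "\<alpha> > 0"
 shows "inner (flux U N h) (potential U N h) = inner h (potential U N h)"
  "inner (flux U N h) (potential U N h) <= (norm h)^2 / \<alpha>"
proof -
 show e: "inner (flux U N h) (potential U N h) = inner h (potential U N h)"
  by(rule potential(2)[OF c potential(1)[OF c]])
 have "inner h (potential U N h) <= norm h * norm (potential U N h)" by(rule norm_cauchy_schwarz)
 also have "... <= norm h * (norm h / \<alpha>)" by(rule mult_left_mono[OF potential_norm_le[OF c]]) simp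
 finally show "inner (flux U N h) (potential U N h) <= (norm h)^2 / \<alpha>" by(simp add: e power2_eq_square)
qed

lemma mul_supported: assumes "bounded_field B N" "u : supported U" shows "mul N u : supported U"
 unfolding supported_def mem_Collect_eq
 using rep_mul[OF assms(1), of u] assms(2)[unfolded supported_def mem_Collect_eq] by eventually_elim auto

text \<open>Gradients vanish outside \<open>U\<close>, so the values of \<open>h\<close> there are
  invisible. This reduces convergence for all right-hand sides to those in the closed span of the
  monomials.\<close>

lemma potential_restr:
 assumes U: "open U" and c: "coercive_field \<alpha> N" "\<alpha> > 0"
 shows "potential U N (restr U h) = potential U N h"
proof (rule potential_eqI[OF c potential(1)[OF c]])
 have bU: "U : sets borel" using U by simp
 fix v assume v: "v : gradients U"
 hence "v : supported U" using gradients_supported[OF U] by blast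
 hence "inner (restr U h) v = inner h v"
  using inner_smul_commute[of "ind U" 1 h v] bU by(simp add: supported_iff[OF bU] indicator_def)
 thus "inner (mul N (potential U N h)) v = inner (restr U h) v"
  using potential(2)[OF c v] by(simp add: flux_def)
qed

text \<open>Cauchy-Schwarz with the factors \<open>g^2 * b\<close> and the energy density. It yields
  L^1 bounds on fluxes, weighted by \<open>g\<close>, without any L^\<infinity> bound on
  \<open>N\<close> in the constants.\<close>

lemma mul_inner_sq_le:
 assumes U: "U : sets borel" and N: "bounded_field B N" "!!x \<xi>. 0 <= (N x *v \<xi>) *. \<xi>"
  and b: "!!x \<xi>. (norm (N x *v \<xi>))^2 <= b x * ((N x *v \<xi>) *. \<xi>)" "b : borel_fun" "!!x. 0 <= b x"
   "L1 (%x. ind U x * b x)"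
  and g: "g : borel_fun" "!!x. abs (g x) <= G" "!!x. x ~: U ==> g x = 0"
 shows "L1 (%x. abs (g x) * norm (N x *v rep u x))"
  "(LI x. abs (g x) * norm (N x *v rep u x))^2 <= (LI x. (g x)^2 * b x) * inner (mul N u) u"
  "L1 (%x. (g x)^2 * b x)"
proof -
 let ?v = "%x. N x *v rep u x" and ?l = "%x. abs (g x) * norm (N x *v rep u x)" and ?c = "%x. (g x)^2 * b x"
 let ?q = "%x. ?v x *. rep u x"
 note [measurable] = bounded_field_measurable[OF N(1)] b(2) g(1) U
 have G: "(g x)^2 <= G^2" for x using g(2)[of x] by(metis abs_ge_zero power2_abs power_mono)
 show i1: "L1 (%x. ?c x)"
 proof (rule L1_bound)
  show "L1 (%x. G^2 * (ind U x * b x))" using b(4) by simp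
  show "AEl x. norm (?c x) <= norm (G^2 * (ind U x * b x))"
   using G b(3) g(3) by(auto intro!: AE_I2 mult_right_mono simp: indicator_def abs_mult)
 qed simp
 have i2: "L1 (%x. ?q x)"
  by(rule integrable_inner[OF sqint_mul[OF N(1) sqint_rep] sqint_rep])
 have p: "(?l x)^2 <= ?c x * ?q x" for x
  using mult_left_mono[OF b(1)[of x "rep u x"], of "(g x)^2"] by(simp add: power_mult_distrib mult.assoc)
 show i3: "L1 (%x. ?l x)"
 proof (rule L1_bound)
  show "L1 (%x. ?c x + ?q x)" using i1 i2 by simp
  have *: "?l x <= ?c x + ?q x" for x
  proof -
   have nn: "0 <= ?c x" "0 <= ?q x" using b(3) N(2) by auto
   have "?c x * ?q x <= (?c x + ?q x)^2"
    using nn mult_nonneg_nonneg[OF nn] zero_le_power2[of "?c x"] zero_le_power2[of "?q x"]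
    unfolding power2_sum by linarith
   with p[of x] have "(?l x)^2 <= (?c x + ?q x)^2" by linarith
   thus ?thesis using nn by(simp add: power2_le_iff_abs_le)
  qed
  have "norm (?l x) <= norm (?c x + ?q x)" for x
   using *[of x] by(simp add: abs_mult)
  thus "AEl x. norm (?l x) <= norm (?c x + ?q x)"
   by simp
 qed measurable
 show "(LI x. ?l x)^2 <= (LI x. ?c x) * inner (mul N u) u"
  unfolding inner_mul[OF N(1)]
  by(rule Cauchy_Schwarz_integral[OF i1 _ i2 _ i3]) (use b(3) N(2) p in auto)
qed

text \<open>All pointwise inequalities hold everywhere, for Borel representatives. Each
  \<open>M n\<close> is bounded, but nothing is uniform in \<open>n\<close> except coercivity and
  the mass bound for \<open>b n\<close>, whose weak limit has the density \<open>a\<close> with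
  values between 0 and \<beta>.\<close>

locale conductivity_sequence =
 fixes U :: "(real^2) set" and M :: "nat => real^2 => real^2^2" and b :: "nat => real^2 => real"
  and a :: "real^2 => real" and \<alpha> K \<beta> :: real
 assumes U: "open U" "bounded U" and \<alpha>: "\<alpha> > 0" and coercive: "!!n. coercive_field \<alpha> (M n)"
  and flux_le: "!!n x \<xi>. (norm (M n x *v \<xi>))^2 <= b n x * ((M n x *v \<xi>) *. \<xi>)"
  and b_measurable[measurable]: "!!n. b n : borel_fun" and b_nonneg: "!!n x. 0 <= b n x"
  and b_integrable: "!!n. L1 (%x. ind U x * b n x)"
  and b_bound: "!!n. (LI x. ind U x * b n x) <= K"
  and b_limit: "!!\<psi>. cc U \<psi> ==> (%n. LI x. \<psi> x * b n x) ----> (LI x. \<psi> x * a x)"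
  and a_measurable[measurable]: "a : borel_fun" and a_bounds: "!!x. 0 <= a x" "!!x. a x <= \<beta>" and \<alpha>_le_\<beta>: "\<alpha> <= \<beta>"
begin

lemma \<beta>: "\<beta> > 0" using \<alpha> \<alpha>_le_\<beta> by linarith

lemma U_borel[measurable, simp]: "U : sets borel" using U(1) by simp

lemma K_nonneg: "0 <= K"
proof -
 have "0 <= (LI x. ind U x * b 0 x)" by(rule Lint_nonneg) (simp add: b_nonneg)
 thus ?thesis using b_bound[of 0] by linarith
qed

lemma M_bounded: obtains B where "bounded_field B (M n)"
 using coercive[of n] by(auto simp: coercive_field_def)

lemma M_coercive: "\<alpha> * (norm \<xi>)^2 <= (M n x *v \<xi>) *. \<xi>"
 using coercive[of n] by(auto simp: coercive_field_def)

lemma M_nonneg: "0 <= (M n x *v \<xi>) *. \<xi>"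
proof -
 have "0 <= \<alpha> * (norm \<xi>)^2" using \<alpha> by simp
 thus ?thesis using M_coercive[of \<xi> n x] by linarith
qed

abbreviation "pot n h \<equiv> potential U (M n) h"
abbreviation "flx n h \<equiv> flux U (M n) h"

lemmas pot_in = potential(1)[OF coercive \<alpha>]
lemmas flx_inner = potential(2)[OF coercive \<alpha>]
lemmas pot_norm = potential_norm_le[OF coercive \<alpha>]
lemmas pot_linear = linear_potential[OF coercive \<alpha>]
lemmas flx_linear = linear_flux[OF coercive \<alpha>]

lemma pot_inner_le: "abs (inner (pot n h) v) <= norm h / \<alpha> * norm v"
 using order_trans[OF Cauchy_Schwarz_ineq2 mult_right_mono[OF pot_norm norm_ge_zero]] .

lemma rep_flx: "AEl x. rep (flx n h) x = M n x *v rep (pot n h) x"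
 unfolding flux_def by(rule M_bounded[of n]) (rule rep_mul)

lemma flx_supported: "flx n h : supported U"
proof -
 obtain B where "bounded_field B (M n)" by(rule M_bounded)
 moreover have "pot n h : supported U" using pot_in gradients_supported[OF U(1)] by blast
 ultimately show ?thesis unfolding flux_def by(rule mul_supported)
qed

lemma flx_l1:
 assumes g: "g : borel_fun" "!!x. abs (g x) <= G" "!!x. x ~: U ==> g x = 0"
 shows "L1 (%x. abs (g x) * norm (rep (flx n h) x))"
  "(LI x. abs (g x) * norm (rep (flx n h) x))^2 <= (LI x. (g x)^2 * b n x) * ((norm h)^2 / \<alpha>)"
  "L1 (%x. (g x)^2 * b n x)"
proof -
 obtain B where B: "bounded_field B (M n)" by(rule M_bounded)
 note [measurable] = g(1) bounded_field_measurable[OF B]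
 note * = mul_inner_sq_le(1,2)[OF U_borel B M_nonneg flux_le b_measurable b_nonneg b_integrable g, of "pot n h"]
 have ae: "AEl x. abs (g x) * norm (rep (flx n h) x) = abs (g x) * norm (M n x *v rep (pot n h) x)"
  using rep_flx[of n h] by eventually_elim simp
 show "L1 (%x. abs (g x) * norm (rep (flx n h) x))"
  by(rule Bochner_Integration.integrable_cong_AE_imp[OF *(1)]) (use ae in auto)
 have "(LI x. abs (g x) * norm (rep (flx n h) x)) = (LI x. abs (g x) * norm (M n x *v rep (pot n h) x))"
  by(rule Lint_cong_AE) (use ae in auto)
 moreover have "0 <= (LI x. (g x)^2 * b n x)" by(rule Lint_nonneg) (simp add: b_nonneg)
 ultimately show "(LI x. abs (g x) * norm (rep (flx n h) x))^2 <= (LI x. (g x)^2 * b n x) * ((norm h)^2 / \<alpha>)"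
  using order_trans[OF *(2) mult_left_mono[OF flux_energy(2)[OF coercive[of n] \<alpha>, of U h, unfolded flux_def]]] by simp
 show "L1 (%x. (g x)^2 * b n x)" 
  by(rule mul_inner_sq_le(3)[OF U_borel B M_nonneg flux_le b_measurable b_nonneg b_integrable g])
qed

lemma flx_l1_U: "(LI x. ind U x * norm (rep (flx n h) x)) <= sqrt (K / \<alpha>) * norm h"
proof -
 have "(LI x. abs (ind U x) * norm (rep (flx n h) x))^2 <= (LI x. (ind U x)^2 * b n x) * ((norm h)^2 / \<alpha>)"
  by(rule flx_l1[of _ 1]) (auto simp: indicator_def)
 also have "(LI x. (ind U x)^2 * b n x) = (LI x. ind U x * b n x)"
  by(rule Lint_cong) (auto simp: indicator_def)
 also have "... * ((norm h)^2 / \<alpha>) <= K * ((norm h)^2 / \<alpha>)" using b_bound \<alpha> by(intro mult_right_mono) auto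
 also have "... = (sqrt (K / \<alpha>) * norm h)^2" using K_nonneg \<alpha> by(simp add: power_mult_distrib)
 finally have "\<bar>LI x. \<bar>ind U x\<bar> * norm (rep (flx n h) x)\<bar> <= sqrt (K / \<alpha>) * norm h"
  using K_nonneg \<alpha> by(subst (asm) power2_le_iff_abs_le) auto
 thus ?thesis by simp
qed

text \<open>The right-hand side involves \<open>b n\<close> only through an integral that converges,
  and in the limit it is at most a constant times the squared L^2 norm of \<psi>. This is why the
  limit flux is in L^2 although the fluxes are bounded only in L^1.\<close>

lemma flx_pairing:
 assumes \<psi>: "cc U \<psi>"
 shows "(inner (flx n h) (cls \<psi>))^2 <= (LI x. (norm (\<psi> x))^2 * b n x) * ((norm h)^2 / \<alpha>)"
proof -
 have [measurable]: "\<psi> : borel_fun" by(rule cc_measurable[OF \<psi>])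
 obtain G where G: "!!x. norm (\<psi> x) <= G" using cc_bounded[OF \<psi>] by blast
 note * = flx_l1(1,2)[of "%x. norm (\<psi> x)" G n h]
 have i: "L1 (%x. norm (\<psi> x) * norm (rep (flx n h) x))" using *(1) G cc_eq_0[OF \<psi>] by simp
 have "abs (inner (flx n h) (cls \<psi>)) <= (LI x. norm (\<psi> x) * norm (rep (flx n h) x))"
  unfolding inner_rep_cls[OF cc_sqint[OF \<psi>]] real_norm_def[symmetric]
  by(rule Lint_norm_bound[OF integrable_inner[OF sqint_rep cc_sqint[OF \<psi>]] i])
   (metis Cauchy_Schwarz_ineq2 mult.commute real_norm_def)
 hence "(inner (flx n h) (cls \<psi>))^2 <= (LI x. norm (\<psi> x) * norm (rep (flx n h) x))^2"
  using power_mono[of "abs (inner (flx n h) (cls \<psi>))" _ 2] by simp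
 also have "... <= (LI x. (norm (\<psi> x))^2 * b n x) * ((norm h)^2 / \<alpha>)" using *(2) G cc_eq_0[OF \<psi>] by simp
 finally show ?thesis .
qed

lemma flx_trunc:
 assumes q: "continuous_on UNIV q" "continuous_on UNIV f" "e >= 0" "!!x. x : U ==> norm (f x - q x) <= e"
 shows "abs (inner (flx n h) (trunc U f) - inner (flx n h) (trunc U q)) <= e * (sqrt (K / \<alpha>) * norm h)"
proof -
 have "abs (inner (flx n h) (trunc U f) - inner (flx n h) (trunc U q)) <= e * (LI x. ind U x * norm (rep (flx n h) x))"
  using trunc_diff_bound(1)[OF U q(2,1,3,4) sqint_rep, of "flx n h"] by simp
 also have "... <= e * (sqrt (K / \<alpha>) * norm h)" by(rule mult_left_mono[OF flx_l1_U q(3)])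
 finally show ?thesis .
qed

end

context conductivity_sequence
begin

lemma flx_trunc_bound:
 assumes p: "continuous_on UNIV p"
 obtains C where "!!n h. abs (inner (flx n h) (trunc U p)) <= C * norm h"
proof -
 have "compact (p ` closure U)"
  using p U(2) by(intro compact_continuous_image) (auto intro: continuous_on_subset simp: compact_closure)
 then obtain P where "!!x. x : closure U ==> norm (p x) <= P"
  using compact_imp_bounded[of "p ` closure U"] unfolding bounded_iff by blast
 hence P: "norm (p x - 0) <= abs P" if "x : U" for x using closure_subset that by fastforce
 have "cls (%x. 0) = 0" by(rule l2_eqI) (use rep_zero rep_cls[OF sqint_zero] in "eventually_elim, simp")
 hence z: "trunc U (%x. 0) = 0" by(simp add: trunc_def)
 have "abs (inner (flx n h) (trunc U p)) <= (abs P * sqrt (K / \<alpha>)) * norm h" for n h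
  using flx_trunc[OF continuous_on_const p _ P, of n h] z by(simp add: mult.assoc)
 thus thesis by(rule that)
qed

lemma subsequence: "conductivity_sequence U (%n. M (r n)) (%n. b (r n)) a \<alpha> K \<beta>" if "strict_mono r"
proof
 show "(%n. LI x. \<psi> x * b (r n) x) ----> (LI x. \<psi> x * a x)" if "cc U \<psi>" for \<psi>
  using LIMSEQ_subseq_LIMSEQ[OF b_limit[OF that] \<open>strict_mono r\<close>] by(simp add: o_def)
qed (fact U \<alpha> coercive flux_le b_measurable b_nonneg b_integrable b_bound a_measurable a_bounds \<alpha>_le_\<beta>)+

end

lemma inner_restr: "U : sets borel ==> u : supported U ==> inner u (restr U v) = inner u v"
 using inner_smul_commute[of "ind U" 1 u v] by(simp add: supported_iff indicator_def)

lemma monomialsE: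
 assumes "v : monomials U" obtains p where "continuous_on UNIV p" "v = trunc U p"
proof -
 obtain m n i where v: "v = trunc U (%x. (x $ 1 ^ m * x $ 2 ^ n) *R axis i 1)"
  using assms by(auto simp: monomials_def)
 show thesis by(rule that[OF _ v]) (intro continuous_intros)
qed

text \<open>The asymmetry is intrinsic: potentials converge weakly in L^2, fluxes only against
  continuous fields of compact support. Requiring \<open>S h\<close> to vanish outside
  \<open>U\<close> makes it unique.\<close>

locale homogenized = conductivity_sequence +
 fixes T S :: "l2 => l2"
 assumes T_limit: "!!h v. (%n. inner (pot n h) v) ----> inner (T h) v"
  and S_limit: "!!h v. v : fields U ==> (%n. inner (flx n h) v) ----> inner (S h) v"
  and S_supported: "!!h. S h : supported U"

context conductivity_sequence
begin

lemma weak_limits_exist: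
 assumes T: "!!h v. convergent (%n. inner (pot n h) v)"
  and S: "!!h v. v : fields U ==> convergent (%n. inner (flx n h) v)"
 obtains T S where "homogenized U M b a \<alpha> K \<beta> T S"
proof -
 have "EX g. ALL v. (%n. inner (pot n h) v) ----> inner g v" for h
 proof -
  define L where "L v = lim (%n. inner (pot n h) v)" for v
  have L: "(%n. inner (pot n h) v) ----> L v" for v using T unfolding L_def by(simp add: convergent_LIMSEQ_iff)
  obtain g where "!!v. v : UNIV ==> inner g v = L v"
  proof (rule Riesz_subspace[of UNIV L "norm h / \<alpha>"])
   show "L (u + v) = L u + L v" for u v
    by(rule LIMSEQ_unique[OF L]) (use tendsto_add[OF L[of u] L[of v]] in "simp add: inner_add_right")
   show "L (c *R u) = c * L u" for c u
    by(rule LIMSEQ_unique[OF L]) (use tendsto_mult_left[OF L[of u], of c] in simp)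
   show "abs (L v) <= norm h / \<alpha> * norm v" for v
   proof (rule LIMSEQ_le_const2[OF tendsto_rabs[OF L]])
    have "abs (inner (pot n h) v) <= norm h / \<alpha> * norm v" for n
     by(rule pot_inner_le)
    thus "EX N. ALL n>=N. abs (inner (pot n h) v) <= norm h / \<alpha> * norm v" by blast
   qed
  qed auto
  thus ?thesis using L by(intro exI[of _ g]) simp
 qed
 hence "ALL h. EX g. ALL v. (%n. inner (pot n h) v) ----> inner g v" by blast
 from choice[OF this] obtain T where T: "!!h v. (%n. inner (pot n h) v) ----> inner (T h) v" by blast
 have "EX g. g : supported U & (ALL v:fields U. (%n. inner (flx n h) v) ----> inner g v)" for h
 proof -
  define L where "L v = lim (%n. inner (flx n h) v)" for v
  have L: "(%n. inner (flx n h) v) ----> L v" if "v : fields U" for v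
   using S[OF that] unfolding L_def by(simp add: convergent_LIMSEQ_iff)
  obtain g where "g : closure (fields U)" "!!v. v : fields U ==> inner g v = L v"
  proof (rule Riesz_subspace[of "fields U" L "sqrt (\<beta> * ((norm h)^2 / \<alpha>))"])
   fix u v :: l2 and c :: real assume u: "u : fields U"
   show "L (c *R u) = c * L u"
    by(rule LIMSEQ_unique[OF L[OF subspace_scale[OF subspace_fields u]]])
     (use tendsto_mult_left[OF L[OF u], of c] in simp)
   obtain \<psi> where \<psi>: "cc U \<psi>" "u = cls \<psi>" using u by(auto simp: fields_def)
   have lim: "(%n. (LI x. (norm (\<psi> x))^2 * b n x) * ((norm h)^2 / \<alpha>)) ----> (LI x. (norm (\<psi> x))^2 * a x) * ((norm h)^2 / \<alpha>)"
    by(rule tendsto_mult_right[OF b_limit[OF cc_sq[OF \<psi>(1)]]])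
   have "(L u)^2 <= (LI x. (norm (\<psi> x))^2 * a x) * ((norm h)^2 / \<alpha>)"
    by(rule LIMSEQ_le[OF tendsto_power[OF L[OF u]] lim]) (use flx_pairing[OF \<psi>(1)] \<psi>(2) in auto)
   also have "(LI x. (norm (\<psi> x))^2 * a x) <= (LI x. \<beta> * (norm (\<psi> x))^2)"
   proof (rule integral_mono_AE')
    show "L1 (%x. \<beta> * (norm (\<psi> x))^2)" using sqint_integrable[OF cc_sqint[OF \<psi>(1)]] by simp
    show "AEl x. (norm (\<psi> x))^2 * a x <= \<beta> * (norm (\<psi> x))^2"
     by(intro AE_I2) (metis a_bounds(2) mult.commute mult_left_mono zero_le_power2)
    show "AEl x. 0 <= \<beta> * (norm (\<psi> x))^2" using \<beta> by auto
   qed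
   also have "... = \<beta> * (norm u)^2" by(simp add: \<psi>(2) norm_cls[OF cc_sqint[OF \<psi>(1)]])
   finally have "(L u)^2 <= \<beta> * (norm u)^2 * ((norm h)^2 / \<alpha>)"
    using \<alpha> by(simp add: mult_right_mono divide_right_mono)
   also have "... = (sqrt (\<beta> * ((norm h)^2 / \<alpha>)) * norm u)^2" using \<beta> \<alpha> by(simp add: power_mult_distrib)
   finally show "abs (L u) <= sqrt (\<beta> * ((norm h)^2 / \<alpha>)) * norm u"
    using \<beta> \<alpha> by(subst (asm) power2_le_iff_abs_le) auto
   assume v: "v : fields U"
   show "L (u + v) = L u + L v"
    by(rule LIMSEQ_unique[OF L[OF subspace_add[OF subspace_fields u v]]])
     (use tendsto_add[OF L[OF u] L[OF v]] in "simp add: inner_add_right")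
  qed (auto simp: subspace_fields)
  thus ?thesis using L closure_fields[OF U(1)] by auto
 qed
 hence "ALL h. EX g. g : supported U & (ALL v:fields U. (%n. inner (flx n h) v) ----> inner g v)" by blast
 from choice[OF this] obtain S where S: "!!h. S h : supported U"
  "!!h v. v : fields U ==> (%n. inner (flx n h) v) ----> inner (S h) v"
  by blast
 have "homogenized U M b a \<alpha> K \<beta> T S"
  by unfold_locales (fact T S)+
 thus thesis by(rule that)
qed

text \<open>The diagonal extraction concerns pairs of monomials, one as datum and one as test field.
  For potentials the test field is generalised by density and then the datum. For fluxes the datum
  is generalised while the test field is still a monomial, and test fields in
  \<open>fields U\<close> are reached by uniform approximation, which an L^1 bound
  tolerates.\<close>

theorem precompactness:
 obtains r T S where "strict_mono (r :: nat => nat)" "homogenized U (%n. M (r n)) (%n. b (r n)) a \<alpha> K \<beta> T S"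
proof -
 define s where "s = (%(h, v, c) n. if c then inner (pot n h) v else inner (flx n h) v)"
 obtain r :: "nat => nat" where r: "strict_mono r"
  "!!i. i : monomials U \<times> monomials U \<times> UNIV ==> convergent (%n. s i (r n))"
 proof (rule diagonal_convergent_subsequence[of "monomials U \<times> monomials U \<times> (UNIV :: bool set)" s])
  fix i assume "i : monomials U \<times> monomials U \<times> (UNIV :: bool set)"
  then obtain h v c where i: "i = (h, v, c)" "v : monomials U" by auto
  obtain p where p: "continuous_on UNIV p" "v = trunc U p" by(rule monomialsE[OF i(2)])
  obtain C where "!!n h. abs (inner (flx n h) v) <= C * norm h" by(rule flx_trunc_bound[OF p(1), folded p(2)]) blast
  hence "abs (s i n) <= max (C * norm h) (norm h / \<alpha> * norm v)" for n
   using pot_inner_le[of n h v] by(auto simp: s_def i max.coboundedI1 max.coboundedI2)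
  thus "bounded (range (s i))" by(auto simp: bounded_iff)
 qed (auto intro: countable_SIGMA countable_monomials)
 interpret r: conductivity_sequence U "%n. M (r n)" "%n. b (r n)" a \<alpha> K \<beta> by(rule subsequence[OF r(1)])
 have lin: "linear (%h. inner (pot n h) v)" "linear (%h. inner (flx n h) v)" for n v
  by(auto intro!: linearI simp: linear_add[OF pot_linear] linear_scale[OF pot_linear] linear_add[OF flx_linear]
    linear_scale[OF flx_linear] inner_add_left)
 have lin2: "linear (%v. inner (u :: l2) v)" for u by(auto intro!: linearI simp: inner_add_right)
 note dense = closure_span_monomials[OF U]
 have p1: "convergent (%n. inner (pot (r n) h) v)" "convergent (%n. inner (flx (r n) h) v)"
  if "h : monomials U" "v : monomials U" for h v
  using r(2)[of "(h, v, True)"] r(2)[of "(h, v, False)"] that by(auto simp: s_def)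
 have p2: "convergent (%n. inner (pot (r n) h) v)" if h: "h : monomials U" for h v
 proof -
  have "convergent (%n. inner (pot (r n) h) (restr U v))"
   by(rule convergent_on_closed_span[where S = "monomials U" and L = "%n v. inner (pot (r n) h) v" and C = "norm h / \<alpha>", OF lin2 pot_inner_le])
    (auto simp: dense restr_supported intro: p1(1)[OF h])
  moreover have "pot n h : supported U" for n using pot_in gradients_supported[OF U(1)] by blast
  ultimately show ?thesis by(simp add: inner_restr)
 qed
 have p3: "convergent (%n. inner (pot (r n) h) v)" for h v
 proof -
  have "convergent (%n. inner (pot (r n) (restr U h)) v)"
  proof (rule convergent_on_closed_span[where S = "monomials U" and L = "%n h. inner (pot (r n) h) v" and C = "norm v / \<alpha>", OF lin(1)])
   show "abs (inner (pot (r n) u) v) <= norm v / \<alpha> * norm u" for n u using pot_inner_le[of "r n" u v] by(simp add: mult.commute)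
  qed (auto simp: dense restr_supported intro: p2)
  thus ?thesis by(simp add: potential_restr[OF U(1) coercive \<alpha>])
 qed
 have f2: "convergent (%n. inner (flx (r n) h) v)" if v: "v : monomials U" for h v
 proof -
  obtain p where p: "continuous_on UNIV p" "v = trunc U p" by(rule monomialsE[OF v])
  obtain C where C: "!!n h. abs (inner (flx n h) v) <= C * norm h" by(rule flx_trunc_bound[OF p(1), folded p(2)]) blast
  have "convergent (%n. inner (flx (r n) (restr U h)) v)"
   by(rule convergent_on_closed_span[where S = "monomials U" and L = "%n h. inner (flx (r n) h) v", OF lin(2) C])
    (auto simp: dense restr_supported intro: p1(2)[OF _ v])
  thus ?thesis by(simp add: potential_restr[OF U(1) coercive \<alpha>] flux_def)
 qed
 have f3: "convergent (%n. inner (flx (r n) h) v)" if v: "v : fields U" for h v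
 proof (rule convergent_uniform_approx)
  fix e :: real assume e: "e > 0"
  obtain \<psi> where \<psi>: "cc U \<psi>" "v = cls \<psi>" using v by(auto simp: fields_def)
  define Z where "Z = sqrt (K / \<alpha>) * norm h + 1"
  have Z: "Z > 0" "sqrt (K / \<alpha>) * norm h <= Z" using K_nonneg \<alpha> by(auto simp: Z_def intro: add_nonneg_pos)
  obtain q where q: "continuous_on UNIV q" "trunc U q : span (monomials U)" "!!x. x : U ==> norm (\<psi> x - q x) < e / Z"
   using uniform_approximation[OF U cc_continuous[OF \<psi>(1)], of "e / Z"] e Z by auto
  have "abs (inner (flx n h) v - inner (flx n h) (trunc U q)) <= e" for n
  proof -
   have "abs (inner (flx n h) (trunc U \<psi>) - inner (flx n h) (trunc U q)) <= e / Z * (sqrt (K / \<alpha>) * norm h)"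
    by(rule flx_trunc[OF q(1) cc_continuous[OF \<psi>(1)]]) (use e Z q(3) in "auto intro: less_imp_le")
   also have "... <= e / Z * Z" using e Z by(intro mult_left_mono) auto
   finally show ?thesis using Z by(simp add: trunc_cc[OF \<psi>(1)] \<psi>(2))
  qed
  moreover have "convergent (%n. inner (flx (r n) h) (trunc U q))"
   by(rule convergent_on_span[where L = "%n v. inner (flx (r n) h) v", OF lin2 _ q(2)]) (rule f2)
  ultimately show "EX y. convergent y & (ALL n. abs (inner (flx (r n) h) v - y n) <= e)" by blast
 qed
 show thesis by(rule r.weak_limits_exist[OF p3 f3]) (auto intro: that[OF r(1)])
qed

end

section \<open>The homogenized conductivity\<close>

lemma AE_local:
 assumes "!!z. z : U ==> EX V. open V & z : V & (AE x\<in>V in lborel. P x)"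
 shows "AEl x. x : (U :: (real^2) set) --> P x"
proof -
 define F where "F = {V. open V & (AE x\<in>V in lborel. P x)}"
 obtain F' where F': "F' \<subseteq> F" "countable F'" "\<Union>F' = \<Union>F"
  by(rule Lindelof[of F]) (auto simp: F_def)
 have "AEl x. ALL V:F'. x : V --> P x"
  using F' by(subst AE_ball_countable) (auto simp: F_def)
 moreover have "U \<subseteq> \<Union>F'" unfolding F'(3) using assms by(auto simp: F_def)
 ultimately show ?thesis by(auto elim!: eventually_mono)
qed

text \<open>The support lies in a square with a margin inside \<open>U\<close>, because stream
  functions are constructed on squares only.\<close>

definition local_test :: "(real^2) set => (real^2 => real) => bool" where
 "local_test U \<phi> \<longleftrightarrow> \<phi> : TF U & (EX z r s. 0 < r & r < s & sq z s \<subseteq> U & (ALL x. x ~: sq z r --> \<phi> x = 0))"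

lemma small_square:
 assumes "open U" "z : U" obtains s where "s > 0" "sq z s \<subseteq> U"
proof -
 obtain e where e: "e > 0" "cball z e \<subseteq> U" using assms open_contains_cball by blast
 have "sq z (e / 2) \<subseteq> cball z e"
 proof
  fix x assume "x : sq z (e / 2)"
  hence "abs ((x - z) $ 1) + abs ((x - z) $ 2) <= e" by(simp add: sq_def)
  thus "x : cball z e" using norm_le_l1_cart[of "x - z"] by(simp add: dist_norm norm_minus_commute sum_2)
 qed
 thus thesis using e by(intro that[of "e / 2"]) auto
qed

lemma AE_nonneg_of_local_test:
 fixes f :: "real^2 => real"
 assumes U: "open U" and f: "f : borel_fun" "L1 (%x. ind U x * f x)"
  and t: "!!\<phi>. local_test U \<phi> ==> (!!x. 0 <= \<phi> x) ==> 0 <= (LI x. \<phi> x * f x)"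
 shows "AE x\<in>U in lborel. 0 <= f x"
proof (rule AE_local)
 fix z assume "z : U"
 then obtain s where s: "s > 0" "sq z s \<subseteq> U" using small_square[OF U] by blast
 define V where "V = ball z (s / 2)"
 have Vs: "V \<subseteq> sq z (s / 2)" using cball_sq[of z "s / 2"] by(auto simp: V_def)
 moreover have "sq z (s / 2) \<subseteq> sq z s" by(rule sq_mono) (use s in simp)
 ultimately have VU: "V \<subseteq> U" using s by blast
 have "AE x\<in>V in lborel. 0 <= f x"
 proof (rule AE_nonneg_of_test)
  show "open V" by(simp add: V_def)
  have [measurable]: "V : sets borel" by(simp add: V_def)
  note [measurable] = f(1)
  show "L1 (%x. ind V x * f x)"
   by(rule L1_bound[OF f(2)]) (use VU in "auto simp: indicator_def")
  fix \<phi> :: "real^2 => real" assume \<phi>: "\<phi> : TF V" "!!x. 0 <= \<phi> x"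
  have z: "\<phi> x = 0" if "x ~: sq z (s / 2)" for x
   using cc_eq_0[OF c1c_D(1)[OF test_function_c1c[OF \<phi>(1)]]] that Vs by blast
  have "\<phi> : TF U" using \<phi>(1) VU unfolding test_functions_def by blast
  hence "local_test U \<phi>" unfolding local_test_def using s z by(intro conjI exI[of _ z] exI[of _ "s / 2"] exI[of _ s]) auto
  thus "0 <= (LI x. \<phi> x * f x)" using \<phi>(2) by(rule t)
 qed (rule f(1))
 thus "EX V. open V & z : V & (AE x\<in>V in lborel. 0 <= f x)"
  using s by(intro exI[of _ V]) (auto simp: V_def)
qed

lemma local_testD:
 assumes "local_test U \<phi>"
 shows "c1c U \<phi> (grad \<phi>)" "cc U \<phi>" "\<phi> : borel_fun" "EX B. ALL x. abs (\<phi> x) <= B"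
proof -
 show c: "c1c U \<phi> (grad \<phi>)" using assms test_function_c1c by(auto simp: local_test_def)
 show cc: "cc U \<phi>" using c1c_D(1)[OF c] .
 show "\<phi> : borel_fun" by(rule cc_measurable[OF cc])
 show "EX B. ALL x. abs (\<phi> x) <= B" using cc_bounded[OF cc] by(metis real_norm_def)
qed

lemma countable_dense_vectors: obtains D :: "(real^2) set" where "countable D" "closure D = UNIV"
proof -
 obtain D :: "(real^2) set" where D: "countable D" "!!X. open X ==> X ~= {} ==> EX d:D. d : X"
  using countable_dense_setE by blast
 have "x : closure D" for x
  unfolding closure_approachable using D(2)[of "ball x e" for e] by(metis centre_in_ball dist_commute empty_iff mem_ball open_ball)
 with D(1) show thesis by(intro that) auto
qed

text \<open>The exceptional null set depends on \<open>c\<close>; a countable dense set of vectors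
  and continuity in \<open>c\<close> remove the dependence. Afterwards \<open>c\<close> may be
  replaced by the value of a field at \<open>x\<close>.\<close>

lemma AE_all_vectors:
 fixes f :: "real^2 => real^2 => real"
 assumes "!!c. AE x\<in>U in lborel. 0 <= f x c" "!!x. continuous_on UNIV (f x)"
 shows "AE x\<in>U in lborel. (ALL c. 0 <= f x c)"
proof -
 obtain D :: "(real^2) set" where D: "countable D" "closure D = UNIV" by(rule countable_dense_vectors)
 have "AEl x. ALL c:D. x : U --> 0 <= f x c" using D(1) assms(1) by(subst AE_ball_countable) auto
 thus ?thesis
 proof eventually_elim
  case (elim x)
  show ?case using continuous_ge_on_closure[of D "f x" _ 0] D(2) assms(2)[of x] elim by auto
 qed
qed

text \<open>Subtracting \<open>s\<close> reduces to the null case. The product structure survives,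
  since \<open>|\<sigma> - s|^2 <= 2 (b + 1) (e + |s|^2)\<close>: the new weight again has limits
  bounded by multiples of the integral of the test function, and the new energy is again bounded in
  L^1.\<close>

theorem div_curl_limit:
 fixes \<sigma> G :: "nat => l2" and b e :: "nat => real^2 => real"
 assumes U: "open U" "bounded U"
  and \<sigma>: "!!n. \<sigma> n : supported U" "s : supported U" "!!n g. g : gradients U ==> inner (\<sigma> n) g = inner s g"
  and be: "!!n x. 0 <= b n x" "!!n x. 0 <= e n x"
   "!!n. L1 (%x. ind U x * b n x)" "!!n. L1 (e n)"
   "!!n. (LI x. ind U x * b n x) <= K" "!!n. (LI x. e n x) <= K"
   "!!n. AEl x. (norm (rep (\<sigma> n) x))^2 <= b n x * e n x"
  and bw: "!!\<psi>. cc U \<psi> ==> (!!x. 0 <= \<psi> x) ==> (ALL n. L1 (%x. \<psi> x * b n x)) &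
   (EX L. (%n. LI x. \<psi> x * b n x) ----> L & L <= K * (LI x. \<psi> x))"
  and weak: "!!v. v : fields U ==> (%n. inner (\<sigma> n) v) ----> inner s v"
  and G: "!!n g. g : gradients U ==> inner (G n) (rot g) = 0" "!!n. norm (G n) <= C"
  and lim: "!!v. (%n. inner (G n) v) ----> inner G' v" and \<phi>: "local_test U \<phi>"
 shows "(%n. inner (smul \<phi> (\<sigma> n)) (G n)) ----> inner (smul \<phi> s) G'"
proof -
 obtain B where B: "!!x. abs (\<phi> x) <= B" using local_testD(4)[OF \<phi>] by blast
 interpret sm: bounded_linear "smul \<phi>" by(rule bounded_linear_mul[OF bounded_field_scalar[OF local_testD(3)[OF \<phi>] B]])
 obtain z r t where z: "0 < r" "r < t" "sq z t \<subseteq> U" "!!x. x ~: sq z r ==> \<phi> x = 0"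
  using \<phi> unfolding local_test_def by blast
 have iU: "L1 (%x. ind U x :: real)"
  using U emeasure_bounded_finite[OF U(2)] by(intro integrable_real_indicator) auto
 define m where "m = (LI x. ind U x :: real)"
 define b' where "b' n x = 2 * (b n x + 1)" for n x
 define e' where "e' n x = e n x + (norm (rep s x))^2" for n x
 have eb: "(%x. ind U x * b' n x) = (%x. 2 * (ind U x * b n x + ind U x))" for n
  by(simp add: b'_def algebra_simps)
 have ie: "L1 (e' n)" for n unfolding e'_def using be(4)[of n] sqint_integrable[OF sqint_rep] by simp
 have e0: "0 <= e' n x" for n x using be(2) by(simp add: e'_def)
 have ie': "L1 (%x. ind U x * e' n x)" for n
  using integrable_mult_indicator[of U lborel "e' n"] U ie by simp
 define K' where "K' = max (max C (2 * (K + m))) (max (K + (norm s)^2) (2 * K + 2))"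
 have K': "C <= K'" "2 * (K + m) <= K'" "K + (norm s)^2 <= K'" "2 * K + 2 <= K'" by(auto simp: K'_def)
 have "(%n. inner (smul \<phi> (\<sigma> n - s)) (G n)) ----> 0"
 proof (rule div_curl_null[OF U, where b = b' and e = e' and K = K' and z = z and r = r and s = t and \<phi>' = "grad \<phi>"])
  show "\<sigma> n - s : supported U" for n using \<sigma>(1,2) U(1) by(intro subspace_diff[OF subspace_supported]) auto
  show "inner (\<sigma> n - s) g = 0" if "g : gradients U" for n g by(simp add: inner_diff_left \<sigma>(3)[OF that])
  show "norm (G n) <= K'" for n using G(2)[of n] K'(1) by linarith
  show "(LI x. ind U x * b' n x) <= K'" for n
   using be(3,5)[of n] iU K'(2) by(simp add: eb m_def)
  show "L1 (%x. ind U x * b' n x)" for n unfolding eb using be(3)[of n] iU by simp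
  have "(LI x. ind U x * e' n x) <= (LI x. e' n x)" for n
   by(rule integral_mono[OF ie' ie]) (use e0 in "auto simp: indicator_def")
  also have "(LI x. e' n x) <= K'" for n
   using be(4,6)[of n] sqint_integrable[OF sqint_rep, of s] K'(3) by(simp add: e'_def norm_l2_sq)
  finally show "(LI x. ind U x * e' n x) <= K'" for n .
  show "AE x\<in>U in lborel. (norm (rep (\<sigma> n - s) x))^2 <= b' n x * e' n x" for n
   using rep_minus[of "\<sigma> n" s] be(7)[of n]
  proof eventually_elim
   case (elim x)
   have "(norm (rep (\<sigma> n - s) x))^2 <= 2 * (norm (rep (\<sigma> n) x))^2 + 2 * (norm (rep s x))^2"
    using norm_add_sq_le[of "rep (\<sigma> n) x" "- rep s x"] elim(1) by simp
   also have "... <= b' n x * e' n x"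
   proof -
    have "b' n x * e' n x = 2 * (b n x * e n x) + 2 * (b n x * (norm (rep s x))^2) + 2 * e n x + 2 * (norm (rep s x))^2"
     by(simp add: b'_def e'_def algebra_simps)
    moreover have "0 <= b n x * (norm (rep s x))^2" using be(1) by simp
    ultimately show ?thesis using elim(2) be(2)[of n x] by linarith
   qed
   finally show ?case by simp
  qed
  show "EX L. (%n. LI x. \<psi> x * b' n x) ----> L & L <= K' * (LI x. \<psi> x)"
   if \<psi>: "cc U \<psi>" "!!x. 0 <= \<psi> x" for \<psi>
  proof -
   obtain L where L: "(%n. LI x. \<psi> x * b n x) ----> L" "L <= K * (LI x. \<psi> x)" using bw[OF \<psi>] by blast
   have "(%x. \<psi> x * b' n x) = (%x. 2 * (\<psi> x * b n x + \<psi> x))" for n by(simp add: b'_def algebra_simps)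
   hence "(LI x. \<psi> x * b' n x) = 2 * ((LI x. \<psi> x * b n x) + (LI x. \<psi> x))" for n
    using bw[OF \<psi>] cc_integrable[OF \<psi>(1)] by simp
   moreover have "2 * (L + (LI x. \<psi> x)) <= K' * (LI x. \<psi> x)"
    using L(2) mult_right_mono[OF K'(4), of "LI x. \<psi> x"] \<psi>(2) by(simp add: Lint_nonneg algebra_simps)
   ultimately show ?thesis using L(1) by(intro exI[of _ "2 * (L + (LI x. \<psi> x))"]) (auto intro!: tendsto_intros)
  qed
  show "(%n. inner (\<sigma> n - s) v) ----> 0" if "v : fields U" for v
   using tendsto_diff[OF weak[OF that] tendsto_const[of "inner s v"]] by(simp add: inner_diff_left)
  show "c1c U \<phi> (grad \<phi>)" by(rule local_testD(1)[OF \<phi>])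
 qed (use G(1) be iU ie' e0 z in "auto simp: b'_def")
 moreover have "(%n. inner (smul \<phi> s) (G n)) ----> inner (smul \<phi> s) G'"
  using lim[of "smul \<phi> s"] by(simp add: inner_commute)
 ultimately show ?thesis using tendsto_add by(fastforce simp: sm.diff inner_diff_left)
qed

context conductivity_sequence
begin

lemma rep_flx_le:
 "AEl x. (norm (rep (flx n h) x))^2 <= b n x * (rep (flx n h) x *. rep (pot n h) x)"
 "AEl x. \<alpha> * (norm (rep (pot n h) x))^2 <= rep (flx n h) x *. rep (pot n h) x"
 by(use rep_flx[of n h] in eventually_elim, simp add: flux_le M_coercive)+

lemma scalar_b_integrable: assumes "cc U (\<psi> :: real^2 => real)" shows "L1 (%x. \<psi> x * b n x)"
proof -
 obtain B where B: "!!x. norm (\<psi> x) <= B" using cc_bounded[OF assms] by blast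
 have [measurable]: "\<psi> : borel_fun" by(rule cc_measurable[OF assms])
 show ?thesis
 proof (rule L1_bound)
  show "L1 (%x. B * (ind U x * b n x))" using b_integrable[of n] by simp
  have "norm (\<psi> x * b n x) <= norm (B * (ind U x * b n x))" for x
   using cc_eq_0[OF assms, of x] mult_right_mono[OF B[of x] b_nonneg[of n x]] b_nonneg[of n x]
   by(cases "x : U") (auto simp: abs_mult intro: order_trans[OF _ mult_right_mono[OF abs_ge_self]])
  thus "AEl x. norm (\<psi> x * b n x) <= norm (B * (ind U x * b n x))" by simp
 qed measurable
qed

lemma scalar_a_bound:
 assumes "cc U (\<psi> :: real^2 => real)"
 shows "L1 (%x. \<psi> x * a x)" "(!!x. 0 <= \<psi> x) ==> (LI x. \<psi> x * a x) <= \<beta> * (LI x. \<psi> x)"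
proof -
 have [measurable]: "\<psi> : borel_fun" by(rule cc_measurable[OF assms])
 have i: "L1 \<psi>" by(rule cc_integrable[OF assms])
 show ia: "L1 (%x. \<psi> x * a x)"
 proof (rule L1_bound)
  show "L1 (%x. \<beta> * \<psi> x)" using i by simp
  have "norm (\<psi> x * a x) <= norm (\<beta> * \<psi> x)" for x
   using mult_left_mono[OF a_bounds(2)[of x], of "abs (\<psi> x)"] a_bounds(1)[of x] \<beta> by(simp add: abs_mult mult.commute)
  thus "AEl x. norm (\<psi> x * a x) <= norm (\<beta> * \<psi> x)" by simp
 qed measurable
 assume p: "!!x. 0 <= \<psi> x"
 have "(LI x. \<psi> x * a x) <= (LI x. \<beta> * \<psi> x)"
  using ia i p a_bounds(2) by(intro integral_mono) (auto simp: mult.commute[of \<beta>] mult_left_mono)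
 thus "(LI x. \<psi> x * a x) <= \<beta> * (LI x. \<psi> x)" by simp
qed

end

context homogenized
begin

lemma T_in: "T h : gradients U"
 by(rule weak_limit_in_closed_subspace[OF subspace_gradients closed_gradients pot_in T_limit])

lemma S_inner: assumes "g : gradients U" shows "inner (S h) g = inner h g"
proof (rule subspace_closure_inner)
 fix v assume "v : {cls (grad \<phi>) |\<phi>. \<phi> : TF U}"
 hence v: "v : fields U" "v : gradients U" using test_gradient_field test_gradient_in by auto
 have "(%n. inner h v) ----> inner (S h) v" using S_limit[OF v(1), of h] by(simp add: flx_inner[OF v(2)])
 thus "inner (S h) v = inner h v" by(simp add: LIMSEQ_const_iff)
qed (use assms in "simp add: gradients_def")

lemma l2_inner_eqI: "(!!w. inner u w = inner v w) ==> u = (v :: l2)"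
 using inner_eq_zero_iff[of "u - v"] by(simp add: inner_diff_left)

lemma T_linear: "linear T"
proof (rule linearI)
 show "T (h + k) = T h + T k" for h k
 proof -
  have "inner (T (h + k)) v = inner (T h + T k) v" for v
   by(rule LIMSEQ_unique[OF T_limit]) (use tendsto_add[OF T_limit[of h v] T_limit[of k v]] in "simp add: linear_add[OF pot_linear] inner_add_left")
  thus ?thesis by(rule l2_inner_eqI)
 qed
 show "T (c *R h) = c *R T h" for c h
 proof -
  have "inner (T (c *R h)) v = inner (c *R T h) v" for v
   by(rule LIMSEQ_unique[OF T_limit]) (use tendsto_mult_left[OF T_limit[of h v], of c] in "simp add: linear_scale[OF pot_linear]")
  thus ?thesis by(rule l2_inner_eqI)
 qed
qed

lemma supported_eqI:
 assumes "u : supported U" "v : supported U" "!!w. w : fields U ==> inner u w = inner v w" shows "u = v"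
proof -
 have "u - v : closure (fields U)"
  using assms(1,2) subspace_diff[OF subspace_supported] U_borel by(simp add: closure_fields[OF U(1)])
 hence "inner u (u - v) = inner v (u - v)" by(rule subspace_closure_inner[rotated]) (rule assms(3))
 hence "inner (u - v) (u - v) = 0" by(simp add: inner_diff_left)
 thus ?thesis by simp
qed

lemma S_linear: "linear S"
proof (rule linearI)
 note sub = subspace_supported[OF U_borel]
 show "S (h + k) = S h + S k" for h k
 proof (rule supported_eqI[OF S_supported subspace_add[OF sub S_supported S_supported]])
  fix v assume v: "v : fields U"
  show "inner (S (h + k)) v = inner (S h + S k) v"
   by(rule LIMSEQ_unique[OF S_limit[OF v]]) (use tendsto_add[OF S_limit[OF v, of h] S_limit[OF v, of k]] in "simp add: linear_add[OF flx_linear] inner_add_left")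
 qed
 show "S (c *R h) = c *R S h" for c h
 proof (rule supported_eqI[OF S_supported subspace_scale[OF sub S_supported]])
  fix v assume v: "v : fields U"
  show "inner (S (c *R h)) v = inner (c *R S h) v"
   by(rule LIMSEQ_unique[OF S_limit[OF v]]) (use tendsto_mult_left[OF S_limit[OF v, of h], of c] in "simp add: linear_scale[OF flx_linear]")
 qed
qed

theorem div_curl:
 assumes G: "!!n g. g : gradients U ==> inner (G n) (rot g) = 0" "!!n. norm (G n) <= C"
  and lim: "!!v. (%n. inner (G n) v) ----> inner G' v" and \<phi>: "local_test U \<phi>"
 shows "(%n. inner (smul \<phi> (flx n h)) (G n)) ----> inner (smul \<phi> (S h)) G'"
proof (rule div_curl_limit[OF U flx_supported S_supported _ b_nonneg _ b_integrable])
 define e where "e n x = (M n x *v rep (pot n h) x) *. rep (pot n h) x" for n x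
 define k where "k = max (max K ((norm h)^2 / \<alpha>)) \<beta>"
 show "inner (flx n h) g = inner (S h) g" if "g : gradients U" for n g by(simp add: S_inner[OF that] flx_inner[OF that])
 show "0 <= e n x" for n x unfolding e_def by(rule M_nonneg)
 show "L1 (e n)" for n
  unfolding e_def by(rule M_bounded[of n]) (rule integrable_inner[OF sqint_mul[OF _ sqint_rep] sqint_rep])
 have "(LI x. e n x) = inner (flx n h) (pot n h)" for n
  unfolding e_def flux_def by(rule M_bounded[of n]) (rule inner_mul[symmetric])
 thus "(LI x. e n x) <= k" "(LI x. ind U x * b n x) <= k" for n
  using flux_energy(2)[OF coercive[of n] \<alpha>, of U h] b_bound[of n] by(auto simp: k_def)
 show "AEl x. (norm (rep (flx n h) x))^2 <= b n x * e n x" for n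
  using rep_flx[of n h] by eventually_elim (simp add: e_def flux_le)
 show "(ALL n. L1 (%x. \<psi> x * b n x)) &
   (EX L. (%n. LI x. \<psi> x * b n x) ----> L & L <= k * (LI x. \<psi> x))" if \<psi>: "cc U \<psi>" "!!x. 0 <= \<psi> x" for \<psi>
 proof (intro conjI allI scalar_b_integrable[OF \<psi>(1)] exI[of _ "LI x. \<psi> x * a x"] b_limit[OF \<psi>(1)])
  have "\<beta> * (LI x. \<psi> x) <= k * (LI x. \<psi> x)"
   using \<psi>(2) by(intro mult_right_mono Lint_nonneg) (auto simp: k_def)
  thus "(LI x. \<psi> x * a x) <= k * (LI x. \<psi> x)" using scalar_a_bound(2)[OF \<psi>] by linarith
 qed
 show "(%n. inner (flx n h) v) ----> inner (S h) v" if "v : fields U" for v by(rule S_limit[OF that])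
qed (use G lim \<phi> in auto)

end

lemma integral_weighted_inner:
 assumes "\<phi> : borel_fun" "!!x. abs (\<phi> x) <= B"
 shows "L1 (%x. \<phi> x * (rep s x *. rep u x))"
  "(LI x. \<phi> x * (rep s x *. rep u x)) = inner (smul \<phi> s) u"
proof -
 have "L1 (%x. (\<phi> x *R mat 1 *v rep s x) *. rep u x)"
  by(rule integrable_inner[OF sqint_mul[OF bounded_field_scalar[OF assms] sqint_rep] sqint_rep])
 thus "L1 (%x. \<phi> x * (rep s x *. rep u x))" by(simp add: scaleR_matrix_vector_assoc[symmetric])
qed (simp add: inner_smul[OF assms])

lemma integral_weighted_const:
 assumes "cc U (\<phi> :: real^2 => real)"
 shows "L1 (%x. \<phi> x * (c *. rep u x))"
  "(LI x. \<phi> x * (c *. rep u x)) = inner u (cls (%x. \<phi> x *R c))"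
  "cls (%x. \<phi> x *R c) : fields U"
proof -
 have c: "cc U (%x. \<phi> x *R c)" using cc_scale_left[OF assms continuous_on_const[of UNIV c]] .
 thus "cls (%x. \<phi> x *R c) : fields U" by(auto simp: fields_def)
 show "L1 (%x. \<phi> x * (c *. rep u x))"
  using integrable_inner[OF cc_sqint[OF c] sqint_rep[of u]] by simp
 show "(LI x. \<phi> x * (c *. rep u x)) = inner u (cls (%x. \<phi> x *R c))"
  unfolding inner_rep_cls[OF cc_sqint[OF c]] by(simp add: inner_commute)
qed

text \<open>This linearises \<open>|s|^2 <= b * e\<close>: the right-hand side is affine in
  \<open>b\<close> and \<open>e\<close>, whose weak limits are known separately.\<close>

lemma two_inner_le_weighted:
 fixes c s :: "'a::real_inner"
 assumes "(norm s)^2 <= b * e" "0 <= b" "0 <= e" shows "2 * (c *. s) <= (norm c)^2 * b + e"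
proof -
 have n: "0 <= (norm c)^2 * b + e" using assms by simp
 have "(2 * (norm c * norm s))^2 <= 4 * (((norm c)^2 * b) * e)"
  using mult_left_mono[OF assms(1), of "(norm c)^2"] by(simp add: power_mult_distrib mult.assoc)
 also have "... <= ((norm c)^2 * b + e)^2"
  using zero_le_power2[of "(norm c)^2 * b - e"] unfolding power2_sum power2_diff by linarith
 finally have "2 * (norm c * norm s) <= (norm c)^2 * b + e" using n by(rule power2_le_imp_le)
 thus ?thesis using norm_cauchy_schwarz[of c s] by linarith
qed

context homogenized
begin

lemma pot_curl_free: "g : gradients U ==> inner (pot n h) (rot g) = 0"
 by(rule gradient_orthogonal_rot[OF pot_in])

lemma energy_limit: "local_test U \<phi> ==> (%n. inner (smul \<phi> (flx n h)) (pot n h)) ----> inner (smul \<phi> (S h)) (T h)"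
 by(rule div_curl[OF pot_curl_free pot_norm T_limit])

text \<open>Every term is the energy density, linear in potential or flux, or affine in
  \<open>b n\<close>, so each passes to the limit against a local test function. The limit density
  of \<open>b n\<close> is then replaced by its bound \<beta>, which needs
  \<open>0 <= j\<close>.\<close>

lemma limit_inequality:
 assumes n: "!!n. AEl x. 0 <= rep (flx n h) x *. rep (pot n h) x + l *. rep (pot n h) x + m *. rep (flx n h) x + (k + j * b n x)"
  and j: "0 <= j"
 shows "AE x\<in>U in lborel. 0 <= rep (S h) x *. rep (T h) x + l *. rep (T h) x + m *. rep (S h) x + (k + j * \<beta>)"
proof (rule AE_nonneg_of_local_test[OF U(1)])
 have iU: "L1 (%x. ind U x :: real)"
  using emeasure_bounded_finite[OF U(2)] by(intro integrable_real_indicator) auto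
 have "L1 (%x. ind U x * (c *. rep u x))" for c u
  using integrable_inner[OF sqint_trunc[OF U continuous_on_const[of UNIV c]] sqint_rep[of u]] by simp
 moreover have "L1 (%x. ind U x * (rep (S h) x *. rep (T h) x))"
  by(rule integral_weighted_inner(1)[of _ 1]) (auto simp: indicator_def)
 ultimately show "L1 (%x. ind U x * (rep (S h) x *. rep (T h) x + l *. rep (T h) x + m *. rep (S h) x + (k + j * \<beta>)))"
  using iU by(simp add: distrib_left)
 fix \<phi> :: "real^2 => real" assume \<phi>: "local_test U \<phi>" "!!x. 0 <= \<phi> x"
 obtain B where B: "!!x. abs (\<phi> x) <= B" using local_testD(4)[OF \<phi>(1)] by blast
 note cc = local_testD(2)[OF \<phi>(1)]
 note w = integral_weighted_inner[OF local_testD(3)[OF \<phi>(1)] B] integral_weighted_const[OF cc] cc_integrable[OF cc]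
 define \<Phi> where "\<Phi> s u = inner (smul \<phi> s) u + inner u (cls (%x. \<phi> x *R l)) + inner s (cls (%x. \<phi> x *R m))" for s u
 have \<Phi>: "(LI x. \<phi> x * (rep s x *. rep u x + l *. rep u x + m *. rep s x + (k + j * f x)))
   = \<Phi> s u + k * (LI x. \<phi> x) + j * (LI x. \<phi> x * f x)" if "L1 (%x. \<phi> x * f x)" for s u f
 proof -
  have "(%x. \<phi> x * (rep s x *. rep u x + l *. rep u x + m *. rep s x + (k + j * f x)))
    = (%x. \<phi> x * (rep s x *. rep u x) + \<phi> x * (l *. rep u x) + \<phi> x * (m *. rep s x) + (k * \<phi> x + j * (\<phi> x * f x)))"
   by(simp add: algebra_simps)
  thus ?thesis using w that by(simp add: \<Phi>_def)
 qed
 have "(%n. \<Phi> (flx n h) (pot n h) + k * (LI x. \<phi> x) + j * (LI x. \<phi> x * b n x))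
   ----> \<Phi> (S h) (T h) + k * (LI x. \<phi> x) + j * (LI x. \<phi> x * a x)"
  unfolding \<Phi>_def by(intro tendsto_intros energy_limit[OF \<phi>(1)] T_limit S_limit w(5) b_limit[OF cc])
 moreover have "0 <= \<Phi> (flx n h) (pot n h) + k * (LI x. \<phi> x) + j * (LI x. \<phi> x * b n x)" for n
  unfolding \<Phi>[OF scalar_b_integrable[OF cc], symmetric]
  by(rule integral_nonneg_AE) (use n[of n] \<phi>(2) in "auto elim!: eventually_mono intro!: mult_nonneg_nonneg")
 ultimately have "0 <= \<Phi> (S h) (T h) + k * (LI x. \<phi> x) + j * (LI x. \<phi> x * a x)" by(intro LIMSEQ_le_const) auto
 also have "... <= \<Phi> (S h) (T h) + k * (LI x. \<phi> x) + j * (LI x. \<phi> x * \<beta>)"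
  using mult_left_mono[OF scalar_a_bound(2)[OF cc \<phi>(2)] j] by(simp add: mult.commute)
 finally show "0 <= (LI x. \<phi> x * (rep (S h) x *. rep (T h) x + l *. rep (T h) x + m *. rep (S h) x + (k + j * \<beta>)))"
  using w by(simp add: \<Phi>)
qed measurable

text \<open>The convex term |u|^2 is replaced by its tangent \<open>2 c . u - |c|^2\<close>, which
  is linear in u; after the limit \<open>c\<close> is taken to be the value of
  \<open>T h\<close>.\<close>

lemma T_coercive: "AE x\<in>U in lborel. \<alpha> * (norm (rep (T h) x))^2 <= rep (S h) x *. rep (T h) x"
proof -
 have "AE x\<in>U in lborel. (ALL c. 0 <= rep (S h) x *. rep (T h) x + ((- 2 * \<alpha>) *R c) *. rep (T h) x + 0 *. rep (S h) x + (\<alpha> * (norm c)^2 + 0 * \<beta>))"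
 proof (intro AE_all_vectors limit_inequality)
  show "AEl x. 0 <= rep (flx n h) x *. rep (pot n h) x + ((- 2 * \<alpha>) *R c) *. rep (pot n h) x + 0 *. rep (flx n h) x + (\<alpha> * (norm c)^2 + 0 * b n x)" for n c
   using rep_flx_le(2)[of n h]
  proof eventually_elim
   case (elim x)
   have "\<alpha> * (2 * (c *. rep (pot n h) x)) <= \<alpha> * ((norm c)^2 + (norm (rep (pot n h) x))^2)"
    using two_inner_le[of c "rep (pot n h) x"] \<alpha> by(intro mult_left_mono) auto
   thus ?case using elim by(simp add: algebra_simps)
  qed
 qed (auto intro!: continuous_intros)
 thus ?thesis
 proof eventually_elim
  case (elim x)
  thus ?case by(auto dest!: spec[of _ "rep (T h) x"] simp: power2_norm_eq_inner)
 qed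
qed

text \<open>The linearised inequality with a constant \<open>c\<close> passes to the limit, and
  \<open>c = S h / \<beta>\<close> is then its optimal value.\<close>

lemma S_le: "AE x\<in>U in lborel. (norm (rep (S h) x))^2 <= \<beta> * (rep (S h) x *. rep (T h) x)"
proof -
 have "AE x\<in>U in lborel. (ALL c. 0 <= rep (S h) x *. rep (T h) x + 0 *. rep (T h) x + (- 2 *R c) *. rep (S h) x + (0 + (norm c)^2 * \<beta>))"
 proof (intro AE_all_vectors limit_inequality)
  show "AEl x. 0 <= rep (flx n h) x *. rep (pot n h) x + 0 *. rep (pot n h) x + (- 2 *R c) *. rep (flx n h) x + (0 + (norm c)^2 * b n x)" for n c
   using rep_flx_le[of n h]
  proof eventually_elim
   case (elim x)
   have "0 <= \<alpha> * (norm (rep (pot n h) x))^2" using \<alpha> by simp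
   hence "0 <= rep (flx n h) x *. rep (pot n h) x" using elim(2) by linarith
   from two_inner_le_weighted[OF elim(1) b_nonneg this, of c] show ?case by simp
  qed
 qed (auto intro!: continuous_intros)
 thus ?thesis
 proof eventually_elim
  case (elim x)
  thus ?case using \<beta>
   by(auto dest!: spec[of _ "(1 / \<beta>) *R rep (S h) x"] simp: power2_norm_eq_inner[symmetric] power_mult_distrib power2_eq_square field_simps)
 qed
qed

end

context homogenized
begin

lemma S_T_norm: "\<alpha> * (norm (T h))^2 <= inner (S h) (T h)" "(norm (S h))^2 <= \<beta> * inner (S h) (T h)"
proof -
 have s: "AEl x. x ~: U --> rep (T h) x = 0" "AEl x. x ~: U --> rep (S h) x = 0"
  using T_in[of h] gradients_supported[OF U(1)] S_supported[of h] by(auto simp: supported_def)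
 note i = integrable_inner[OF sqint_rep[of "S h"] sqint_rep[of "T h"]]
 have "\<alpha> * (norm (T h))^2 = (LI x. \<alpha> * (norm (rep (T h) x))^2)" by(simp add: norm_l2_sq)
 also have "... <= inner (S h) (T h)"
  unfolding inner_l2_def
  by(rule integral_mono_AE) (use i sqint_integrable[OF sqint_rep] T_coercive[of h] s(1) in "auto elim!: eventually_elim2")
 finally show "\<alpha> * (norm (T h))^2 <= inner (S h) (T h)" .
 have "(norm (S h))^2 = (LI x. (norm (rep (S h) x))^2)" by(rule norm_l2_sq)
 also have "... <= (LI x. \<beta> * (rep (S h) x *. rep (T h) x))"
  by(rule integral_mono_AE) (use i sqint_integrable[OF sqint_rep] S_le[of h] s(2) in "auto elim!: eventually_elim2")
 finally show "(norm (S h))^2 <= \<beta> * inner (S h) (T h)" by(simp add: inner_l2_def)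
qed

text \<open>\<open>T\<close> is coercive on gradients. As \<open>S h\<close> and \<open>h\<close>
  agree against gradients, |h|^2 is the inner product of \<open>S h\<close> and \<open>h\<close>, so
  |h| <= |S h|; and |S h|^2 is at most \<beta> times the inner product of \<open>h\<close> and
  \<open>T h\<close>. Lax-Milgram then solves \<open>T h = g\<close>.\<close>

lemma T_surj: assumes g: "g : gradients U" obtains h where "T h = g"
proof -
 have "bounded_linear T"
 proof (rule bounded_linear_intro[where K = "1 / \<alpha>"])
  show "T (h + k) = T h + T k" "T (c *R h) = c *R T h" for h k c
   by(rule linear_add[OF T_linear] linear_scale[OF T_linear])+
  show "norm (T h) <= norm h * (1 / \<alpha>)" for h
  proof -
   have "\<alpha> * (norm (T h))^2 <= inner h (T h)" using S_T_norm(1)[of h] S_inner[OF T_in] by simp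
   also have "... <= norm h * norm (T h)" by(rule norm_cauchy_schwarz)
   finally have "norm (T h) * (\<alpha> * norm (T h)) <= norm (T h) * norm h" by(simp add: power2_eq_square mult_ac)
   thus ?thesis using \<alpha> by(cases "T h = 0") (auto simp: mult_le_cancel_left field_simps)
  qed
 qed
 moreover have "1 / \<beta> * (norm h)^2 <= inner (T h) h" if h: "h : gradients U" for h
 proof -
  have "norm h * norm h = inner (S h) h" using S_inner[OF h, of h] by(simp add: power2_norm_eq_inner[symmetric] power2_eq_square)
  also have "... <= norm (S h) * norm h" by(rule norm_cauchy_schwarz)
  finally have "norm h <= norm (S h)" by(cases "h = 0") (auto simp: mult_le_cancel_right)
  hence "(norm h)^2 <= (norm (S h))^2" by(rule power_mono) simp
  also have "... <= \<beta> * inner (T h) h" using S_T_norm(2)[of h] S_inner[OF T_in, of h h] by(simp add: inner_commute)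
  finally show ?thesis using \<beta> by(simp add: field_simps)
 qed
 ultimately obtain h where h: "h : gradients U" "!!v. v : gradients U ==> inner (T h) v = inner g v"
  using Lax_Milgram[OF subspace_gradients[of U] closed_gradients, of T "1 / \<beta>" g] \<beta> by auto
 have "inner (T h - g) (T h - g) = 0"
  using h(2)[OF subspace_diff[OF subspace_gradients T_in g], of h] by(simp add: inner_diff_left)
 thus thesis by(intro that[of h]) simp
qed

end

text \<open>A linear function times a cutoff. Together with surjectivity of \<open>T\<close> this
  provides data whose limit gradient is a prescribed constant on \<open>V\<close>, and such data
  probe the limit flux.\<close>

lemma local_constant_gradients:
 assumes U: "open U" and z: "z : U"
 obtains V where "open V" "z : V" "V \<subseteq> U" "!!c. EX g:gradients U. AE x\<in>V in lborel. rep g x = c"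
proof -
 obtain r where r: "r > 0" "cball z r \<subseteq> U" using U z open_contains_cball by blast
 obtain \<eta> :: "nat => real^2 => real" where \<eta>: "\<eta> 0 : TF U" "!!x. x : cball z r ==> \<eta> 0 x = 1"
  by(rule cutoff_exists[OF compact_cball r(2) U]) blast
 have "EX g:gradients U. AEl x. x : ball z r --> rep g x = c" for c
 proof -
  have l: "((%x. x *. c) has_derivative (%v. c *. v)) (at x)" for x
   using bounded_linear_imp_has_derivative[OF bounded_linear_inner_left[of c]] by(simp add: inner_commute)
  have c: "c1c U (%x. \<eta> 0 x * (x *. c)) (%x. (x *. c) *R grad (\<eta> 0) x + \<eta> 0 x *R c)"
   by(rule c1c_mult[OF test_function_c1c[OF \<eta>(1)] l continuous_on_const])
  note s = cc_sqint[OF c1c_D(2)[OF c]]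
  have "(x *. c) *R grad (\<eta> 0) x + \<eta> 0 x *R c = c" if x: "x : ball z r" for x
  proof -
   have "(\<eta> 0 has_derivative (%v. 0)) (at x)"
    by(rule has_derivative_transform_within_open[OF has_derivative_const[of 1] open_ball x]) (use \<eta>(2) in auto)
   from grad_inner[OF this] have "grad (\<eta> 0) x *. v = 0" for v .
   hence "grad (\<eta> 0) x = 0" by(metis inner_eq_zero_iff)
   thus ?thesis using \<eta>(2)[of x] x by auto
  qed
  hence "AEl x. x : ball z r --> rep (cls (%x. (x *. c) *R grad (\<eta> 0) x + \<eta> 0 x *R c)) x = c"
   using rep_cls[OF s] by(auto elim!: eventually_mono)
  thus ?thesis using c1c_gradient_in[OF c U] by blast
 qed
 thus thesis using r by(intro that[of "ball z r"]) auto
qed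

definition columns :: "real^2 => real^2 => real^2^2" where
 "columns v w = (\<chi> i. v $ i *R axis 1 1 + w $ i *R axis 2 1)"

lemma columns_mult: "columns v w *v c = c $ 1 *R v + c $ 2 *R w"
 by(simp add: columns_def vec_eq_iff matrix_vector_mult_def sum_2 axis_def forall_2)

lemma measurable_columns[measurable]:
 assumes [measurable]: "f : borel_measurable M" "g : borel_measurable M"
 shows "(%x. columns (f x) (g x)) : borel_measurable M"
proof -
 have c: "continuous_on UNIV (%p::(real^2) \<times> (real^2). columns (fst p) (snd p))"
  unfolding columns_def by(intro continuous_intros)
 have "(%x. (f x, g x)) : borel_measurable M" by measurable
 from measurable_compose[OF this borel_measurable_continuous_onI[OF c]] show ?thesis by simp
qed

context homogenized
begin

text \<open>The columns are the limit fluxes of data whose limit gradients are the unit vectors on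
  \<open>V\<close>. By linearity, \<open>S_le\<close> for \<open>k\<close> minus a combination of
  these data gives \<open>|S k - A c| <= \<beta> |T k - c|\<close> for every constant
  \<open>c\<close>, and \<open>c = T k\<close> at the point \<open>x\<close> finishes.\<close>

lemma local_matrix:
 assumes z: "z : U"
 obtains V A where "open V" "z : V" "V \<subseteq> U" "A : borel_fun"
  "!!h. AE x\<in>V in lborel. rep (S h) x = A x *v rep (T h) x"
proof -
 obtain V where V: "open V" "z : V" "V \<subseteq> U" "!!c. EX g:gradients U. AE x\<in>V in lborel. rep g x = c"
  by(rule local_constant_gradients[OF U(1) z]) blast
 have "EX h. AE x\<in>V in lborel. rep (T h) x = c" for c using V(4)[of c] T_surj by metis
 then obtain h where h: "!!c. AE x\<in>V in lborel. rep (T (h c)) x = c" by metis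
 define s1 s2 where "s1 = h (axis 1 1)" and "s2 = h (axis 2 1)"
 define A where "A x = columns (rep (S s1) x) (rep (S s2) x)" for x
 have "AE x\<in>V in lborel. rep (S k) x = A x *v rep (T k) x" for k
 proof -
  have "AE x\<in>V in lborel. (ALL c. 0 <= (\<beta> * norm (rep (T k) x - c))^2 - (norm (rep (S k) x - A x *v c))\<^sup>2)"
  proof (rule AE_all_vectors)
   fix c :: "real^2"
   define w where "w = - c $ 1 *R s1 + - c $ 2 *R s2"
   have l: "L (k + w) = L k + (- c $ 1 *R L s1 + - c $ 2 *R L s2)" if "linear L" for L :: "l2 => l2"
    unfolding w_def by(simp only: linear_add[OF that] linear_scale[OF that])
   have r: "AEl x. rep (u + (- c $ 1 *R v + - c $ 2 *R w)) x = rep u x + (- c $ 1 *R rep v x + - c $ 2 *R rep w x)" for u v w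
    using rep_add[of u "- c $ 1 *R v + - c $ 2 *R w"] rep_add[of "- c $ 1 *R v" "- c $ 2 *R w"]
     rep_scaleR[of "- c $ 1" v] rep_scaleR[of "- c $ 2" w] by eventually_elim simp
   show "AE x\<in>V in lborel. 0 <= (\<beta> * norm (rep (T k) x - c))^2 - (norm (rep (S k) x - A x *v c))\<^sup>2"
    using S_le[of "k + w"] r[of "T k" "T s1" "T s2"] r[of "S k" "S s1" "S s2"] h[of "axis 1 1"] h[of "axis 2 1"]
    unfolding l[OF T_linear] l[OF S_linear] s1_def[symmetric] s2_def[symmetric]
   proof eventually_elim
    case (elim x)
    show ?case
    proof
     assume x: "x : V"
     have c: "c = c $ 1 *R axis 1 1 + c $ 2 *R axis 2 1" by(simp add: vec_eq_iff axis_def forall_2)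
     define u s where "u = rep (T k) x - c" and "s = rep (S k) x - A x *v c"
     have "u = rep (T k) x + (- c $ 1 *R axis 1 1 + - c $ 2 *R axis 2 1)" unfolding u_def by(subst c) simp
     moreover have "s = rep (S k) x + (- c $ 1 *R rep (S s1) x + - c $ 2 *R rep (S s2) x)"
     by(simp add: s_def A_def columns_mult)
     ultimately have "(norm s)^2 <= \<beta> * (s *. u)" using elim x V(3) by auto
     also have "... <= \<beta> * (norm s * norm u)" by(rule mult_left_mono[OF norm_cauchy_schwarz]) (use \<beta> in simp)
     finally have "norm s * norm s <= norm s * (\<beta> * norm u)" by(simp add: power2_eq_square mult_ac)
     hence "norm s <= \<beta> * norm u" using \<beta> by(cases "norm s = 0") (auto simp: mult_le_cancel_left)
     hence "(norm s)^2 <= (\<beta> * norm u)^2" by(rule power_mono) simp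
     thus "0 <= (\<beta> * norm (rep (T k) x - c))^2 - (norm (rep (S k) x - A x *v c))\<^sup>2" by(simp add: u_def s_def)
    qed
   qed
  qed (intro continuous_intros matrix_vector_mult_linear_continuous_on)
  thus ?thesis
  proof eventually_elim
   case (elim x)
   thus ?case by(auto dest!: spec[of _ "rep (T k) x"])
  qed
 qed
 moreover have "A : borel_fun" unfolding A_def by measurable
 ultimately show thesis using V by(intro that[of V A]) auto
qed

theorem homogenized_matrix:
 obtains A where "A : borel_fun" "!!x c. \<alpha> * (norm c)^2 <= (A x *v c) *. c"
  "!!x c. (norm (A x *v c))^2 <= \<beta> * ((A x *v c) *. c)"
  "!!h. AE x\<in>U in lborel. rep (S h) x = A x *v rep (T h) x"
proof -
 define fits where "fits V A \<longleftrightarrow> A : borel_fun & (ALL h. AE x\<in>V in lborel. rep (S h) x = A x *v rep (T h) x)" for V A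
 define F where "F = {V. open V & V \<subseteq> U & (EX A. fits V A)}"
 obtain F' where F': "F' \<subseteq> F" "countable F'" "\<Union>F' = \<Union>F" by(rule Lindelof[of F]) (auto simp: F_def)
 have "fits {} (%x. 0)" by(simp add: fits_def)
 hence "{} : F" by(auto simp: F_def)
 have UF: "U \<subseteq> \<Union>F"
 proof
  fix z assume "z : U"
  then obtain V A where V: "open V" "z : V" "V \<subseteq> U" "A : borel_fun"
   "!!h. AE x\<in>V in lborel. rep (S h) x = A x *v rep (T h) x" by(rule local_matrix) blast
  hence "V : F" by(auto simp: fits_def F_def)
  thus "z : \<Union>F" using V by blast
 qed
 define V where "V = from_nat_into (insert {} F')"
 have V: "V k : F" for k
 proof -
  have "V k : insert {} F'" unfolding V_def by(rule from_nat_into) simp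
  thus ?thesis using F'(1) \<open>{} : F\<close> by auto
 qed
 have rV: "range V = insert {} F'" unfolding V_def by(rule range_from_nat_into) (use F'(2) in auto)
 have "ALL k. EX A. fits (V k) A" using V by(auto simp: F_def)
 from choice[OF this] obtain A where A: "!!k. fits (V k) (A k)" by blast
 have [measurable]: "A k : borel_fun" "V k : sets borel" for k using A[of k] V[of k] by(simp_all add: fits_def F_def)
 \<comment> \<open>The first index of a countable cover that contains \<open>x\<close>, so that the
   glued matrix is Borel.\<close>
 define A0 where "A0 x = A (LEAST k. x : V k) x" for x
 have A0[measurable]: "A0 : borel_fun" unfolding A0_def by measurable
 have fit: "AE x\<in>U in lborel. rep (S h) x = A0 x *v rep (T h) x" for h
 proof -
  have "AEl x. ALL k. x : V k --> rep (S h) x = A k x *v rep (T h) x"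
   using A by(subst AE_all_countable) (auto simp: fits_def)
  thus ?thesis
  proof eventually_elim
   case (elim x)
   show ?case
   proof
    assume "x : U"
    hence "x : \<Union>(range V)" using UF F'(3) rV by auto
    hence "x : V (LEAST k. x : V k)" by(auto intro: LeastI)
    thus "rep (S h) x = A0 x *v rep (T h) x" using elim unfolding A0_def by blast
   qed
  qed
 qed
 define f where "f x c = min ((A0 x *v c) *. c - \<alpha> * (norm c)^2) (\<beta> * ((A0 x *v c) *. c) - (norm (A0 x *v c))\<^sup>2)" for x c
 have "AE x\<in>U in lborel. (ALL c. 0 <= f x c)"
 proof (rule AE_all_vectors)
  show "continuous_on UNIV (f x)" for x
   unfolding f_def by(intro continuous_intros matrix_vector_mult_linear_continuous_on)
  fix c
  show "AE x\<in>U in lborel. 0 <= f x c"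
  proof (rule AE_local)
   fix z assume "z : U"
   then obtain W where W: "open W" "z : W" "W \<subseteq> U" "!!c. EX g:gradients U. AE x\<in>W in lborel. rep g x = c"
    by(rule local_constant_gradients[OF U(1)]) blast
   obtain g where g: "g : gradients U" "AE x\<in>W in lborel. rep g x = c" using W(4) by blast
   obtain h where h: "T h = g" using T_surj[OF g(1)] by blast
   have "AE x\<in>W in lborel. 0 <= f x c"
    using T_coercive[of h] S_le[of h] fit[of h] g(2) unfolding h
   proof eventually_elim
    case (elim x)
    show ?case
    proof
     assume "x : W"
     with W(3) have x: "x : U" "rep g x = c" "rep (S h) x = A0 x *v rep g x" using elim by auto
     show "0 <= f x c" using elim(1,2) x unfolding f_def by simp
    qed
   qed
   thus "EX V. open V & z : V & (AE x\<in>V in lborel. 0 <= f x c)" using W by blast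
  qed
 qed
 then obtain N where N: "{x : space lborel. \<not> (x : U --> (ALL c. 0 <= f x c))} \<subseteq> N" "emeasure lborel N = 0" "N : sets lborel" by(rule AE_E)
 have [measurable]: "N : sets borel" using N(3) by simp
 \<comment> \<open>Outside \<open>U\<close> and on the exceptional null set the default is \<alpha>
   times the identity; it satisfies the upper bound because
   \<open>\<alpha> <= \<beta>\<close>.\<close>
 define A' where "A' x = (if x : U - N then A0 x else \<alpha> *R mat 1)" for x
 have scal: "(\<alpha> *R mat 1 :: real^2^2) *v c = \<alpha> *R c" for c by(simp add: scaleR_matrix_vector_assoc[symmetric])
 have "\<alpha> * (norm c)^2 <= (A' x *v c) *. c & (norm (A' x *v c))^2 <= \<beta> * ((A' x *v c) *. c)" for x c
 proof (cases "x : U - N")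
  case True
  hence "0 <= f x c" using N(1) by auto
  thus ?thesis using True by(simp add: A'_def f_def)
 next
  case False
  have "(\<alpha> * norm c)^2 <= \<beta> * (\<alpha> * (norm c)^2)"
   using mult_right_mono[OF \<alpha>_le_\<beta>, of "\<alpha> * (norm c)^2"] \<alpha> by(simp add: power2_eq_square mult_ac)
  moreover have "A' x = \<alpha> *R mat 1" unfolding A'_def by(rule if_not_P[OF False])
  ultimately show ?thesis using \<alpha> by(simp add: scal power2_norm_eq_inner[symmetric])
 qed
 moreover have "AE x\<in>U in lborel. rep (S h) x = A' x *v rep (T h) x" for h
  using fit[of h] AE_not_in[OF null_setsI[OF N(2,3)]] by eventually_elim (simp add: A'_def)
 moreover have "A' : borel_fun" unfolding A'_def by measurable
 ultimately show thesis by(intro that[of A']) auto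
qed

end

section \<open>Perturbation by antisymmetric terms\<close>

text \<open>A rotated gradient is divergence free and bounded in L^2, so the general lemma applies
  with the constant weight 1.\<close>

lemma rotated_div_curl:
 assumes U: "open U" "bounded U" and u: "!!n. u n : gradients U" "!!n. norm (u n) <= C" "!!v. (%n. inner (u n) v) ----> inner u' v"
  and G: "!!n g. g : gradients U ==> inner (G n) (rot g) = 0" "!!n. norm (G n) <= C" "!!v. (%n. inner (G n) v) ----> inner G' v"
  and \<phi>: "local_test U \<phi>"
 shows "(%n. inner (smul \<phi> (rot (u n))) (G n)) ----> inner (smul \<phi> (rot u')) G'"
proof -
 have u': "u' : gradients U" by(rule weak_limit_in_closed_subspace[OF subspace_gradients closed_gradients u(1,3)])
 have supp: "rot g : supported U" "inner (rot g) g' = 0" if "g : gradients U" "g' : gradients U" for g g'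
  using mul_supported[OF bounded_field_J] gradients_supported[OF U(1)] gradient_orthogonal_rot[OF that(2,1)] that
  by(auto simp: inner_commute)
 define e where "e n x = (norm (rep (u n) x))^2" for n x
 define K where "K = max 1 (max (LI x. ind U x) (C^2))"
 have iU: "L1 (%x. ind U x :: real)"
  using U emeasure_bounded_finite[OF U(2)] by(intro integrable_real_indicator) auto
 show ?thesis
 proof (rule div_curl_limit[OF U, where b = "%n x. 1" and e = e and K = K])
  show "rot (u n) : supported U" "rot u' : supported U" for n using supp(1) u(1) u' by blast+
  show "inner (rot (u n)) g = inner (rot u') g" if "g : gradients U" for n g
   using supp(2)[OF u(1) that] supp(2)[OF u' that] by simp
  show "L1 (e n)" "0 <= e n x" for n x unfolding e_def by(auto intro: sqint_integrable[OF sqint_rep])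
  show "(LI x. e n x) <= K" for n
   using power_mono[OF u(2) norm_ge_zero, of n 2] by(simp add: e_def K_def norm_l2_sq[symmetric])
  show "AEl x. (norm (rep (rot (u n)) x))^2 <= 1 * e n x" for n
   using rep_rot[of "u n"] by eventually_elim (simp add: e_def)
  show "(ALL n::nat. L1 (%x. \<psi> x * 1)) & (EX L. (%n. LI x. \<psi> x * 1) ----> L & L <= K * (LI x. \<psi> x))"
   if \<psi>: "cc U \<psi>" "!!x. 0 <= \<psi> x" for \<psi>
   using mult_right_mono[of 1 K "LI x. \<psi> x"] cc_integrable[OF \<psi>(1)] \<psi>(2)
   by(auto simp: K_def Lint_nonneg intro!: exI[of _ "LI x. \<psi> x"])
  show "(%n. inner (rot (u n)) v) ----> inner (rot u') v" for v
   using tendsto_minus[OF u(3)[of "rot v"]] by(simp add: inner_rot)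
 qed (use G \<phi> iU in "auto simp: K_def")
qed

text \<open>An L^2 bound allows passing from continuous test fields to all of L^2 by density. It
  serves for \<open>rn\<close> times the fluxes, which are first known to vanish only against
  \<open>fields U\<close>.\<close>

lemma weakly_null_supported:
 assumes U: "open U" and x: "!!n. x n : supported U" "!!n. norm (x n) <= C"
  "!!v. v : fields U ==> (%n. inner (x n) v) ----> 0"
 shows "(%n. inner (x n) v) ----> 0"
proof -
 have bU: "U : sets borel" using U by simp
 have "(%n. inner (x n) (restr U v)) ----> inner 0 (restr U v)"
  by(rule subspace_closure_tendsto_inner[of "fields U" _ _ C])
   (use x in "auto simp: closure_fields[OF U] restr_supported[OF bU]")
 thus ?thesis by(simp add: inner_restr[OF bU x(1)])
qed

lemma inner_smul_rot_self:
 assumes "\<phi> : borel_fun" "!!x. abs (\<phi> x) <= B" shows "inner (smul \<phi> (rot u)) u = 0"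
proof -
 have "(LI x. \<phi> x * (rep (rot u) x *. rep u x)) = (LINT x::real^2|lborel. 0)"
 proof (rule Lint_cong_AE)
  show "AEl x. \<phi> x * (rep (rot u) x *. rep u x) = 0"
   using rep_rot[of u]
  proof eventually_elim
   case (elim x)
   have "rep (rot u) x *. rep u x = 0" unfolding elim using inner_J(4)[of "rep u x"] inner_commute[of "rep u x"] by metis
   thus ?case by simp
  qed
 qed (use assms(1) in measurable)
 thus ?thesis by(simp add: inner_smul[OF assms])
qed

text \<open>Minty's trick for a matrix: the choice \<open>c = v + t d\<close> with
  \<open>d = s - C v\<close> gives \<open>|d|^2 <= t (C d . d)\<close>, and t tends to zero.\<close>

lemma Minty_pointwise:
 fixes C :: "real^2^2"
 assumes "!!c. 0 <= (s - C *v c) *. (v - c)" shows "s = C *v v"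
proof -
 define d where "d = s - C *v v"
 define m where "m = abs ((C *v d) *. d)"
 have m: "m >= 0" by(simp add: m_def)
 have le: "d *. d <= t * m" if t: "t > 0" for t
 proof -
  have "0 <= (d - t *R (C *v d)) *. (- t *R d)"
   using assms[of "v + t *R d"] by(simp add: d_def matrix_vector_right_distrib matrix_vector_mult_scaleR algebra_simps)
  hence "0 <= t * (t * ((C *v d) *. d) - d *. d)" by(simp add: inner_diff_left algebra_simps)
  hence "d *. d <= t * ((C *v d) *. d)" using t by(simp add: zero_le_mult_iff)
  also have "... <= t * m" unfolding m_def using t by simp
  finally show ?thesis .
 qed
 have "d *. d <= 0"
 proof (rule field_le_epsilon)
  fix e :: real assume e: "e > 0"
  have "d *. d <= e / (m + 1) * m" by(rule le) (use e m in "auto intro!: divide_pos_pos")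
  also have "... <= e" using e m by(simp add: field_simps)
  finally show "d *. d <= 0 + e" by simp
 qed
 hence "d = 0" using inner_ge_zero[of d] by(metis inner_eq_zero_iff order_antisym)
 thus ?thesis by(simp add: d_def)
qed

text \<open>\<open>relation\<close> states without inverses that \<open>N n\<close> is the inverse
  of \<open>(pn M + qn J)^-1 + rn J\<close>: applying \<open>pn M + qn J\<close> to
  \<open>\<xi> - rn J N \<xi>\<close> gives \<open>N \<xi>\<close>.\<close>

locale perturbation = A: homogenized U M b a \<alpha> K \<beta> T S + B: homogenized U N b2 a2 \<alpha>2 K2 \<beta>2 T2 S2
 for U M b a \<alpha> K \<beta> T S N b2 a2 \<alpha>2 K2 \<beta>2 T2 S2 +
 fixes pn qn rn :: "nat => real" and p q p0 R :: real
 assumes relation: "!!n x \<xi>. N n x *v \<xi> = pn n *R (M n x *v (\<xi> - rn n *R (J *v (N n x *v \<xi>))))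
   + qn n *R (J *v (\<xi> - rn n *R (J *v (N n x *v \<xi>))))"
  and limits: "pn ----> p" "qn ----> q" "rn ----> 0" and p0: "0 < p0" "!!n. p0 <= pn n"
  and R: "!!n x \<xi>. abs (rn n) * norm (M n x *v \<xi>) <= R * norm \<xi>"
begin

text \<open>\<open>rotated n h\<close> is the image of the flux of the perturbed problem under the inverse of \<open>pn n M n + qn n J\<close>;
 it is a gradient up to the strongly vanishing field \<open>- rn n rot h\<close>.\<close>

definition rotated :: "nat => l2 => l2" where
 "rotated n h = B.pot n h - rn n *R rot (B.flx n h)"

lemma rep_rotated:
 "AEl x. rep (rotated n h) x = rep (B.pot n h) x - rn n *R (J *v rep (B.flx n h) x)"
 unfolding rotated_def
 using rep_minus[of "B.pot n h" "rn n *R rot (B.flx n h)"] rep_scaleR[of "rn n" "rot (B.flx n h)"] rep_rot[of "B.flx n h"]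
 by eventually_elim simp

lemma rep_B_flx:
 "AEl x. rep (B.flx n h) x = pn n *R (M n x *v rep (rotated n h) x) + qn n *R (J *v rep (rotated n h) x)"
 using B.rep_flx[of n h] rep_rotated[of n h]
proof eventually_elim
 case (elim x)
 show ?case unfolding elim(2) unfolding elim(1) by(rule relation)
qed

text \<open>The rotation drops out twice. The term \<open>qn J\<close> does not contribute to the
  coercivity of \<open>pn M + qn J\<close>, and the flux is orthogonal to its own rotation, so its
  pairing with \<open>rotated n h\<close> is the energy of the perturbed problem.\<close>

lemma rotated_norm: obtains C where "!!n. norm (rotated n h) <= C" "C >= 0"
proof -
 have "norm (rotated n h) <= norm h / sqrt (p0 * \<alpha> * \<alpha>2)" for n
 proof -
  have "p0 * \<alpha> * (norm (rotated n h))^2 = (LI x. p0 * \<alpha> * (norm (rep (rotated n h) x))^2)" by(simp add: norm_l2_sq)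
  also have "... <= (LI x. rep (B.flx n h) x *. rep (rotated n h) x)"
  proof (rule integral_mono_AE)
   show "AEl x. p0 * \<alpha> * (norm (rep (rotated n h) x))^2 <= rep (B.flx n h) x *. rep (rotated n h) x"
    using rep_B_flx[of n h]
   proof eventually_elim
    case (elim x)
    let ?g = "rep (rotated n h) x"
    have "p0 * \<alpha> * (norm ?g)^2 <= pn n * (\<alpha> * (norm ?g)^2)"
     using mult_right_mono[OF p0(2)[of n], of "\<alpha> * (norm ?g)^2"] A.\<alpha> by(simp add: mult.assoc)
    also have "... <= pn n * ((M n x *v ?g) *. ?g)" by(rule mult_left_mono[OF A.M_coercive]) (use p0(1) p0(2)[of n] in linarith)
    also have "... = rep (B.flx n h) x *. ?g" using inner_J(4)[of ?g] inner_commute[of "J *v ?g" ?g] unfolding elim by(simp add: inner_add_left)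
    finally show ?case .
   qed
  qed (simp_all add: sqint_integrable integrable_inner)
  also have "... = inner (B.flx n h) (rotated n h)" by(simp add: inner_l2_def)
  also have "... = inner (B.flx n h) (B.pot n h)" 
  proof -
   have "inner (B.flx n h) (rot (B.flx n h)) = 0"
    using inner_rot[of "B.flx n h" "B.flx n h"] inner_commute[of "rot (B.flx n h)" "B.flx n h"] by linarith
   thus ?thesis by(simp add: rotated_def inner_diff_right)
  qed
  also have "... <= (norm h)^2 / \<alpha>2" by(rule flux_energy(2)[OF B.coercive B.\<alpha>])
  finally have "(norm (rotated n h))^2 <= (norm h)^2 / (p0 * \<alpha> * \<alpha>2)" using p0 A.\<alpha> B.\<alpha> by(simp add: field_simps)
  also have "... = (norm h / sqrt (p0 * \<alpha> * \<alpha>2))^2" using p0 A.\<alpha> B.\<alpha> by(simp add: power_divide)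
  finally show ?thesis by(rule power2_le_imp_le) (use p0 A.\<alpha> B.\<alpha> in simp)
 qed
 thus thesis by(rule that) (use p0 A.\<alpha> B.\<alpha> in simp)
qed

text \<open>Against \<open>rot g\<close> with \<open>g\<close> a gradient, the term
  \<open>rn rot (flux)\<close> pairs like \<open>rn\<close> times the flux with \<open>g\<close>,
  that is, like \<open>rn h\<close> with \<open>g\<close>. Adding \<open>rn rot h\<close> cancels
  it, so \<open>corrected n h\<close> is exactly curl free, as the div-curl lemma requires.\<close>

definition corrected :: "nat => l2 => l2" where "corrected n h = rotated n h + rn n *R rot h"

lemma corrected_curl_free: assumes "g : gradients U" shows "inner (corrected n h) (rot g) = 0"
 using gradient_orthogonal_rot[OF B.pot_in assms] B.flx_inner[OF assms, of n h]
 by(simp add: corrected_def rotated_def inner_add_left inner_diff_left inner_rot_rot)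

lemma rn_bounded: obtains r where "!!n. abs (rn n) <= r" "r >= 0"
proof -
 have "Bseq rn" using limits(3) by(intro convergent_imp_Bseq) (auto simp: convergent_def)
 then obtain r where "r > 0" "!!n. norm (rn n) <= r" by(auto simp: Bseq_def)
 thus thesis by(intro that[of r]) auto
qed

lemma corrected_norm: obtains C where "!!n. norm (corrected n h) <= C"
proof -
 obtain C where C: "!!n. norm (rotated n h) <= C" by(rule rotated_norm) blast
 obtain r where r: "!!n. abs (rn n) <= r" by(rule rn_bounded) blast
 have "norm (corrected n h) <= C + r * norm (rot h)" for n
  using norm_triangle_le[of "rotated n h" "rn n *R rot h" "C + r * norm (rot h)"] C[of n] mult_right_mono[OF r[of n], of "norm (rot h)"]
  by(simp add: corrected_def)
 thus thesis by(rule that)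
qed

text \<open>The L^2 bound is free of assumptions on the perturbed matrices: up to a rotation this
  field is the difference of \<open>pot\<close> and \<open>rotated\<close>, both bounded.\<close>

lemma rn_B_flx: "(%n. inner (rn n *R B.flx n h) v) ----> 0"
proof -
 have supp: "rn n *R B.flx n h : supported U" for n
  by(rule subspace_scale[OF subspace_supported B.flx_supported]) simp
 obtain C where C: "!!n. norm (rotated n h) <= C" by(rule rotated_norm) blast
 have n: "norm (rot u) = norm u" for u by(simp add: norm_eq_sqrt_inner inner_rot_rot)
 have "rn n *R rot (B.flx n h) = B.pot n h - rotated n h" for n by(simp add: rotated_def)
 hence bound: "norm (rn n *R B.flx n h) <= norm h / \<alpha>2 + C" for n
  using norm_triangle_ineq4[of "B.pot n h" "rotated n h"] C[of n] B.pot_norm[of U n h] by(metis add_mono n norm_scaleR order_trans)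
 have weak: "(%n. inner (rn n *R B.flx n h) v) ----> 0" if "v : fields U" for v
  using tendsto_mult[OF limits(3) B.S_limit[OF that, of h]] by simp
 show ?thesis by(rule weakly_null_supported[OF A.U(1) supp bound weak])
qed

text \<open>Here the L^2 bound comes from the uniform bound on \<open>rn M n\<close>.\<close>

lemma rn_A_flx: "(%n. inner (rn n *R A.flx n h) v) ----> 0"
proof -
 have "rn n *R A.flx n h : supported U" for n
  by(rule subspace_scale[OF subspace_supported A.flx_supported]) simp
 moreover have "norm (rn n *R A.flx n h) <= abs R * (norm h / \<alpha>)" for n
 proof -
  obtain B where B: "bounded_field B (M n)" by(rule A.M_bounded)
  have "bounded_field \<bar>R\<bar> (%x. rn n *R M n x)"
   using order_trans[OF R mult_right_mono[OF abs_ge_self norm_ge_zero]] bounded_field_measurable[OF B]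
   by(simp add: bounded_field_def scaleR_matrix_vector_assoc[symmetric])
  hence "norm (mul (%x. rn n *R M n x) (A.pot n h)) <= abs R * norm (A.pot n h)" by(rule norm_mul_le)
  moreover have "mul (%x. rn n *R M n x) (A.pot n h) = rn n *R A.flx n h"
   by(simp add: flux_def mul_def cls_scaleR[OF sqint_mul[OF B sqint_rep]] scaleR_matrix_vector_assoc[symmetric])
  ultimately show ?thesis using mult_left_mono[OF A.pot_norm[of U n h], of "abs R"] by simp
 qed
 moreover have "(%n. inner (rn n *R A.flx n h) v) ----> 0" if "v : fields U" for v
  using tendsto_mult[OF limits(3) A.S_limit[OF that, of h]] by simp
 ultimately show ?thesis by(rule weakly_null_supported[OF A.U(1)])
qed

lemma rotated_limit: "(%n. inner (rotated n h) v) ----> inner (T2 h) v"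
proof -
 have "inner (rotated n h) v = inner (B.pot n h) v + inner (rn n *R B.flx n h) (rot v)" for n
  by(simp add: rotated_def inner_diff_left inner_rot)
 thus ?thesis using tendsto_add[OF B.T_limit[of h v] rn_B_flx[of h "rot v"]] by simp
qed

lemma corrected_limit: "(%n. inner (corrected n h) v) ----> inner (T2 h) v"
 using tendsto_add[OF rotated_limit[of h v] tendsto_mult_left_zero[OF limits(3), of "inner (rot h) v"]]
 by(simp add: corrected_def inner_add_left)

text \<open>Div-curl applies to \<open>corrected\<close>. The difference is \<open>rn rot h\<close>,
  and moving the factor \<open>rn\<close> onto the flux produces a sequence that vanishes
  weakly.\<close>

lemma A_flx_rotated_limit:
 assumes \<phi>: "local_test U \<phi>"
 shows "(%n. inner (smul \<phi> (A.flx n k)) (rotated n h)) ----> inner (smul \<phi> (S k)) (T2 h)"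
proof -
 obtain B where B: "!!x. abs (\<phi> x) <= B" using local_testD(4)[OF \<phi>] by blast
 obtain C where C: "!!n. norm (corrected n h) <= C" by(rule corrected_norm) blast
 have "inner (smul \<phi> (A.flx n k)) (rotated n h)
   = inner (smul \<phi> (A.flx n k)) (corrected n h) - inner (rn n *R A.flx n k) (smul \<phi> (rot h))" for n
  by(simp add: corrected_def inner_add_right inner_smul_commute[OF local_testD(3)[OF \<phi>] B, of "A.flx n k" "rot h"])
 thus ?thesis
  using tendsto_diff[OF A.div_curl[OF corrected_curl_free C corrected_limit \<phi>] rn_A_flx[of k "smul \<phi> (rot h)"]] by simp
qed

lemma A_pot_rotated_limit:
 assumes \<phi>: "local_test U \<phi>"
 shows "(%n. inner (smul \<phi> (rot (A.pot n k))) (rotated n h)) ----> inner (smul \<phi> (rot (T k))) (T2 h)"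
proof -
 obtain B where B: "!!x. abs (\<phi> x) <= B" using local_testD(4)[OF \<phi>] by blast
 obtain C where C: "!!n. norm (corrected n h) <= C" by(rule corrected_norm) blast
 define C' where "C' = max C (norm k / \<alpha>)"
 have C': "norm (corrected n h) <= C'" "norm (A.pot n k) <= C'" for n
  using C[of n] A.pot_norm[of U n k] by(auto simp: C'_def)
 have "inner (smul \<phi> (rot (A.pot n k))) (rotated n h)
   = inner (smul \<phi> (rot (A.pot n k))) (corrected n h) - rn n * inner (A.pot n k) (- rot (smul \<phi> (rot h)))" for n
  by(simp add: corrected_def inner_add_right inner_smul_commute[OF local_testD(3)[OF \<phi>] B, of "rot (A.pot n k)" "rot h"] inner_rot)
 moreover have "(%n. rn n * inner (A.pot n k) (- rot (smul \<phi> (rot h)))) ----> 0"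
  using tendsto_mult[OF limits(3) A.T_limit[of k "- rot (smul \<phi> (rot h))"]] by simp
 ultimately show ?thesis
  using tendsto_diff[OF rotated_div_curl[OF A.U A.pot_in C'(2) A.T_limit corrected_curl_free C'(1) corrected_limit \<phi>]] by fastforce
qed

text \<open>Monotonicity of \<open>pn M + qn J\<close> is applied to the difference of
  \<open>rotated n h\<close> and the potential of the first problem. In the expansion, the flux
  against \<open>rotated\<close> may be replaced by the flux against \<open>pot\<close>, as they
  differ by a pairing of the flux with its own rotation. Every remaining term is a product to which
  a div-curl argument applies.\<close>

lemma monotone_limit:
 assumes \<phi>: "local_test U \<phi>" "!!x. 0 <= \<phi> x"
 shows "0 <= inner (smul \<phi> (S2 h - (p *R S k + q *R rot (T k)))) (T2 h - T k)"
proof -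
 let ?F = "%n. B.flx n h - (pn n *R A.flx n k + qn n *R rot (A.pot n k))" and ?S = "S2 h - (p *R S k + q *R rot (T k))"
 note m = local_testD(3)[OF \<phi>(1)]
 obtain B where B: "!!x. abs (\<phi> x) <= B" using local_testD(4)[OF \<phi>(1)] by blast
 interpret sm: bounded_linear "smul \<phi>" by(rule bounded_linear_mul[OF bounded_field_scalar[OF m B]])
 note z = inner_smul_rot_self[OF m B]
 define \<Phi> where "\<Phi> n = inner (smul \<phi> (B.flx n h)) (B.pot n h) - inner (smul \<phi> (B.flx n h)) (A.pot n k)
  - pn n * inner (smul \<phi> (A.flx n k)) (rotated n h) - qn n * inner (smul \<phi> (rot (A.pot n k))) (rotated n h)
  + pn n * inner (smul \<phi> (A.flx n k)) (A.pot n k)" for n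
 have "\<Phi> ----> inner (smul \<phi> (S2 h)) (T2 h) - inner (smul \<phi> (S2 h)) (T k)
  - p * inner (smul \<phi> (S k)) (T2 h) - q * inner (smul \<phi> (rot (T k))) (T2 h) + p * inner (smul \<phi> (S k)) (T k)"
  unfolding \<Phi>_def
  by(intro tendsto_intros limits B.energy_limit[OF \<phi>(1)] A.energy_limit[OF \<phi>(1)] A_flx_rotated_limit[OF \<phi>(1)]
    A_pot_rotated_limit[OF \<phi>(1)] B.div_curl[OF A.pot_curl_free A.pot_norm A.T_limit \<phi>(1)])
 also have "inner (smul \<phi> (S2 h)) (T2 h) - inner (smul \<phi> (S2 h)) (T k)
  - p * inner (smul \<phi> (S k)) (T2 h) - q * inner (smul \<phi> (rot (T k))) (T2 h) + p * inner (smul \<phi> (S k)) (T k)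
  = inner (smul \<phi> ?S) (T2 h - T k)"
  using z[of "T k"] by(simp add: sm.diff sm.add sm.scaleR inner_diff_left inner_diff_right inner_add_left)
 finally have lim: "\<Phi> ----> inner (smul \<phi> ?S) (T2 h - T k)" .
 have "0 <= \<Phi> n" for n
 proof -
  have zf: "inner (smul \<phi> (B.flx n h)) (rot (B.flx n h)) = 0"
   using z[of "B.flx n h"] inner_smul_commute[OF m B, of "B.flx n h" "rot (B.flx n h)"] by(simp add: inner_commute)
  have "\<Phi> n = inner (smul \<phi> (?F n)) (rotated n h - A.pot n k)"
   using z[of "A.pot n k"] zf
   by(simp add: \<Phi>_def sm.diff sm.add sm.scaleR inner_diff_left inner_diff_right inner_add_left)
    (simp add: rotated_def inner_diff_right)
  also have "... = (LI x. \<phi> x * (rep (?F n) x *. rep (rotated n h - A.pot n k) x))"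
   by(rule inner_smul[OF m B])
  also have "... >= 0"
  proof (rule integral_nonneg_AE)
   show "AEl x. 0 <= \<phi> x * (rep (?F n) x *. rep (rotated n h - A.pot n k) x)"
    using rep_minus[of "B.flx n h" "pn n *R A.flx n k + qn n *R rot (A.pot n k)"]
     rep_add[of "pn n *R A.flx n k" "qn n *R rot (A.pot n k)"] rep_scaleR[of "pn n" "A.flx n k"]
     rep_scaleR[of "qn n" "rot (A.pot n k)"] rep_rot[of "A.pot n k"] A.rep_flx[of n k] rep_B_flx[of n h]
     rep_minus[of "rotated n h" "A.pot n k"]
   proof eventually_elim
    case (elim x)
    define d where "d = rep (rotated n h) x - rep (A.pot n k) x"
    have "rep (?F n) x = pn n *R (M n x *v d) + qn n *R (J *v d)"
     using elim by(simp add: d_def matrix_vector_mult_diff_distrib algebra_simps)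
    moreover have "(J *v d) *. d = 0" using inner_J(4)[of d] inner_commute[of d] by metis
    moreover have "0 <= pn n" using p0(1) p0(2)[of n] by linarith
    ultimately show ?case
     using elim(8) A.M_nonneg[of n x d] \<phi>(2)[of x] by(simp add: d_def[symmetric] inner_add_left)
   qed
  qed
  finally show ?thesis .
 qed
 thus ?thesis using lim by(intro LIMSEQ_le_const) auto
qed

text \<open>The datum \<open>k\<close> is chosen with \<open>T k\<close> equal to a constant
  \<open>c\<close> on \<open>V\<close>, which turns the limit of the monotonicity inequality into
  the hypothesis of \<open>Minty_pointwise\<close>.\<close>

theorem perturbed_flux:
 assumes fit: "!!h. AE x\<in>U in lborel. rep (S h) x = A' x *v rep (T h) x"
 shows "AE x\<in>U in lborel. rep (S2 h) x = (p *R A' x + q *R J) *v rep (T2 h) x"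
proof (rule AE_local)
 fix z assume "z : U"
 then obtain V where V: "open V" "z : V" "V \<subseteq> U" "!!c. EX g:gradients U. AE x\<in>V in lborel. rep g x = c"
  by(rule local_constant_gradients[OF A.U(1)]) blast
 have "AE x\<in>V in lborel. (ALL c. 0 <= (rep (S2 h) x - (p *R A' x + q *R J) *v c) *. (rep (T2 h) x - c))"
 proof (rule AE_all_vectors)
  fix c
  obtain g where g: "g : gradients U" "AE x\<in>V in lborel. rep g x = c" using V(4) by blast
  obtain k where k: "T k = g" by(rule A.T_surj[OF g(1)])
  define s u where "s = S2 h - (p *R S k + q *R rot (T k))" and "u = T2 h - T k"
  have "AE x\<in>U in lborel. 0 <= rep s x *. rep u x"
  proof (rule AE_nonneg_of_local_test[OF A.U(1)])
   show "L1 (%x. ind U x * (rep s x *. rep u x))"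
    by(rule integral_weighted_inner(1)[of _ 1]) (auto simp: indicator_def)
   fix \<phi> :: "real^2 => real" assume \<phi>: "local_test U \<phi>" "!!x. 0 <= \<phi> x"
   obtain B where B: "!!x. abs (\<phi> x) <= B" using local_testD(4)[OF \<phi>(1)] by blast
   show "0 <= (LI x. \<phi> x * (rep s x *. rep u x))"
    using monotone_limit[OF \<phi>, of h k] by(simp add: integral_weighted_inner(2)[OF local_testD(3)[OF \<phi>(1)] B] s_def u_def)
  qed measurable
  thus "AE x\<in>V in lborel. 0 <= (rep (S2 h) x - (p *R A' x + q *R J) *v c) *. (rep (T2 h) x - c)"
   using rep_minus[of "S2 h" "p *R S k + q *R rot g"] rep_add[of "p *R S k" "q *R rot g"] rep_scaleR[of p "S k"]
    rep_scaleR[of q "rot g"] rep_rot[of g] rep_minus[of "T2 h" g] fit[of k] g(2)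
   unfolding s_def u_def k
  proof eventually_elim
   case (elim x)
   show ?case
   proof
    assume "x : V"
    with V(3) have x: "x : U" "rep g x = c" "rep (S k) x = A' x *v rep g x" using elim by auto
    show "0 <= (rep (S2 h) x - (p *R A' x + q *R J) *v c) *. (rep (T2 h) x - c)"
     using elim(1-7) x by(simp add: matrix_vector_mult_add_rdistrib scaleR_matrix_vector_assoc[symmetric])
   qed
  qed
 qed (intro continuous_intros matrix_vector_mult_linear_continuous_on)
 hence "AE x\<in>V in lborel. rep (S2 h) x = (p *R A' x + q *R J) *v rep (T2 h) x"
  by eventually_elim (auto intro!: Minty_pointwise)
 thus "EX V. open V & z : V & (AE x\<in>V in lborel. rep (S2 h) x = (p *R A' x + q *R J) *v rep (T2 h) x)"
  using V by blast
qed

end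

section \<open>Two by two matrices\<close>

definition adjugate :: "real^2^2 => real^2^2" where
 "adjugate A = columns (A $ 2 $ 2 *R axis 1 1 - A $ 2 $ 1 *R axis 2 1) (A $ 1 $ 1 *R axis 2 1 - A $ 1 $ 2 *R axis 1 1)"

lemma adjugate_mult: "A *v (adjugate A *v x) = det A *R x" "adjugate A *v (A *v x) = det A *R x"
 by(simp_all add: adjugate_def columns_def vec_eq_iff matrix_vector_mult_def sum_2 axis_def forall_2 det_2 algebra_simps)

lemma matrix_inv_mult:
 assumes "det (A :: real^2^2) ~= 0"
 shows "A *v (matrix_inv A *v x) = x" "matrix_inv A *v (A *v x) = x"
proof -
 have "invertible A" using assms by(simp add: invertible_det_nz)
 hence "EX X. A ** X = mat 1 & X ** A = mat 1" by(simp add: invertible_def)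
 from someI_ex[OF this] have "A ** matrix_inv A = mat 1" "matrix_inv A ** A = mat 1" by(auto simp: matrix_inv_def)
 thus "A *v (matrix_inv A *v x) = x" "matrix_inv A *v (A *v x) = x" by(simp_all add: matrix_vector_mul_assoc)
qed

lemma matrix_inv_adjugate:
 assumes "det (A :: real^2^2) ~= 0" shows "matrix_inv A = (1 / det A) *R adjugate A"
proof -
 have "matrix_inv A *v x = ((1 / det A) *R adjugate A) *v x" for x
 proof -
  have "det A *R (matrix_inv A *v x) = adjugate A *v x"
   using adjugate_mult(2)[of A "matrix_inv A *v x"] matrix_inv_mult(1)[OF assms, of x] by simp
  thus ?thesis using assms by(metis (no_types, lifting) scaleR_matrix_vector_assoc scaleR_scaleR nonzero_divide_eq_eq scaleR_one)
 qed
 thus ?thesis by(simp add: matrix_eq)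
qed

text \<open>On singular matrices \<open>matrix_inv\<close> is a fixed junk value, which keeps it Borel measurable.\<close>

lemma matrix_inv_singular:
 assumes "det (A :: real^2^2) = 0" shows "matrix_inv A = (SOME X. False)"
proof -
 have "(%X. A ** X = mat 1 & X ** A = mat 1) = (%X. False)"
  using assms invertible_det_nz[of A] unfolding invertible_def by(auto simp: fun_eq_iff)
 thus ?thesis unfolding matrix_inv_def by(rule arg_cong)
qed

lemma measurable_det[measurable]:
 assumes [measurable]: "f : borel_measurable M" shows "(%x. det (f x :: real^2^2)) : borel_measurable M"
proof -
 have "continuous_on UNIV (%X :: real^2^2. det X)" unfolding det_2 by(intro continuous_intros)
 from measurable_compose[OF assms borel_measurable_continuous_onI[OF this]] show ?thesis .
qed

lemma measurable_matrix_inv[measurable]: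
 assumes [measurable]: "f : borel_measurable M" shows "(%x. matrix_inv (f x :: real^2^2)) : borel_measurable M"
proof -
 have "continuous_on UNIV adjugate"
  unfolding adjugate_def columns_def by(intro continuous_intros)
 hence "adjugate : borel_fun" by(rule borel_measurable_continuous_onI)
 hence [measurable]: "(%x. adjugate (f x)) : borel_measurable M" by(rule measurable_compose[OF assms])
 have "(%x. matrix_inv (f x)) = (%x. if det (f x) = 0 then SOME X. False else (1 / det (f x)) *R adjugate (f x))"
  by(rule ext) (simp add: matrix_inv_adjugate matrix_inv_singular)
 thus ?thesis by simp
qed

lemma det_nonzero_of_coercive:
 assumes "\<alpha> > 0" "!!\<xi>. \<alpha> * (norm \<xi>)^2 <= (A *v \<xi>) *. \<xi>" shows "det (A :: real^2^2) ~= 0"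
proof -
 have "\<xi> = 0" if "A *v \<xi> = 0" for \<xi>
 proof -
  have "\<alpha> * (norm \<xi>)^2 <= 0" using assms(2)[of \<xi>] that by simp
  thus ?thesis using assms(1) by(simp add: mult_le_0_iff)
 qed
 hence "EX X. X ** A = mat 1" by(simp add: matrix_left_invertible_ker)
 hence "invertible A" by(simp add: invertible_left_inverse)
 thus ?thesis by(simp add: invertible_det_nz)
qed

text \<open>The substitution \<open>\<zeta> = A \<xi>\<close> removes the inverse; only the
  resulting form is carried through the limits.\<close>

lemma inverse_coercive_iff:
 assumes "det (A :: real^2^2) ~= 0" "\<beta> > 0"
 shows "(ALL \<zeta>. inverse \<beta> * (norm \<zeta>)^2 <= (matrix_inv A *v \<zeta>) *. \<zeta>) \<longleftrightarrow> (ALL \<xi>. (norm (A *v \<xi>))^2 <= \<beta> * ((A *v \<xi>) *. \<xi>))"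
proof
 assume l: "ALL \<zeta>. inverse \<beta> * (norm \<zeta>)^2 <= (matrix_inv A *v \<zeta>) *. \<zeta>"
 show "ALL \<xi>. (norm (A *v \<xi>))^2 <= \<beta> * ((A *v \<xi>) *. \<xi>)"
 proof
  fix \<xi>
  have "inverse \<beta> * (norm (A *v \<xi>))^2 <= \<xi> *. (A *v \<xi>)"
   using l[rule_format, of "A *v \<xi>"] by(simp add: matrix_inv_mult(2)[OF assms(1)])
  thus "(norm (A *v \<xi>))^2 <= \<beta> * ((A *v \<xi>) *. \<xi>)" using assms(2) by(simp add: field_simps inner_commute)
 qed
next
 assume r: "ALL \<xi>. (norm (A *v \<xi>))^2 <= \<beta> * ((A *v \<xi>) *. \<xi>)"
 show "ALL \<zeta>. inverse \<beta> * (norm \<zeta>)^2 <= (matrix_inv A *v \<zeta>) *. \<zeta>"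
 proof
  fix \<zeta>
  have "(norm \<zeta>)^2 <= \<beta> * (\<zeta> *. (matrix_inv A *v \<zeta>))"
   using r[rule_format, of "matrix_inv A *v \<zeta>"] by(simp add: matrix_inv_mult(1)[OF assms(1)])
  thus "inverse \<beta> * (norm \<zeta>)^2 <= (matrix_inv A *v \<zeta>) *. \<zeta>" using assms(2) by(simp add: field_simps inner_commute)
 qed
qed

lemma conductivities_iff:
 assumes "\<alpha> > 0" "\<beta> > 0"
 shows "A : conductivities \<alpha> \<beta> U \<longleftrightarrow> A : borel_measurable (lebesgue_on U) &
  (AE x in lebesgue_on U. (ALL \<xi>. \<alpha> * (norm \<xi>)^2 <= (A x *v \<xi>) *. \<xi>) & (ALL \<xi>. (norm (A x *v \<xi>))^2 <= \<beta> * ((A x *v \<xi>) *. \<xi>)))"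
proof -
 have "(invertible M & (ALL \<xi>. (M *v \<xi>) *. \<xi> >= \<alpha> * (norm \<xi>)^2) & (ALL \<xi>. (matrix_inv M *v \<xi>) *. \<xi> >= inverse \<beta> * (norm \<xi>)^2)) \<longleftrightarrow>
  ((ALL \<xi>. \<alpha> * (norm \<xi>)^2 <= (M *v \<xi>) *. \<xi>) & (ALL \<xi>. (norm (M *v \<xi>))^2 <= \<beta> * ((M *v \<xi>) *. \<xi>)))" for M :: "real^2^2"
  using inverse_coercive_iff[OF _ assms(2), of M] det_nonzero_of_coercive[OF assms(1), of M] invertible_det_nz[of M] by blast
 thus ?thesis by(simp add: conductivities_def)
qed

text \<open>Cauchy-Schwarz for the form of \<open>S\<close> between \<open>x\<close> and
  \<open>y = S x\<close>, obtained by minimising it along \<open>x - t y\<close>, together with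
  \<open>S y . y <= |S| |y|^2\<close>.\<close>

lemma norm_sq_le_of_symmetric:
 fixes S :: "real^2^2"
 assumes sym: "!!x y. (S *v x) *. y = x *. (S *v y)" and pos: "!!x. x ~= 0 ==> 0 < (S *v x) *. x"
 shows "(norm (S *v x))^2 <= matrix_norm S * ((S *v x) *. x)"
proof (cases "S *v x = 0")
 case False
 define y where "y = S *v x"
 define m where "m = (S *v y) *. y"
 have y: "y ~= 0" using False by(simp add: y_def)
 have m: "m > 0" using pos[OF y] by(simp add: m_def)
 define t where "t = (y *. y) / m"
 have "0 <= (S *v (x - t *R y)) *. (x - t *R y)" using pos[of "x - t *R y"] by(cases "x - t *R y = 0") auto
 also have "... = (S *v x) *. x - 2 * t * (y *. y) + t^2 * m"
  using sym[of x y] by(simp add: y_def[symmetric] m_def matrix_vector_mult_diff_distrib matrix_vector_mult_scaleR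
   inner_diff_left inner_diff_right power2_eq_square inner_commute algebra_simps)
 also have "... = (S *v x) *. x - (y *. y)\<^sup>2 / m" using m by(simp add: t_def power2_eq_square field_simps)
 finally have "(y *. y)^2 <= ((S *v x) *. x) * m" using m by(simp add: field_simps)
 also have "... <= ((S *v x) *. x) * (matrix_norm S * (y *. y))"
 proof (rule mult_left_mono)
  have "m <= norm (S *v y) * norm y" unfolding m_def by(rule norm_cauchy_schwarz)
  also have "... <= (matrix_norm S * norm y) * norm y"
   unfolding matrix_norm_def by(intro mult_right_mono onorm) simp_all
  finally show "m <= matrix_norm S * (y *. y)" by(simp add: power2_norm_eq_inner[symmetric] power2_eq_square mult.assoc)
  show "0 <= (S *v x) *. x" using pos[of x] by(cases "x = 0") auto
 qed
 finally have "(y *. y) * (y *. y) <= (matrix_norm S * ((S *v x) *. x)) * (y *. y)" by(simp add: power2_eq_square mult_ac)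
 hence "y *. y <= matrix_norm S * ((S *v x) *. x)" using y by(simp add: mult_le_cancel_right)
 thus ?thesis by(simp add: y_def power2_norm_eq_inner)
next
 case True thus ?thesis by simp
qed

lemma sym_part_nth: "sym_part A $ i $ j = (A $ i $ j + A $ j $ i) / 2"
 by(simp add: sym_part_def transpose_def)

lemma matrix_mult_nth2: "((A :: real^2^2) *v x) $ i = A $ i $ 1 * x $ 1 + A $ i $ 2 * x $ 2"
 by(simp add: matrix_vector_mult_def sum_2)

text \<open>With \<open>S\<close> the symmetric part, \<open>A\<^sup>T S\<^sup>-\<^sup>1 A = (det A / det S) S\<close> in dimension two.\<close>

lemma norm_sq_le_of_coercive:
 fixes A :: "real^2^2"
 assumes \<alpha>: "\<alpha> > 0" "!!\<xi>. \<alpha> * (norm \<xi>)^2 <= (A *v \<xi>) *. \<xi>"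
 shows "(norm (A *v \<xi>))^2 <= det A / det (sym_part A) * matrix_norm (sym_part A) * ((A *v \<xi>) *. \<xi>)"
proof -
 define S where "S = sym_part A"
 have S: "(S *v x) *. x = (A *v x) *. x" for x
  by(simp add: S_def inner_real2 matrix_mult_nth2 sym_part_nth field_simps)
 have sym: "(S *v x) *. y = x *. (S *v y)" for x y
  by(simp add: S_def inner_real2 matrix_mult_nth2 sym_part_nth field_simps)
 have pos: "0 < (S *v x) *. x" if "x ~= 0" for x
 proof -
  have "0 < \<alpha> * (norm x)^2" using \<alpha>(1) that by simp
  thus ?thesis using \<alpha>(2)[of x] S[of x] by linarith
 qed
 have d: "det S ~= 0" by(rule det_nonzero_of_coercive[OF \<alpha>(1)]) (use \<alpha>(2) S in simp)
 define \<zeta> where "\<zeta> = (1 / det S) *R (adjugate S *v (A *v \<xi>))"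
 have \<zeta>: "S *v \<zeta> = A *v \<xi>" using d by(simp add: \<zeta>_def matrix_vector_mult_scaleR adjugate_mult(1))
 have "(A *v \<xi>) *. (adjugate S *v (A *v \<xi>)) = det A * ((A *v \<xi>) *. \<xi>)"
  unfolding S_def inner_real2 matrix_mult_nth2 adjugate_def columns_mult sym_part_nth det_2
  by(simp add: matrix_mult_nth2 sym_part_nth axis_def field_simps)
 hence "(S *v \<zeta>) *. \<zeta> = det A / det S * ((A *v \<xi>) *. \<xi>)" unfolding \<zeta> by(simp add: \<zeta>_def)
 hence "(norm (A *v \<xi>))^2 <= matrix_norm S * (det A / det S * ((A *v \<xi>) *. \<xi>))"
  using norm_sq_le_of_symmetric[OF sym pos, of \<zeta>] \<zeta> by simp
 thus ?thesis by(simp add: S_def mult_ac)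
qed

lemma coercive_le_bound:
 fixes A :: "real^2^2"
 assumes \<alpha>: "\<alpha> > 0" "!!\<xi>. \<alpha> * (norm \<xi>)^2 <= (A *v \<xi>) *. \<xi>" and b: "!!\<xi>. (norm (A *v \<xi>))^2 <= b * ((A *v \<xi>) *. \<xi>)"
 shows "\<alpha> <= b"
proof -
 define \<xi> :: "real^2" where "\<xi> = axis 1 1"
 have n: "norm \<xi> = 1" by(simp add: \<xi>_def)
 define m where "m = (A *v \<xi>) *. \<xi>"
 have m: "\<alpha> <= m" "m <= norm (A *v \<xi>)" using \<alpha>(2)[of \<xi>] norm_cauchy_schwarz[of "A *v \<xi>" \<xi>] n by(simp_all add: m_def)
 have "m * m <= (norm (A *v \<xi>))^2" unfolding power2_eq_square by(rule mult_mono) (use m \<alpha>(1) in auto)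
 also have "... <= b * m" using b by(simp add: m_def)
 finally show ?thesis using m \<alpha>(1) by(simp add: mult_le_cancel_right)
qed

lemma bounded_of_norm_sq_le:
 fixes A :: "real^2^2"
 assumes "b >= 0" "!!\<xi>. (norm (A *v \<xi>))^2 <= b * ((A *v \<xi>) *. \<xi>)"
 shows "norm (A *v \<xi>) <= b * norm \<xi>"
proof -
 have "norm (A *v \<xi>) * norm (A *v \<xi>) <= b * ((A *v \<xi>) *. \<xi>)" using assms(2)[of \<xi>] by(simp add: power2_eq_square)
 also have "... <= b * (norm (A *v \<xi>) * norm \<xi>)" by(rule mult_left_mono[OF norm_cauchy_schwarz assms(1)])
 finally have "norm (A *v \<xi>) * norm (A *v \<xi>) <= norm (A *v \<xi>) * (b * norm \<xi>)" by(simp add: mult_ac)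
 thus ?thesis using assms(1) by(cases "norm (A *v \<xi>) = 0") (auto simp: mult_le_cancel_left)
qed

text \<open>Let \<open>C = p A + q J\<close> and \<open>\<eta> = \<xi> - r J B \<xi>\<close>. Then
  \<open>B \<xi> = C \<eta>\<close>, and the rotation drops out of
  \<open>B \<xi> . \<xi> = C \<eta> . \<eta>\<close>. The lower bound follows from |\<xi>| <= (1 +
  L) |\<eta>|, where \<open>L\<close> is controlled through the bound on \<open>r A\<close>; the
  upper bound follows from that of \<open>A\<close>.\<close>

lemma perturbed_matrix:
 fixes A :: "real^2^2"
 assumes \<alpha>: "\<alpha> > 0" "!!\<xi>. \<alpha> * (norm \<xi>)^2 <= (A *v \<xi>) *. \<xi>"
  and p: "0 < p0" "p0 <= p" "p <= P" "abs q <= Q"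
  and r: "!!\<xi>. abs r * norm (A *v \<xi>) <= R * norm \<xi>" "abs r <= r'"
 defines "B \<equiv> matrix_inv (matrix_inv (p *R A + q *R J) + r *R J)"
 shows "B *v \<xi> = p *R (A *v (\<xi> - r *R (J *v (B *v \<xi>)))) + q *R (J *v (\<xi> - r *R (J *v (B *v \<xi>))))"
  "p0 * \<alpha> / (1 + (P * abs R + Q * r'))^2 * (norm \<xi>)^2 <= (B *v \<xi>) *. \<xi>"
  "(!!\<xi>. (norm (A *v \<xi>))^2 <= b * ((A *v \<xi>) *. \<xi>)) ==>
   (norm (B *v \<xi>))^2 <= (2 * P + 2 * Q^2 / (\<alpha>^2 * p0)) * b * ((B *v \<xi>) *. \<xi>)"
proof -
 have pp: "0 < p" "0 < P" "0 <= Q" "0 <= r'" using p r(2) by linarith+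
 define C where "C = p *R A + q *R J"
 have Cv: "C *v \<eta> = p *R (A *v \<eta>) + q *R (J *v \<eta>)" for \<eta>
  by(simp add: C_def matrix_vector_mult_add_rdistrib scaleR_matrix_vector_assoc[symmetric])
 have J0: "(J *v \<eta>) *. \<eta> = 0" for \<eta> using inner_J(4)[of \<eta>] inner_commute[of \<eta>] by metis
 have CC: "(C *v \<eta>) *. \<eta> = p * ((A *v \<eta>) *. \<eta>)" for \<eta> by(simp add: Cv inner_add_left J0)
 have Cc: "(p0 * \<alpha>) * (norm \<eta>)^2 <= (C *v \<eta>) *. \<eta>" for \<eta>
 proof -
  have "(p0 * \<alpha>) * (norm \<eta>)^2 <= p * (\<alpha> * (norm \<eta>)^2)" using mult_right_mono[OF p(2), of "\<alpha> * (norm \<eta>)^2"] \<alpha>(1) by(simp add: mult.assoc)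
  also have "... <= p * ((A *v \<eta>) *. \<eta>)" by(rule mult_left_mono[OF \<alpha>(2)]) (use pp in simp)
  finally show ?thesis by(simp add: CC)
 qed
 have dC: "det C ~= 0" by(rule det_nonzero_of_coercive[OF _ Cc]) (use p \<alpha> in simp)
 define E where "E = matrix_inv C + r *R J"
 have Ev: "E *v \<zeta> = matrix_inv C *v \<zeta> + r *R (J *v \<zeta>)" for \<zeta>
  by(simp add: E_def matrix_vector_mult_add_rdistrib scaleR_matrix_vector_assoc[symmetric])
 have "\<zeta> = 0" if "E *v \<zeta> = 0" for \<zeta>
 proof -
  define \<eta> where "\<eta> = matrix_inv C *v \<zeta>"
  have "C *v \<eta> = \<zeta>" by(simp add: \<eta>_def matrix_inv_mult(1)[OF dC])
  moreover have "(E *v \<zeta>) *. \<zeta> = \<eta> *. \<zeta>" by(simp add: Ev inner_add_left J0 \<eta>_def)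
  ultimately have "(C *v \<eta>) *. \<eta> = 0" using that by(simp add: inner_commute)
  hence "(p0 * \<alpha>) * (norm \<eta>)^2 <= 0" using Cc[of \<eta>] by simp
  hence "\<eta> = 0" using p \<alpha> by(simp add: mult_le_0_iff)
  thus ?thesis using \<open>C *v \<eta> = \<zeta>\<close> by simp
 qed
 hence "EX X. X ** E = mat 1" by(simp add: matrix_left_invertible_ker)
 hence dE: "det E ~= 0" using invertible_left_inverse[of E] invertible_det_nz[of E] by blast
 have B: "B = matrix_inv E" by(simp add: B_def E_def C_def)
 define \<eta> where "\<eta> = \<xi> - r *R (J *v (B *v \<xi>))"
 have "matrix_inv C *v (B *v \<xi>) = \<eta>"
  using Ev[of "B *v \<xi>"] matrix_inv_mult(1)[OF dE, of \<xi>] by(simp add: B \<eta>_def algebra_simps)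
 hence BC: "B *v \<xi> = C *v \<eta>" using matrix_inv_mult(1)[OF dC, of "B *v \<xi>"] by simp
 thus "B *v \<xi> = p *R (A *v (\<xi> - r *R (J *v (B *v \<xi>)))) + q *R (J *v (\<xi> - r *R (J *v (B *v \<xi>))))"
  unfolding Cv \<eta>_def .
 have "(B *v \<xi>) *. \<eta> = (B *v \<xi>) *. \<xi>" using inner_J(4)[of "B *v \<xi>"] by(simp add: \<eta>_def inner_diff_right)
 hence BC2: "(B *v \<xi>) *. \<xi> = (C *v \<eta>) *. \<eta>" using BC by simp
 define L where "L = P * abs R + Q * r'"
 have L: "L >= 0" using pp by(simp add: L_def)
 have "norm (r *R (J *v (B *v \<xi>))) = abs r * norm (C *v \<eta>)" by(simp add: BC)
 also have "... <= abs r * (p * norm (A *v \<eta>) + abs q * norm \<eta>)"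
  using norm_triangle_ineq[of "p *R (A *v \<eta>)" "q *R (J *v \<eta>)"] pp by(intro mult_left_mono) (simp_all add: Cv)
 also have "... = p * (abs r * norm (A *v \<eta>)) + (abs q * abs r) * norm \<eta>" by(simp add: algebra_simps)
 also have "... <= P * (abs R * norm \<eta>) + (Q * r') * norm \<eta>"
 proof (rule add_mono[OF mult_mono mult_right_mono])
  show "abs q * abs r <= Q * r'" by(rule mult_mono) (use p r pp in auto)
  show "abs r * norm (A *v \<eta>) <= abs R * norm \<eta>" using r(1)[of \<eta>] mult_right_mono[OF abs_ge_self, of "norm \<eta>" R] by simp
 qed (use p r pp in auto)
 also have "... = L * norm \<eta>" by(simp add: L_def algebra_simps)
 finally have "norm \<xi> <= (1 + L) * norm \<eta>"
  using norm_triangle_ineq[of \<eta> "r *R (J *v (B *v \<xi>))"] by(simp add: \<eta>_def algebra_simps)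
 from power_mono[OF this, of 2] have "(norm \<xi>)^2 <= (1 + L)^2 * (norm \<eta>)^2" by(simp add: power_mult_distrib)
 hence "p0 * \<alpha> / (1 + L)^2 * (norm \<xi>)^2 <= p0 * \<alpha> / (1 + L)^2 * ((1 + L)^2 * (norm \<eta>)^2)"
  by(rule mult_left_mono) (use p \<alpha> in simp)
 also have "... = (p0 * \<alpha>) * (norm \<eta>)^2" using L by simp
 also have "... <= (B *v \<xi>) *. \<xi>" unfolding BC2 by(rule Cc)
 finally show "p0 * \<alpha> / (1 + (P * abs R + Q * r'))^2 * (norm \<xi>)^2 <= (B *v \<xi>) *. \<xi>" by(simp add: L_def)
 assume b: "!!\<xi>. (norm (A *v \<xi>))^2 <= b * ((A *v \<xi>) *. \<xi>)"
 have ab: "\<alpha> <= b" by(rule coercive_le_bound[OF \<alpha> b])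
 define c where "c = (C *v \<eta>) *. \<eta>"
 have c: "c >= 0" unfolding c_def by(rule order_trans[OF _ Cc]) (use p \<alpha>(1) in simp)
 \<comment> \<open>The first term is at most \<open>P * b * c\<close>. For the second, coercivity
   gives |\<eta>|^2 <= c / (p0 \<alpha>), and \<open>\<alpha> <= b\<close> supplies the missing
   factor b / \<alpha>, so that both terms carry \<open>b\<close> linearly.\<close>
 have "(norm (C *v \<eta>))^2 <= 2 * (p^2 * (norm (A *v \<eta>))^2) + 2 * (q^2 * (norm \<eta>)^2)"
  using norm_add_sq_le[of "p *R (A *v \<eta>)" "q *R (J *v \<eta>)"] by(simp add: Cv power_mult_distrib)
 also have "p^2 * (norm (A *v \<eta>))^2 <= p^2 * (b * ((A *v \<eta>) *. \<eta>))" by(rule mult_left_mono[OF b]) simp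
 also have "p^2 * (b * ((A *v \<eta>) *. \<eta>)) = p * (b * c)" by(simp add: c_def CC power2_eq_square)
 also have "p * (b * c) <= P * (b * c)" by(rule mult_right_mono[OF p(3)]) (use ab \<alpha> c in simp)
 also have "q^2 * (norm \<eta>)^2 <= Q^2 * (b * c / (\<alpha>^2 * p0))"
 proof (rule mult_mono)
  show "q^2 <= Q^2" using power_mono[OF p(4), of 2] by simp
  have "\<alpha> * (norm \<eta>)^2 * (p0 * \<alpha>) <= \<alpha> * c" using mult_left_mono[OF Cc[of \<eta>], of \<alpha>] \<alpha>(1) by(simp add: c_def mult_ac)
  also have "... <= b * c" by(rule mult_right_mono[OF ab c])
  finally show "(norm \<eta>)^2 <= b * c / (\<alpha>^2 * p0)" using \<alpha>(1) p(1) by(simp add: field_simps power2_eq_square)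
 qed auto
 finally show "(norm (B *v \<xi>))^2 <= (2 * P + 2 * Q^2 / (\<alpha>^2 * p0)) * b * ((B *v \<xi>) *. \<xi>)"
  unfolding BC2 unfolding BC c_def[symmetric] by(simp add: algebra_simps)
qed

section \<open>From completed Lebesgue measure to Borel representatives\<close>

lemma AE_on: "open U ==> (AE x in lebesgue_on U. P x) \<longleftrightarrow> (AE x\<in>U in lborel. P (x :: real^2))"
 by(simp add: AE_restrict_space_iff AE_completion_iff)

lemma measurable_on_iff:
 fixes f :: "real^2 => 'b::euclidean_space"
 shows "open U ==> f : borel_measurable (lebesgue_on U) \<longleftrightarrow> (%x. ind U x *R f x) : borel_measurable lebesgue"
 by(rule borel_measurable_restrict_space_iff) simp

lemma borel_version:
 fixes f :: "real^2 => 'b::euclidean_space"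
 assumes U: "open U" and f: "f : borel_measurable (lebesgue_on U)"
 obtains g where "g : borel_fun" "!!x. x ~: U ==> g x = 0" "AE x\<in>U in lborel. f x = g x"
proof -
 have "EX g:borel_measurable lborel. AEl x. (ind U x *R f x) *. b = g x" for b
  using f unfolding measurable_on_iff[OF U] by(intro completion_ex_borel_measurable_real borel_measurable_inner) simp_all
 hence "ALL b. EX g. g : borel_measurable lborel & (AEl x. (ind U x *R f x) *. b = g x)" by blast
 from choice[OF this] obtain g where
  g: "!!b. g b : borel_measurable lborel" "!!b. AEl x. (ind U x *R f x) *. b = g b x" by blast
 have [measurable]: "g b : borel_fun" "U : sets borel" for b using g(1)[of b] U by auto
 define h where "h x = ind U x *R (\<Sum>b\<in>Basis. g b x *R b)" for x
 have "AEl x. ALL b:Basis. (ind U x *R f x) *. b = g b x" by(intro AE_finite_allI g(2)) simp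
 hence "AE x\<in>U in lborel. f x = h x"
 proof eventually_elim
  case (elim x)
  have "x : U ==> (\<Sum>b\<in>Basis. g b x *R b) = (\<Sum>b\<in>Basis. (f x *. b) *R b)" using elim by(intro sum.cong) auto
  thus ?case by(simp add: h_def euclidean_representation)
 qed
 moreover have "h : borel_fun" unfolding h_def by measurable
 ultimately show thesis by(intro that[of h]) (simp_all add: h_def)
qed

lemma lebesgue_on_lborel:
 fixes f g :: "real^2 => 'b::euclidean_space"
 assumes U: "open U" and g[measurable]: "g : borel_fun" and e: "AE x\<in>U in lborel. f x = g x"
 shows "f : borel_measurable (lebesgue_on U)"
  "integrable (lebesgue_on U) f \<longleftrightarrow> L1 (%x. ind U x *R g x)"
  "(LINT x|lebesgue_on U. f x) = (LI x. ind U x *R g x)"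
proof -
 have [measurable]: "U : sets borel" using U by simp
 have s: "U \<inter> space lebesgue : sets lebesgue" using U by simp
 have gm: "(%x. ind U x *R g x) : borel_measurable lborel" by measurable
 have ae: "AE x in lebesgue. ind U x *R g x = ind U x *R f x"
  unfolding AE_completion_iff using e by eventually_elim (auto simp: indicator_def)
 note fm = borel_measurable_AE[OF measurable_completion[OF gm] ae]
 thus "f : borel_measurable (lebesgue_on U)" by(simp add: measurable_on_iff[OF U])
 show "integrable (lebesgue_on U) f \<longleftrightarrow> L1 (%x. ind U x *R g x)"
  unfolding integrable_restrict_space[OF s] integrable_completion[OF gm, symmetric]
  by(rule integrable_cong_AE[OF fm measurable_completion[OF gm]]) (use ae in "auto elim!: eventually_mono")
 show "(LINT x|lebesgue_on U. f x) = (LI x. ind U x *R g x)"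
  unfolding integral_restrict_space[OF s] integral_completion[OF gm, symmetric]
  by(rule Lint_cong_AE[OF fm measurable_completion[OF gm]]) (use ae in "auto elim!: eventually_mono")
qed

text \<open>The value \<open>c\<close> fills the exceptional null set. A property known almost
  everywhere thus becomes one valid at every point.\<close>

lemma borel_version_everywhere:
 fixes f :: "real^2 => 'b::euclidean_space"
 assumes U: "open U" and f: "f : borel_measurable (lebesgue_on U)" and P: "AE x in lebesgue_on U. P (f x)" "P c"
 obtains g where "g : borel_fun" "!!x. P (g x)" "AE x\<in>U in lborel. f x = g x"
proof -
 obtain g where g: "g : borel_fun" "AE x\<in>U in lborel. f x = g x" by(rule borel_version[OF U f])
 have "AE x\<in>U in lborel. P (g x)" using P(1)[unfolded AE_on[OF U]] g(2) by eventually_elim auto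
 then obtain N where N: "{x : space lborel. \<not> (x : U --> P (g x))} \<subseteq> N" "emeasure lborel N = 0" "N : sets lborel" by(rule AE_E)
 have [measurable]: "g : borel_fun" "N : sets borel" "U : sets borel" using g N U by auto
 define h where "h x = (if x : U - N then g x else c)" for x
 have "h : borel_fun" unfolding h_def by measurable
 moreover have "P (h x)" for x using N(1) P(2) by(auto simp: h_def)
 moreover have "AE x\<in>U in lborel. f x = h x"
  using g(2) AE_not_in[OF null_setsI[OF N(2,3)]] by eventually_elim (simp add: h_def)
 ultimately show thesis by(rule that)
qed

section \<open>Test functions vanishing at the boundary, and the bound on the masses\<close>

lemma cc_C0: assumes "cc U (\<phi> :: real^2 => real)" shows "\<phi> : C0 U"
proof -
 obtain K where K: "compact K" "K \<subseteq> U" "!!x. x ~: K ==> \<phi> x = 0" using ccE[OF assms] by metis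
 have "compact {x : U. abs (\<phi> x) >= e}" if "e > 0" for e
 proof -
  have "{x : U. abs (\<phi> x) >= e} = K \<inter> {x. e <= abs (\<phi> x)}" using K that by fastforce
  moreover have "closed {x. e <= abs (\<phi> x)}" by(intro closed_Collect_le continuous_intros cc_continuous[OF assms])
  ultimately show ?thesis using K(1) by(simp add: compact_Int_closed)
 qed
 thus ?thesis using cc_continuous[OF assms] by(auto simp: C0_def intro: continuous_on_subset)
qed

lemma cc_lebesgue_on:
 fixes b :: "real^2 => 'b::euclidean_space"
 assumes U: "open U" and \<psi>: "cc U (\<psi> :: real^2 => real)" and b[measurable]: "b : borel_fun" and e: "AE x\<in>U in lborel. f x = b x"
 shows "(LINT x|lebesgue_on U. \<psi> x *R f x) = (LI x. \<psi> x *R b x)"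
proof -
 have [measurable]: "\<psi> : borel_fun" by(rule cc_measurable[OF \<psi>])
 have "(LINT x|lebesgue_on U. \<psi> x *R f x) = (LI x. ind U x *R (\<psi> x *R b x))"
  by(rule lebesgue_on_lborel(3)[OF U]) (use e in "auto elim!: eventually_mono")
 also have "... = (LI x. \<psi> x *R b x)"
  by(rule Lint_cong) (use cc_eq_0[OF \<psi>] in "auto simp: indicator_def")
 finally show ?thesis .
qed

text \<open>The series converges uniformly, so its sum lies in \<open>C0 U\<close> although its
  support need not be compact: where the sum is at least e, some term of a finite partial sum is
  nonzero.\<close>

lemma C0_series:
 assumes \<psi>: "!!k::nat. cc U (\<psi> k :: real^2 => real)" "!!k x. 0 <= \<psi> k x & \<psi> k x <= 1"
 obtains \<phi> where "\<phi> : C0 U" "\<phi> : borel_fun" "!!k x. (1/2)^k * \<psi> k x <= \<phi> x" "!!x. \<phi> x <= 2"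
proof -
 define \<phi> where "\<phi> x = (\<Sum>k. (1/2)^k * \<psi> k x)" for x
 have g: "(%k. (1/2)^k :: real) sums 2" using geometric_sums[of "1/2 :: real"] by simp
 have b: "norm ((1/2)^k * \<psi> k x) <= (1/2)^k" for k x using \<psi>(2)[of k x] by simp
 have s: "summable (%k. (1/2)^k * \<psi> k x)" for x by(rule summable_comparison_test[OF _ sums_summable[OF g]]) (use b in auto)
 have u: "uniform_limit UNIV (%n x. \<Sum>k<n. (1/2)^k * \<psi> k x) \<phi> sequentially"
  unfolding \<phi>_def by(rule Weierstrass_m_test[OF _ sums_summable[OF g]]) (use b in auto)
 have c: "continuous_on UNIV (%x. \<Sum>k<n. (1/2)^k * \<psi> k x)" for n by(intro continuous_intros cc_continuous[OF \<psi>(1)])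
 hence \<phi>: "continuous_on UNIV \<phi>" by(intro uniform_limit_theorem[OF _ u]) auto
 have p: "0 <= \<phi> x" for x unfolding \<phi>_def by(rule suminf_nonneg[OF s]) (use \<psi>(2) in simp)
 have "compact {x : U. abs (\<phi> x) >= e}" if e: "e > 0" for e
 proof -
  obtain n where n: "!!x. dist (\<Sum>k<n. (1/2)^k * \<psi> k x) (\<phi> x) < e"
   using u e unfolding uniform_limit_iff eventually_sequentially by blast
  have "ALL k. EX K. compact K & K \<subseteq> U & (ALL x. x ~: K --> \<psi> k x = 0)" using \<psi>(1) unfolding cc_def by blast
  from choice[OF this] obtain K where K: "!!k. compact (K k)" "!!k. K k \<subseteq> U" "!!k x. x ~: K k ==> \<psi> k x = 0" by blast
  have "x : (\<Union>k<n. K k)" if "abs (\<phi> x) >= e" for x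
  proof (rule ccontr)
   assume "x ~: (\<Union>k<n. K k)"
   hence "(\<Sum>k<n. (1/2)^k * \<psi> k x) = 0" using K(3) by(intro sum.neutral) auto
   thus False using n[of x] that by(simp add: dist_real_def)
  qed
  hence "{x : U. abs (\<phi> x) >= e} = (\<Union>k<n. K k) \<inter> {x. e <= abs (\<phi> x)}" using K(2) by blast
  moreover have "closed {x. e <= abs (\<phi> x)}" by(intro closed_Collect_le continuous_intros \<phi>)
  ultimately show ?thesis using K(1) by(simp add: compact_Int_closed compact_UN)
 qed
 hence "\<phi> : C0 U" using \<phi> by(auto simp: C0_def intro: continuous_on_subset)
 moreover have "(1/2)^k * \<psi> k x <= \<phi> x" for k x
  using sum_le_suminf[OF s, of "{k}" x] \<psi>(2) by(simp add: \<phi>_def)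
 moreover have "\<phi> x <= 2" for x
  using suminf_le[OF _ s sums_summable[OF g], of x] \<psi>(2)[of _ x] sums_unique[OF g] by(simp add: \<phi>_def)
 ultimately show thesis using borel_measurable_continuous_onI[OF \<phi>] by(intro that)
qed

text \<open>Nonnegativity replaces the uniform boundedness principle: one series of cutoffs tests all large masses at once.\<close>

lemma bounded_mass:
 fixes b :: "nat => real^2 => real"
 assumes U: "open U" and b[measurable]: "!!n. b n : borel_fun" and p: "!!n x. 0 <= b n x"
  and i: "!!n. L1 (%x. ind U x * b n x)"
  and conv: "!!\<phi>. \<phi> : C0 U ==> Bseq (%n. LI x. ind U x * (\<phi> x * b n x))"
 obtains K where "!!n. (LI x. ind U x * b n x) <= K"
proof (rule ccontr)
 have [measurable]: "U : sets borel" using U by simp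
 assume "\<not> thesis"
 hence big: "EX n. (LI x. ind U x * b n x) > K" for K using that by(meson not_le)
 \<comment> \<open>Masses of size \<open>4^k\<close> outweigh the coefficients
   \<open>(1/2)^k\<close> of the series and leave \<open>2^k\<close>.\<close>
 have "EX n \<psi>. cc U \<psi> & (ALL x. 0 <= \<psi> x & \<psi> x <= 1) & 4^k <= (LI x. ind U x * (\<psi> x * b n x))" for k :: nat
 proof -
  obtain n where n: "(LI x. ind U x * b n x) > 4^k" using big by blast
  obtain C where C: "!!j::nat. compact (C j)" "!!j. C j \<subseteq> U" "!!j. C j \<subseteq> interior (C (Suc j))" "\<Union>(range C) = U"
   by(rule open_Union_compact_subsets[OF U]) blast
  have [measurable]: "C j : sets borel" for j using C(1) by(simp add: borel_compact)
  have mono: "incseq C" using C(3) interior_subset by(intro incseq_SucI) blast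
  have "(%j. LI x. ind (C j) x * b n x) ----> (LI x. ind U x * b n x)"
  proof (rule integral_dominated_convergence[OF _ _ i[of n]])
   have "(%j. ind (C j) x :: real) ----> ind U x" for x using LIMSEQ_indicator_incseq[OF mono] C(4) by simp
   thus "AEl x. (%j. ind (C j) x * b n x) ----> ind U x * b n x" by(auto intro!: tendsto_intros)
   show "AEl x. norm (ind (C j) x * b n x) <= ind U x * b n x" for j
    using C(2)[of j] p by(auto simp: indicator_def)
  qed measurable
  hence "\<forall>\<^sub>F j in sequentially. (LI x. ind (C j) x * b n x) > 4^k" using n by(rule order_tendstoD(1))
  then obtain j where j: "(LI x. ind (C j) x * b n x) > 4^k" by(auto simp: eventually_sequentially)
  obtain \<psi> :: "nat => real^2 => real" where \<psi>: "\<psi> 0 : TF U" "!!x. 0 <= \<psi> 0 x & \<psi> 0 x <= 1" "!!x. x : C j ==> \<psi> 0 x = 1"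
   by(rule cutoff_exists[OF C(1,2) U]) blast
  note cc = c1c_D(1)[OF test_function_c1c[OF \<psi>(1)]]
  note [measurable] = cc_measurable[OF cc]
  have "(LI x. ind (C j) x * b n x) <= (LI x. ind U x * (\<psi> 0 x * b n x))"
  proof (rule integral_mono)
   have le: "ind (C j) x * b n x <= ind U x * (\<psi> 0 x * b n x)" "ind U x * (\<psi> 0 x * b n x) <= ind U x * b n x" for x
    using \<psi>(2,3)[of x] p[of n x] C(2)[of j] by(auto simp: indicator_def mult_left_le_one_le)
   show "ind (C j) x * b n x <= ind U x * (\<psi> 0 x * b n x)" for x by(rule le)
   show "L1 (%x. ind U x * (\<psi> 0 x * b n x))"
    by(rule L1_bound[OF i[of n]]) (use le(2) p \<psi>(2) in "auto simp: abs_mult indicator_def mult_left_le_one_le")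
   show "L1 (%x. ind (C j) x * b n x)"
    by(rule L1_bound[OF i[of n]]) (use C(2)[of j] p in "auto simp: indicator_def")
  qed
  thus ?thesis using cc \<psi>(2) j by(intro exI[of _ n] exI[of _ "\<psi> 0"]) auto
 qed
 hence "ALL k. EX x. cc U (snd x) & (ALL y. 0 <= snd x y & snd x y <= 1) & 4^k <= (LI y. ind U y * (snd x y * b (fst x) y))" by fastforce
 from choice[OF this] obtain f where f: "!!k::nat. cc U (snd (f k))" "!!k x. 0 <= snd (f k) x & snd (f k) x <= 1"
  "!!k. 4^k <= (LI y. ind U y * (snd (f k) y * b (fst (f k)) y))" by blast
 obtain \<phi> where \<phi>: "\<phi> : C0 U" "\<phi> : borel_fun" "!!k x. (1/2)^k * snd (f k) x <= \<phi> x" "!!x. \<phi> x <= 2"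
  by(rule C0_series[of U "%k. snd (f k)", OF f(1,2)]) blast
 note [measurable] = \<phi>(2) cc_measurable[OF f(1)]
 have \<phi>0: "0 <= \<phi> x" for x using \<phi>(3)[of 0 x] f(2)[of 0 x] by simp
 obtain L where L: "!!n. norm (LI x. ind U x * (\<phi> x * b n x)) <= L" using conv[OF \<phi>(1)] by(auto simp: Bseq_def)
 have "2^k <= L" for k :: nat
 proof -
  define n where "n = fst (f k)"
  have "(1/2)^k * 4^k <= (1/2)^k * (LI y. ind U y * (snd (f k) y * b n y))"
   unfolding n_def by(rule mult_left_mono[OF f(3)]) simp
  also have "... = (LI y. (1/2)^k * (ind U y * (snd (f k) y * b n y)))" by simp
  also have "... <= (LI x. ind U x * (\<phi> x * b n x))"
  proof (rule integral_mono)
   show "L1 (%x. ind U x * (\<phi> x * b n x))"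
    by(rule L1_bound[where f = "%x. 2 * (ind U x * b n x)"])
     (use i[of n] \<phi>0 \<phi>(4) p in "auto simp: indicator_def abs_mult intro!: mult_right_mono")
   show "L1 (%x. (1/2)^k * (ind U x * (snd (f k) x * b n x)))"
    by(rule L1_bound[where f = "%x. (1/2)^k * (ind U x * b n x)"])
     (use i[of n] f(2) p in "auto simp: indicator_def abs_mult mult_left_le_one_le")
   show "(1/2)^k * (ind U x * (snd (f k) x * b n x)) <= ind U x * (\<phi> x * b n x)" for x
    using mult_right_mono[OF \<phi>(3)[of k x] p[of n x]] by(simp add: indicator_def mult.assoc)
  qed
  also have "... <= L" using L[of n] by simp
  finally show ?thesis by(simp add: power_mult_distrib[symmetric])
 qed
 moreover obtain k where "L < 2^k" using real_arch_pow[of 2 L] by auto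
 ultimately show False using not_le by blast
qed

section \<open>The Sobolev space\<close>

text \<open>The class of a function given on \<open>U\<close>, extended by zero. The description
  determines it, by \<open>supported_unique\<close>.\<close>

definition emb :: "(real^2) set => (real^2 => real^2) => l2" where
 "emb U v = (SOME w. w : supported U & (AE x\<in>U in lborel. v x = rep w x))"

abbreviation scalar_field :: "(real^2 => real) => 2 => real^2 => real^2" where
 "scalar_field f i \<equiv> %x. f x *R axis i 1"

text \<open>Scalar functions are embedded as first components, so the one Hilbert space of vector
  fields also serves for them.\<close>

abbreviation semb :: "(real^2) set => (real^2 => real) => l2" where "semb U u \<equiv> emb U (scalar_field u 1)"

abbreviation wgrad :: "(real^2) set => (real^2 => real) => l2" where "wgrad U u \<equiv> emb U (weak_grad U u)"

locale domain = fixes U :: "(real^2) set" assumes U: "open U" "bounded U"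
begin

lemma U_borel[measurable, simp]: "U : sets borel" using U by simp

lemma supported_unique:
 assumes "w : supported U" "w' : supported U" "AE x\<in>U in lborel. rep w x = rep w' x" shows "w = w'"
proof (rule l2_eqI)
 from assms[unfolded supported_def mem_Collect_eq] show "AEl x. rep w x = rep w' x" by eventually_elim auto
qed

lemma rep_L2:
 assumes w: "w : supported U" "AE x\<in>U in lborel. v x = rep w x" shows "v : L2 U" "emb U v = w"
proof -
 have "AEl x. ind U x *R (norm (rep w x))\<^sup>2 = (norm (rep w x))^2"
  using w(1)[unfolded supported_def mem_Collect_eq] by eventually_elim (auto simp: indicator_def)
 hence "L1 (%x. ind U x *R (norm (rep w x))\<^sup>2) \<longleftrightarrow> L1 (%x. (norm (rep w x))^2)"
  by(intro integrable_cong_AE) auto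
 hence "integrable (lebesgue_on U) (%x. (norm (v x))^2)"
  using sqint_integrable[OF sqint_rep] w(2) by(subst lebesgue_on_lborel(2)[OF U(1), of "%x. (norm (rep w x))^2"]) auto
 thus "v : L2 U" using lebesgue_on_lborel(1)[OF U(1) rep_measurable w(2)] by(simp add: L2_def)
 show "emb U v = w"
  unfolding emb_def
 proof (rule some_equality)
  fix w' assume "w' : supported U & (AE x\<in>U in lborel. v x = rep w' x)"
  hence w': "w' : supported U" "AE x\<in>U in lborel. v x = rep w' x" by blast+
  from w'(2) w(2) have "AE x\<in>U in lborel. rep w' x = rep w x" by eventually_elim auto
  thus "w' = w" by(rule supported_unique[OF w'(1) w(1)])
 qed (use w in blast)
qed

lemma emb:
 assumes v: "v : L2 U" shows "emb U v : supported U" "AE x\<in>U in lborel. v x = rep (emb U v) x"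
proof -
 obtain g where g: "g : borel_fun" "!!x. x ~: U ==> g x = 0" "AE x\<in>U in lborel. v x = g x"
  by(rule borel_version[OF U(1), of v]) (use v in "auto simp: L2_def")
 note [measurable] = g(1)
 have "L1 (%x. ind U x *R (norm (g x))\<^sup>2)"
 proof (rule lebesgue_on_lborel(2)[OF U(1), THEN iffD1])
  show "AE x\<in>U in lborel. (norm (v x))^2 = (norm (g x))^2" using g(3) by eventually_elim simp
 qed (use v in "simp_all add: L2_def")
 moreover have "(%x. ind U x *R (norm (g x))\<^sup>2) = (%x. (norm (g x))^2)" using g(2) by(auto simp: indicator_def fun_eq_iff)
 ultimately have s: "sqint g" by(simp add: sqint_def)
 have "AE x\<in>U in lborel. v x = rep (cls g) x" using g(3) rep_cls[OF s] by eventually_elim simp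
 moreover have "cls g : supported U" by(rule supported_cls[OF s g(2)])
 ultimately have "EX w. w : supported U & (AE x\<in>U in lborel. v x = rep w x)" by blast
 from someI_ex[OF this] show "emb U v : supported U" "AE x\<in>U in lborel. v x = rep (emb U v) x"
  by(auto simp: emb_def)
qed

lemma emb_linear:
 assumes v: "v : L2 U" "w : L2 U"
 shows "(%x. a *R v x + b *R w x) : L2 U" "emb U (%x. a *R v x + b *R w x) = a *R emb U v + b *R emb U w"
proof -
 have s: "a *R emb U v + b *R emb U w : supported U"
  by(intro subspace_add subspace_scale subspace_supported emb v U_borel)
 have "AE x\<in>U in lborel. a *R v x + b *R w x = rep (a *R emb U v + b *R emb U w) x"
  using emb(2)[OF v(1)] emb(2)[OF v(2)] rep_add[of "a *R emb U v" "b *R emb U w"] rep_scaleR[of a "emb U v"] rep_scaleR[of b "emb U w"]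
  by eventually_elim auto
 from rep_L2[OF s this] show "(%x. a *R v x + b *R w x) : L2 U"
  "emb U (%x. a *R v x + b *R w x) = a *R emb U v + b *R emb U w" by simp_all
qed

lemma inner_emb: assumes "v : L2 U" "w : L2 U" shows "inner (emb U v) (emb U w) = (LINT x|lebesgue_on U. v x *. w x)"
proof -
 have "(LINT x|lebesgue_on U. v x *. w x) = (LI x. ind U x *R (rep (emb U v) x *. rep (emb U w) x))"
 proof (rule lebesgue_on_lborel(3)[OF U(1)])
  show "AE x\<in>U in lborel. v x *. w x = rep (emb U v) x *. rep (emb U w) x"
   using emb(2)[OF assms(1)] emb(2)[OF assms(2)] by eventually_elim simp
 qed measurable
 also have "... = inner (emb U v) (emb U w)"
  unfolding inner_l2_def
 proof (rule Lint_cong_AE)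
  show "AEl x. ind U x *R (rep (emb U v) x *. rep (emb U w) x) = rep (emb U v) x *. rep (emb U w) x"
   using emb(1)[OF assms(1), unfolded supported_def mem_Collect_eq] by eventually_elim (auto simp: indicator_def)
 qed measurable
 finally show ?thesis by simp
qed

lemma L2_scalar: "u : L2 U \<longleftrightarrow> scalar_field u 1 : L2 U"
proof -
 have "u : borel_measurable (lebesgue_on U)" if "scalar_field u 1 : borel_measurable (lebesgue_on U)"
  using measurable_vec_nth[OF that, of 1] by simp
 moreover have "scalar_field u 1 : borel_measurable (lebesgue_on U)" if "u : borel_measurable (lebesgue_on U)"
  using that by(intro borel_measurable_scaleR) auto
 ultimately have "u : borel_measurable (lebesgue_on U) \<longleftrightarrow> scalar_field u 1 : borel_measurable (lebesgue_on U)" by blast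
 thus ?thesis by(simp add: L2_def)
qed

lemma cc_L2:
 assumes "cc U (h :: real^2 => real^2)" shows "h : L2 U" "emb U h = cls h"
proof -
 have "AE x\<in>U in lborel. h x = rep (cls h) x" using rep_cls[OF cc_sqint[OF assms]] by eventually_elim simp
 from rep_L2[OF supported_cls[OF cc_sqint[OF assms] cc_eq_0[OF assms]] this] show "h : L2 U" "emb U h = cls h" by simp_all
qed

lemma cc_scalar_field: "cc U (f :: real^2 => real) ==> cc U (scalar_field f i)"
 using cc_scale_left[of U f "%x. axis i 1"] by simp

lemma inner_scalar_field:
 assumes "cc U (f :: real^2 => real)" shows "inner w (cls (scalar_field f i)) = (LI x. f x * rep w x $ i)"
 unfolding inner_rep_cls[OF cc_sqint[OF cc_scalar_field[OF assms]]] by(simp add: inner_axis mult.commute)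

lemma test_cc: assumes "\<phi> : TF U" shows "cc U \<phi>" "cc U (grad \<phi>)" "cc U (%x. grad \<phi> x $ i)"
 using c1c_D[OF test_function_c1c[OF assms]] cc_inner_right[OF c1c_D(2)[OF test_function_c1c[OF assms]], of "%x. axis i 1"]
 by(simp_all add: inner_axis')

text \<open>As a family of identities between inner products, the relation is visibly linear and
  stable under L^2 limits.\<close>

lemma has_weak_grad_iff:
 assumes u: "u : L2 U" and g: "g : L2 U"
 shows "has_weak_grad U u g \<longleftrightarrow> (ALL \<phi>:test_functions U. ALL i.
  inner (semb U u) (cls (scalar_field (%x. grad \<phi> x $ i) 1)) = - inner (emb U g) (cls (scalar_field \<phi> i)))"
proof -
 note us = emb(2)[OF u[unfolded L2_scalar]]
 have "(LINT x|lebesgue_on U. u x *R grad \<phi> x) $ i = inner (semb U u) (cls (scalar_field (%x. grad \<phi> x $ i) 1))"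
  "(LINT x|lebesgue_on U. \<phi> x *R g x) $ i = inner (emb U g) (cls (scalar_field \<phi> i))" if \<phi>: "\<phi> : TF U" for \<phi> i
 proof -
  note [measurable] = cc_measurable[OF test_cc(1)[OF \<phi>]] cc_measurable[OF test_cc(2)[OF \<phi>]]
  define U' where "U' x = rep (semb U u) x $ 1" for x
  have 1: "(LINT x|lebesgue_on U. u x *R grad \<phi> x) = (LI x. ind U x *R (U' x *R grad \<phi> x))"
  proof (rule lebesgue_on_lborel(3)[OF U(1)])
   show "AE x\<in>U in lborel. u x *R grad \<phi> x = U' x *R grad \<phi> x"
    using us
   proof eventually_elim
    case (elim x)
    hence "x : U ==> (u x *R axis 1 1 :: real^2) $ 1 = U' x" unfolding U'_def by metis
    thus ?case by(simp add: axis_def)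
   qed
  qed (unfold U'_def, measurable)
  have e1: "ind U x *R (U' x *R grad \<phi> x) = U' x *R grad \<phi> x" for x
   using cc_eq_0[OF test_cc(2)[OF \<phi>], of x] by(auto simp: indicator_def)
  have i1: "L1 (%x. U' x *R grad \<phi> x)"
  proof (rule L1_bound)
   show "L1 (%x. (norm (rep (semb U u) x))^2 + (norm (grad \<phi> x))^2)"
    using sqint_integrable[OF sqint_rep] sqint_integrable[OF test_sqint[OF \<phi>]] by simp
   have "norm (U' x *R grad \<phi> x) <= norm ((norm (rep (semb U u) x))^2 + (norm (grad \<phi> x))^2)" for x
   proof -
    have "abs (U' x) <= norm (rep (semb U u) x)" unfolding U'_def by(rule component_le_norm_cart)
    hence "norm (U' x *R grad \<phi> x) <= norm (rep (semb U u) x) * norm (grad \<phi> x)" by(simp add: mult_right_mono)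
    also have "... <= (norm (rep (semb U u) x))^2 + (norm (grad \<phi> x))^2"
     using sum_squares_bound[of "norm (rep (semb U u) x)" "norm (grad \<phi> x)"] mult_nonneg_nonneg[OF norm_ge_zero[of "rep (semb U u) x"] norm_ge_zero[of "grad \<phi> x"]] by linarith
    finally show ?thesis by simp
   qed
   thus "AEl x. norm (U' x *R grad \<phi> x) <= norm ((norm (rep (semb U u) x))^2 + (norm (grad \<phi> x))^2)" by simp
  qed (unfold U'_def, measurable)
  show "(LINT x|lebesgue_on U. u x *R grad \<phi> x) $ i = inner (semb U u) (cls (scalar_field (%x. grad \<phi> x $ i) 1))"
   unfolding 1 e1 inner_scalar_field[OF test_cc(3)[OF \<phi>]]
   using integral_inner_left[of "axis i 1" lborel "%x. U' x *R grad \<phi> x", OF i1] by(simp add: inner_axis U'_def mult.commute)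
  have 2: "(LINT x|lebesgue_on U. \<phi> x *R g x) = (LI x. \<phi> x *R rep (emb U g) x)"
   by(rule cc_lebesgue_on[OF U(1) test_cc(1)[OF \<phi>] rep_measurable emb(2)[OF g]])
  obtain B where "!!x. norm (\<phi> x) <= B" using cc_bounded[OF test_cc(1)[OF \<phi>]] by blast
  hence "sqint (%x. (\<phi> x *R mat 1) *v rep (emb U g) x)"
   by(intro sqint_mul[OF bounded_field_scalar[of _ B] sqint_rep]) auto
  hence "sqint (%x. \<phi> x *R rep (emb U g) x)" by(simp add: scaleR_matrix_vector_assoc[symmetric])
  hence i2: "L1 (%x. \<phi> x *R rep (emb U g) x)"
   by(rule sqint_bounded_support_integrable[OF _ U(2)]) (use cc_eq_0[OF test_cc(1)[OF \<phi>]] in simp)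
  show "(LINT x|lebesgue_on U. \<phi> x *R g x) $ i = inner (emb U g) (cls (scalar_field \<phi> i))"
   unfolding 2 inner_scalar_field[OF test_cc(1)[OF \<phi>]]
   using integral_inner_left[of "axis i 1" lborel "%x. \<phi> x *R rep (emb U g) x", OF i2] by(simp add: inner_axis)
 qed
 thus ?thesis by(simp add: has_weak_grad_def vec_eq_iff)
qed

lemma weak_grad_unique: assumes "u : L2 U" "g : L2 U" "g' : L2 U" "has_weak_grad U u g" "has_weak_grad U u g'"
 shows "emb U g = emb U g'"
proof (rule supported_unique[OF emb(1)[OF assms(2)] emb(1)[OF assms(3)]])
 define d where "d = emb U g - emb U g'"
 have o: "inner d (cls (scalar_field \<phi> i)) = 0" if "\<phi> : TF U" for \<phi> i
  using assms(4,5) that by(simp add: has_weak_grad_iff[OF assms(1)] assms(2,3) d_def inner_diff_left)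
 have "AE x\<in>U in lborel. rep d x $ i = 0" for i
 proof (rule AE_eq_0_of_test[OF U(1)])
  show "L1 (%x. ind U x * rep d x $ i)"
   using integrable_inner[OF sqint_trunc[OF U continuous_on_const[of UNIV "axis i 1"]] sqint_rep[of d]] by(simp add: inner_axis inner_axis')
  show "(LI x. \<phi> x * rep d x $ i) = 0" if "\<phi> : TF U" for \<phi>
   using o[OF that, of i] by(simp add: inner_scalar_field[OF test_cc(1)[OF that]])
 qed measurable
 from this[of 1] this[of 2] rep_minus[of "emb U g" "emb U g'"]
 show "AE x\<in>U in lborel. rep (emb U g) x = rep (emb U g') x"
  by eventually_elim (auto simp: d_def vec_eq_iff forall_2)
qed

lemma H1_I: assumes "u : L2 U" "g : L2 U" "has_weak_grad U u g"
 shows "u : H1 U" "wgrad U u = emb U g"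
proof -
 show "u : H1 U" using assms by(auto simp: H1_def)
 have "EX g. g : L2 U & has_weak_grad U u g" using assms by blast
 from someI_ex[OF this] have "weak_grad U u : L2 U" "has_weak_grad U u (weak_grad U u)" by(auto simp: weak_grad_def)
 thus "wgrad U u = emb U g" using assms by(intro weak_grad_unique)
qed

lemma H1_D: assumes "u : H1 U"
 shows "u : L2 U" "weak_grad U u : L2 U" "has_weak_grad U u (weak_grad U u)" "scalar_field u 1 : L2 U"
proof -
 have "EX g. g : L2 U & has_weak_grad U u g" using assms by(auto simp: H1_def)
 from someI_ex[OF this] show "weak_grad U u : L2 U" "has_weak_grad U u (weak_grad U u)" by(auto simp: weak_grad_def)
 show "u : L2 U" using assms by(simp add: H1_def)
 thus "scalar_field u 1 : L2 U" using L2_scalar by blast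
qed

lemma H1_norm_sq: assumes "u : H1 U" shows "(H1_norm U u)^2 = (norm (semb U u))^2 + (norm (wgrad U u))^2"
proof -
 have "(norm (semb U u))^2 = (LINT x|lebesgue_on U. (u x)^2)" "(norm (wgrad U u))^2 = (LINT x|lebesgue_on U. (norm (weak_grad U u x))^2)"
  unfolding power2_norm_eq_inner inner_emb[OF H1_D(4)[OF assms] H1_D(4)[OF assms]] inner_emb[OF H1_D(2)[OF assms] H1_D(2)[OF assms]]
  by(simp_all add: inner_axis_axis power2_eq_square)
 moreover have "0 <= (norm (semb U u))^2 + (norm (wgrad U u))^2" by simp
 ultimately show ?thesis unfolding H1_norm_def by simp
qed

lemma H1_linear:
 assumes u: "u : H1 U" "v : H1 U"
 shows "(%x. a * u x + b * v x) : H1 U" "semb U (%x. a * u x + b * v x) = a *R semb U u + b *R semb U v"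
  "wgrad U (%x. a * u x + b * v x) = a *R wgrad U u + b *R wgrad U v"
proof -
 let ?l = "%x. a * u x + b * v x"
 have e: "scalar_field ?l 1 = (%x. a *R scalar_field u 1 x + b *R scalar_field v 1 x)"
  by(simp add: scaleR_add_left)
 note s = emb_linear[OF H1_D(4)[OF u(1)] H1_D(4)[OF u(2)], of a b, folded e]
 note g = emb_linear[OF H1_D(2)[OF u(1)] H1_D(2)[OF u(2)], of a b]
 show "semb U ?l = a *R semb U u + b *R semb U v" by(rule s(2))
 have L: "?l : L2 U" using s(1) L2_scalar by blast
 have "has_weak_grad U ?l (%x. a *R weak_grad U u x + b *R weak_grad U v x)"
  using H1_D(3)[OF u(1)] H1_D(3)[OF u(2)]
  by(simp add: has_weak_grad_iff[OF L g(1)] has_weak_grad_iff[OF H1_D(1,2)[OF u(1)]] has_weak_grad_iff[OF H1_D(1,2)[OF u(2)]]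
    s(2) g(2) inner_add_left)
 from H1_I[OF L g(1) this] g(2)
 show "?l : H1 U" "wgrad U ?l = a *R wgrad U u + b *R wgrad U v" by simp_all
qed

lemma test_H1:
 assumes \<phi>: "\<phi> : TF U" shows "\<phi> : H1 U" "semb U \<phi> = cls (scalar_field \<phi> 1)" "wgrad U \<phi> = cls (grad \<phi>)"
proof -
 note s = cc_L2[OF cc_scalar_field[OF test_cc(1)[OF \<phi>]], of 1] and g = cc_L2[OF test_cc(2)[OF \<phi>]]
 show "semb U \<phi> = cls (scalar_field \<phi> 1)" by(rule s(2))
 have L: "\<phi> : L2 U" using s(1) L2_scalar by blast
 have "has_weak_grad U \<phi> (grad \<phi>)"
  unfolding has_weak_grad_iff[OF L g(1)] s(2) g(2)
 proof (intro ballI allI)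
  fix \<psi> i assume \<psi>: "\<psi> : TF U"
  note c = test_function_c1c[OF \<phi>] test_function_c1c[OF \<psi>]
  have "inner (cls (scalar_field \<phi> 1)) (cls (scalar_field (%x. grad \<psi> x $ i) 1)) = (LI x. \<phi> x * grad \<psi> x $ i)"
   unfolding inner_cls[OF cc_sqint[OF cc_scalar_field[OF test_cc(1)[OF \<phi>]]] cc_sqint[OF cc_scalar_field[OF test_cc(3)[OF \<psi>]]]]
   by(simp add: inner_axis_axis mult.commute)
  moreover have "inner (cls (grad \<phi>)) (cls (scalar_field \<psi> i)) = (LI x. \<psi> x * grad \<phi> x $ i)"
   unfolding inner_cls[OF test_sqint[OF \<phi>] cc_sqint[OF cc_scalar_field[OF test_cc(1)[OF \<psi>]]]]
   by(simp add: inner_axis mult.commute)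
  moreover have "(LI x. \<psi> x * grad \<phi> x $ i + \<phi> x * grad \<psi> x $ i) = 0"
   using integral_grad_zero[OF c1c_mult[OF c(1) c1c_D(3)[OF c(2)] cc_continuous[OF c1c_D(2)[OF c(2)]]], of "axis i 1"]
   by(simp add: inner_add_left inner_axis)
  moreover have "L1 (%x. \<psi> x * grad \<phi> x $ i)" "L1 (%x. \<phi> x * grad \<psi> x $ i)"
   using cc_integrable[OF cc_scale_left[OF test_cc(1)[OF \<psi>] cc_continuous[OF test_cc(3)[OF \<phi>]]]]
    cc_integrable[OF cc_scale_left[OF test_cc(1)[OF \<phi>] cc_continuous[OF test_cc(3)[OF \<psi>]]]] by auto
  ultimately show "inner (cls (scalar_field \<phi> 1)) (cls (scalar_field (%x. grad \<psi> x $ i) 1)) = - inner (cls (grad \<phi>)) (cls (scalar_field \<psi> i))"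
   by simp
 qed
 from H1_I[OF L g(1) this] g(2) show "\<phi> : H1 U" "wgrad U \<phi> = cls (grad \<phi>)" by simp_all
qed

lemma H1_diff: "u : H1 U ==> v : H1 U ==> (H1_norm U (%x. u x - v x))^2 = (norm (semb U u - semb U v))^2 + (norm (wgrad U u - wgrad U v))^2"
 using H1_norm_sq[OF H1_linear(1), of u v 1 "-1"] H1_linear(2,3)[of u v 1 "-1"] by simp

lemma H1_norm_nonneg: "0 <= H1_norm U u"
 unfolding H1_norm_def by(intro real_sqrt_ge_zero add_nonneg_nonneg Lint_nonneg) auto

lemma H10_iff:
 "u : H10 U \<longleftrightarrow> u : H1 U & (EX \<phi>. (ALL k::nat. \<phi> k : TF U) &
  (%k. semb U (\<phi> k)) ----> semb U u & (%k. cls (grad (\<phi> k))) ----> wgrad U u)"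
proof -
 have "(%k. H1_norm U (%x. \<phi> k x - u x)) ----> 0 \<longleftrightarrow>
   (%k. semb U (\<phi> k)) ----> semb U u & (%k. cls (grad (\<phi> k))) ----> wgrad U u"
  if \<phi>: "ALL k::nat. \<phi> k : TF U" and u: "u : H1 U" for \<phi>
 proof -
  define A B where "A k = norm (semb U (\<phi> k) - semb U u)" and "B k = norm (cls (grad (\<phi> k)) - wgrad U u)" for k
  have e: "(H1_norm U (%x. \<phi> k x - u x))^2 = (A k)^2 + (B k)^2" for k
   using H1_diff[OF test_H1(1) u] \<phi> test_H1(3) by(simp add: A_def B_def)
  have h: "H1_norm U (%x. \<phi> k x - u x) = sqrt ((A k)^2 + (B k)^2)" for k
   using e[of k] H1_norm_nonneg by(metis real_sqrt_abs abs_of_nonneg)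
  have "(%k. sqrt ((A k)^2 + (B k)^2)) ----> 0 \<longleftrightarrow> A ----> 0 & B ----> 0"
  proof
   assume l: "(%k. sqrt ((A k)^2 + (B k)^2)) ----> 0"
   show "A ----> 0 & B ----> 0"
    by(intro conjI; rule tendsto_sandwich[OF _ _ tendsto_const l]) (auto simp: A_def B_def real_le_rsqrt)
  next
   assume "A ----> 0 & B ----> 0"
   hence "(%k. sqrt ((A k)^2 + (B k)^2)) ----> sqrt (0^2 + 0^2)" by(intro tendsto_intros) auto
   thus "(%k. sqrt ((A k)^2 + (B k)^2)) ----> 0" by simp
  qed
  thus ?thesis unfolding h A_def B_def by(simp only: LIM_zero_iff tendsto_norm_zero_iff)
 qed
 thus ?thesis unfolding H10_def by blast
qed

end

context domain
begin

lemma rep_in_L2: assumes "w : supported U" shows "rep w : L2 U" "emb U (rep w) = w"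
 using rep_L2[OF assms, of "rep w"] by simp_all

lemma Poincare_test: obtains C where "C >= 0" "!!\<phi>. \<phi> : TF U ==> norm (semb U \<phi>) <= C * norm (cls (grad \<phi>))"
proof -
 obtain R where R: "!!x. x : U ==> norm x <= R" using U(2) unfolding bounded_iff by blast
 have "norm (semb U \<phi>) <= (2 * abs R) * norm (cls (grad \<phi>))" if \<phi>: "\<phi> : TF U" for \<phi>
 proof (rule power2_le_imp_le)
  have "(norm (semb U \<phi>))^2 = (LI x. (\<phi> x)^2)"
   unfolding test_H1(2)[OF \<phi>] norm_cls[OF cc_sqint[OF cc_scalar_field[OF test_cc(1)[OF \<phi>]]]] by simp
  also have "... <= 4 * \<bar>R\<bar>^2 * (LI x. (norm (grad \<phi> x))^2)"
   by(rule Poincare[OF test_function_c1c[OF \<phi>]]) (use R in "auto intro: order_trans[OF _ abs_ge_self]")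
  finally show "(norm (semb U \<phi>))^2 <= (2 * abs R * norm (cls (grad \<phi>)))^2"
   by(simp add: power_mult_distrib norm_cls[OF test_sqint[OF \<phi>]])
 qed simp
 thus thesis by(intro that[of "2 * abs R"]) auto
qed

lemma H10_approx:
 assumes "u : H10 U"
 obtains \<phi> where "!!k::nat. \<phi> k : TF U" "(%k. semb U (\<phi> k)) ----> semb U u" "(%k. cls (grad (\<phi> k))) ----> wgrad U u"
 using assms unfolding H10_iff by blast

lemma H10_H1: "u : H10 U ==> u : H1 U" by(simp add: H10_iff)

lemma wgrad_in: assumes "u : H10 U" shows "wgrad U u : gradients U"
proof -
 obtain \<phi> where \<phi>: "!!k::nat. \<phi> k : TF U" "(%k. cls (grad (\<phi> k))) ----> wgrad U u" by(rule H10_approx[OF assms]) blast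
 show ?thesis by(rule closed_sequentially[OF closed_gradients _ \<phi>(2)]) (rule test_gradient_in[OF \<phi>(1)])
qed

lemma Poincare_H10: obtains C where "C >= 0" "!!u. u : H10 U ==> norm (semb U u) <= C * norm (wgrad U u)"
proof -
 obtain C where C: "C >= 0" "!!\<phi>. \<phi> : TF U ==> norm (semb U \<phi>) <= C * norm (cls (grad \<phi>))" by(rule Poincare_test) blast
 have "norm (semb U u) <= C * norm (wgrad U u)" if u: "u : H10 U" for u
 proof -
  obtain \<phi> where \<phi>: "!!k::nat. \<phi> k : TF U" "(%k. semb U (\<phi> k)) ----> semb U u" "(%k. cls (grad (\<phi> k))) ----> wgrad U u"
   by(rule H10_approx[OF u]) blast
  show ?thesis by(rule LIMSEQ_le[OF tendsto_norm[OF \<phi>(2)] tendsto_mult_left[OF tendsto_norm[OF \<phi>(3)]]]) (use C(2) \<phi>(1) in blast)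
 qed
 with C(1) show thesis by(rule that)
qed

lemma test_linear: "\<phi> : TF U ==> \<psi> : TF U ==> (%x. a * \<phi> x + b * \<psi> x) : TF U"
 by(intro test_functions_add test_functions_scale)

lemma test_H10: "\<phi> : TF U ==> \<phi> : H10 U"
 unfolding H10_iff using test_H1 by(auto intro!: exI[of _ "%k. \<phi>"])

lemma H10_linear: assumes "u : H10 U" "v : H10 U" shows "(%x. a * u x + b * v x) : H10 U"
proof -
 obtain \<phi> where \<phi>: "!!k::nat. \<phi> k : TF U" "(%k. semb U (\<phi> k)) ----> semb U u" "(%k. cls (grad (\<phi> k))) ----> wgrad U u"
  by(rule H10_approx[OF assms(1)]) blast
 obtain \<psi> where \<psi>: "!!k::nat. \<psi> k : TF U" "(%k. semb U (\<psi> k)) ----> semb U v" "(%k. cls (grad (\<psi> k))) ----> wgrad U v"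
  by(rule H10_approx[OF assms(2)]) blast
 note l = H1_linear[OF H10_H1[OF assms(1)] H10_H1[OF assms(2)], of a b]
 note lk = H1_linear[OF test_H1(1)[OF \<phi>(1)] test_H1(1)[OF \<psi>(1)], of a _ b]
 have t: "(%x. a * \<phi> k x + b * \<psi> k x) : TF U" for k by(rule test_linear[OF \<phi>(1) \<psi>(1)])
 show ?thesis unfolding H10_iff
 proof (intro conjI l(1) exI[of _ "%k x. a * \<phi> k x + b * \<psi> k x"] allI t)
  show "(%k. semb U (%x. a * \<phi> k x + b * \<psi> k x)) ----> semb U (%x. a * u x + b * v x)"
   unfolding l(2) lk(2) by(intro tendsto_intros \<phi> \<psi>)
  show "(%k. cls (grad (%x. a * \<phi> k x + b * \<psi> k x))) ----> wgrad U (%x. a * u x + b * v x)"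
   unfolding l(3) test_H1(3)[OF t, symmetric] lk(3) test_H1(3)[OF \<phi>(1)] test_H1(3)[OF \<psi>(1)] by(intro tendsto_intros \<phi> \<psi>)
 qed
qed

lemma H10_unique:
 assumes u: "u : H10 U" "v : H10 U" "wgrad U u = wgrad U v"
 shows "AE x in lebesgue_on U. u x = v x" "H1_norm U (%x. u x - v x) = 0"
proof -
 obtain C where C: "!!u. u : H10 U ==> norm (semb U u) <= C * norm (wgrad U u)" by(rule Poincare_H10) blast
 have "semb U u = semb U v"
  using C[OF H10_linear[OF u(1,2), of 1 "-1"]] u(3) unfolding H1_linear(2,3)[OF H10_H1[OF u(1)] H10_H1[OF u(2)]] by simp
 thus "H1_norm U (%x. u x - v x) = 0" using H1_diff[OF H10_H1[OF u(1)] H10_H1[OF u(2)]] u(3) by simp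
 show "AE x in lebesgue_on U. u x = v x"
  unfolding AE_on[OF U(1)]
  using emb(2)[OF H1_D(4)[OF H10_H1[OF u(1)]]] emb(2)[OF H1_D(4)[OF H10_H1[OF u(2)]]] unfolding \<open>semb U u = semb U v\<close>
 proof eventually_elim
  case (elim x)
  hence "x : U ==> (u x *R axis 1 1 :: real^2) $ 1 = (v x *R axis 1 1 :: real^2) $ 1" by metis
  thus ?case by(simp add: axis_def)
 qed
qed

lemma H10_limit:
 assumes \<phi>: "!!k::nat. \<phi> k : TF U" and u: "u : L2 U" "(%k. semb U (\<phi> k)) ----> semb U u"
  and g: "(%k. cls (grad (\<phi> k))) ----> g"
 shows "u : H10 U" "wgrad U u = g"
proof -
 have "g : gradients U" by(rule closed_sequentially[OF closed_gradients _ g]) (rule test_gradient_in[OF \<phi>])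
 hence gs: "g : supported U" using gradients_supported[OF U(1)] by blast
 have "has_weak_grad U u (rep g)"
  unfolding has_weak_grad_iff[OF u(1) rep_in_L2(1)[OF gs]] rep_in_L2(2)[OF gs]
 proof (intro ballI allI)
  fix \<psi> i assume \<psi>: "\<psi> : TF U"
  have e: "inner (semb U (\<phi> k)) (cls (scalar_field (%x. grad \<psi> x $ i) 1)) = - inner (cls (grad (\<phi> k))) (cls (scalar_field \<psi> i))" for k
   using H1_D(3)[OF test_H1(1)[OF \<phi>]] \<psi> unfolding has_weak_grad_iff[OF H1_D(1,2)[OF test_H1(1)[OF \<phi>]]] test_H1(3)[OF \<phi>] by blast
  have "(%k. - inner (cls (grad (\<phi> k))) (cls (scalar_field \<psi> i))) ----> - inner g (cls (scalar_field \<psi> i))" by(intro tendsto_intros g)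
  moreover have "(%k. - inner (cls (grad (\<phi> k))) (cls (scalar_field \<psi> i))) ----> inner (semb U u) (cls (scalar_field (%x. grad \<psi> x $ i) 1))"
   unfolding e[symmetric] by(intro tendsto_intros u)
  ultimately show "inner (semb U u) (cls (scalar_field (%x. grad \<psi> x $ i) 1)) = - inner g (cls (scalar_field \<psi> i))" by(rule LIMSEQ_unique[symmetric])
 qed
 note h = H1_I[OF u(1) rep_in_L2(1)[OF gs] this]
 show "wgrad U u = g" unfolding h(2) by(rule rep_in_L2(2)[OF gs])
 thus "u : H10 U" unfolding H10_iff using h(1) \<phi> u(2) g by blast
qed

text \<open>Convergent gradients come from Cauchy sequences of test functions, by Poincare's
  inequality applied to differences.\<close>

lemma wgrad_surj: assumes "g : gradients U" obtains u where "u : H10 U" "wgrad U u = g"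
proof -
 obtain y where y: "!!k. y k : {cls (grad \<phi>) |\<phi>. \<phi> : TF U}" "y ----> g"
  using assms closure_sequential unfolding gradients_def by blast
 have "ALL k. EX \<phi>. \<phi> : TF U & y k = cls (grad \<phi>)" using y(1) by blast
 from choice[OF this] obtain \<phi> where \<phi>: "!!k. \<phi> k : TF U" "!!k. y k = cls (grad (\<phi> k))" by blast
 obtain C where C: "C >= 0" "!!\<phi>. \<phi> : TF U ==> norm (semb U \<phi>) <= C * norm (cls (grad \<phi>))" by(rule Poincare_test) blast
 have le: "norm (semb U (\<phi> m) - semb U (\<phi> n)) <= C * norm (y m - y n)" for m n
  using C(2)[OF test_linear[OF \<phi>(1)[of m] \<phi>(1)[of n], of 1 "-1"]] H1_linear[OF test_H1(1)[OF \<phi>(1)[of m]] test_H1(1)[OF \<phi>(1)[of n]], of 1 "-1"]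
   test_H1(3)[OF test_linear[OF \<phi>(1)[of m] \<phi>(1)[of n], of 1 "-1"]] test_H1(3)[OF \<phi>(1)] by(simp add: \<phi>(2))
 have "Cauchy (%k. semb U (\<phi> k))"
 proof (rule metric_CauchyI)
  fix e :: real assume e: "e > 0"
  obtain N where N: "!!m n. m >= N ==> n >= N ==> dist (y m) (y n) < e / (C + 1)"
   using metric_CauchyD[OF LIMSEQ_imp_Cauchy[OF y(2)], of "e / (C + 1)"] e C(1) by auto
  have "dist (semb U (\<phi> m)) (semb U (\<phi> n)) < e" if "m >= N" "n >= N" for m n
  proof -
   have "dist (semb U (\<phi> m)) (semb U (\<phi> n)) <= (C + 1) * dist (y m) (y n)"
    using le[of m n] norm_ge_zero[of "y m - y n"] unfolding dist_norm distrib_right by linarith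
   also have "... < e" using N[OF that] C(1) by(simp add: field_simps)
   finally show ?thesis .
  qed
  thus "EX N. ALL m>=N. ALL n>=N. dist (semb U (\<phi> m)) (semb U (\<phi> n)) < e" by blast
 qed
 then obtain w where w: "(%k. semb U (\<phi> k)) ----> w" using Cauchy_convergent convergent_def by blast
 \<comment> \<open>The projection onto the first component fixes every
   \<open>semb U (\<phi> k)\<close>, hence also the limit \<open>w\<close>, which is therefore a
   scalar function.\<close>
 define M where "M = columns (axis 1 1) 0"
 have M: "M *v v = v $ 1 *R axis 1 1" for v by(simp add: M_def columns_mult)
 have ws: "w : supported U"
  by(rule closed_sequentially[OF closed_supported _ w]) (auto intro: emb H1_D(4) test_H1(1) \<phi>(1))
 have "mul (%x. M) (semb U (\<phi> k)) = semb U (\<phi> k)" for k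
  unfolding test_H1(2)[OF \<phi>(1)] mul_cls[OF bounded_field_const cc_sqint[OF cc_scalar_field[OF test_cc(1)[OF \<phi>(1)]]]] by(simp add: M)
 hence "(%k. semb U (\<phi> k)) ----> mul (%x. M) w"
  using bounded_linear.tendsto[OF bounded_linear_mul[OF bounded_field_const] w, of M] by simp
 hence "w = mul (%x. M) w" using w by(rule LIMSEQ_unique[symmetric])
 hence "AE x\<in>U in lborel. scalar_field (%x. rep w x $ 1) 1 x = rep w x"
  using rep_mul[OF bounded_field_const, of M w] unfolding \<open>w = mul (%x. M) w\<close>[symmetric] M by eventually_elim metis
 from rep_L2[OF ws this] have u: "(%x. rep w x $ 1) : L2 U" "semb U (%x. rep w x $ 1) = w" by(simp_all add: L2_scalar)
 have g: "(%k. cls (grad (\<phi> k))) ----> g" using y(2) by(simp add: \<phi>(2)[symmetric])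
 show thesis by(rule that[OF H10_limit[OF \<phi>(1) u(1) _ g]]) (simp_all add: u(2) w)
qed

text \<open>A functional depends only on the gradient, because functions with equal gradients have
  H^1 distance zero. Poincare's inequality bounds it by the norm of the gradient, and Riesz applies.
  The sign is that of the distribution \<open>div h\<close>.\<close>

lemma H_minus1_representation:
 assumes F: "F : H_minus1 U" obtains h where "!!u. u : H10 U ==> F u = - inner h (wgrad U u)"
proof -
 have add: "F (%x. u x + v x) = F u + F v" if "u : H10 U" "v : H10 U" for u v using F that by(simp add: H_minus1_def)
 have scale: "F (%x. c * u x) = c * F u" if "u : H10 U" for c u using F that by(simp add: H_minus1_def)
 obtain B where B: "!!u. u : H10 U ==> abs (F u) <= B * H1_norm U u" using F unfolding H_minus1_def by blast
 have sc: "(%x. c * u x) : H10 U" if "u : H10 U" for c u using H10_linear[OF that that, of c 0] by simp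
 have lin: "F (%x. a * u x + b * v x) = a * F u + b * F v" if "u : H10 U" "v : H10 U" for a b u v
  using add[OF sc[OF that(1), of a] sc[OF that(2), of b]] scale that by simp
 have eq: "F u = F v" if uv: "u : H10 U" "v : H10 U" "wgrad U u = wgrad U v" for u v
  using B[OF H10_linear[OF uv(1,2), of 1 "-1"]] lin[OF uv(1,2), of 1 "-1"] H10_unique(2)[OF uv] by simp
 \<comment> \<open>A choice of a primitive for each gradient; it need not be linear, as
   \<open>F\<close> does not distinguish primitives.\<close>
 define pick where "pick g = (SOME u. u : H10 U & wgrad U u = g)" for g
 have pick: "pick g : H10 U" "wgrad U (pick g) = g" if "g : gradients U" for g
 proof -
  have "EX u. u : H10 U & wgrad U u = g" using wgrad_surj[OF that] by metis
  from someI_ex[OF this] show "pick g : H10 U" "wgrad U (pick g) = g" by(auto simp: pick_def)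
 qed
 have pl: "F (pick (a *R g + b *R g')) = a * F (pick g) + b * F (pick g')" if g: "g : gradients U" "g' : gradients U" for a b g g'
 proof -
  note s = subspace_add[OF subspace_gradients subspace_scale[OF subspace_gradients g(1)] subspace_scale[OF subspace_gradients g(2)]]
  have "F (pick (a *R g + b *R g')) = F (%x. a * pick g x + b * pick g' x)"
   by(rule eq[OF pick(1)[OF s] H10_linear[OF pick(1)[OF g(1)] pick(1)[OF g(2)]]])
    (simp add: pick(2)[OF s] H1_linear(3)[OF H10_H1[OF pick(1)[OF g(1)]] H10_H1[OF pick(1)[OF g(2)]]] pick(2) g)
  thus ?thesis using lin[OF pick(1)[OF g(1)] pick(1)[OF g(2)]] by simp
 qed
 obtain C where C: "C >= 0" "!!u. u : H10 U ==> norm (semb U u) <= C * norm (wgrad U u)" by(rule Poincare_H10) blast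
 have bound: "abs (F (pick g)) <= (abs B * (C + 1)) * norm g" if g: "g : gradients U" for g
 proof -
  have "(H1_norm U (pick g))^2 <= (C * norm g)^2 + (norm g)^2"
   using H1_norm_sq[OF H10_H1[OF pick(1)[OF g]]] power_mono[OF C(2)[OF pick(1)[OF g]], of 2] by(simp add: pick(2)[OF g])
  also have "... <= ((C + 1) * norm g)^2" using C(1) by(simp add: power2_eq_square algebra_simps)
  finally have "H1_norm U (pick g) <= (C + 1) * norm g" by(rule power2_le_imp_le) (use C(1) in simp)
  from mult_left_mono[OF this, of "abs B"] mult_right_mono[OF abs_ge_self H1_norm_nonneg, of B "pick g"] B[OF pick(1)[OF g]]
  show ?thesis by(simp add: mult.assoc)
 qed
 obtain h where h: "!!g. g : gradients U ==> inner h g = F (pick g)"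
 proof (rule Riesz_subspace[of "gradients U" "%g. F (pick g)" "abs B * (C + 1)"])
  show "F (pick (u + v)) = F (pick u) + F (pick v)" if "u : gradients U" "v : gradients U" for u v using pl[OF that, of 1 1] by simp
  show "F (pick (c *R u)) = c * F (pick u)" if "u : gradients U" for c u using pl[OF that that, of c 0] by simp
 qed (use bound subspace_gradients in auto)
 show thesis
 proof (rule that[of "- h"])
  fix u assume u: "u : H10 U"
  show "F u = - inner (- h) (wgrad U u)" using eq[OF u pick(1)[OF wgrad_in[OF u]]] pick(2)[OF wgrad_in[OF u]] h[OF wgrad_in[OF u]] by simp
 qed
qed

lemma L2_integrable: assumes "(v :: real^2 => real^2) : L2 U" shows "integrable (lebesgue_on U) v"
proof -
 have "sqint (%x. ind U x *R rep (emb U v) x)"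
  by(rule sqint_bound[OF _ sqint_integrable[OF sqint_rep[of "emb U v"]]]) (auto simp: indicator_def)
 hence "L1 (%x. ind U x *R rep (emb U v) x)" by(rule sqint_bounded_support_integrable[OF _ U(2)]) simp
 thus ?thesis using lebesgue_on_lborel(2)[OF U(1) rep_measurable emb(2)[OF assms]] by simp
qed

lemma flux_emb:
 assumes N: "coercive_field \<alpha> N" and A: "AE x\<in>U in lborel. A x = N x" and u: "u : H1 U"
 shows "(%x. A x *v weak_grad U u x) : L2 U" "emb U (%x. A x *v weak_grad U u x) = mul N (wgrad U u)"
proof -
 obtain B where B: "bounded_field B N" using N by(auto simp: coercive_field_def)
 have "AE x\<in>U in lborel. A x *v weak_grad U u x = rep (mul N (wgrad U u)) x"
  using A rep_mul[OF B, of "wgrad U u"] emb(2)[OF H1_D(2)[OF u]] by eventually_elim simp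
 from rep_L2[OF mul_supported[OF B emb(1)[OF H1_D(2)[OF u]]] this]
 show "(%x. A x *v weak_grad U u x) : L2 U" "emb U (%x. A x *v weak_grad U u x) = mul N (wgrad U u)" by simp_all
qed

lemma is_solution_iff:
 assumes N: "coercive_field \<alpha> N" "\<alpha> > 0" and A: "AE x\<in>U in lborel. A x = N x"
  and F: "!!u. u : H10 U ==> F u = - inner h (wgrad U u)"
 shows "is_solution U A F u \<longleftrightarrow> u : H10 U & wgrad U u = potential U N h"
proof (cases "u : H10 U")
 case True
 note f = flux_emb[OF N(1) A H10_H1[OF True]]
 have "(LINT x|lebesgue_on U. (A x *v weak_grad U u x) *. grad \<phi> x) = inner (mul N (wgrad U u)) (cls (grad \<phi>))"
  if "\<phi> : TF U" for \<phi>
  using inner_emb[OF f(1) cc_L2(1)[OF test_cc(2)[OF that]]] by(simp add: f(2) cc_L2(2)[OF test_cc(2)[OF that]])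
 hence "is_solution U A F u \<longleftrightarrow> (ALL \<phi>:test_functions U. inner (mul N (wgrad U u)) (cls (grad \<phi>)) = inner h (cls (grad \<phi>)))"
  using True L2_integrable[OF f(1)] F[OF test_H10] test_H1(3) by(simp add: is_solution_def)
 also have "... \<longleftrightarrow> wgrad U u = potential U N h"
 proof
  assume l: "ALL \<phi>:test_functions U. inner (mul N (wgrad U u)) (cls (grad \<phi>)) = inner h (cls (grad \<phi>))"
  have "inner (mul N (wgrad U u)) v = inner h v" if "v : gradients U" for v
   using l that unfolding gradients_def by(intro subspace_closure_inner[of _ "mul N (wgrad U u)" h v]) auto
  thus "wgrad U u = potential U N h" by(rule potential_eqI[OF N wgrad_in[OF True], symmetric])
 qed (use potential(2)[OF N test_gradient_in] in "simp add: flux_def")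
 finally show ?thesis using True by simp
qed (simp add: is_solution_def)

lemma is_unique_solutionI:
 assumes "coercive_field \<alpha> N" "\<alpha> > 0" "AE x\<in>U in lborel. A x = N x"
  "!!u. u : H10 U ==> F u = - inner h (wgrad U u)" "u : H10 U" "wgrad U u = potential U N h"
 shows "is_unique_solution U A F u"
proof -
 have "is_solution U A F v \<longleftrightarrow> v : H10 U & wgrad U v = potential U N h" for v
  by(rule is_solution_iff[OF assms(1-3)]) (rule assms(4))
 thus ?thesis unfolding is_unique_solution_def using assms(5,6) H10_unique(1) by auto
qed

end

section \<open>Weak-star convergence and H-convergence\<close>

text \<open>Soft thresholding moves all values towards zero by \<open>e\<close>: the result vanishes
  wherever |\<phi>| < e, which leaves a compact support, and continuity is kept.\<close>

lemma C0_soft_truncation: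
 assumes U: "open U" and \<phi>: "\<phi> : C0 U" and e: "e > 0"
 obtains \<psi> where "cc U (\<psi> :: real^2 => real)" "!!x. x : U ==> abs (\<phi> x - \<psi> x) <= e"
proof -
 define s where "s t = max (t - e) 0 + min (t + e) 0" for t :: real
 define \<psi> where "\<psi> x = (if x : U then s (\<phi> x) else 0)" for x
 define K where "K = {x : U. abs (\<phi> x) >= e}"
 have K: "compact K" "K \<subseteq> U" using \<phi> e by(auto simp: C0_def K_def)
 have z: "\<psi> x = 0" if "x ~: K" for x using that by(auto simp: \<psi>_def K_def s_def)
 have "continuous_on U (%x. s (\<phi> x))" unfolding s_def using \<phi> by(intro continuous_intros) (auto simp: C0_def)
 hence "continuous_on U \<psi>" by(subst continuous_on_cong[OF refl, of _ _ "%x. s (\<phi> x)"]) (auto simp: \<psi>_def)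
 moreover have "continuous_on (- K) \<psi>" by(subst continuous_on_cong[OF refl, of _ _ "%x. 0"]) (auto simp: z)
 ultimately have "continuous_on (U \<union> - K) \<psi>" using U K(1) by(intro continuous_on_open_Un) (auto simp: compact_imp_closed)
 hence "cc U \<psi>" using K z by(intro ccI[of \<psi> K]) (auto simp: Un_absorb1 elim: continuous_on_subset)
 moreover have "abs (\<phi> x - \<psi> x) <= e" if "x : U" for x using that e by(auto simp: \<psi>_def s_def)
 ultimately show thesis by(rule that)
qed

lemma tendsto_uniform_approx:
 fixes x :: "nat => 'a::metric_space"
 assumes "!!e. e > 0 ==> EX y y'. y ----> y' & (ALL n. dist (x n) (y n) <= e) & dist x' y' <= e"
 shows "x ----> x'"
proof (rule tendstoI)
 fix e :: real assume "e > 0"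
 then obtain y y' where y: "y ----> y'" "!!n. dist (x n) (y n) <= e / 4" "dist x' y' <= e / 4" using assms[of "e / 4"] by auto
 have e4: "0 < e / 4" using \<open>e > 0\<close> by simp
 show "\<forall>\<^sub>F n in sequentially. dist (x n) x' < e"
  using tendstoD[OF y(1) e4]
 proof eventually_elim
  case (elim n)
  thus ?case using \<open>e > 0\<close> y(2)[of n] y(3) dist_triangle[of "x n" x' "y n"] dist_triangle[of "y n" x' y'] dist_commute[of x' y'] by linarith
 qed
qed

context domain
begin

lemma C0_pairing:
 assumes \<phi>: "\<phi> : C0 U" "cc U \<psi>" "e >= 0" "!!x. x : U ==> abs (\<phi> x - \<psi> x) <= e" and v: "v : L2 U"
 shows "dist (LINT x|lebesgue_on U. \<phi> x *R v x) (LI x. \<psi> x *R rep (emb U v) x)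
  <= e * (LI x. ind U x * norm (rep (emb U v) x))"
proof -
 define w where "w x = rep (emb U v) x" for x
 define f where "f x = ind U x *R \<phi> x" for x
 have [measurable]: "w : borel_fun" "f : borel_fun" "\<psi> : borel_fun"
  using borel_measurable_continuous_on_indicator[OF U_borel, of \<phi>] \<phi>(1) cc_measurable[OF \<phi>(2)] unfolding w_def f_def C0_def by simp_all
 have ae: "AE x\<in>U in lborel. \<phi> x *R v x = f x *R w x"
  using emb(2)[OF v] by eventually_elim (simp add: w_def f_def)
 obtain B where B: "!!x. norm (\<psi> x) <= B" using cc_bounded[OF \<phi>(2)] by blast
 have iw: "L1 (%x. ind U x *R w x)"
  using L2_integrable[OF v] lebesgue_on_lborel(2)[OF U(1) rep_measurable emb(2)[OF v]] by(simp add: w_def)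
 hence iw': "L1 (%x. ind U x * norm (w x))" using integrable_norm[OF iw] by simp
 have fb: "abs (f x) <= B + e" "abs (f x - \<psi> x) <= ind U x * e" for x
 proof -
  have "0 <= B" using norm_ge_zero[of "\<psi> x"] B[of x] by linarith
  thus "abs (f x) <= B + e" "abs (f x - \<psi> x) <= ind U x * e"
   using \<phi>(4)[of x] B[of x] \<phi>(3) cc_eq_0[OF \<phi>(2), of x] by(auto simp: f_def indicator_def)
 qed
 have i: "L1 (%x. ind U x *R (f x *R w x))"
  by(rule L1_bound[OF integrable_mult_right[OF iw', of "B + e"]])
   (use fb(1) in "auto simp: indicator_def abs_mult intro!: AE_I2 mult_right_mono order_trans[OF _ abs_ge_self]")
 have j: "L1 (%x. \<psi> x *R w x)"
  by(rule L1_bound[OF integrable_mult_right[OF iw', of B]])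
   (use B cc_eq_0[OF \<phi>(2)] in "auto simp: indicator_def abs_mult intro!: AE_I2 mult_right_mono order_trans[OF _ abs_ge_self]")
 have "(LINT x|lebesgue_on U. \<phi> x *R v x) = (LI x. ind U x *R (f x *R w x))"
  by(rule lebesgue_on_lborel(3)[OF U(1) _ ae]) measurable
 hence "dist (LINT x|lebesgue_on U. \<phi> x *R v x) (LI x. \<psi> x *R w x)
   = norm (LI x. ind U x *R (f x *R w x) - \<psi> x *R w x)" using i j by(simp add: dist_norm)
 also have "... <= (LI x. e * (ind U x * norm (w x)))"
 proof (rule Lint_norm_bound)
  fix x
  have "ind U x *R (f x *R w x) - \<psi> x *R w x = (f x - \<psi> x) *R w x" by(auto simp: f_def indicator_def scaleR_diff_left)
  thus "norm (ind U x *R (f x *R w x) - \<psi> x *R w x) <= e * (ind U x * norm (w x))"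
   using mult_right_mono[OF fb(2)[of x], of "norm (w x)"] by(simp add: mult_ac)
 qed (use i j iw' in auto)
 finally show ?thesis by(simp add: w_def)
qed

text \<open>Passing from test functions of compact support to those in \<open>C0 U\<close> costs a
  uniformly small error, because the L^1 norms are bounded.\<close>

lemma weak_star_of_fields:
 assumes v: "!!n. v n : L2 U" "w : L2 U" and C: "!!n. (LI x. ind U x * norm (rep (emb U (v n)) x)) <= C"
  and lim: "!!f. f : fields U ==> (%n. inner (emb U (v n)) f) ----> inner (emb U w) f"
 shows "weak_star_converges U v w"
 unfolding weak_star_converges_def
proof (intro conjI allI ballI L2_integrable v)
 fix \<phi> assume \<phi>: "\<phi> : C0 U"
 define D where "D = max C (LI x. ind U x * norm (rep (emb U w) x))"
 have "0 <= (LI x. ind U x * norm (rep (emb U w) x))" by(rule Lint_nonneg) simp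
 hence D: "D >= 0" "C <= D" "(LI x. ind U x * norm (rep (emb U w) x)) <= D"
  unfolding D_def by linarith+
 show "(%n. LINT x|lebesgue_on U. \<phi> x *R v n x) ----> (LINT x|lebesgue_on U. \<phi> x *R w x)"
 proof (rule tendsto_uniform_approx)
  fix e :: real assume e: "e > 0"
  define d where "d = e / (D + 1)"
  have d: "d > 0" "d * D <= e" using e D(1) by(auto simp: d_def field_simps)
  obtain \<psi> where \<psi>: "cc U \<psi>" "!!x. x : U ==> abs (\<phi> x - \<psi> x) <= d" by(rule C0_soft_truncation[OF U(1) \<phi> d(1)]) blast
  have c: "(LI x. \<psi> x *R rep u x) $ i = inner u (cls (scalar_field \<psi> i))" if "L1 (%x. \<psi> x *R rep u x)" for u i
   using integral_inner_left[of "axis i 1" lborel "%x. \<psi> x *R rep u x", OF that] by(simp add: inner_axis inner_scalar_field[OF \<psi>(1)])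
  obtain B where B: "!!x. abs (\<psi> x) <= B" using cc_bounded[OF \<psi>(1)] by(metis real_norm_def)
  have ig: "L1 (%x. \<psi> x *R rep u x)" for u
  proof (rule sqint_bounded_support_integrable[OF _ U(2)])
   show "sqint (%x. \<psi> x *R rep u x)"
    using sqint_mul[OF bounded_field_scalar[OF cc_measurable[OF \<psi>(1)] B] sqint_rep] by(simp add: scaleR_matrix_vector_assoc[symmetric])
  qed (use cc_eq_0[OF \<psi>(1)] in simp)
  have "cls (scalar_field \<psi> i) : fields U" for i using cc_scalar_field[OF \<psi>(1)] by(auto simp: fields_def)
  hence "(%n. LI x. \<psi> x *R rep (emb U (v n)) x) ----> (LI x. \<psi> x *R rep (emb U w) x)"
   by(intro vec_tendstoI) (simp only: c[OF ig] lim)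
  moreover have "dist (LINT x|lebesgue_on U. \<phi> x *R u x) (LI x. \<psi> x *R rep (emb U u) x) <= e"
   if "u : L2 U" "(LI x. ind U x * norm (rep (emb U u) x)) <= D" for u
   using C0_pairing[OF \<phi> \<psi>(1) _ \<psi>(2) that(1)] mult_left_mono[OF that(2), of d] d by linarith
  ultimately show "EX y y'. y ----> y' & (ALL n. dist (LINT x|lebesgue_on U. \<phi> x *R v n x) (y n) <= e) & dist (LINT x|lebesgue_on U. \<phi> x *R w x) y' <= e"
   using v order_trans[OF C D(2)] D(3) by blast
 qed
qed

end

context homogenized
begin

text \<open>Since \<open>S h\<close> and \<open>h\<close> agree against gradients, the relation
  \<open>S h = N (T h)\<close> says that \<open>T h\<close> solves the limit problem. Uniqueness
  identifies \<open>T h\<close> with \<open>potential U N h\<close>, and it remains to translate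
  back to functions in \<open>H10\<close>.\<close>

theorem H_convergence:
 assumes A: "!!n. AE x\<in>U in lborel. A n x = M n x"
  and cond: "!!n. 0 < \<alpha>' n & \<alpha>' n <= \<beta>' n & A n : conductivities (\<alpha>' n) (\<beta>' n) U"
  and N: "coercive_field \<gamma> N" "\<gamma> > 0" and A': "AE x\<in>U in lborel. A' x = N x"
  and S_eq: "!!h. AE x\<in>U in lborel. rep (S h) x = N x *v rep (T h) x"
 shows "H_converges U A A'"
 unfolding H_converges_def
proof (intro conjI ballI)
 show "EX \<alpha> \<beta>. ALL n. 0 < \<alpha> n & \<alpha> n <= \<beta> n & A n : conductivities (\<alpha> n) (\<beta> n) U" using cond by blast
 interpret domain U by unfold_locales (fact U)+
 fix F assume F: "F : H_minus1 U"
 obtain h where h: "!!u. u : H10 U ==> F u = - inner h (wgrad U u)" by(rule H_minus1_representation[OF F]) blast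
 obtain B where B: "bounded_field B N" using N by(auto simp: coercive_field_def)
 have "T h : supported U" using T_in gradients_supported[OF U(1)] by blast
 hence "S h = mul N (T h)"
  by(rule supported_unique[OF S_supported mul_supported[OF B]])
   (use S_eq[of h] rep_mul[OF B, of "T h"] in "eventually_elim, simp")
 hence "potential U N h = T h" using potential_eqI[OF N T_in] S_inner by metis
 with \<open>S h = mul N (T h)\<close> have Tp: "T h = potential U N h" "S h = mul N (potential U N h)" by simp_all
 have "EX u. u : H10 U & wgrad U u = pot n h" for n using wgrad_surj[OF pot_in] by metis
 then obtain u where u: "!!n. u n : H10 U" "!!n. wgrad U (u n) = pot n h" by metis
 obtain v where v: "v : H10 U" "wgrad U v = T h" using wgrad_surj[OF T_in] by metis
 note fu = flux_emb[OF coercive A H10_H1[OF u(1)]] and fv = flux_emb[OF N(1) A' H10_H1[OF v(1)]]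
 show "EX u v. (ALL n. is_unique_solution U (A n) F (u n)) & is_unique_solution U A' F v &
   weakly_converges_H10 U u v & weak_star_converges U (%n x. A n x *v weak_grad U (u n) x) (%x. A' x *v weak_grad U v x)"
 proof (intro exI[of _ u] exI[of _ v] conjI allI)
  show "is_unique_solution U (A n) F (u n)" for n by(rule is_unique_solutionI[OF coercive \<alpha> A h u])
  show "is_unique_solution U A' F v" by(rule is_unique_solutionI[OF N A' h v[unfolded Tp(1)]])
  show "weakly_converges_H10 U u v"
   unfolding weakly_converges_H10_def
  proof (intro conjI allI ballI u v)
   fix F' assume "F' : H_minus1 U"
   then obtain k where k: "!!u. u : H10 U ==> F' u = - inner k (wgrad U u)" by(rule H_minus1_representation) blast
   show "(%n. F' (u n)) ----> F' v"
    using tendsto_minus[OF T_limit[of h k]] by(simp add: k[OF u(1)] k[OF v(1)] u(2) v(2) inner_commute[of k])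
  qed
  show "weak_star_converges U (%n x. A n x *v weak_grad U (u n) x) (%x. A' x *v weak_grad U v x)"
  proof (rule weak_star_of_fields[OF fu(1) fv(1)])
   show "(LI x. ind U x * norm (rep (emb U (%x. A n x *v weak_grad U (u n) x)) x)) <= sqrt (K / \<alpha>) * norm h" for n
    using flx_l1_U[of n h] by(simp add: fu(2) u(2) flux_def)
   show "(%n. inner (emb U (%x. A n x *v weak_grad U (u n) x)) f) ----> inner (emb U (%x. A' x *v weak_grad U v x)) f" if "f : fields U" for f
    using S_limit[OF that, of h] by(simp add: fu(2) fv(2) u(2) v(2) Tp flux_def)
  qed
 qed
qed

lemma homogenized_subsequence:
 assumes r: "strict_mono r" shows "homogenized U (%n. M (r n)) (%n. b (r n)) a \<alpha> K \<beta> T S"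
proof -
 interpret r: conductivity_sequence U "%n. M (r n)" "%n. b (r n)" a \<alpha> K \<beta> by(rule subsequence[OF r])
 show ?thesis
  by unfold_locales (use LIMSEQ_subseq_LIMSEQ[OF T_limit r] LIMSEQ_subseq_LIMSEQ[OF S_limit r] S_supported in "auto simp: o_def")
qed

end

section \<open>Borel representatives of the data and bounds on the limit density\<close>

lemma scaleR_mat: "(c *R mat 1 :: real^2^2) *v x = c *R x"
 by(simp add: scaleR_matrix_vector_assoc[symmetric])

text \<open>Matrix and density are regularised as a pair, so that the inequality linking them holds
  at every point. The default value is \<alpha> times the identity with density \<alpha>, which is
  why \<open>R\<close> has to dominate \<open>abs r * \<alpha>\<close>.\<close>

lemma conductivity_representative:
 fixes A :: "real^2 => real^2^2"
 defines "d \<equiv> %x. det (A x) / det (sym_part (A x)) * matrix_norm (sym_part (A x))"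
 assumes U: "open U" and A: "A : conductivities \<alpha> \<beta> U" and \<alpha>: "\<alpha> > 0" "\<alpha> <= \<beta>"
  and d: "d : borel_measurable (lebesgue_on U)"
  and R: "AE x in lebesgue_on U. matrix_norm (r *R A x) <= R" "abs r * \<alpha> <= R"
 obtains M b where "M : borel_fun" "b : borel_fun"
  "AE x\<in>U in lborel. A x = M x" "AE x\<in>U in lborel. d x = b x"
  "coercive_field \<alpha> M" "!!x \<xi>. (norm (M x *v \<xi>))^2 <= b x * ((M x *v \<xi>) *. \<xi>)" "!!x \<xi>. abs r * norm (M x *v \<xi>) <= R * norm \<xi>"
proof -
 define P where "P X \<longleftrightarrow> (ALL \<xi>. \<alpha> * (norm \<xi>)^2 <= (fst X *v \<xi>) *. \<xi>) & (ALL \<xi>. (norm (fst X *v \<xi>))^2 <= \<beta> * ((fst X *v \<xi>) *. \<xi>)) &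
  (ALL \<xi>. (norm (fst X *v \<xi>))^2 <= snd X * ((fst X *v \<xi>) *. \<xi>)) & (ALL \<xi>. abs r * norm (fst X *v \<xi>) <= R * norm \<xi>)" for X :: "(real^2^2) \<times> real"
 have \<beta>: "\<beta> > 0" using \<alpha> by linarith
 have A': "A : borel_measurable (lebesgue_on U)" "AE x in lebesgue_on U. (ALL \<xi>. \<alpha> * (norm \<xi>)^2 <= (A x *v \<xi>) *. \<xi>) & (ALL \<xi>. (norm (A x *v \<xi>))^2 <= \<beta> * ((A x *v \<xi>) *. \<xi>))"
  using A unfolding conductivities_iff[OF \<alpha>(1) \<beta>] by blast+
 have "AE x in lebesgue_on U. P (A x, d x)"
  using A'(2) R(1)
 proof eventually_elim
  case (elim x)
  have "abs r * norm (A x *v \<xi>) <= R * norm \<xi>" for \<xi>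
  proof -
   have "norm ((r *R A x) *v \<xi>) <= matrix_norm (r *R A x) * norm \<xi>" unfolding matrix_norm_def by(rule onorm) simp
   also have "... <= R * norm \<xi>" by(rule mult_right_mono) (use elim in simp_all)
   finally show ?thesis by(simp add: scaleR_matrix_vector_assoc[symmetric])
  qed
  thus ?case using elim norm_sq_le_of_coercive[OF \<alpha>(1), of "A x"] by(simp add: P_def d_def)
 qed
 moreover have "P (\<alpha> *R mat 1, \<alpha>)"
 proof -
  have "\<alpha> * \<alpha> * (norm \<xi>)^2 <= \<beta> * \<alpha> * (norm \<xi>)^2" for \<xi> :: "real^2" using \<alpha> by(simp add: mult_right_mono)
  moreover have "abs r * \<alpha> * norm \<xi> <= R * norm \<xi>" for \<xi> :: "real^2" by(rule mult_right_mono[OF R(2)]) simp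
  ultimately show ?thesis using \<alpha> by(simp add: P_def scaleR_mat power_mult_distrib power2_norm_eq_inner[symmetric] mult.assoc power2_eq_square[of \<alpha>])
 qed
 ultimately obtain g where g: "g : borel_fun" "!!x. P (g x)" "AE x\<in>U in lborel. (A x, d x) = g x"
  using borel_version_everywhere[OF U borel_measurable_Pair[OF A'(1) d], of P] by blast
 have M: "(%x. fst (g x)) : borel_fun" "(%x. snd (g x)) : borel_fun"
  using borel_measurable_continuous_onI[OF continuous_on_fst[OF continuous_on_id]] borel_measurable_continuous_onI[OF continuous_on_snd[OF continuous_on_id]]
  by(auto intro: measurable_compose[OF g(1)])
 have "bounded_field \<beta> (%x. fst (g x))"
  using M(1) bounded_of_norm_sq_le[of \<beta>] g(2) \<beta> by(simp add: bounded_field_def P_def)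
 hence "coercive_field \<alpha> (%x. fst (g x))" using g(2) by(auto simp: coercive_field_def P_def)
 moreover have "AE x\<in>U in lborel. A x = fst (g x)" "AE x\<in>U in lborel. d x = snd (g x)"
  using g(3) by(eventually_elim, metis fst_conv snd_conv)+
 ultimately show thesis using M g(2) by(intro that) (auto simp: P_def)
qed

lemma coercive_field_le:
 assumes "coercive_field \<alpha> N" "\<alpha> > 0"
 obtains \<beta> where "\<alpha> <= \<beta>" "!!x \<xi>. (norm (N x *v \<xi>))^2 <= \<beta> * ((N x *v \<xi>) *. \<xi>)"
proof -
 obtain B where B: "bounded_field B N" using assms by(auto simp: coercive_field_def)
 have le: "(norm (N x *v \<xi>))^2 <= max \<alpha> (B^2 / \<alpha>) * ((N x *v \<xi>) *. \<xi>)" for x \<xi>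
 proof -
  have c: "\<alpha> * (norm \<xi>)^2 <= (N x *v \<xi>) *. \<xi>" using assms by(simp add: coercive_field_def)
  have "(norm (N x *v \<xi>))^2 <= (B * norm \<xi>)^2" by(rule power_mono[OF bounded_field_le[OF B]]) simp
  also have "... = B^2 / \<alpha> * (\<alpha> * (norm \<xi>)^2)" using assms(2) by(simp add: power_mult_distrib)
  also have "... <= B^2 / \<alpha> * ((N x *v \<xi>) *. \<xi>)" by(rule mult_left_mono[OF c]) (use assms(2) in simp)
  also have "... <= max \<alpha> (B^2 / \<alpha>) * ((N x *v \<xi>) *. \<xi>)"
   by(rule mult_right_mono) (use c assms(2) order_trans[OF mult_nonneg_nonneg c] in auto)
  finally show ?thesis .
 qed
 show thesis by(rule that[OF _ le]) simp
qed

lemma conductivities_of_coercive: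
 assumes U: "open U" and N: "coercive_field \<alpha> N" "\<alpha> > 0" and A: "AE x\<in>U in lborel. A x = N x"
  and le: "!!x \<xi>. (norm (N x *v \<xi>))^2 <= \<beta> * ((N x *v \<xi>) *. \<xi>)"
 shows "A : conductivities \<alpha> \<beta> U"
proof -
 have Nm: "N : borel_fun" and c: "!!x \<xi>. \<alpha> * (norm \<xi>)^2 <= (N x *v \<xi>) *. \<xi>"
  using N(1) by(auto simp: coercive_field_def bounded_field_def)
 have "\<alpha> <= \<beta>" by(rule coercive_le_bound[OF N(2) c le])
 hence "\<beta> > 0" using N(2) by linarith
 thus ?thesis
  unfolding conductivities_iff[OF N(2) \<open>\<beta> > 0\<close>] AE_on[OF U]
  using lebesgue_on_lborel(1)[OF U Nm A] A c le by(auto elim!: eventually_mono)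
qed

text \<open>The lower bound passes from \<open>b n\<close> to the density by testing with
  nonnegative functions on small balls, and the upper bound is the essential supremum. For a
  nonempty domain the two together compare \<alpha> with the norm of \<open>a\<close>.\<close>

lemma density_bounds:
 fixes b :: "nat => real^2 => real"
 assumes U: "open U" and a: "a : Linf U" "integrable (lebesgue_on U) a"
  and b: "!!n. b n : borel_fun" "!!n x. \<alpha> <= b n x" "!!n. L1 (%x. ind U x * b n x)"
  and lim: "!!\<psi>. cc U \<psi> ==> (%n. LI x. \<psi> x * b n x) ----> (LINT x|lebesgue_on U. \<psi> x * a x)"
 shows "AE x in lebesgue_on U. \<alpha> <= a x & a x <= Linf_norm U a"
proof -
 have [measurable]: "U : sets borel" using U by simp
 obtain g where g[measurable]: "g : borel_fun" and g0: "!!x. x ~: U ==> g x = 0" and ag: "AE x\<in>U in lborel. a x = g x"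
  by(rule borel_version[OF U, of a]) (use a in "auto simp: Linf_def")
 have gi: "L1 (%x. ind U x * g x)" using a(2) lebesgue_on_lborel(2)[OF U g ag] by simp
 have fin: "L1 (%x. \<phi> x * h x)" if t: "cc U \<phi>" "h : borel_fun" "L1 (%x. ind U x * h x)" for \<phi> h :: "real^2 => real"
 proof -
  note [measurable] = cc_measurable[OF t(1)] t(2)
  obtain B where B: "B > 0" "!!x. norm (\<phi> x) <= B" using cc_bounded[OF t(1)] by blast
  show ?thesis
   by(rule L1_bound[OF integrable_mult_right[OF t(3), of B]])
    (use B cc_eq_0[OF t(1)] in "auto simp: indicator_def abs_mult intro!: AE_I2 mult_right_mono")
 qed
 have "AE x\<in>U in lborel. 0 <= g x - \<alpha>"
 proof (rule AE_local)
  fix z assume "z : U"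
  then obtain e where e: "e > 0" "ball z e \<subseteq> U" using U open_contains_ball by blast
  have "AEl x. x : ball z e --> 0 <= g x - \<alpha>"
  proof (rule AE_nonneg_of_test)
   have "L1 (%x. ind (ball z e) x * g x)"
    by(rule L1_bound[OF gi]) (auto simp: indicator_def g0)
   moreover have "L1 (%x. ind (ball z e) x :: real)"
    using emeasure_bounded_finite[of "ball z e"] by(intro integrable_real_indicator) auto
   ultimately show "L1 (%x. ind (ball z e) x * (g x - \<alpha>))" by(simp add: right_diff_distrib)
   fix \<phi> :: "real^2 => real" assume \<phi>: "\<phi> : TF (ball z e)" "!!x. 0 <= \<phi> x"
   have cc: "cc U \<phi>" by(rule cc_mono[OF c1c_D(1)[OF test_function_c1c[OF \<phi>(1)]] e(2)])
   have "(LINT x|lebesgue_on U. \<phi> x * a x) = (LI x. \<phi> x * g x)" using cc_lebesgue_on[OF U cc g ag] by simp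
   hence "(%n. LI x. \<phi> x * b n x) ----> (LI x. \<phi> x * g x)" using lim[OF cc] by simp
   moreover have "(LI x. \<phi> x * \<alpha>) <= (LI x. \<phi> x * b n x)" for n
    by(rule integral_mono) (use cc_integrable[OF cc] fin[OF cc b(1,3)] b(2) \<phi>(2) in "auto intro: mult_left_mono")
   ultimately have "(LI x. \<phi> x * \<alpha>) <= (LI x. \<phi> x * g x)" by(intro LIMSEQ_le_const) auto
   thus "0 <= (LI x. \<phi> x * (g x - \<alpha>))"
    using fin[OF cc g gi] cc_integrable[OF cc] by(simp add: right_diff_distrib)
  qed auto
  thus "EX V. open V & z : V & (AE x\<in>V in lborel. 0 <= g x - \<alpha>)" using e by(intro exI[of _ "ball z e"]) auto
 qed
 hence "AE x in lebesgue_on U. \<alpha> <= a x" unfolding AE_on[OF U] using ag by eventually_elim auto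
 moreover have "AE x in lebesgue_on U. ereal \<bar>a x\<bar> <= esssup (lebesgue_on U) (%x. ereal \<bar>a x\<bar>)" by(rule esssup_AE)
 ultimately show ?thesis
 proof eventually_elim
  case (elim x)
  have "esssup (lebesgue_on U) (%x. ereal \<bar>a x\<bar>) < \<infinity>" using a(1) by(simp add: Linf_def)
  thus ?case using elim unfolding Linf_norm_def by(cases "esssup (lebesgue_on U) (%x. ereal \<bar>a x\<bar>)") auto
 qed
qed

context conductivity_sequence
begin

definition perturbed :: "(nat => real) => (nat => real) => (nat => real) => nat => real^2 => real^2^2" where
 "perturbed pn qn rn n x = matrix_inv (matrix_inv (pn n *R M n x + qn n *R J) + rn n *R J)"

lemma perturbed_sequence:
 assumes p: "0 < p0" "!!n. p0 <= pn n" "!!n. pn n <= P" "!!n. abs (qn n) <= Q" "!!n. abs (rn n) <= r'"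
  and R: "!!n x \<xi>. abs (rn n) * norm (M n x *v \<xi>) <= R * norm \<xi>"
 defines "k \<equiv> 2 * P + 2 * Q^2 / (\<alpha>^2 * p0)" and "\<gamma> \<equiv> p0 * \<alpha> / (1 + (P * abs R + Q * r'))^2"
 shows "conductivity_sequence U (perturbed pn qn rn) (%n x. k * b n x) (%x. k * a x) \<gamma> (k * K) (max (k * \<beta>) \<gamma>)"
  "perturbed pn qn rn n x *v \<xi> = pn n *R (M n x *v (\<xi> - rn n *R (J *v (perturbed pn qn rn n x *v \<xi>))))
   + qn n *R (J *v (\<xi> - rn n *R (J *v (perturbed pn qn rn n x *v \<xi>))))" "\<gamma> > 0"
proof -
 let ?N = "perturbed pn qn rn"
 let ?z = "%n x \<xi>. \<xi> - rn n *R (J *v (?N n x *v \<xi>))"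
 have pm: "?N n x *v \<xi> = pn n *R (M n x *v ?z n x \<xi>)
   + qn n *R (J *v ?z n x \<xi>)"
  "\<gamma> * (norm \<xi>)^2 <= (?N n x *v \<xi>) *. \<xi>"
  "(!!\<xi>. (norm (M n x *v \<xi>))^2 <= c * ((M n x *v \<xi>) *. \<xi>)) ==>
   (norm (?N n x *v \<xi>))^2 <= k * c * ((?N n x *v \<xi>) *. \<xi>)" for n x \<xi> c
  using perturbed_matrix[OF \<alpha> M_coercive[of _ n x] p(1) p(2)[of n] p(3)[of n] p(4)[of n] R p(5)[of n], where \<xi> = \<xi>]
  unfolding perturbed_def k_def \<gamma>_def by blast+
 show "?N n x *v \<xi> = pn n *R (M n x *v ?z n x \<xi>)
   + qn n *R (J *v ?z n x \<xi>)" by(rule pm(1))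
 have "0 < P" "0 <= Q" "0 <= r'" using p(1) p(2,3,4,5)[of 0] by linarith+
 hence "0 < 1 + (P * abs R + Q * r')" by(intro add_pos_nonneg) auto
 thus \<gamma>: "\<gamma> > 0" using p(1) \<alpha> by(simp add: \<gamma>_def)
 have k: "k > 0" unfolding k_def using \<open>0 < P\<close> p(1) \<alpha> by(intro add_pos_nonneg) auto
 show "conductivity_sequence U ?N (%n x. k * b n x) (%x. k * a x) \<gamma> (k * K) (max (k * \<beta>) \<gamma>)"
 proof
  show "coercive_field \<gamma> (?N n)" for n
  proof -
   obtain c where c: "\<alpha> <= c" "!!x \<xi>. (norm (M n x *v \<xi>))^2 <= c * ((M n x *v \<xi>) *. \<xi>)" by(rule coercive_field_le[OF coercive \<alpha>]) blast
   obtain B where B: "bounded_field B (M n)" by(rule M_bounded)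
   note [measurable] = bounded_field_measurable[OF B]
   have "bounded_field (k * c) (?N n)"
    unfolding bounded_field_def using bounded_of_norm_sq_le[OF _ pm(3)[OF c(2)]] k c(1) \<alpha>
    by(auto simp: perturbed_def[abs_def])
   thus ?thesis using pm(2) by(auto simp: coercive_field_def)
  qed
  show "(norm (?N n x *v \<xi>))^2 <= k * b n x * ((?N n x *v \<xi>) *. \<xi>)" for n x \<xi> by(rule pm(3)[OF flux_le])
  show "L1 (%x. ind U x * (k * b n x))" for n using b_integrable[of n] by(simp add: mult.left_commute)
  show "(LI x. ind U x * (k * b n x)) <= k * K" for n using b_bound[of n] k by(simp add: mult.left_commute)
  show "(%n. LI x. \<psi> x * (k * b n x)) ----> (LI x. \<psi> x * (k * a x))" if "cc U \<psi>" for \<psi>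
   using tendsto_mult_left[OF b_limit[OF that], of k] by(simp add: mult.left_commute[of _ k])
  show "k * a x <= max (k * \<beta>) \<gamma>" for x
   by(rule order_trans[OF mult_left_mono[OF a_bounds(2)] max.cobounded1]) (use k in simp)
 qed (use U \<gamma> k b_nonneg a_bounds in auto)
qed

end

section \<open>Assembly of the two homogenized problems along one subsequence\<close>

theorem proposition2p1:
  fixes \<Omega> :: "(real^2) set"
    and p\<^sub>n q\<^sub>n r\<^sub>n \<beta>\<^sub>n :: "nat \<Rightarrow> real"
    and p q \<alpha> :: real
    and A :: "nat \<Rightarrow> real^2 \<Rightarrow> real^2^2"
    and a :: "real^2 \<Rightarrow> real"
  assumes "open \<Omega>" and "bounded \<Omega>" and "frontier \<Omega> \<in> null_sets lebesgue"
    and "p\<^sub>n \<longlonglongrightarrow> p" and "p > 0" and "q\<^sub>n \<longlonglongrightarrow> q" and "r\<^sub>n \<longlonglongrightarrow> 0"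
    and "\<alpha> > 0" and "\<And>n. \<beta>\<^sub>n n \<ge> \<alpha>"
    and "\<And>n. A n \<in> conductivities \<alpha> (\<beta>\<^sub>n n) \<Omega>"
    and "bounded_in_Linf_matrix \<Omega> (\<lambda>n x. r\<^sub>n n *\<^sub>R A n x)"
    and "a \<in> Linf \<Omega>"
    and "weak_star_converges \<Omega>
           (\<lambda>n x. det (A n x) / det (sym_part (A n x)) * matrix_norm (sym_part (A n x))) a"
    and "\<And>n. AE x in lebesgue_on \<Omega>.
           transpose (matrix_inv (matrix_inv (p\<^sub>n n *\<^sub>R A n x + q\<^sub>n n *\<^sub>R J) + r\<^sub>n n *\<^sub>R J))
             = matrix_inv (matrix_inv (p\<^sub>n n *\<^sub>R A n x + q\<^sub>n n *\<^sub>R J) + r\<^sub>n n *\<^sub>R J)"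
  shows "\<exists>(\<sigma> :: nat \<Rightarrow> nat) A'. strict_mono \<sigma> \<and>
           A' \<in> conductivities \<alpha> (2 * Linf_norm \<Omega> a) \<Omega> \<and>
           H_converges \<Omega> (\<lambda>n. A (\<sigma> n)) A' \<and>
           H_converges \<Omega>
             (\<lambda>n x. matrix_inv (matrix_inv (p\<^sub>n (\<sigma> n) *\<^sub>R A (\<sigma> n) x + q\<^sub>n (\<sigma> n) *\<^sub>R J)
                      + r\<^sub>n (\<sigma> n) *\<^sub>R J))
             (\<lambda>x. p *\<^sub>R A' x + q *\<^sub>R J)"
proof -
 note O = assms(1,2) and \<alpha> = \<open>\<alpha> > 0\<close>
 define d where "d n x = det (A n x) / det (sym_part (A n x)) * matrix_norm (sym_part (A n x))" for n x
 have ws: "weak_star_converges \<Omega> d a" unfolding d_def by(rule assms(13))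
 have di: "integrable (lebesgue_on \<Omega>) (d n)" "integrable (lebesgue_on \<Omega>) a" for n using ws by(auto simp: weak_star_converges_def)
 obtain C where C: "!!n. AE x in lebesgue_on \<Omega>. matrix_norm (r\<^sub>n n *R A n x) <= C"
  using assms(11) by(auto simp: bounded_in_Linf_matrix_def)
 have bs: "EX B. ALL n. abs (s n) <= B" if "s ----> l" for s :: "nat => real" and l
  using Bseq_def convergent_imp_Bseq[of s] that unfolding convergent_def by(metis real_norm_def)
 obtain P where P: "!!n. abs (p\<^sub>n n) <= P" using bs[OF assms(4)] by blast
 obtain Q where Q: "!!n. abs (q\<^sub>n n) <= Q" using bs[OF assms(6)] by blast
 obtain r' where r': "!!n. abs (r\<^sub>n n) <= r'" using bs[OF assms(7)] by blast
 \<comment> \<open>A uniform positive lower bound for the \<open>p\<^sub>n\<close> holds only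
   eventually; the indices are therefore shifted by \<open>n\<^sub>0\<close>.\<close>
 have "\<forall>\<^sub>F n in sequentially. p / 2 < p\<^sub>n n" by(rule order_tendstoD(1)[OF assms(4)]) (use assms(5) in simp)
 then obtain n\<^sub>0 where n\<^sub>0: "!!n. n >= n\<^sub>0 ==> p / 2 < p\<^sub>n n" by(auto simp: eventually_sequentially)
 \<comment> \<open>The second entry makes the bound valid for the default matrix, \<alpha> times the
   identity.\<close>
 define R where "R = max C (r' * \<alpha>)"
 define good where "good n X \<longleftrightarrow> fst X : borel_fun & snd X : borel_fun &
  (AE x\<in>\<Omega> in lborel. A n x = fst X x) & (AE x\<in>\<Omega> in lborel. d n x = snd X x) &
  coercive_field \<alpha> (fst X) & (ALL x \<xi>. (norm (fst X x *v \<xi>))^2 <= snd X x * ((fst X x *v \<xi>) *. \<xi>)) &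
  (ALL x \<xi>. abs (r\<^sub>n n) * norm (fst X x *v \<xi>) <= R * norm \<xi>)" for n X
 have "EX X. good n X" for n
 proof -
  have "AE x in lebesgue_on \<Omega>. matrix_norm (r\<^sub>n n *R A n x) <= R" using C[of n] by eventually_elim (simp add: R_def)
  moreover have "abs (r\<^sub>n n) * \<alpha> <= R" unfolding R_def by(rule order_trans[OF mult_right_mono[OF r'] max.cobounded2]) (use \<alpha> in simp)
  ultimately obtain M b where "M : borel_fun" "b : borel_fun"
   "AE x\<in>\<Omega> in lborel. A n x = M x" "AE x\<in>\<Omega> in lborel. d n x = b x"
   "coercive_field \<alpha> M" "!!x \<xi>. (norm (M x *v \<xi>))^2 <= b x * ((M x *v \<xi>) *. \<xi>)" "!!x \<xi>. abs (r\<^sub>n n) * norm (M x *v \<xi>) <= R * norm \<xi>"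
   using conductivity_representative[OF O(1) assms(10)[of n] \<alpha> assms(9)[of n], of "r\<^sub>n n" R] borel_measurable_integrable[OF di(1)[of n]]
   unfolding d_def by blast
  thus ?thesis by(intro exI[of _ "(M, b)"]) (simp add: good_def)
 qed
 then obtain X where good: "!!n. good n (X n)" by metis
 have X: "snd (X n) : borel_fun"
  "AE x\<in>\<Omega> in lborel. A n x = fst (X n) x" "AE x\<in>\<Omega> in lborel. d n x = snd (X n) x"
  "coercive_field \<alpha> (fst (X n))" "(norm (fst (X n) x *v \<xi>))^2 <= snd (X n) x * ((fst (X n) x *v \<xi>) *. \<xi>)"
  "abs (r\<^sub>n n) * norm (fst (X n) x *v \<xi>) <= R * norm \<xi>"  for n x \<xi> using good[of n] unfolding good_def by blast+
 define M where "M n = fst (X n)" for n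
 define b where "b n = snd (X n)" for n
 note X = X[folded M_def b_def]
 have b: "\<alpha> <= b n x" for n x
  by(rule coercive_le_bound[OF \<alpha> _ X(5)]) (use X(4)[of n] in "simp add: coercive_field_def")
 have bi: "L1 (%x. ind \<Omega> x * b n x)" for n
  using di(1)[of n] lebesgue_on_lborel(2)[OF O(1) X(1) X(3), of n] by simp
 have conv: "(%n. LINT x|lebesgue_on \<Omega>. \<psi> x * d n x) ----> (LINT x|lebesgue_on \<Omega>. \<psi> x * a x)" if "\<psi> : C0 \<Omega>" for \<psi>
  using ws that by(simp add: weak_star_converges_def)
 have lim: "(%n. LI x. \<psi> x * b n x) ----> (LINT x|lebesgue_on \<Omega>. \<psi> x * a x)" if \<psi>: "cc \<Omega> \<psi>" for \<psi>
  using conv[OF cc_C0[OF \<psi>]] cc_lebesgue_on[OF O(1) \<psi> X(1) X(3)] by simp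
 have db: "AE x in lebesgue_on \<Omega>. \<alpha> <= a x & a x <= Linf_norm \<Omega> a"
  by(rule density_bounds[OF O(1) assms(12) di(2) X(1) b bi]) (rule lim)
 \<comment> \<open>The maximum secures \<open>\<alpha> <= \<beta>\<close> also for an empty domain,
   where the norm gives no information.\<close>
 define \<beta> where "\<beta> = max \<alpha> (Linf_norm \<Omega> a)"
 have "AE x in lebesgue_on \<Omega>. \<alpha> <= a x & a x <= \<beta>" using db by eventually_elim (simp add: \<beta>_def)
 then obtain a\<^sub>0 where a\<^sub>0: "a\<^sub>0 : borel_fun" "!!x. \<alpha> <= a\<^sub>0 x & a\<^sub>0 x <= \<beta>" "AE x\<in>\<Omega> in lborel. a x = a\<^sub>0 x"
  by(rule borel_version_everywhere[OF O(1) borel_measurable_integrable[OF di(2)], where c = \<alpha>]) (auto simp: \<beta>_def)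
 obtain K where K: "!!n. (LI x. ind \<Omega> x * b n x) <= K"
 proof (rule bounded_mass[OF O(1) X(1) _ bi])
  show "0 <= b n x" for n x using b[of n x] \<alpha> by linarith
  fix \<phi> assume \<phi>: "\<phi> : C0 \<Omega>"
  have [measurable]: "\<Omega> : sets borel" using O(1) by simp
  have [measurable]: "(%x. ind \<Omega> x *R \<phi> x) : borel_fun" "b n : borel_fun" for n
   using O(1) \<phi> X(1) by(auto simp: C0_def simp del: real_scaleR_def intro!: borel_measurable_continuous_on_indicator)
  have "(LINT x|lebesgue_on \<Omega>. \<phi> x * d n x) = (LI x. ind \<Omega> x *R ((ind \<Omega> x *R \<phi> x) * b n x))" for n
  proof (rule lebesgue_on_lborel(3)[OF O(1)])
   show "AE x\<in>\<Omega> in lborel. \<phi> x * d n x = (ind \<Omega> x *R \<phi> x) * b n x"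
    using X(3)[of n] by eventually_elim simp
  qed measurable
  moreover have "(%x. ind \<Omega> x *R ((ind \<Omega> x *R \<phi> x) * b n x)) = (%x. ind \<Omega> x * (\<phi> x * b n x))" for n
   by(auto simp: indicator_def)
  ultimately show "Bseq (%n. LI x. ind \<Omega> x * (\<phi> x * b n x))"
   using conv[OF \<phi>] by(intro convergent_imp_Bseq) (auto simp: convergent_def)
 qed blast
 interpret A: conductivity_sequence \<Omega> "%n. M (n + n\<^sub>0)" "%n. b (n + n\<^sub>0)" a\<^sub>0 \<alpha> K \<beta>
 proof
  show "(%n. LI x. \<psi> x * b (n + n\<^sub>0) x) ----> (LI x. \<psi> x * a\<^sub>0 x)" if "cc \<Omega> \<psi>" for \<psi>
   using LIMSEQ_ignore_initial_segment[OF lim[OF that], of n\<^sub>0] cc_lebesgue_on[OF O(1) that a\<^sub>0(1,3)] by simp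
  show "0 <= b (n + n\<^sub>0) x" "0 <= a\<^sub>0 x" for n x using b[of "n + n\<^sub>0" x] a\<^sub>0(2)[of x] \<alpha> by linarith+
 qed (use O \<alpha> X bi K a\<^sub>0 in "auto simp: \<beta>_def")
 obtain r1 T S where r1: "strict_mono r1" and H1: "homogenized \<Omega> (%n. M (r1 n + n\<^sub>0)) (%n. b (r1 n + n\<^sub>0)) a\<^sub>0 \<alpha> K \<beta> T S"
  by(rule A.precompactness)
 interpret H1: homogenized \<Omega> "%n. M (r1 n + n\<^sub>0)" "%n. b (r1 n + n\<^sub>0)" a\<^sub>0 \<alpha> K \<beta> T S by(rule H1)
 obtain A' where A': "A' : borel_fun" "!!x c. \<alpha> * (norm c)^2 <= (A' x *v c) *. c"
  "!!x c. (norm (A' x *v c))^2 <= \<beta> * ((A' x *v c) *. c)"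
  and fit: "!!h. AE x\<in>\<Omega> in lborel. rep (S h) x = A' x *v rep (T h) x" by(rule H1.homogenized_matrix) blast
 have "bounded_field \<beta> A'" using A'(1) bounded_of_norm_sq_le[OF _ A'(3)] H1.\<beta> by(simp add: bounded_field_def)
 hence cA': "coercive_field \<alpha> A'" using A'(2) by(auto simp: coercive_field_def)
 let ?p = "%n. p\<^sub>n (r1 n + n\<^sub>0)" and ?q = "%n. q\<^sub>n (r1 n + n\<^sub>0)" and ?r = "%n. r\<^sub>n (r1 n + n\<^sub>0)"
 have ps: "0 < p / 2" "p / 2 <= ?p n" "?p n <= P" "abs (?q n) <= Q" "abs (?r n) <= r'" for n
  using assms(5) n\<^sub>0[of "r1 n + n\<^sub>0"] P[of "r1 n + n\<^sub>0"] Q r' by auto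
 \<comment> \<open>The constants of \<open>perturbed_matrix\<close> with \<open>p0 = p / 2\<close>;
   they do not depend on the index.\<close>
 define k \<gamma> where "k = 2 * P + 2 * Q^2 / (\<alpha>^2 * (p / 2))" and "\<gamma> = p / 2 * \<alpha> / (1 + (P * abs R + Q * r'))^2"
 let ?N = "H1.perturbed ?p ?q ?r"
 note pert = H1.perturbed_sequence[where pn = ?p and qn = ?q and rn = ?r, OF ps X(6), folded k_def \<gamma>_def]
 interpret N: conductivity_sequence \<Omega> ?N "%n x. k * b (r1 n + n\<^sub>0) x" "%x. k * a\<^sub>0 x" \<gamma> "k * K" "max (k * \<beta>) \<gamma>"
  by(rule pert(1))
 \<comment> \<open>The second extraction takes place inside the first subsequence, along which the
   limits \<open>T\<close> and \<open>S\<close> persist.\<close>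
 obtain r2 T2 S2 where r2: "strict_mono r2"
  and H2: "homogenized \<Omega> (%n. ?N (r2 n)) (%n x. k * b (r1 (r2 n) + n\<^sub>0) x) (%x. k * a\<^sub>0 x) \<gamma> (k * K) (max (k * \<beta>) \<gamma>) T2 S2"
  by(rule N.precompactness)
 define \<sigma> where "\<sigma> n = r1 (r2 n) + n\<^sub>0" for n
 have \<sigma>: "strict_mono \<sigma>" unfolding \<sigma>_def using strict_mono_o[OF r1 r2] by(simp add: strict_mono_def)
 note lims = LIMSEQ_subseq_LIMSEQ[OF _ \<sigma>, unfolded o_def \<sigma>_def]
 interpret P: perturbation \<Omega> "%n. M (r1 (r2 n) + n\<^sub>0)" "%n. b (r1 (r2 n) + n\<^sub>0)" a\<^sub>0 \<alpha> K \<beta> T S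
  "%n. ?N (r2 n)" "%n x. k * b (r1 (r2 n) + n\<^sub>0) x" "%x. k * a\<^sub>0 x" \<gamma> "k * K" "max (k * \<beta>) \<gamma>" T2 S2
  "%n. ?p (r2 n)" "%n. ?q (r2 n)" "%n. ?r (r2 n)" p q "p / 2" R
  by(intro perturbation.intro perturbation_axioms.intro)
   (rule H1.homogenized_subsequence[OF r2] H2 pert(2) lims[OF assms(4)] lims[OF assms(6)] lims[OF assms(7)] ps(1,2) X(6))+
 have cond: "0 < \<alpha> & \<alpha> <= \<beta>\<^sub>n (\<sigma> n) & A (\<sigma> n) : conductivities \<alpha> (\<beta>\<^sub>n (\<sigma> n)) \<Omega>" for n using \<alpha> assms(9,10) by blast
 have HA: "H_converges \<Omega> (%n. A (\<sigma> n)) A'"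
  by(rule P.A.H_convergence[OF _ cond cA' \<alpha>]) (use X(2) fit in "simp_all add: \<sigma>_def")
 define B where "B n x = matrix_inv (matrix_inv (p\<^sub>n (\<sigma> n) *R A (\<sigma> n) x + q\<^sub>n (\<sigma> n) *R J) + r\<^sub>n (\<sigma> n) *R J)" for n x
 have B: "AE x\<in>\<Omega> in lborel. B n x = ?N (r2 n) x" for n
  using X(2)[of "\<sigma> n"] by eventually_elim (simp add: B_def H1.perturbed_def \<sigma>_def)
 \<comment> \<open>Each perturbed matrix has its own upper constant; the lower constant \<gamma> is
   uniform.\<close>
 have "EX \<beta>. \<gamma> <= \<beta> & B n : conductivities \<gamma> \<beta> \<Omega>" for n
 proof -
  obtain \<beta> where "\<gamma> <= \<beta>" "!!x \<xi>. (norm (?N (r2 n) x *v \<xi>))^2 <= \<beta> * ((?N (r2 n) x *v \<xi>) *. \<xi>)"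
   by(rule coercive_field_le[OF P.B.coercive pert(3)]) blast
  thus ?thesis using conductivities_of_coercive[OF O(1) P.B.coercive pert(3) B] by blast
 qed
 hence "ALL n. EX \<beta>. \<gamma> <= \<beta> & B n : conductivities \<gamma> \<beta> \<Omega>" by blast
 from choice[OF this] obtain \<beta>' where "!!n. \<gamma> <= \<beta>' n & B n : conductivities \<gamma> (\<beta>' n) \<Omega>" by blast
 hence condB: "0 < \<gamma> & \<gamma> <= \<beta>' n & B n : conductivities \<gamma> (\<beta>' n) \<Omega>" for n using pert(3) by blast
 define L where "L x = p *R A' x + q *R J" for x
 have Lv: "L x *v c = p *R (A' x *v c) + q *R (J *v c)" for x c
  by(simp add: L_def matrix_vector_mult_add_rdistrib scaleR_matrix_vector_assoc[symmetric])
 have "coercive_field (p * \<alpha>) L"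
  unfolding coercive_field_def
 proof (intro conjI exI allI)
  have "norm (L x *v c) <= (p * \<beta> + abs q) * norm c" for x c
  proof -
   have "norm (L x *v c) <= p * norm (A' x *v c) + abs q * norm c"
    using norm_triangle_ineq[of "p *R (A' x *v c)" "q *R (J *v c)"] assms(5) by(simp add: Lv)
   also have "p * norm (A' x *v c) <= p * (\<beta> * norm c)"
    by(rule mult_left_mono[OF bounded_field_le[OF \<open>bounded_field \<beta> A'\<close>]]) (use assms(5) in simp)
   finally show ?thesis by(simp add: algebra_simps)
  qed
  moreover have "L : borel_fun" unfolding L_def using A'(1) by measurable
  ultimately show "bounded_field (p * \<beta> + abs q) L" by(simp add: bounded_field_def)
  show "p * \<alpha> * (norm \<xi>)^2 <= (L x *v \<xi>) *. \<xi>" for x \<xi>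
   using mult_left_mono[OF A'(2)[of \<xi> x], of p] assms(5) inner_J(4)[of \<xi>] inner_commute[of "J *v \<xi>" \<xi>] by(simp add: Lv inner_add_left mult.assoc)
 qed
 hence HB: "H_converges \<Omega> B L"
  by(rule P.B.H_convergence[OF B condB]) (use \<alpha> assms(5) P.perturbed_flux[OF fit] in "simp_all add: L_def")
 have "A' : conductivities \<alpha> (2 * Linf_norm \<Omega> a) \<Omega>"
 proof (cases "\<Omega> = {}")
  case True
  thus ?thesis using lebesgue_on_lborel(1)[OF O(1) A'(1), of A'] by(simp add: conductivities_def AE_on)
 next
  case False
  hence ne: "\<not> (AEl x. x ~: \<Omega>)" using O(1) AE_iff_null_sets[of \<Omega> lborel] open_not_negligible[OF O(1)] by(auto simp: negligible_iff_null_sets null_sets_completionI)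
  have "\<alpha> <= Linf_norm \<Omega> a"
  proof (rule ccontr)
   assume "\<not> \<alpha> <= Linf_norm \<Omega> a"
   hence "AEl x. x ~: \<Omega>" using db[unfolded AE_on[OF O(1)]] by(auto elim: eventually_mono)
   with ne show False by blast
  qed
  \<comment> \<open>For a nonempty domain \<beta> is the norm of \<open>a\<close> itself, so the
    stated constant follows by monotonicity.\<close>
  hence "\<beta> <= 2 * Linf_norm \<Omega> a" using \<alpha> by(simp add: \<beta>_def)
  moreover have "0 <= (A' x *v c) *. c" for x c by(rule order_trans[OF _ A'(2)]) (use \<alpha> in simp)
  ultimately have "(norm (A' x *v c))^2 <= 2 * Linf_norm \<Omega> a * ((A' x *v c) *. c)" for x c
   using order_trans[OF A'(3) mult_right_mono] by blast
  thus ?thesis by(intro conductivities_of_coercive[OF O(1) cA' \<alpha>]) auto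
 qed
 thus ?thesis using \<sigma> HA HB unfolding B_def[abs_def] L_def[abs_def] by blast
qed


end
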